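(* Let $0<p<\infty$ and $\varepsilon>0$, and let $w$ be a weight with $w\in C^+_{\max\{p,1\}+\varepsilon}$. Let $G$ stand either for the one-sided discrete square function $S^+$ or for the operator $\mathcal{O}^+$. Then there is a constant $C>0$, independent of $f$, such that for every locally integrable $f$ on $\mathbb{R}$ $$\|Gf\|_{L^{p}(w)}\le C\,\|M_{L\log L}^{+}f\|_{L^{p}(w)}.$$
   Context: A weight is a nonnegative locally integrable function $w$ on $\mathbb{R}$; $\|g\|_{L^p(w)}=\left(\int_{\mathbb{R}}|g|^p w\right)^{1/p}$ for $0<p<\infty$. $M^{+}f(x)=\sup_{h>0}\frac1h\int_x^{x+h}|f(y)|\,dy$. For $1<r<\infty$, $w\in C_r^+$ means: there exist $\varepsilon_0>0$ and $C>0$ such that for all $a<b<c$ with $c-b<b-a$ and every measurable $E\subset(a,b)$, $\int_E w\le C\left(\frac{|E|}{c-b}\right)^{\varepsilon_0}\int_{\mathbb{R}}\left(M^+\chi_{(a,c)}\right)^r w$. For $f$ locally integrable and $s>0$, $A_sf(x)=\frac1s\int_x^{x+s}f(y)\,dy$, and $$S^{+}f(x)=\Big(\sum_{n\in\mathbb{Z}}|A_{2^{n}}f(x)-A_{2^{n-1}}f(x)|^{2}\Big)^{1/2},\qquad \mathcal{O}^{+}f(x)=\Big(\sum_{n\in\mathbb{Z}}\sup_{s\in[2^{n},2^{n+1})}|A_{2^{n}}f(x)-A_{s}f(x)|^{2}\Big)^{1/2}.$$ For a Young function $\Phi$, $\|f\|_{\Phi,E}=\inf\{\lambda>0:\frac1{|E|}\int_E\Phi(|f|/\lambda)\le1\}$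 and $M_\Phi^+f(x)=\sup_{h>0}\|f\|_{\Phi,[x,x+h]}$. $M^+_{L\log L}$ is $M^+_\Phi$ with $\Phi(t)=t(1+\log^+t)$. *)

theory Defs
  imports "HOL-Analysis.Analysis"
begin

text \<open>
  ``Measurable'' means Lebesgue measurable. Nonnegative quantities that may be infinite
  (maximal functions, the square function, the norms) take values in \<^typ>\<open>ennreal\<close>.
\<close>

definition locally_integrable :: "(real \<Rightarrow> real) \<Rightarrow> bool" where
  "locally_integrable f \<longleftrightarrow> (\<forall>K. compact K \<longrightarrow> set_integrable lebesgue K f)"

definition weight :: "(real \<Rightarrow> real) \<Rightarrow> bool" where
  "weight w \<longleftrightarrow> (\<forall>x. 0 \<le> w x) \<and> locally_integrable w"

text \<open>
  Powers of extended nonnegative reals; only used for \<open>a > 0\<close>, where \<open>\<infinity>\<^sup>a = \<infinity>\<close>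
  (and \<open>0 powr a = 0\<close>).
\<close>

definition epowr :: "ennreal \<Rightarrow> real \<Rightarrow> ennreal" where
  "epowr x a = (if x = \<infinity> then \<infinity> else ennreal (enn2real x powr a))"

definition Lp_norm :: "real \<Rightarrow> (real \<Rightarrow> real) \<Rightarrow> (real \<Rightarrow> ennreal) \<Rightarrow> ennreal" where
  "Lp_norm p w g = epowr (\<integral>\<^sup>+ x. epowr (g x) p * ennreal (w x) \<partial>lebesgue) (1 / p)"

definition M_plus :: "(real \<Rightarrow> real) \<Rightarrow> real \<Rightarrow> ennreal" where
  "M_plus f x =
     (SUP h\<in>{0<..}. ennreal (1 / h) * (\<integral>\<^sup>+ y\<in>{x..x + h}. ennreal \<bar>f y\<bar> \<partial>lebesgue))"

definition C_plus :: "real \<Rightarrow> (real \<Rightarrow> real) set" where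
  "C_plus r = {w. \<exists>\<epsilon>\<^sub>0 C. \<epsilon>\<^sub>0 > 0 \<and> C > 0 \<and>
     (\<forall>a b c E. a < b \<and> b < c \<and> c - b < b - a \<and> E \<in> sets lebesgue \<and> E \<subseteq> {a<..<b} \<longrightarrow>
        (\<integral>\<^sup>+ x\<in>E. ennreal (w x) \<partial>lebesgue)
          \<le> ennreal (C * (measure lebesgue E / (c - b)) powr \<epsilon>\<^sub>0) *
            (\<integral>\<^sup>+ x. epowr (M_plus (indicator {a<..<c}) x) r * ennreal (w x) \<partial>lebesgue))}"

definition avg :: "real \<Rightarrow> (real \<Rightarrow> real) \<Rightarrow> real \<Rightarrow> real" where
  "avg s f x = 1 / s * (LINT y:{x..x + s}|lebesgue. f y)"

definition S_plus :: "(real \<Rightarrow> real) \<Rightarrow> real \<Rightarrow> ennreal" where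
  "S_plus f x =
     epowr (\<Sum>\<^sub>\<infinity>n::int. ennreal (\<bar>avg (2 powi n) f x - avg (2 powi (n - 1)) f x\<bar>\<^sup>2)) (1 / 2)"

definition O_plus :: "(real \<Rightarrow> real) \<Rightarrow> real \<Rightarrow> ennreal" where
  "O_plus f x =
     epowr (\<Sum>\<^sub>\<infinity>n::int. SUP s\<in>{2 powi n..<2 powi (n + 1)}.
              ennreal (\<bar>avg (2 powi n) f x - avg s f x\<bar>\<^sup>2)) (1 / 2)"

text \<open>
  The Luxemburg average; it is \<open>\<infinity>\<close>, as the infimum of the empty set, if no \<open>t > 0\<close> is admissible.
\<close>

definition Luxemburg :: "(real \<Rightarrow> real) \<Rightarrow> (real \<Rightarrow> real) \<Rightarrow> real set \<Rightarrow> ennreal" where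
  "Luxemburg \<Phi> f E = (INF t\<in>{t. 0 < t \<and>
       (\<integral>\<^sup>+ y\<in>E. ennreal (\<Phi> (\<bar>f y\<bar> / t)) \<partial>lebesgue) / emeasure lebesgue E \<le> 1}. ennreal t)"

definition M_Young_plus :: "(real \<Rightarrow> real) \<Rightarrow> (real \<Rightarrow> real) \<Rightarrow> real \<Rightarrow> ennreal" where
  "M_Young_plus \<Phi> f x = (SUP h\<in>{0<..}. Luxemburg \<Phi> f {x..x + h})"

definition log_plus :: "real \<Rightarrow> real" where
  "log_plus t = (if t \<le> 1 then 0 else ln t)"

definition M_LlogL_plus :: "(real \<Rightarrow> real) \<Rightarrow> real \<Rightarrow> ennreal" where
  "M_LlogL_plus = M_Young_plus (\<lambda>t. t * (1 + log_plus t))"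

end

theory Submission
  imports Defs
begin

text \<open>
  The operator \<open>O\<^sup>+\<close> is the square root of \<open>sqO f = (\<Sum>n. osc f n)\<close>, and it dominates \<open>S\<^sup>+\<close>,
  because the averages are continuous in their length and so the length \<open>2\<^sup>n\<^sup>+\<^sup>1\<close> is a limit
  of lengths in \<open>[2\<^sup>n, 2\<^sup>n\<^sup>+\<^sup>1)\<close>. The weighted bound for \<open>sqO\<close> is a good-lambda argument:
  the sets where \<open>sqO f > (\<Lambda> K\<^sup>i)\<^sup>2\<close> are compared with the open sets \<open>lvl f (\<gamma> \<Lambda> K\<^sup>i)\<close>, on
  which \<open>M\<^sup>+\<^bsub>L log L\<^esub> f\<close> is at least \<open>\<gamma> \<Lambda> K\<^sup>i\<close>.

  For the unweighted bounds, note that the mean over a dyadic window is the average of the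
  means over its halves, so by the parallelogram law the \<open>L\<^sup>2\<close> norms of the dyadic
  differences telescope over the scales. Lengths between two powers of two are reached by
  repeated halving, each halving being paid by one dyadic difference; this gives the \<open>L\<^sup>2\<close>
  bound \<open>nn_integral_sqO_le\<close>. The rising sun lemma yields a Calderon-Zygmund decomposition
  adapted to averages to the right, and with it the weak type bound \<open>weak_type_sqO\<close>.

  The local estimate is \<open>local_good_lambda\<close>. Let \<open>t \<notin> lvl f (\<gamma> l)\<close> and let \<open>y\<close> be a point
  of \<open>[t, t + L]\<close> where \<open>sqO f\<close> is at most \<open>l\<^sup>2\<close>. The part of \<open>f\<close> on \<open>[t, t + 4 L]\<close> falls
  under the weak type bound. For the rest, the averages of length \<open>s \<approx> 2\<^sup>i L\<close> at another
  point \<open>x\<close> of this interval and at \<open>y\<close> essentially differ by the integral of \<open>f\<close> over an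
  interval of length at most \<open>L\<close>, divided by \<open>s\<close>. The \<open>L log L\<close> control of \<open>f\<close> on
  \<open>[t, t + s]\<close> makes this \<open>O(\<gamma> l / i)\<close>, which is square summable over the scales; a control
  of the plain averages of \<open>f\<close> would leave an error of size \<open>\<gamma> l\<close> on each of them. This is
  where \<open>L log L\<close> is needed.

  The weight enters through the integrals \<open>W a b\<close> of \<open>(M\<^sup>+ \<chi>\<^bsub>(a,b)\<^esub>)\<^sup>r\<close> against it. The
  condition bounds the weight of sparse subsets of an interval by a small multiple of its
  \<open>W\<close> (\<open>sparse_le\<close>), but the sum of \<open>W\<close> over the components of an open set may well exceed
  the weight of the set. These sums satisfy a recursion over the levels instead
  (\<open>tail_sum_recursion\<close>): if the components of the next level have density at most \<open>\<eta>\<close> to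
  the right of the left end point \<open>a\<close> of \<open>(a, b)\<close>, then the sum of their \<open>W\<close> is at most
  \<open>m A\<close> times the weight of \<open>(a, b)\<close> plus a multiple \<open>D2 g\<^sup>m + D1 \<eta>\<^sup>r\<close> of \<open>W a b\<close>, with
  \<open>g < 1\<close>. From one level to the next \<open>\<eta> = 3 / K\<close>, and the level sums carry the factor
  \<open>K\<^sup>p\<close>, so that \<open>p < r\<close> makes the multiple of \<open>W\<close> absorbable for large \<open>K\<close> and \<open>m\<close>. The
  weight of a superlevel set outside the level set of the maximal function is a small
  multiple of the sum of \<open>W\<close> by the local estimate, and \<open>good_lambda_sum\<close> closes the two
  recursions.

  All sums in this argument are finite if \<open>f\<close> is bounded with bounded support, the right-hand
  side of the claim is finite, and only finitely many levels above some \<open>\<Lambda> > 0\<close> are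
  considered. The error at the lowest level vanishes as \<open>\<Lambda> \<rightarrow> 0\<close> (\<open>nice_estimate\<close>), and
  Fatou's lemma passes from truncations to \<open>f\<close>.
\<close>

section \<open>Open sets of reals and their components\<close>

lemma open_component_interval:
  fixes U :: "real set"
  assumes "open U" "bounded U" "J \<in> components U"
  shows "J = {Inf J<..<Sup J}" "Inf J < Sup J" "Inf J \<notin> U" "Sup J \<notin> U"
proof -
  have op: "open J" using assms open_components by blast
  have con: "connected J" and ne: "J \<noteq> {}" and sub: "J \<subseteq> U"
    using assms(3) in_components_connected in_components_nonempty in_components_subset by blast+
  have bd: "bdd_above J" "bdd_below J"
    using bounded_subset[OF assms(2) sub] by (auto intro: bounded_imp_bdd_above bounded_imp_bdd_below)
  have lo: "Inf J < x" and hi: "x < Sup J" if xJ: "x \<in> J" for x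
  proof -
    obtain e where e: "e > 0" "ball x e \<subseteq> J" using openE[OF op xJ] by metis
    then have "x - e/2 \<in> J" "x + e/2 \<in> J" by (auto simp: subset_iff dist_real_def)
    then have "Inf J \<le> x - e/2" "x + e/2 \<le> Sup J" using bd by (auto intro: cInf_lower cSup_upper)
    then show "Inf J < x" "x < Sup J" using e by auto
  qed
  have mid: "y \<in> J" if yy: "Inf J < y" "y < Sup J" for y
  proof -
    obtain u where u: "u \<in> J" "u < y" using yy ne bd cInf_less_iff by blast
    obtain v where v: "v \<in> J" "y < v" using yy ne bd less_cSup_iff by blast
    show ?thesis using con u v by (meson connected_contains_Icc atLeastAtMost_iff less_imp_le subsetD)
  qed
  show eq: "J = {Inf J<..<Sup J}" using lo hi mid by auto
  show lt: "Inf J < Sup J" using ne lo hi by (meson all_not_in_conv less_trans)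
  have max: "T \<subseteq> J" if "connected T" "T \<subseteq> U" "J \<inter> T \<noteq> {}" for T
    using components_maximal[OF assms(3)] that by blast
  show "Inf J \<notin> U"
  proof
    assume i: "Inf J \<in> U"
    have "{Inf J..<Sup J} \<subseteq> U" using i sub mid by (force simp: le_less)
    then have "{Inf J..<Sup J} \<subseteq> J" using ne lo hi by (intro max) (auto simp: less_le)
    then show False using lt lo by (meson atLeastLessThan_iff less_irrefl order_refl subsetD)
  qed
  show "Sup J \<notin> U"
  proof
    assume i: "Sup J \<in> U"
    have "{Inf J<..Sup J} \<subseteq> U" using i sub mid by (force simp: le_less)
    then have "{Inf J<..Sup J} \<subseteq> J" using ne lo hi by (intro max) (auto simp: less_le)
    then show False using lt hi by (meson greaterThanAtMost_iff less_irrefl order_refl subsetD)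
  qed
qed

lemma countable_components_open:
  fixes U :: "real set"
  assumes "open U" shows "countable (components U)"
  using countable_disjoint_open_subsets[of "components U"] open_components[OF assms]
    pairwise_disjoint_components[of U] by (simp add: disjnt_def pairwise_def)

lemma emeasure_Union_count_space:
  assumes "countable \<J>" "\<And>J. J \<in> \<J> \<Longrightarrow> J \<in> sets M" "disjoint \<J>"
  shows "emeasure M (\<Union>\<J>) = (\<integral>\<^sup>+J. emeasure M J \<partial>count_space \<J>)"
  using emeasure_UN_countable[of \<J> id M] assms by (auto simp: disjoint_family_on_def pairwise_def disjnt_def)

lemma emeasure_components:
  fixes U :: "real set"
  assumes "open U" "sets borel \<subseteq> sets M"
  shows "emeasure M U = (\<integral>\<^sup>+J. emeasure M J \<partial>count_space (components U))"
proof -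
  have "emeasure M (\<Union>(components U)) = (\<integral>\<^sup>+J. emeasure M J \<partial>count_space (components U))"
  proof (rule emeasure_Union_count_space)
    show "disjoint (components U)" using pairwise_disjoint_components by (simp add: pairwise_def disjnt_def)
  qed (use assms countable_components_open open_components borel_open in blast)+
  then show ?thesis by simp
qed

lemma emeasure_Int_components:
  fixes U :: "real set"
  assumes "open U" "sets borel \<subseteq> sets M" "E \<in> sets M" "E \<subseteq> U"
  shows "emeasure M E = (\<integral>\<^sup>+J. emeasure M (E \<inter> J) \<partial>count_space (components U))"
proof -
  have "emeasure M (\<Union>J\<in>components U. E \<inter> J) = (\<integral>\<^sup>+J. emeasure M (E \<inter> J) \<partial>count_space (components U))"
  proof (rule emeasure_UN_countable)
    show "disjoint_family_on (\<lambda>J. E \<inter> J) (components U)"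
      using pairwise_disjoint_components[of U] by (fastforce simp: disjoint_family_on_def pairwise_def)
    show "countable (components U)" using assms countable_components_open by blast
    show "E \<inter> J \<in> sets M" if "J \<in> components U" for J
      using assms that open_components borel_open by (metis sets.Int subsetD)
  qed
  moreover have "(\<Union>J\<in>components U. E \<inter> J) = E" using assms(4) Union_components[of U] by blast
  ultimately show ?thesis by simp
qed

section \<open>Sums over the scales\<close>

text \<open>An integral against the counting measure is open to monotone convergence, Fatou and
  Fubini.\<close>
lemma infsum_int_eq_nn_integral:
  fixes f :: "int \<Rightarrow> ennreal"
  shows "infsum f UNIV = (\<integral>\<^sup>+n. f n \<partial>count_space UNIV)"
proof (rule antisym)
  have "infsum f UNIV = (SUP F\<in>{F. finite F \<and> F \<subseteq> UNIV}. sum f F)"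
    by (rule nonneg_infsum_complete) auto
  also have "\<dots> \<le> (\<integral>\<^sup>+n. f n \<partial>count_space UNIV)"
  proof (rule SUP_least)
    fix F :: "int set" assume "F \<in> {F. finite F \<and> F \<subseteq> UNIV}"
    then have "sum f F = (\<integral>\<^sup>+n. f n \<partial>count_space F)" by (simp add: nn_integral_count_space_finite)
    also have "\<dots> = (\<integral>\<^sup>+n. f n * indicator F n \<partial>count_space UNIV)"
      by (subst nn_integral_count_space_indicator) auto
    also have "\<dots> \<le> (\<integral>\<^sup>+n. f n \<partial>count_space UNIV)"
      by (rule nn_integral_mono) (auto split: split_indicator)
    finally show "sum f F \<le> (\<integral>\<^sup>+n. f n \<partial>count_space UNIV)" .
  qed
  finally show "infsum f UNIV \<le> (\<integral>\<^sup>+n. f n \<partial>count_space UNIV)" .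
next
  have "(\<integral>\<^sup>+n. f n \<partial>count_space UNIV) = (\<integral>\<^sup>+n. f (int_decode n) \<partial>count_space UNIV)"
    by (rule nn_integral_bij_count_space[symmetric]) (rule bij_int_decode)
  also have "\<dots> = (\<Sum>n. f (int_decode n))" by (rule nn_integral_count_space_nat)
  also have "\<dots> \<le> infsum f UNIV"
  proof (rule suminf_le_const)
    fix n
    have "(\<Sum>i<n. f (int_decode i)) = sum f (int_decode ` {..<n})"
      by (subst sum.reindex) (auto simp: inj_int_decode intro: inj_on_subset[OF inj_int_decode])
    also have "\<dots> \<le> infsum f UNIV"
      unfolding nonneg_infsum_complete[of UNIV f, simplified] by (intro SUP_upper) auto
    finally show "(\<Sum>i<n. f (int_decode i)) \<le> infsum f UNIV" .
  qed auto
  finally show "(\<integral>\<^sup>+n. f n \<partial>count_space UNIV) \<le> infsum f UNIV" .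
qed

lemma nn_integral_int_ge:
  fixes g :: "int \<Rightarrow> ennreal"
  assumes "\<And>n. n < n0 \<Longrightarrow> g n = 0"
  shows "(\<integral>\<^sup>+n. g n \<partial>count_space UNIV) = (\<Sum>i. g (n0 + int i))"
proof -
  have "(\<integral>\<^sup>+n. g n \<partial>count_space UNIV) = (\<integral>\<^sup>+n. g n \<partial>count_space {n0..})"
    by (rule nn_integral_count_space_eq) (use assms in auto)
  also have "\<dots> = (\<integral>\<^sup>+i. g (n0 + int i) \<partial>count_space UNIV)"
  proof (rule nn_integral_bij_count_space[symmetric])
    show "bij_betw (\<lambda>i. n0 + int i) UNIV {n0..}"
      by (rule bij_betw_byWitness[where f'="\<lambda>k. nat (k - n0)"]) auto
  qed
  finally show ?thesis by (simp add: nn_integral_count_space_nat)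
qed

lemma ex_least_power2_gt:
  fixes e :: real assumes "e > 0"
  obtains n0 :: int where "2 powi n0 > e" "\<And>n. 2 powi n > e \<Longrightarrow> n0 \<le> n"
proof
  let ?n = "\<lfloor>log 2 e\<rfloor> + 1"
  have iff: "2 powi n > e \<longleftrightarrow> log 2 e < of_int n" for n :: int
  proof -
    have "(2::real) powi n = 2 powr of_int n" by (simp add: powr_real_of_int')
    then show ?thesis using assms log_less_iff[of 2 e "of_int n"] by simp
  qed
  show "2 powi ?n > e" unfolding iff by linarith
  show "?n \<le> n" if "2 powi n > e" for n using that unfolding iff by linarith
qed

text \<open>A geometric series, dominated by the first scale above \<open>e\<close>.\<close>
lemma sum_powi_le:
  fixes g :: "int \<Rightarrow> real"
  assumes "e > 0" "D \<ge> 0" "\<And>n. 2 powi n \<le> e \<Longrightarrow> g n = 0"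
    and "\<And>n. 2 powi n > e \<Longrightarrow> g n \<le> D / (2 powi n)\<^sup>2"
  shows "(\<integral>\<^sup>+n. ennreal (g n) \<partial>count_space UNIV) \<le> ennreal (4 / 3 * D / e\<^sup>2)"
proof -
  obtain n0 :: int where n0: "2 powi n0 > e" "\<And>n. 2 powi n > e \<Longrightarrow> n0 \<le> n"
    using ex_least_power2_gt[OF assms(1)] by metis
  have "(\<integral>\<^sup>+n. ennreal (g n) \<partial>count_space UNIV) = (\<Sum>i. ennreal (g (n0 + int i)))"
  proof (rule nn_integral_int_ge)
    fix n assume "n < n0"
    then have "\<not> 2 powi n > e" using n0(2)[of n] by auto
    then show "ennreal (g n) = 0" using assms(3)[of n] by auto
  qed
  also have "\<dots> \<le> (\<Sum>i. ennreal (D / e\<^sup>2 * (1/4) ^ i))"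
  proof (rule suminf_le)
    fix i :: nat
    have e: "(2::real) powi (n0 + int i) = 2 powi n0 * 2 ^ i" by (simp add: power_int_add)
    have "2 powi (n0 + int i) > e"
      using n0(1) assms(1) unfolding e by (meson less_le_trans mult_less_cancel_left1 one_le_power one_le_numeral
          mult_le_cancel_left1 order_less_le_trans not_le order.strict_trans)
    then have "g (n0 + int i) \<le> D / (2 powi (n0 + int i))\<^sup>2" by (rule assms(4))
    also have "\<dots> = D / (2 powi n0)\<^sup>2 * (1/4) ^ i"
      unfolding e by (simp add: power_mult_distrib power_divide power_even_eq[symmetric] power2_eq_square
          power_mult_distrib[symmetric] flip: power_mult)
    also have "\<dots> \<le> D / e\<^sup>2 * (1/4) ^ i"
      using n0(1) assms(1,2) by (intro mult_right_mono divide_left_mono power_mono) auto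
    finally show "ennreal (g (n0 + int i)) \<le> ennreal (D / e\<^sup>2 * (1/4) ^ i)" by (rule ennreal_leI)
  qed auto
  also have "\<dots> = ennreal (\<Sum>i. D / e\<^sup>2 * (1/4) ^ i)"
    using assms by (intro suminf_ennreal2) (auto intro!: summable_mult summable_geometric)
  also have "(\<Sum>i. D / e\<^sup>2 * (1/4) ^ i) = D / e\<^sup>2 * (\<Sum>i. (1/4::real) ^ i)"
    by (rule suminf_mult) (auto intro!: summable_geometric)
  also have "\<dots> = 4 / 3 * D / e\<^sup>2" by (simp add: suminf_geometric)
  finally show ?thesis .
qed

section \<open>Bounded Borel functions of bounded support\<close>

text \<open>The class for which the estimate is proved first: all its integrals are finite, and
  the functions \<open>Phi (\<bar>f x\<bar> / \<mu>)\<close> stay in it.\<close>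
definition nice :: "(real \<Rightarrow> real) \<Rightarrow> bool" where
  "nice f \<longleftrightarrow> f \<in> borel_measurable borel \<and> (\<exists>B R. \<forall>x. \<bar>f x\<bar> \<le> B \<and> (R < \<bar>x\<bar> \<longrightarrow> f x = 0))"

lemma niceE:
  assumes "nice f"
  obtains B R where "f \<in> borel_measurable borel" "B > 0" "R > 0" "\<And>x. \<bar>f x\<bar> \<le> B" "\<And>x. R < \<bar>x\<bar> \<Longrightarrow> f x = 0"
proof -
  obtain B R where *: "f \<in> borel_measurable borel" "\<And>x. \<bar>f x\<bar> \<le> B" "\<And>x. R < \<bar>x\<bar> \<Longrightarrow> f x = 0"
    using assms unfolding nice_def by auto
  show thesis
    by (rule that[of "max B 1" "max R 1"]) (use * in \<open>auto intro: le_max_iff_disj[THEN iffD2]\<close>)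
qed

lemma nice_measurable[measurable_dest]: "nice f \<Longrightarrow> f \<in> borel_measurable borel"
  unfolding nice_def by blast

lemma nice_bound:
  assumes "nice f" "g \<in> borel_measurable borel" "\<And>x. \<bar>g x\<bar> \<le> c * \<bar>f x\<bar>"
  shows "nice g"
proof -
  obtain B R where *: "B > 0" "\<And>x. \<bar>f x\<bar> \<le> B" "\<And>x. R < \<bar>x\<bar> \<Longrightarrow> f x = 0" using niceE[OF assms(1)] by metis
  have "\<bar>g x\<bar> \<le> \<bar>c\<bar> * B \<and> (R < \<bar>x\<bar> \<longrightarrow> g x = 0)" for x
  proof -
    have "\<bar>g x\<bar> \<le> \<bar>c\<bar> * \<bar>f x\<bar>" using assms(3)[of x] by (smt (verit) mult_right_mono abs_ge_zero abs_ge_self)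
    moreover have "\<bar>c\<bar> * \<bar>f x\<bar> \<le> \<bar>c\<bar> * B" using *(2)[of x] by (intro mult_left_mono) auto
    ultimately show ?thesis using *(3)[of x] by auto
  qed
  then show ?thesis using assms(2) unfolding nice_def by blast
qed

lemma nice_add: "nice f \<Longrightarrow> nice g \<Longrightarrow> nice (\<lambda>x. f x + g x)"
proof -
  assume f: "nice f" and g: "nice g"
  obtain B R where 1: "\<And>x. \<bar>f x\<bar> \<le> B" "\<And>x. R < \<bar>x\<bar> \<Longrightarrow> f x = 0" using niceE[OF f] by metis
  obtain B' R' where 2: "\<And>x. \<bar>g x\<bar> \<le> B'" "\<And>x. R' < \<bar>x\<bar> \<Longrightarrow> g x = 0" using niceE[OF g] by metis
  have "\<bar>f x + g x\<bar> \<le> B + B' \<and> (max R R' < \<bar>x\<bar> \<longrightarrow> f x + g x = 0)" for x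
    using 1(1)[of x] 2(1)[of x] 1(2)[of x] 2(2)[of x] by auto
  then show ?thesis using f g unfolding nice_def by (intro conjI exI[of _ "B + B'"] exI[of _ "max R R'"]) auto
qed

lemma nice_cmult: "nice f \<Longrightarrow> nice (\<lambda>x. c * f x)"
  by (rule nice_bound[where c="\<bar>c\<bar>"]) (auto simp: abs_mult dest: nice_measurable)

lemma nice_diff: "nice f \<Longrightarrow> nice g \<Longrightarrow> nice (\<lambda>x. f x - g x)"
  using nice_add[of f "\<lambda>x. (-1) * g x"] nice_cmult[of g "-1"] by simp

lemma nice_abs: "nice f \<Longrightarrow> nice (\<lambda>x. \<bar>f x\<bar>)"
  by (rule nice_bound[where c=1]) (auto dest: nice_measurable)

lemma nice_indicator: "nice f \<Longrightarrow> A \<in> sets borel \<Longrightarrow> nice (\<lambda>x. indicator A x * f x)"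
  by (rule nice_bound[where c=1 and f=f]) (auto dest: nice_measurable split: split_indicator)

lemma nice_integrable:
  assumes "nice f" shows "integrable lborel f"
proof -
  obtain B R where *: "f \<in> borel_measurable borel" "B > 0" "\<And>x. \<bar>f x\<bar> \<le> B" "\<And>x. R < \<bar>x\<bar> \<Longrightarrow> f x = 0" using niceE[OF assms] by metis
  have "integrable lborel (\<lambda>x. B * indicator {-R..R} x)" by (simp add: emeasure_lborel_Icc_eq)
  then show ?thesis
  proof (rule Bochner_Integration.integrable_bound)
    show "AE x in lborel. norm (f x) \<le> norm (B * indicator {- R..R} x)"
    proof (rule AE_I2)
      show "norm (f x) \<le> norm (B * indicator {- R..R} x)" for x
        using *(2) *(3)[of x] *(4)[of x] by (cases "x \<in> {-R..R}") auto
    qed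
  qed (use * in auto)
qed

lemma nice_set_integrable:
  assumes "nice f" "A \<in> sets borel" shows "set_integrable lborel A f"
  unfolding set_integrable_def using nice_integrable[OF nice_indicator[OF assms]] by simp

text \<open>Averages to the right are difference quotients of this Lipschitz function, which makes
  them continuous both in the point and in the length.\<close>
definition cumul :: "(real \<Rightarrow> real) \<Rightarrow> real \<Rightarrow> real" where
  "cumul f z = (LBINT y:{..z}. f y)"

lemma cumul_diff:
  assumes "nice f" "a \<le> b" shows "cumul f b - cumul f a = (LBINT y:{a<..b}. f y)"
proof -
  have "{..b} = {..a} \<union> {a<..b}" using assms(2) by auto
  then have "cumul f b = cumul f a + (LBINT y:{a<..b}. f y)"
    unfolding cumul_def by (metis set_integral_Un[of "{..a}" "{a<..b}"] nice_set_integrable[OF assms(1)]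
        disjoint_iff atMost_iff greaterThanAtMost_iff leD atMost_borel greaterThanAtMost_borel)
  then show ?thesis by simp
qed

lemma set_lborel_cong_AE_point:
  fixes f :: "real \<Rightarrow> real"
  assumes "f \<in> borel_measurable borel" "A \<in> sets borel" "B \<in> sets borel" "(A - B) \<union> (B - A) \<subseteq> {a, b}"
  shows "(LBINT y:A. f y) = (LBINT y:B. f y)"
  unfolding set_lebesgue_integral_def
proof (rule integral_cong_AE)
  have "AE y in lborel. y \<noteq> a \<and> y \<noteq> b" using AE_lborel_singleton[of a] AE_lborel_singleton[of b] by auto
  then show "AE x in lborel. indicat_real A x *\<^sub>R f x = indicat_real B x *\<^sub>R f x"
    by eventually_elim (use assms(4) in \<open>auto split: split_indicator\<close>)
qed (use assms in measurable)

lemma cumul_diff_Icc: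
  assumes "nice f" "a \<le> b" shows "cumul f b - cumul f a = (LBINT y:{a..b}. f y)"
  unfolding cumul_diff[OF assms]
  by (rule set_lborel_cong_AE_point[where a=a and b=b]) (use assms in \<open>auto dest: nice_measurable\<close>)

lemma cumul_diff_Ioo:
  assumes "nice f" "a \<le> b" shows "cumul f b - cumul f a = (LBINT y:{a<..<b}. f y)"
  unfolding cumul_diff[OF assms]
  by (rule set_lborel_cong_AE_point[where a=a and b=b]) (use assms in \<open>auto dest: nice_measurable\<close>)

lemma cumul_diff_abs:
  assumes "nice f" "a \<le> b"
  shows "\<bar>cumul f b - cumul f a\<bar> \<le> cumul (\<lambda>x. \<bar>f x\<bar>) b - cumul (\<lambda>x. \<bar>f x\<bar>) a"
  unfolding cumul_diff[OF assms] cumul_diff[OF nice_abs[OF assms(1)] assms(2)]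
  using set_integral_norm_bound[OF nice_set_integrable[OF assms(1), of "{a<..b}"]] by simp

lemma cumul_mono:
  assumes "nice f" "\<And>x. f x \<ge> 0" "a \<le> b" shows "cumul f a \<le> cumul f b"
proof -
  have "(LBINT y:{a<..b}. f y) \<ge> 0" unfolding set_lebesgue_integral_def
    by (rule integral_nonneg_AE) (use assms in auto)
  then show ?thesis using cumul_diff[OF assms(1,3)] by simp
qed

lemma nn_cumul_diff:
  assumes "nice f" "\<And>x. f x \<ge> 0" "a \<le> b"
  shows "(\<integral>\<^sup>+y\<in>{a..b}. ennreal (f y) \<partial>lborel) = ennreal (cumul f b - cumul f a)"
proof -
  have "(\<integral>\<^sup>+y\<in>{a..b}. ennreal (f y) \<partial>lborel) = (\<integral>\<^sup>+y. ennreal (indicator {a..b} y * f y) \<partial>lborel)"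
    by (intro nn_integral_cong) (auto split: split_indicator)
  also have "\<dots> = ennreal (\<integral>y. indicator {a..b} y * f y \<partial>lborel)"
    by (rule nn_integral_eq_integral) (use nice_integrable[OF nice_indicator[OF assms(1)]] assms in auto)
  also have "\<dots> = ennreal (cumul f b - cumul f a)"
    using cumul_diff_Icc[OF assms(1,3)] by (simp add: set_lebesgue_integral_def)
  finally show ?thesis .
qed

lemma cumul_lipschitz:
  assumes "nice f" "\<And>x. \<bar>f x\<bar> \<le> B" "a \<le> b" shows "\<bar>cumul f b - cumul f a\<bar> \<le> B * (b - a)"
proof -
  have "\<bar>LBINT y:{a<..b}. f y\<bar> \<le> (LBINT y:{a<..b}. \<bar>f y\<bar>)"
    using set_integral_norm_bound[OF nice_set_integrable[OF assms(1), of "{a<..b}"]] by simp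
  also have "\<dots> \<le> (LBINT y:{a<..b}. B)"
    by (rule set_integral_mono) (use nice_set_integrable[OF nice_abs[OF assms(1)]] assms in \<open>auto simp: set_integrable_def\<close>)
  also have "\<dots> = B * (b - a)" using assms(3) by (simp add: set_lebesgue_integral_def)
  finally show ?thesis using cumul_diff[OF assms(1,3)] by simp
qed

lemma continuous_cumul:
  assumes "nice f" shows "continuous_on S (cumul f)"
proof -
  obtain B where B: "B > 0" "\<And>x. \<bar>f x\<bar> \<le> B" using niceE[OF assms] by metis
  have "\<bar>cumul f b - cumul f a\<bar> \<le> B * \<bar>b - a\<bar>" for a b
    using cumul_lipschitz[OF assms B(2), of a b] cumul_lipschitz[OF assms B(2), of b a] by (cases "a \<le> b") auto
  then have "B-lipschitz_on UNIV (cumul f)" using B by (intro lipschitz_onI) (auto simp: dist_real_def abs_minus_commute)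
  then show ?thesis using lipschitz_on_continuous_on continuous_on_subset by blast
qed

lemma isCont_cumul: "nice f \<Longrightarrow> isCont (cumul f) x"
  using continuous_cumul[of f UNIV] by (simp add: continuous_on_eq_continuous_at)

lemma tendsto_cumul: "nice f \<Longrightarrow> (g \<longlongrightarrow> x) F \<Longrightarrow> ((\<lambda>i. cumul f (g i)) \<longlongrightarrow> cumul f x) F"
  using isCont_cumul isCont_tendsto_compose by blast

lemma cumul_add: "nice f \<Longrightarrow> nice g \<Longrightarrow> cumul (\<lambda>x. f x + g x) z = cumul f z + cumul g z"
  unfolding cumul_def by (rule set_integral_add) (auto intro: nice_set_integrable)

lemma cumul_le:
  assumes "nice f" "nice g" "a \<le> b" "\<And>x. a < x \<Longrightarrow> x \<le> b \<Longrightarrow> f x \<le> g x"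
  shows "cumul f b - cumul f a \<le> cumul g b - cumul g a"
  unfolding cumul_diff[OF assms(1,3)] cumul_diff[OF assms(2,3)]
  by (rule set_integral_mono) (use assms nice_set_integrable in auto)

lemma cumul_diff_le_total:
  assumes "nice f" "\<And>x. f x \<ge> 0" "a \<le> b"
  shows "cumul f b - cumul f a \<le> (\<integral>x. f x \<partial>lborel)"
  unfolding cumul_diff[OF assms(1,3)] set_lebesgue_integral_def
  by (rule integral_mono) (use nice_integrable[OF nice_indicator[OF assms(1)]] nice_integrable[OF assms(1)] assms in \<open>auto split: split_indicator\<close>)

lemma avg_cumul:
  assumes "nice f" "s > 0" shows "avg s f x = (cumul f (x + s) - cumul f x) / s"
proof -
  have "(LINT y:{x..x + s}|lebesgue. f y) = (LBINT y:{x..x + s}. f y)"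
    unfolding set_lebesgue_integral_def
    by (rule integral_completion) (use assms in \<open>auto dest: nice_measurable\<close>)
  then show ?thesis using cumul_diff_Icc[OF assms(1), of x "x + s"] assms(2) by (simp add: avg_def)
qed

section \<open>The oscillation square function\<close>

definition osc :: "(real \<Rightarrow> real) \<Rightarrow> int \<Rightarrow> real \<Rightarrow> ennreal" where
  "osc f n x = (SUP s\<in>{2 powi n..<2 powi (n + 1)}. ennreal ((avg (2 powi n) f x - avg s f x)\<^sup>2))"

definition sqO :: "(real \<Rightarrow> real) \<Rightarrow> real \<Rightarrow> ennreal" where
  "sqO f x = (\<integral>\<^sup>+n. osc f n x \<partial>count_space UNIV)"

lemma O_plus_eq: "O_plus f x = epowr (sqO f x) (1 / 2)"
  unfolding O_plus_def sqO_def osc_def by (simp add: infsum_int_eq_nn_integral)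

lemma osc_liminf:
  assumes "\<And>s. s > 0 \<Longrightarrow> (\<lambda>i. avg s (F i) (X i)) \<longlonglongrightarrow> avg s f x"
  shows "osc f n x \<le> liminf (\<lambda>i. osc (F i) n (X i))"
  unfolding osc_def[of f]
proof (rule SUP_least)
  fix s :: real assume s: "s \<in> {2 powi n..<2 powi (n + 1)}"
  then have "s > 0" by (smt (verit) atLeastLessThan_iff zero_less_power_int)
  let ?g = "\<lambda>i. ennreal ((avg (2 powi n) (F i) (X i) - avg s (F i) (X i))\<^sup>2)"
  have "?g \<longlonglongrightarrow> ennreal ((avg (2 powi n) f x - avg s f x)\<^sup>2)"
    using \<open>s > 0\<close> by (intro tendsto_ennrealI tendsto_power tendsto_diff assms) auto
  then have "ennreal ((avg (2 powi n) f x - avg s f x)\<^sup>2) = liminf ?g"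
    by (rule lim_imp_Liminf[OF sequentially_bot, symmetric])
  also have "\<dots> \<le> liminf (\<lambda>i. osc (F i) n (X i))"
    unfolding osc_def by (intro Liminf_mono always_eventually allI SUP_upper s)
  finally show "ennreal ((avg (2 powi n) f x - avg s f x)\<^sup>2) \<le> liminf (\<lambda>i. osc (F i) n (X i))" .
qed

text \<open>Fatou's lemma for the sum over the scales. With \<open>F i = f\<close> it gives the lower
  semicontinuity of \<open>sqO f\<close>, with \<open>X i = x\<close> the passage from truncations to \<open>f\<close>.\<close>
lemma sqO_liminf:
  assumes "\<And>s. s > 0 \<Longrightarrow> (\<lambda>i. avg s (F i) (X i)) \<longlonglongrightarrow> avg s f x"
  shows "sqO f x \<le> liminf (\<lambda>i. sqO (F i) (X i))"
proof -
  have "sqO f x \<le> (\<integral>\<^sup>+n. liminf (\<lambda>i. osc (F i) n (X i)) \<partial>count_space UNIV)"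
    unfolding sqO_def by (intro nn_integral_mono osc_liminf assms)
  also have "\<dots> \<le> liminf (\<lambda>i. sqO (F i) (X i))"
    unfolding sqO_def by (rule nn_integral_liminf) auto
  finally show ?thesis .
qed

lemma open_superlevel_of_liminf:
  fixes h :: "real \<Rightarrow> ennreal"
  assumes "\<And>X x. X \<longlonglongrightarrow> x \<Longrightarrow> h x \<le> liminf (\<lambda>i. h (X i))"
  shows "open {x. c < h x}"
proof -
  have "closed {x. h x \<le> c}"
    unfolding closed_sequential_limits
  proof (intro allI impI)
    fix X x assume a: "(\<forall>n. X n \<in> {x. h x \<le> c}) \<and> X \<longlonglongrightarrow> x"
    then have "h x \<le> liminf (\<lambda>i. h (X i))" using assms by blast
    also have "\<dots> \<le> liminf (\<lambda>i::nat. c)" using a by (intro Liminf_mono always_eventually) auto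
    also have "\<dots> = c" by (simp add: Liminf_const)
    finally show "x \<in> {x. h x \<le> c}" by simp
  qed
  moreover have "{x. c < h x} = - {x. h x \<le> c}" by auto
  ultimately show ?thesis by (simp add: open_Compl)
qed

lemma tendsto_avg:
  assumes "nice f" "X \<longlonglongrightarrow> x" "s > 0" shows "(\<lambda>i. avg s f (X i)) \<longlonglongrightarrow> avg s f x"
  unfolding avg_cumul[OF assms(1,3)] using assms
  by (intro tendsto_divide tendsto_diff tendsto_cumul tendsto_add) auto

lemma open_sqO: "nice f \<Longrightarrow> open {x. c < sqO f x}"
  by (intro open_superlevel_of_liminf sqO_liminf tendsto_avg)

lemma open_osc: "nice f \<Longrightarrow> open {x. c < osc f n x}"
  by (intro open_superlevel_of_liminf osc_liminf tendsto_avg)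

lemma measurable_osc[measurable]: "nice f \<Longrightarrow> osc f n \<in> borel_measurable borel"
  by (rule borel_measurableI_greater) (simp add: open_osc)

lemma measurable_sqO[measurable]: "nice f \<Longrightarrow> sqO f \<in> borel_measurable borel"
  by (rule borel_measurableI_greater) (simp add: open_sqO)

lemma avg_add:
  assumes "nice f" "nice g" "s > 0" shows "avg s (\<lambda>x. f x + g x) x = avg s f x + avg s g x"
  using assms by (simp add: avg_cumul nice_add cumul_add add_divide_distrib diff_divide_distrib)

lemma square_add_le: "((a::real) + b)\<^sup>2 \<le> 2 * a\<^sup>2 + 2 * b\<^sup>2"
  using sum_squares_bound[of a b] by (simp add: power2_sum)

lemma osc_upper:
  "s \<in> {2 powi n..<2 powi (n + 1)} \<Longrightarrow> ennreal ((avg (2 powi n) f x - avg s f x)\<^sup>2) \<le> osc f n x"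
  unfolding osc_def by (rule SUP_upper)

lemma osc_add:
  assumes "nice f" "nice g"
  shows "osc (\<lambda>x. f x + g x) n x \<le> 2 * osc f n x + 2 * osc g n x"
  unfolding osc_def[of "\<lambda>x. f x + g x"]
proof (rule SUP_least)
  fix s :: real assume s: "s \<in> {2 powi n..<2 powi (n + 1)}"
  then have s0: "s > 0" by (smt (verit) atLeastLessThan_iff zero_less_power_int)
  let ?a = "avg (2 powi n) f x - avg s f x" and ?b = "avg (2 powi n) g x - avg s g x"
  have "avg (2 powi n) (\<lambda>x. f x + g x) x - avg s (\<lambda>x. f x + g x) x = ?a + ?b"
    using s0 assms by (simp add: avg_add)
  then have "ennreal ((avg (2 powi n) (\<lambda>x. f x + g x) x - avg s (\<lambda>x. f x + g x) x)\<^sup>2) \<le> ennreal (2 * ?a\<^sup>2 + 2 * ?b\<^sup>2)"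
    by (simp only:) (intro ennreal_leI square_add_le)
  also have "\<dots> = 2 * ennreal (?a\<^sup>2) + 2 * ennreal (?b\<^sup>2)"
    by (simp add: ennreal_mult ennreal_plus)
  also have "\<dots> \<le> 2 * osc f n x + 2 * osc g n x"
    by (intro add_mono mult_left_mono osc_upper s) auto
  finally show "ennreal ((avg (2 powi n) (\<lambda>x. f x + g x) x - avg s (\<lambda>x. f x + g x) x)\<^sup>2) \<le> 2 * osc f n x + 2 * osc g n x" .
qed

lemma sqO_add:
  assumes "nice f" "nice g"
  shows "sqO (\<lambda>x. f x + g x) x \<le> 2 * sqO f x + 2 * sqO g x"
proof -
  have "sqO (\<lambda>x. f x + g x) x \<le> (\<integral>\<^sup>+n. 2 * osc f n x + 2 * osc g n x \<partial>count_space UNIV)"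
    unfolding sqO_def by (intro nn_integral_mono osc_add assms)
  also have "\<dots> = 2 * sqO f x + 2 * sqO g x"
    unfolding sqO_def by (simp add: nn_integral_add nn_integral_cmult)
  finally show ?thesis .
qed

section \<open>The \<open>L\<^sup>2\<close> bound\<close>

lemma nn_integral_shift:
  assumes "g \<in> borel_measurable borel"
  shows "(\<integral>\<^sup>+x. g (x + c) \<partial>lborel) = (\<integral>\<^sup>+x. g x \<partial>(lborel::real measure))"
  using nn_integral_real_affine[OF assms, of 1 c] by (simp add: add.commute)

lemma nn_integral_cumul_diff:
  assumes "nice f" "\<And>x. f x \<ge> 0" "s > 0"
  shows "(\<integral>\<^sup>+x. ennreal (cumul f (x + s) - cumul f x) \<partial>lborel) = ennreal s * (\<integral>\<^sup>+x. ennreal (f x) \<partial>lborel)"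
proof -
  have [measurable]: "f \<in> borel_measurable borel" using assms nice_measurable by blast
  have "(\<integral>\<^sup>+x. ennreal (cumul f (x + s) - cumul f x) \<partial>lborel) = (\<integral>\<^sup>+x. \<integral>\<^sup>+y. ennreal (f y) * indicator {x..x+s} y \<partial>lborel \<partial>lborel)"
    by (intro nn_integral_cong, subst nn_cumul_diff[OF assms(1,2)]) (use assms in auto)
  also have "\<dots> = (\<integral>\<^sup>+x. \<integral>\<^sup>+y. ennreal (f y) * indicator {(x, y). x \<le> y \<and> y \<le> x + s} (x, y) \<partial>lborel \<partial>lborel)"
    by (intro nn_integral_cong) (auto split: split_indicator)
  also have "\<dots> = (\<integral>\<^sup>+y. \<integral>\<^sup>+x. ennreal (f y) * indicator {(x, y). x \<le> y \<and> y \<le> x + s} (x, y) \<partial>lborel \<partial>lborel)"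
    by (rule lborel_pair.Fubini') measurable
  also have "\<dots> = (\<integral>\<^sup>+y. \<integral>\<^sup>+x. ennreal (f y) * indicator {y - s..y} x \<partial>lborel \<partial>lborel)"
    by (intro nn_integral_cong) (auto split: split_indicator)
  also have "\<dots> = (\<integral>\<^sup>+y. ennreal (f y) * ennreal s \<partial>lborel)"
    by (intro nn_integral_cong) (use assms in \<open>simp add: nn_integral_cmult\<close>)
  also have "\<dots> = ennreal s * (\<integral>\<^sup>+x. ennreal (f x) \<partial>lborel)"
    by (subst nn_integral_multc) (auto simp: mult.commute)
  finally show ?thesis .
qed

lemma nice_square: "nice f \<Longrightarrow> nice (\<lambda>x. (f x)\<^sup>2)"
proof -
  assume f: "nice f"
  obtain B where B: "B > 0" "\<And>x. \<bar>f x\<bar> \<le> B" using niceE[OF f] by metis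
  show ?thesis
  proof (rule nice_bound[OF f, of _ B])
    show "\<bar>(f x)\<^sup>2\<bar> \<le> B * \<bar>f x\<bar>" for x
      using mult_right_mono[OF B(2)[of x], of "\<bar>f x\<bar>"] by (simp add: power2_eq_square abs_mult)
  qed (use f nice_measurable in measurable)
qed

lemma avg_square_le:
  assumes "nice f" "s > 0"
  shows "(avg s f x)\<^sup>2 \<le> (cumul (\<lambda>y. (f y)\<^sup>2) (x + s) - cumul (\<lambda>y. (f y)\<^sup>2) x) / s"
proof -
  define c where "c = avg s f x"
  have I: "cumul f (x + s) - cumul f x = s * c" using assms by (simp add: c_def avg_cumul)
  have si: "set_integrable lborel {x<..x+s} (\<lambda>y. (f y)\<^sup>2)" "set_integrable lborel {x<..x+s} (\<lambda>y. 2 * c * f y)" "set_integrable lborel {x<..x+s} (\<lambda>y. c\<^sup>2)"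
    using nice_set_integrable[OF nice_square[OF assms(1)]] nice_set_integrable[OF nice_cmult[OF assms(1)]]
    using assms(2) by (auto simp: set_integrable_def intro!: integrable_real_indicator)
  have "0 \<le> (LBINT y:{x<..x+s}. (f y - c)\<^sup>2)"
    unfolding set_lebesgue_integral_def by (rule integral_nonneg_AE) auto
  also have "(LBINT y:{x<..x+s}. (f y - c)\<^sup>2) = (LBINT y:{x<..x+s}. (f y)\<^sup>2 - 2 * c * f y + c\<^sup>2)"
    by (simp add: power2_diff algebra_simps)
  also have "\<dots> = (LBINT y:{x<..x+s}. (f y)\<^sup>2) - 2 * c * (LBINT y:{x<..x+s}. f y) + c\<^sup>2 * s"
    using si assms(2)
    by (simp add: set_integral_add set_integral_diff)
       (simp add: set_lebesgue_integral_def)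
  also have "\<dots> = (LBINT y:{x<..x+s}. (f y)\<^sup>2) - c\<^sup>2 * s"
    using I cumul_diff[OF assms(1), of x "x + s"] assms(2) by (simp add: power2_eq_square algebra_simps)
  finally show ?thesis
    using cumul_diff[OF nice_square[OF assms(1)], of x "x + s"] assms(2) by (simp add: c_def field_simps)
qed

lemma measurable_avg[measurable]:
  assumes "nice f" "s > 0" shows "avg s f \<in> borel_measurable borel"
proof -
  have [measurable]: "cumul f \<in> borel_measurable borel"
    by (rule borel_measurable_continuous_onI) (rule continuous_cumul[OF assms(1)])
  have "avg s f = (\<lambda>x. (cumul f (x + s) - cumul f x) / s)" using assms by (simp add: avg_cumul fun_eq_iff)
  then show ?thesis by simp
qed

text \<open>Jensen and Fubini.\<close>
lemma nn_integral_avg_square_le: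
  assumes "nice f" "s > 0"
  shows "(\<integral>\<^sup>+x. ennreal ((avg s f x)\<^sup>2) \<partial>lborel) \<le> (\<integral>\<^sup>+x. ennreal ((f x)\<^sup>2) \<partial>lborel)"
proof -
  let ?g = "\<lambda>y. (f y)\<^sup>2"
  have [measurable]: "cumul ?g \<in> borel_measurable borel"
    by (rule borel_measurable_continuous_onI) (rule continuous_cumul[OF nice_square[OF assms(1)]])
  have "(\<integral>\<^sup>+x. ennreal ((avg s f x)\<^sup>2) \<partial>lborel) \<le> (\<integral>\<^sup>+x. ennreal (1 / s) * ennreal (cumul ?g (x + s) - cumul ?g x) \<partial>lborel)"
  proof (rule nn_integral_mono)
    show "ennreal ((avg s f x)\<^sup>2) \<le> ennreal (1 / s) * ennreal (cumul ?g (x + s) - cumul ?g x)" for x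
    proof -
      have "cumul ?g (x + s) - cumul ?g x \<ge> 0" using cumul_mono[OF nice_square[OF assms(1)], of x "x + s"] assms by auto
      then show ?thesis using avg_square_le[OF assms, of x] assms
        by (subst ennreal_mult[symmetric]) (auto intro!: ennreal_leI)
    qed
  qed
  also have "\<dots> = ennreal (1 / s) * (ennreal s * (\<integral>\<^sup>+x. ennreal ((f x)\<^sup>2) \<partial>lborel))"
    by (subst nn_integral_cmult) (use nn_integral_cumul_diff[OF nice_square[OF assms(1)] _ assms(2)] in auto)
  also have "\<dots> = (\<integral>\<^sup>+x. ennreal ((f x)\<^sup>2) \<partial>lborel)"
    using assms(2) by (simp add: mult.assoc[symmetric] ennreal_mult[symmetric])
  finally show ?thesis .
qed

definition avgdiff :: "(real \<Rightarrow> real) \<Rightarrow> int \<Rightarrow> real \<Rightarrow> real" where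
  "avgdiff f m x = avg (2 powi m) f x - avg (2 powi (m + 1)) f x"

lemma measurable_avgdiff[measurable]: "nice f \<Longrightarrow> avgdiff f m \<in> borel_measurable borel"
  unfolding avgdiff_def[abs_def] by (intro borel_measurable_diff measurable_avg) auto

lemma avg_halves:
  assumes "nice f"
  shows "avg (2 powi (m + 1)) f x = (avg (2 powi m) f x + avg (2 powi m) f (x + 2 powi m)) / 2"
proof -
  have "x + 2 powi (m + 1) = x + 2 powi m + 2 powi m" by (simp add: power_int_add)
  then show ?thesis using assms by (simp add: avg_cumul power_int_add field_simps)
qed

text \<open>The mean over the window of length \<open>2\<^sup>m\<^sup>+\<^sup>1\<close> and \<open>avgdiff f m\<close> are the half sum and
  the half difference of the means over the two halves. The parallelogram law, integrated in
  \<open>x\<close>, shows that the energy lost from one scale to the next is that of \<open>avgdiff f m\<close>.\<close>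
lemma avgdiff_energy:
  assumes "nice f"
  shows "(\<integral>\<^sup>+x. ennreal ((avg (2 powi m) f x)\<^sup>2) \<partial>lborel) =
         (\<integral>\<^sup>+x. ennreal ((avg (2 powi (m + 1)) f x)\<^sup>2) \<partial>lborel) + (\<integral>\<^sup>+x. ennreal ((avgdiff f m x)\<^sup>2) \<partial>lborel)"
proof -
  let ?a = "\<lambda>x. avg (2 powi m) f x"
  have [measurable]: "avg (2 powi m) f \<in> borel_measurable borel" "avg (2 powi (m + 1)) f \<in> borel_measurable borel"
    "avgdiff f m \<in> borel_measurable borel"
    using measurable_avg[OF assms] measurable_avgdiff[OF assms] by auto
  have pt: "ennreal ((avg (2 powi (m + 1)) f x)\<^sup>2) + ennreal ((avgdiff f m x)\<^sup>2) =
      ennreal (1/2) * ennreal ((?a x)\<^sup>2) + ennreal (1/2) * ennreal ((?a (x + 2 powi m))\<^sup>2)" for x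
  proof -
    have "(avg (2 powi (m + 1)) f x)\<^sup>2 + (avgdiff f m x)\<^sup>2 = 1/2 * (?a x)\<^sup>2 + 1/2 * (?a (x + 2 powi m))\<^sup>2"
      unfolding avgdiff_def avg_halves[OF assms] by (simp add: power2_eq_square field_simps)
    moreover have "ennreal (1/2) * ennreal (z\<^sup>2) = ennreal (1/2 * z\<^sup>2)" for z :: real
      by (rule ennreal_mult[symmetric]) auto
    ultimately show ?thesis by (simp only:) (simp flip: ennreal_plus)
  qed
  have "(\<integral>\<^sup>+x. ennreal ((avg (2 powi (m + 1)) f x)\<^sup>2) \<partial>lborel) + (\<integral>\<^sup>+x. ennreal ((avgdiff f m x)\<^sup>2) \<partial>lborel)
     = (\<integral>\<^sup>+x. ennreal ((avg (2 powi (m + 1)) f x)\<^sup>2) + ennreal ((avgdiff f m x)\<^sup>2) \<partial>lborel)"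
    by (rule nn_integral_add[symmetric]) measurable
  also have "\<dots> = ennreal (1/2) * (\<integral>\<^sup>+x. ennreal ((?a x)\<^sup>2) \<partial>lborel) + ennreal (1/2) * (\<integral>\<^sup>+x. ennreal ((?a (x + 2 powi m))\<^sup>2) \<partial>lborel)"
    unfolding pt by (simp add: nn_integral_add nn_integral_cmult)
  also have "(\<integral>\<^sup>+x. ennreal ((?a (x + 2 powi m))\<^sup>2) \<partial>lborel) = (\<integral>\<^sup>+x. ennreal ((?a x)\<^sup>2) \<partial>lborel)"
    by (rule nn_integral_shift[where g="\<lambda>x. ennreal ((?a x)\<^sup>2)"]) measurable
  also have "ennreal (1/2) * (\<integral>\<^sup>+x. ennreal ((?a x)\<^sup>2) \<partial>lborel) + ennreal (1/2) * (\<integral>\<^sup>+x. ennreal ((?a x)\<^sup>2) \<partial>lborel)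
    = (ennreal (1/2) + ennreal (1/2)) * (\<integral>\<^sup>+x. ennreal ((?a x)\<^sup>2) \<partial>lborel)" by (simp only: distrib_right)
  also have "ennreal (1/2) + ennreal (1/2) = 1" by (subst ennreal_plus[symmetric]) auto
  finally show ?thesis by simp
qed

lemma sum_avgdiff_energy:
  assumes "nice f" "finite F"
  shows "(\<Sum>m\<in>F. \<integral>\<^sup>+x. ennreal ((avgdiff f m x)\<^sup>2) \<partial>lborel) \<le> (\<integral>\<^sup>+x. ennreal ((f x)\<^sup>2) \<partial>lborel)"
proof -
  let ?b = "\<lambda>m. \<integral>\<^sup>+x. ennreal ((avgdiff f m x)\<^sup>2) \<partial>lborel" and ?e = "\<lambda>m. \<integral>\<^sup>+x. ennreal ((avg (2 powi m) f x)\<^sup>2) \<partial>lborel"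
  have tele: "(\<Sum>j<k. ?b (m0 + int j)) + ?e (m0 + int k) = ?e m0" for k m0
  proof (induction k)
    case (Suc k)
    have "?e (m0 + int k) = ?e (m0 + int k + 1) + ?b (m0 + int k)" by (rule avgdiff_energy[OF assms(1)])
    then show ?case using Suc by (simp add: algebra_simps)
  qed simp
  obtain m0 k where F: "F \<subseteq> (\<lambda>j. m0 + int j) ` {..<k}"
  proof (cases "F = {}")
    case False
    have "F \<subseteq> (\<lambda>j. Min F + int j) ` {..<nat (Max F - Min F + 1)}"
    proof
      fix n assume n: "n \<in> F"
      then have "Min F \<le> n" "n \<le> Max F" using assms(2) by auto
      then show "n \<in> (\<lambda>j. Min F + int j) ` {..<nat (Max F - Min F + 1)}"
        by (intro image_eqI[of _ _ "nat (n - Min F)"]) auto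
    qed
    then show ?thesis using that by blast
  qed (rule that[of 0 0], simp)
  have "(\<Sum>m\<in>F. ?b m) \<le> (\<Sum>m\<in>(\<lambda>j. m0 + int j) ` {..<k}. ?b m)"
    by (rule sum_mono2) (use F in auto)
  also have "\<dots> = (\<Sum>j<k. ?b (m0 + int j))" by (subst sum.reindex) (auto simp: inj_on_def)
  also have "\<dots> \<le> (\<Sum>j<k. ?b (m0 + int j)) + ?e (m0 + int k)" by simp
  also have "\<dots> = ?e m0" by (rule tele)
  also have "\<dots> \<le> (\<integral>\<^sup>+x. ennreal ((f x)\<^sup>2) \<partial>lborel)" by (rule nn_integral_avg_square_le[OF assms(1)]) simp
  finally show ?thesis .
qed

text \<open>A bound for the square of the deviation of the primitive of \<open>f\<close> from its chord over
  \<open>[y, y + 2\<^sup>m]\<close>, relative to \<open>2\<^sup>m\<close>, which does not depend on the point where the deviation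
  is taken. Halving the window moves the point into one of the halves and changes the chord
  by at most \<open>\<bar>avgdiff f (m - 1) y\<bar>\<close> relative to the length of the half. After \<open>M\<close> halvings
  the deviation is bounded trivially.\<close>
primrec chord_bound :: "(real \<Rightarrow> real) \<Rightarrow> nat \<Rightarrow> int \<Rightarrow> real \<Rightarrow> ennreal" where
  "chord_bound f 0 m y = ennreal (4 * (avg (2 powi m) (\<lambda>x. \<bar>f x\<bar>) y)\<^sup>2)"
| "chord_bound f (Suc M) m y = ennreal (3/4 * (avgdiff f (m - 1) y)\<^sup>2) +
     ennreal (3/8) * (chord_bound f M (m - 1) y + chord_bound f M (m - 1) (y + 2 powi (m - 1)))"

lemma measurable_chord_bound[measurable]:
  assumes "nice f" shows "chord_bound f M m \<in> borel_measurable borel"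
proof (induction M arbitrary: m)
  case 0
  have [measurable]: "avg (2 powi m) (\<lambda>x. \<bar>f x\<bar>) \<in> borel_measurable borel" using measurable_avg[OF nice_abs[OF assms]] by simp
  show ?case by simp
next
  case (Suc M)
  note [measurable] = Suc[of "m - 1"] measurable_avgdiff[OF assms, of "m-1"]
  show ?case by simp
qed

lemma chord_deviation_le:
  assumes "nice f" "0 \<le> t" "t \<le> 2 powi m"
  shows "ennreal (((cumul f (y + t) - cumul f y - t * avg (2 powi m) f y) / 2 powi m)\<^sup>2) \<le> chord_bound f M m y"
  using assms(2,3)
proof (induction M arbitrary: m y t)
  case 0
  let ?L = "2 powi m :: real" and ?V = "cumul (\<lambda>x. \<bar>f x\<bar>)"
  have L: "?L > 0" by simp
  have a: "\<bar>cumul f (y + t) - cumul f y\<bar> \<le> ?V (y + ?L) - ?V y"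
    using cumul_diff_abs[OF assms(1), of y "y + t"] cumul_mono[OF nice_abs[OF assms(1)], of "y + t" "y + ?L"] 0 by auto
  have b: "\<bar>t * avg ?L f y\<bar> \<le> ?V (y + ?L) - ?V y"
  proof -
    have "\<bar>t * avg ?L f y\<bar> = t / ?L * \<bar>cumul f (y + ?L) - cumul f y\<bar>"
      using 0 L by (simp add: avg_cumul[OF assms(1)] abs_mult)
    also have "\<dots> \<le> 1 * \<bar>cumul f (y + ?L) - cumul f y\<bar>" using 0 L by (intro mult_right_mono) auto
    also have "\<dots> \<le> ?V (y + ?L) - ?V y" using cumul_diff_abs[OF assms(1), of y "y + ?L"] by simp
    finally show ?thesis .
  qed
  have "\<bar>(cumul f (y + t) - cumul f y - t * avg ?L f y) / ?L\<bar> \<le> \<bar>2 * avg ?L (\<lambda>x. \<bar>f x\<bar>) y\<bar>"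
    using a b L by (simp add: avg_cumul[OF nice_abs[OF assms(1)]] field_simps)
  then have "((cumul f (y + t) - cumul f y - t * avg ?L f y) / ?L)\<^sup>2 \<le> (2 * avg ?L (\<lambda>x. \<bar>f x\<bar>) y)\<^sup>2"
    by (simp only: abs_le_square_iff)
  then show ?case by (auto simp: power_mult_distrib intro!: ennreal_leI)
next
  case (Suc M)
  let ?l = "2 powi (m - 1) :: real"
  define b where "b = avgdiff f (m - 1) y"
  have l: "?l > 0" and L: "2 powi m = 2 * ?l" using power_int_add[of "2::real" "m - 1" 1] by auto
  have A1: "avg (2 powi m) f y = avg ?l f y - b" by (simp add: b_def avgdiff_def)
  have A2: "avg (2 powi m) f y = avg ?l f (y + ?l) + b"
    using avg_halves[OF assms(1), of "m - 1" y] by (simp add: b_def avgdiff_def)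
  \<comment> \<open>The weights are such that \<open>3/2\<close>, divided by the \<open>4\<close> from the halved length and counted
    for both halves, is less than \<open>1\<close>.\<close>
  have sq: "(u + e)\<^sup>2 \<le> 3/2 * u\<^sup>2 + 3 * e\<^sup>2" for u e :: real
    using zero_le_power2[of "u - 2 * e"] by (simp add: power2_eq_square algebra_simps)
  obtain y' t' e where *: "y' = y \<or> y' = y + ?l" "0 \<le> t'" "t' \<le> ?l" "\<bar>e\<bar> \<le> ?l * \<bar>b\<bar>"
    "cumul f (y + t) - cumul f y - t * avg (2 powi m) f y = (cumul f (y' + t') - cumul f y' - t' * avg ?l f y') + e"
  proof (cases "t \<le> ?l")
    case True
    show ?thesis
    proof (rule that[of y t "t * b"])
      show "\<bar>t * b\<bar> \<le> ?l * \<bar>b\<bar>" using True Suc.prems by (simp add: abs_mult mult_right_mono)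
          have "avg ?l f y = avg (2 powi m) f y + b" using A1 by simp
      then show "cumul f (y + t) - cumul f y - t * avg (2 powi m) f y =
        (cumul f (y + t) - cumul f y - t * avg ?l f y) + t * b" by (simp add: algebra_simps)
    qed (use True Suc.prems in auto)
  next
    case False
    have c: "cumul f (y + ?l) - cumul f y = ?l * avg ?l f y" using l by (simp add: avg_cumul[OF assms(1)])
    show ?thesis
    proof (rule that[of "y + ?l" "t - ?l" "(2 * ?l - t) * b"])
      show "\<bar>(2 * ?l - t) * b\<bar> \<le> ?l * \<bar>b\<bar>" using False Suc.prems L by (simp add: abs_mult mult_right_mono)
      have "?l * avg ?l f y - t * avg (2 powi m) f y = - ((t - ?l) * avg ?l f (y + ?l)) + (2 * ?l - t) * b"
      proof -
        have "avg ?l f y = avg ?l f (y + ?l) + 2 * b" using A1 A2 by simp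
        then show ?thesis unfolding A2 by (simp add: algebra_simps)
      qed
      then show "cumul f (y + t) - cumul f y - t * avg (2 powi m) f y =
        (cumul f (y + ?l + (t - ?l)) - cumul f (y + ?l) - (t - ?l) * avg ?l f (y + ?l)) + (2 * ?l - t) * b"
        using c by (simp add: algebra_simps)
    qed (use False Suc.prems L in auto)
  qed
  define u where "u = (cumul f (y' + t') - cumul f y' - t' * avg ?l f y')"
  have IH: "ennreal ((u / ?l)\<^sup>2) \<le> chord_bound f M (m - 1) y'"
    unfolding u_def by (rule Suc.IH) (use * in auto)
  have "\<bar>e / ?l\<bar> \<le> \<bar>b\<bar>" using *(4) l by (simp add: abs_divide field_simps)
  then have el: "(e / ?l)\<^sup>2 \<le> b\<^sup>2" by (simp only: abs_le_square_iff)
  have "((u + e) / 2 powi m)\<^sup>2 \<le> (3/2 * u\<^sup>2 + 3 * e\<^sup>2) / (2 powi m)\<^sup>2"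
    unfolding power_divide by (intro divide_right_mono sq) auto
  also have "\<dots> = 3/8 * (u / ?l)\<^sup>2 + 3/4 * (e / ?l)\<^sup>2"
    unfolding L by (simp add: power_divide power_mult_distrib field_simps)
  also have "(e / ?l)\<^sup>2 \<le> b\<^sup>2" by (rule el)
  finally have "ennreal (((u + e) / 2 powi m)\<^sup>2) \<le> ennreal (3/8 * (u / ?l)\<^sup>2 + 3/4 * b\<^sup>2)"
    by (intro ennreal_leI) auto
  also have "\<dots> = ennreal (3/4 * b\<^sup>2) + ennreal (3/8) * ennreal ((u / ?l)\<^sup>2)"
    by (subst ennreal_mult[symmetric]) (simp_all add: add.commute flip: ennreal_plus)
  also have "\<dots> \<le> ennreal (3/4 * b\<^sup>2) + ennreal (3/8) * (chord_bound f M (m - 1) y + chord_bound f M (m - 1) (y + ?l))"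
    using IH *(1) by (intro add_left_mono mult_left_mono) (auto intro: order_trans add_increasing2 add_increasing)
  finally show ?case unfolding *(5) u_def[symmetric] by (simp add: b_def)
qed

text \<open>A window of length in \<open>[2\<^sup>n, 2\<^sup>n\<^sup>+\<^sup>1)\<close> is a full dyadic one followed by an initial
  piece of its right neighbour. If \<open>f\<close> is replaced by its mean on the neighbour, the error
  is a deviation from the chord there, and the two means differ by \<open>2 * avgdiff f n x\<close>.\<close>
lemma osc_le_chord_bound:
  assumes "nice f"
  shows "osc f n x \<le> 2 * chord_bound f M n (x + 2 powi n) + 2 * ennreal ((avgdiff f n x)\<^sup>2)"
  unfolding osc_def
proof (rule SUP_least)
  fix s :: real assume s: "s \<in> {2 powi n..<2 powi (n + 1)}"
  let ?L = "2 powi n :: real"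
  define t where "t = s - ?L"
  define y where "y = x + ?L"
  define d where "d = cumul f (y + t) - cumul f y - t * avg ?L f y"
  have L: "?L > 0" "2 powi (n + 1) = 2 * ?L" by (auto simp: power_int_add)
  have t: "0 \<le> t" "t \<le> ?L" "s = ?L + t" "s > 0" "s \<ge> ?L" using s L by (auto simp: t_def)
  have "avgdiff f n x = (avg ?L f x - avg ?L f y) / 2"
    unfolding avgdiff_def avg_halves[OF assms] y_def by (simp add: field_simps)
  then have ay: "avg ?L f y = avg ?L f x - 2 * avgdiff f n x" by simp
  have "s * avg s f x = ?L * avg ?L f x + (d + t * avg ?L f y)"
  proof -
    have "s * avg s f x = cumul f (x + s) - cumul f x" "?L * avg ?L f x = cumul f (x + ?L) - cumul f x"
      using avg_cumul[OF assms t(4), of x] avg_cumul[OF assms L(1), of x] t(4) L(1) by simp_all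
    then show ?thesis using t(3) by (simp add: d_def y_def add.assoc)
  qed
  then have "s * avg s f x = s * avg ?L f x + d - 2 * t * avgdiff f n x"
    unfolding ay t(3) by (simp add: algebra_simps)
  then have "avg ?L f x - avg s f x = (2 * t * avgdiff f n x - d) / s"
    using t(4) by (subst eq_divide_eq) (simp add: algebra_simps)
  then have "avg ?L f x - avg s f x = (- (d / s)) + (2 * t / s) * avgdiff f n x"
    by (simp add: diff_divide_distrib)
  then have "(avg ?L f x - avg s f x)\<^sup>2 \<le> 2 * (d / s)\<^sup>2 + 2 * ((2 * t / s) * avgdiff f n x)\<^sup>2"
    using square_add_le[of "- (d / s)" "(2 * t / s) * avgdiff f n x"] by simp
  also have "(d / s)\<^sup>2 \<le> (d / ?L)\<^sup>2"
  proof -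
    have "?L\<^sup>2 \<le> s\<^sup>2" by (rule power_mono[OF t(5)]) (use L in simp)
    moreover have "0 < ?L\<^sup>2" by simp
    ultimately show ?thesis unfolding power_divide by (intro frac_le) auto
  qed
  also have "((2 * t / s) * avgdiff f n x)\<^sup>2 \<le> (1 * avgdiff f n x)\<^sup>2"
    unfolding power_mult_distrib using t by (intro mult_right_mono power_mono) auto
  finally have "ennreal ((avg ?L f x - avg s f x)\<^sup>2) \<le> ennreal (2 * (d / ?L)\<^sup>2 + 2 * (avgdiff f n x)\<^sup>2)"
    by (intro ennreal_leI) auto
  also have "\<dots> = 2 * ennreal ((d / ?L)\<^sup>2) + 2 * ennreal ((avgdiff f n x)\<^sup>2)"
    by (simp add: ennreal_mult)
  also have "ennreal ((d / ?L)\<^sup>2) \<le> chord_bound f M n y"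
    unfolding d_def by (rule chord_deviation_le[OF assms t(1,2)])
  finally show "ennreal ((avg ?L f x - avg s f x)\<^sup>2) \<le> 2 * chord_bound f M n (x + 2 powi n) + 2 * ennreal ((avgdiff f n x)\<^sup>2)"
    by (auto simp: y_def add_mono mult_left_mono)
qed

text \<open>One halving contracts by \<open>2 * 3/8 = 3/4\<close> and adds \<open>3/4\<close> of the energy of the dyadic
  differences, so that the fixed point is \<open>3\<close>. The trivial bound at depth \<open>M\<close> is not
  summable over the scales and is counted for each of them.\<close>
lemma sum_chord_bound:
  assumes "nice f" "finite F"
  shows "(\<Sum>m\<in>F. \<integral>\<^sup>+y. chord_bound f M m y \<partial>lborel) \<le>
    ennreal (3 + 4 * real (card F) * (3/4)^M) * (\<integral>\<^sup>+x. ennreal ((f x)\<^sup>2) \<partial>lborel)"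
  using assms(2)
proof (induction M arbitrary: F)
  case 0
  let ?N = "\<integral>\<^sup>+x. ennreal ((f x)\<^sup>2) \<partial>lborel"
  note [measurable] = measurable_avg[OF nice_abs[OF assms(1)]]
  have "(\<integral>\<^sup>+y. chord_bound f 0 m y \<partial>lborel) \<le> ennreal 4 * ?N" for m
  proof -
    have "(\<integral>\<^sup>+y. chord_bound f 0 m y \<partial>lborel) = ennreal 4 * (\<integral>\<^sup>+y. ennreal ((avg (2 powi m) (\<lambda>x. \<bar>f x\<bar>) y)\<^sup>2) \<partial>lborel)"
      by (subst nn_integral_cmult[symmetric]) (auto simp: ennreal_mult intro!: nn_integral_cong)
    also have "\<dots> \<le> ennreal 4 * ?N"
      using nn_integral_avg_square_le[OF nice_abs[OF assms(1)], of "2 powi m"] by (intro mult_left_mono) auto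
    finally show ?thesis .
  qed
  then have "(\<Sum>m\<in>F. \<integral>\<^sup>+y. chord_bound f 0 m y \<partial>lborel) \<le> (\<Sum>m\<in>F. ennreal 4 * ?N)" by (intro sum_mono)
  also have "\<dots> = ennreal (4 * real (card F)) * ?N"
    by (simp add: ennreal_mult ennreal_of_nat_eq_real_of_nat algebra_simps)
  also have "\<dots> \<le> ennreal (3 + 4 * real (card F) * (3/4)^0) * ?N" by (intro mult_right_mono ennreal_leI) auto
  finally show ?case .
next
  case (Suc M)
  let ?N = "\<integral>\<^sup>+x. ennreal ((f x)\<^sup>2) \<partial>lborel" and ?b = "\<lambda>m. \<integral>\<^sup>+x. ennreal ((avgdiff f m x)\<^sup>2) \<partial>lborel"
  let ?I = "\<lambda>m. \<integral>\<^sup>+y. chord_bound f M m y \<partial>lborel"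
  note [measurable] = measurable_chord_bound[OF assms(1)] measurable_avgdiff[OF assms(1)]
  have e: "ennreal (3/4 * b\<^sup>2) = ennreal (3/4) * ennreal (b\<^sup>2)" for b :: real by (rule ennreal_mult) auto
  have step: "(\<integral>\<^sup>+y. chord_bound f (Suc M) m y \<partial>lborel) = ennreal (3/4) * ?b (m - 1) + ennreal (3/4) * ?I (m - 1)" for m
  proof -
    have "(\<integral>\<^sup>+y. chord_bound f M (m - 1) (y + 2 powi (m - 1)) \<partial>lborel) = ?I (m - 1)"
      by (rule nn_integral_shift) measurable
    then have "(\<integral>\<^sup>+y. chord_bound f (Suc M) m y \<partial>lborel) = ennreal (3/4) * ?b (m - 1) + ennreal (3/8) * (?I (m - 1) + ?I (m - 1))"
      unfolding chord_bound.simps e by (simp add: nn_integral_add nn_integral_cmult)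
    also have "ennreal (3/8) * (?I (m - 1) + ?I (m - 1)) = (ennreal (3/8) + ennreal (3/8)) * ?I (m - 1)"
      by (simp only: distrib_left distrib_right)
    also have "ennreal (3/8) + ennreal (3/8) = ennreal (3/4)" by (subst ennreal_plus[symmetric]) auto
    finally show ?thesis .
  qed
  let ?F = "(\<lambda>m. m - 1) ` F"
  have fin: "finite ?F" and card: "card ?F = card F" using Suc.prems by (auto intro!: card_image simp: inj_on_def)
  have "(\<Sum>m\<in>F. \<integral>\<^sup>+y. chord_bound f (Suc M) m y \<partial>lborel) = (\<Sum>m\<in>?F. ennreal (3/4) * ?b m + ennreal (3/4) * ?I m)"
    unfolding step by (subst sum.reindex) (auto simp: inj_on_def)
  also have "\<dots> = ennreal (3/4) * (\<Sum>m\<in>?F. ?b m) + ennreal (3/4) * (\<Sum>m\<in>?F. ?I m)"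
    by (simp add: sum.distrib sum_distrib_left)
  also have "\<dots> \<le> ennreal (3/4) * ?N + ennreal (3/4) * (ennreal (3 + 4 * real (card F) * (3/4)^M) * ?N)"
    using Suc.IH[OF fin] sum_avgdiff_energy[OF assms(1) fin] unfolding card by (intro add_mono mult_left_mono) auto
  also have "\<dots> = (ennreal (3/4) + ennreal (3/4) * ennreal (3 + 4 * real (card F) * (3/4)^M)) * ?N"
    by (simp only: distrib_right mult.assoc)
  also have "ennreal (3/4) + ennreal (3/4) * ennreal (3 + 4 * real (card F) * (3/4)^M) = ennreal (3/4 + 3/4 * (3 + 4 * real (card F) * (3/4)^M))"
    by (subst ennreal_mult[symmetric], simp, simp, subst ennreal_plus[symmetric]) auto
  also have "3/4 + 3/4 * (3 + 4 * real (card F) * (3/4)^M) = 3 + 4 * real (card F) * (3/4)^Suc M"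
    by (simp add: algebra_simps)
  finally show ?case .
qed

text \<open>For a finite set of scales the depth of the halving may tend to infinity, which
  removes the term with the number of scales.\<close>
theorem nn_integral_sqO_le:
  assumes "nice f"
  shows "(\<integral>\<^sup>+x. sqO f x \<partial>lborel) \<le> 8 * (\<integral>\<^sup>+x. ennreal ((f x)\<^sup>2) \<partial>lborel)"
proof -
  let ?N = "\<integral>\<^sup>+x. ennreal ((f x)\<^sup>2) \<partial>lborel"
  define \<nu> where "\<nu> = (\<integral>x. (f x)\<^sup>2 \<partial>lborel)"
  have N: "?N = ennreal \<nu>" unfolding \<nu>_def
    by (rule nn_integral_eq_integral) (use nice_integrable[OF nice_square[OF assms]] in auto)
  have \<nu>0: "\<nu> \<ge> 0" unfolding \<nu>_def by (rule integral_nonneg_AE) auto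
  note [measurable] = measurable_chord_bound[OF assms] measurable_avgdiff[OF assms] measurable_osc[OF assms]
  have fin: "(\<Sum>n\<in>F. \<integral>\<^sup>+x. osc f n x \<partial>lborel) \<le> 8 * ?N" if F: "finite F" for F
  proof -
    have "(\<Sum>n\<in>F. \<integral>\<^sup>+x. osc f n x \<partial>lborel) \<le> ennreal ((8 + 8 * real (card F) * (3/4)^M) * \<nu>)" for M
    proof -
      have "(\<integral>\<^sup>+x. osc f n x \<partial>lborel) \<le> 2 * (\<integral>\<^sup>+y. chord_bound f M n y \<partial>lborel) + 2 * (\<integral>\<^sup>+x. ennreal ((avgdiff f n x)\<^sup>2) \<partial>lborel)" for n
      proof -
        have "(\<integral>\<^sup>+x. osc f n x \<partial>lborel) \<le> (\<integral>\<^sup>+x. 2 * chord_bound f M n (x + 2 powi n) + 2 * ennreal ((avgdiff f n x)\<^sup>2) \<partial>lborel)"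
          by (intro nn_integral_mono osc_le_chord_bound assms)
        also have "\<dots> = 2 * (\<integral>\<^sup>+x. chord_bound f M n (x + 2 powi n) \<partial>lborel) + 2 * (\<integral>\<^sup>+x. ennreal ((avgdiff f n x)\<^sup>2) \<partial>lborel)"
          by (simp add: nn_integral_add nn_integral_cmult)
        also have "(\<integral>\<^sup>+x. chord_bound f M n (x + 2 powi n) \<partial>lborel) = (\<integral>\<^sup>+x. chord_bound f M n x \<partial>lborel)"
          by (rule nn_integral_shift) measurable
        finally show ?thesis .
      qed
      then have "(\<Sum>n\<in>F. \<integral>\<^sup>+x. osc f n x \<partial>lborel) \<le> 2 * (\<Sum>n\<in>F. \<integral>\<^sup>+y. chord_bound f M n y \<partial>lborel) + 2 * (\<Sum>n\<in>F. \<integral>\<^sup>+x. ennreal ((avgdiff f n x)\<^sup>2) \<partial>lborel)"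
        unfolding sum_distrib_left sum.distrib[symmetric] by (intro sum_mono)
      also have "\<dots> \<le> 2 * (ennreal (3 + 4 * real (card F) * (3/4)^M) * ennreal \<nu>) + 2 * ennreal \<nu>"
        using sum_chord_bound[OF assms F, of M] sum_avgdiff_energy[OF assms F] unfolding N
        by (intro add_mono mult_left_mono) auto
      also have "\<dots> = ennreal (2 * ((3 + 4 * real (card F) * (3/4)^M) * \<nu>) + 2 * \<nu>)"
        using \<nu>0 by (simp add: ennreal_mult)
      also have "2 * ((3 + 4 * real (card F) * (3/4)^M) * \<nu>) + 2 * \<nu> = (8 + 8 * real (card F) * (3/4)^M) * \<nu>"
        by (simp add: algebra_simps)
      finally show ?thesis .
    qed
    moreover have "(\<lambda>M. ennreal ((8 + 8 * real (card F) * (3/4)^M) * \<nu>)) \<longlonglongrightarrow> ennreal ((8 + 8 * real (card F) * 0) * \<nu>)"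
      by (intro tendsto_intros LIMSEQ_power_zero) auto
    ultimately have "(\<Sum>n\<in>F. \<integral>\<^sup>+x. osc f n x \<partial>lborel) \<le> ennreal ((8 + 8 * real (card F) * 0) * \<nu>)"
      by (intro LIMSEQ_le_const) auto
    then show ?thesis using \<nu>0 by (simp add: N ennreal_mult)
  qed
  have "(\<integral>\<^sup>+x. sqO f x \<partial>lborel) = (\<integral>\<^sup>+x. (\<Sum>i. osc f (int_decode i) x) \<partial>lborel)"
    unfolding sqO_def nn_integral_count_space_nat[symmetric]
    by (intro nn_integral_cong nn_integral_bij_count_space[symmetric] bij_int_decode)
  also have "\<dots> = (\<Sum>i. \<integral>\<^sup>+x. osc f (int_decode i) x \<partial>lborel)" by (rule nn_integral_suminf) measurable
  also have "\<dots> \<le> 8 * ?N"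
  proof (rule suminf_le_const)
    fix n
    have "(\<Sum>i<n. \<integral>\<^sup>+x. osc f (int_decode i) x \<partial>lborel) = (\<Sum>m\<in>int_decode ` {..<n}. \<integral>\<^sup>+x. osc f m x \<partial>lborel)"
      by (subst sum.reindex) (auto simp: inj_int_decode intro: inj_on_subset[OF inj_int_decode])
    also have "\<dots> \<le> 8 * ?N" by (rule fin) simp
    finally show "(\<Sum>i<n. \<integral>\<^sup>+x. osc f (int_decode i) x \<partial>lborel) \<le> 8 * ?N" .
  qed auto
  finally show ?thesis .
qed

section \<open>The rising sun lemma\<close>

text \<open>For \<open>\<phi> \<ge> 0\<close>, the set where the one-sided maximal function of \<open>\<phi>\<close> exceeds \<open>c\<close>.\<close>
definition rising :: "(real \<Rightarrow> real) \<Rightarrow> real \<Rightarrow> real set" where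
  "rising \<phi> c = {x. \<exists>h>0. c * h < cumul \<phi> (x + h) - cumul \<phi> x}"

lemma open_rising:
  assumes "nice \<phi>" shows "open (rising \<phi> c)"
proof -
  have "open {x. c * h < cumul \<phi> (x + h) - cumul \<phi> x}" for h
    by (intro open_Collect_less continuous_on_diff continuous_on_compose2[OF continuous_cumul[OF assms, of UNIV]]
        continuous_cumul[OF assms] continuous_intros) auto
  moreover have "rising \<phi> c = (\<Union>h\<in>{0<..}. {x. c * h < cumul \<phi> (x + h) - cumul \<phi> x})"
    unfolding rising_def by auto
  ultimately show ?thesis by auto
qed

lemma not_risingD:
  assumes "a \<notin> rising \<phi> c" "a \<le> b" shows "cumul \<phi> b - cumul \<phi> a \<le> c * (b - a)"
proof (cases "a = b")
  case False
  have "\<forall>h>0. \<not> c * h < cumul \<phi> (a + h) - cumul \<phi> a" using assms(1) by (auto simp: rising_def)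
  from this[rule_format, of "b - a"] show ?thesis using False assms(2) by simp
qed simp

lemma cumul_eq:
  assumes "nice f" "a \<le> b" "\<And>x. a < x \<Longrightarrow> x \<le> b \<Longrightarrow> f x = 0" shows "cumul f a = cumul f b"
proof -
  have "(LBINT y:{a<..b}. f y) = 0"
    unfolding set_lebesgue_integral_def using assms(3)
    by (intro integral_eq_zero_AE AE_I2) (auto split: split_indicator)
  then show ?thesis using cumul_diff[OF assms(1,2)] by simp
qed

lemma bounded_rising:
  assumes "nice \<phi>" "\<And>x. \<phi> x \<ge> 0" "c > 0" shows "bounded (rising \<phi> c)"
proof -
  obtain R where R: "R > 0" "\<And>x. R < \<bar>x\<bar> \<Longrightarrow> \<phi> x = 0" using niceE[OF assms(1)] by metis
  let ?I = "\<integral>x. \<phi> x \<partial>lborel"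
  have "x \<in> {- R - ?I / c..R}" if "x \<in> rising \<phi> c" for x
  proof -
    obtain h where h: "h > 0" "c * h < cumul \<phi> (x + h) - cumul \<phi> x" using \<open>x \<in> rising \<phi> c\<close> unfolding rising_def by auto
    have p: "c * h > 0" using h assms by simp
    have "x \<le> R"
    proof (rule ccontr)
      assume "\<not> x \<le> R"
      then have "cumul \<phi> x = cumul \<phi> (x + h)" using h R(1) by (intro cumul_eq assms R(2)) auto
      then show False using h p by simp
    qed
    moreover have "x + h \<ge> - R"
    proof (rule ccontr)
      assume "\<not> x + h \<ge> - R"
      then have "cumul \<phi> x = cumul \<phi> (x + h)" using h R(1) by (intro cumul_eq assms R(2)) auto
      then show False using h p by simp
    qed
    moreover have "h \<le> ?I / c"
      using h cumul_diff_le_total[OF assms(1,2), of x "x + h"] assms(3) by (simp add: field_simps)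
    ultimately show ?thesis by auto
  qed
  then show ?thesis using bounded_subset[OF bounded_closed_interval] by blast
qed

text \<open>The rising sun lemma of F. Riesz. On a component, every point has a higher point of
  the graph of \<open>cumul \<phi> x - c x\<close> to its right, while \<open>Sup J\<close> has none; hence the maximum
  over \<open>[x, Sup J]\<close> is attained at \<open>Sup J\<close>.\<close>
lemma rising_component:
  assumes "nice \<phi>" "\<And>x. \<phi> x \<ge> 0" "c > 0" "J \<in> components (rising \<phi> c)"
  shows "c * (Sup J - Inf J) \<le> cumul \<phi> (Sup J) - cumul \<phi> (Inf J)"
proof -
  define G where "G x = cumul \<phi> x - c * x" for x
  note J = open_component_interval[OF open_rising[OF assms(1)] bounded_rising[OF assms(1-3)] assms(4)]
  have cont: "continuous_on S G" for S unfolding G_def by (intro continuous_on_diff continuous_cumul assms continuous_intros)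
  have rs: "z \<in> rising \<phi> c" if "z < y" "G z < G y" for z y
    unfolding rising_def using that by (auto simp: G_def algebra_simps intro!: exI[of _ "y - z"])
  have le: "G x \<le> G (Sup J)" if x: "Inf J < x" "x < Sup J" for x
  proof (rule ccontr)
    assume n: "\<not> G x \<le> G (Sup J)"
    obtain z where z: "z \<in> {x..Sup J}" "\<And>y. y \<in> {x..Sup J} \<Longrightarrow> G y \<le> G z"
      using continuous_attains_sup[of "{x..Sup J}" G] cont x by auto
    have Gz: "G z > G (Sup J)" using z(2)[of x] n x by auto
    then have "z \<in> J" using z x by (subst J(1)) (cases "z = Sup J", auto)
    then have "z \<in> rising \<phi> c" using in_components_subset[OF assms(4)] by auto
    then obtain h where h: "h > 0" "G (z + h) > G z" unfolding rising_def by (auto simp: G_def algebra_simps)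
    have "z + h > Sup J" using z(2)[of "z + h"] h z(1) by (cases "z + h \<le> Sup J") auto
    then have "Sup J \<in> rising \<phi> c" using rs[of "Sup J" "z + h"] h Gz by auto
    then show False using J(4) by simp
  qed
  have "(G \<longlongrightarrow> G (Inf J)) (at_right (Inf J))"
    using cont[of UNIV] by (meson UNIV_I continuous_on_eq_continuous_within continuous_within tendsto_within_subset subset_UNIV)
  then have "G (Inf J) \<le> G (Sup J)"
  proof (rule tendsto_upperbound)
    show "\<forall>\<^sub>F x in at_right (Inf J). G x \<le> G (Sup J)"
      using eventually_at_right[OF J(2)] J(2) le by (auto intro!: exI[of _ "Sup J"])
  qed simp
  then show ?thesis by (simp add: G_def algebra_simps)
qed

lemma nn_cumul_diff_Ioo:
  assumes "nice f" "\<And>x. f x \<ge> 0" "a \<le> b"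
  shows "emeasure (density lborel (\<lambda>x. ennreal (f x))) {a<..<b} = ennreal (cumul f b - cumul f a)"
proof -
  have [measurable]: "f \<in> borel_measurable borel" using assms nice_measurable by blast
  have "emeasure (density lborel (\<lambda>x. ennreal (f x))) {a<..<b} = (\<integral>\<^sup>+y\<in>{a<..<b}. ennreal (f y) \<partial>lborel)"
    by (subst emeasure_density) auto
  also have "\<dots> = (\<integral>\<^sup>+y\<in>{a..b}. ennreal (f y) \<partial>lborel)"
  proof (rule nn_integral_cong_AE)
    have "AE y in lborel. y \<noteq> a \<and> y \<noteq> b" using AE_lborel_singleton[of a] AE_lborel_singleton[of b] by auto
    then show "AE y in lborel. ennreal (f y) * indicator {a<..<b} y = ennreal (f y) * indicator {a..b} y"
      by eventually_elim (auto split: split_indicator)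
  qed
  also have "\<dots> = ennreal (cumul f b - cumul f a)" by (rule nn_cumul_diff[OF assms])
  finally show ?thesis .
qed

lemma emeasure_component:
  assumes "open U" "bounded U" "J \<in> components U"
  shows "emeasure lborel J = ennreal (Sup J - Inf J)"
  using open_component_interval(1,2)[OF assms] by (metis emeasure_lborel_Ioo less_imp_le)

lemma emeasure_density_component:
  assumes "open U" "bounded U" "J \<in> components U" "nice f" "\<And>x. f x \<ge> 0"
  shows "emeasure (density lborel (\<lambda>x. ennreal (f x))) J = ennreal (cumul f (Sup J) - cumul f (Inf J))"
  using open_component_interval(1,2)[OF assms(1-3)] nn_cumul_diff_Ioo[OF assms(4,5)] by (metis less_imp_le)

lemma emeasure_rising_le:
  assumes "nice \<phi>" "\<And>x. \<phi> x \<ge> 0" "c > 0"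
  shows "ennreal c * emeasure lborel (rising \<phi> c) \<le> (\<integral>\<^sup>+x. ennreal (\<phi> x) \<partial>lborel)"
proof -
  let ?U = "rising \<phi> c" and ?D = "density lborel (\<lambda>x. ennreal (\<phi> x))"
  have [measurable]: "\<phi> \<in> borel_measurable borel" using assms nice_measurable by blast
  note U = open_rising[OF assms(1), of c] bounded_rising[OF assms]
  have "ennreal c * emeasure lborel ?U = (\<integral>\<^sup>+J. ennreal c * emeasure lborel J \<partial>count_space (components ?U))"
    by (subst emeasure_components[OF U(1)]) (auto simp: nn_integral_cmult)
  also have "\<dots> \<le> (\<integral>\<^sup>+J. emeasure ?D J \<partial>count_space (components ?U))"
  proof (rule nn_integral_mono)
    fix J assume "J \<in> space (count_space (components ?U))"
    then have J: "J \<in> components ?U" by simp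
    show "ennreal c * emeasure lborel J \<le> emeasure ?D J"
      unfolding emeasure_component[OF U J] emeasure_density_component[OF U J assms(1,2)]
      using rising_component[OF assms J] open_component_interval(2)[OF U J] assms(3)
      by (subst ennreal_mult[symmetric]) (auto intro: ennreal_leI)
  qed
  also have "\<dots> = emeasure ?D ?U" by (rule emeasure_components[symmetric, OF U(1)]) auto
  also have "\<dots> \<le> emeasure ?D UNIV" by (rule emeasure_mono) auto
  also have "\<dots> = (\<integral>\<^sup>+x. ennreal (\<phi> x) \<partial>lborel)" by (simp add: emeasure_density)
  finally show ?thesis .
qed

text \<open>Outside the rising set all averages to the right are at most \<open>c\<close>. In each component of
  an open superset of \<open>E\<close> this is applied at the first point of the closure of \<open>E\<close>, which
  lies outside the open rising set as well.\<close>
lemma nn_integral_off_rising: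
  assumes "nice f" "c > 0" "E \<in> sets borel" "bounded E" "E \<inter> rising (\<lambda>x. \<bar>f x\<bar>) c = {}"
  shows "emeasure (density lborel (\<lambda>x. ennreal \<bar>f x\<bar>)) E \<le> ennreal c * emeasure lborel E"
proof (rule ennreal_le_epsilon)
  fix e :: real assume "e > 0"
  let ?D = "density lborel (\<lambda>x. ennreal \<bar>f x\<bar>)" and ?V = "cumul (\<lambda>x. \<bar>f x\<bar>)"
  note na = nice_abs[OF assms(1)]
  have [measurable]: "(\<lambda>x. \<bar>f x\<bar>) \<in> borel_measurable borel" using na nice_measurable by blast
  obtain T' where T': "open T'" "E \<subseteq> T'" "T' - E \<in> lmeasurable" "emeasure lebesgue (T' - E) < ennreal (e / c)"
    using sets_lebesgue_outer_open[of E "e / c"] assms \<open>e > 0\<close> by auto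
  obtain R where R: "E \<subseteq> ball 0 R" using assms(4) bounded_subset_ballD by blast
  define T where "T = T' \<inter> ball 0 R"
  have T: "open T" "bounded T" "E \<subseteq> T" using T' R by (auto simp: T_def bounded_Int)
  have "emeasure ?D E = (\<integral>\<^sup>+J. emeasure ?D (E \<inter> J) \<partial>count_space (components T))"
    by (rule emeasure_Int_components) (use T assms in auto)
  also have "\<dots> \<le> (\<integral>\<^sup>+J. ennreal c * emeasure lborel J \<partial>count_space (components T))"
  proof (rule nn_integral_mono)
    fix J assume "J \<in> space (count_space (components T))"
    then have J: "J \<in> components T" by simp
    note JI = open_component_interval[OF T(1,2) J]
    show "emeasure ?D (E \<inter> J) \<le> ennreal c * emeasure lborel J"
    proof (cases "E \<inter> J = {}")
      case False
      define u where "u = Inf (E \<inter> J)"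
      have bb: "bdd_below (E \<inter> J)" by (subst JI(1)) auto
      have "u \<in> closure (E \<inter> J)" unfolding u_def by (rule closure_contains_Inf[OF False bb])
      also have "\<dots> \<subseteq> - rising (\<lambda>x. \<bar>f x\<bar>) c"
        by (rule closure_minimal) (use assms(5) open_rising[OF na] in auto)
      finally have u: "u \<notin> rising (\<lambda>x. \<bar>f x\<bar>) c" by simp
      have lb: "Inf J \<le> u" unfolding u_def by (rule cInf_greatest[OF False]) (metis IntD2 JI(1) greaterThanLessThan_iff less_imp_le)
      have sub: "E \<inter> J \<subseteq> {u..<Sup J}"
        using cInf_lower[OF _ bb] JI(1) unfolding u_def by (metis IntD2 atLeastLessThan_iff greaterThanLessThan_iff subsetI)
      then have uS: "u \<le> Sup J" using False by fastforce
      have "emeasure ?D (E \<inter> J) \<le> emeasure ?D {u..Sup J}" using sub by (intro emeasure_mono) auto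
      also have "\<dots> = ennreal (?V (Sup J) - ?V u)"
        by (subst emeasure_density) (use nn_cumul_diff[OF na _ uS] in auto)
      also have "\<dots> \<le> ennreal (c * (Sup J - Inf J))"
        using not_risingD[OF u uS] lb assms(2) by (intro ennreal_leI) (smt (verit) mult_left_mono)
      also have "\<dots> = ennreal c * emeasure lborel J"
        using JI(2) assms(2) by (simp add: emeasure_component[OF T(1,2) J] ennreal_mult)
      finally show ?thesis .
    qed simp
  qed
  also have "\<dots> = ennreal c * emeasure lborel T"
    by (subst emeasure_components[OF T(1)]) (auto simp: nn_integral_cmult)
  also have "emeasure lborel T \<le> emeasure lborel E + ennreal (e / c)"
  proof -
    have "emeasure lborel T \<le> emeasure lborel (E \<union> (T' - E))" using T' assms(3) by (intro emeasure_mono) (auto simp: T_def)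
    also have "\<dots> \<le> emeasure lborel E + emeasure lborel (T' - E)" using T' assms(3) by (intro emeasure_subadditive) auto
    also have "emeasure lborel (T' - E) = emeasure lebesgue (T' - E)" using T' assms(3) by simp
    finally show ?thesis using T'(4) by (meson add_left_mono less_imp_le order_trans)
  qed
  finally show "emeasure ?D E \<le> ennreal c * emeasure lborel E + ennreal e"
    using assms(2) \<open>e > 0\<close> by (auto simp: distrib_left ennreal_mult[symmetric] mult_left_mono)
qed

text \<open>If \<open>\<bar>f\<bar>\<close> exceeded \<open>c\<close> by \<open>1 / (j + 1)\<close> on a set of positive measure outside the rising
  set, the preceding bound would fail for this set.\<close>
lemma AE_le_off_rising:
  assumes "nice f" "c > 0"
  shows "AE x in lborel. x \<notin> rising (\<lambda>x. \<bar>f x\<bar>) c \<longrightarrow> \<bar>f x\<bar> \<le> c"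
proof -
  let ?D = "density lborel (\<lambda>x. ennreal \<bar>f x\<bar>)" and ?U = "rising (\<lambda>x. \<bar>f x\<bar>) c"
  define E where "E j = {x. x \<notin> ?U \<and> c + 1 / real (Suc j) < \<bar>f x\<bar>}" for j
  obtain R where R: "\<And>x. R < \<bar>x\<bar> \<Longrightarrow> f x = 0" using niceE[OF assms(1)] by metis
  have [measurable]: "f \<in> borel_measurable borel" using assms nice_measurable by blast
  have [measurable]: "?U \<in> sets borel" using open_rising[OF nice_abs[OF assms(1)]] by auto
  have "E j \<in> null_sets lborel" for j
  proof -
    have b: "E j \<subseteq> {-R..R}"
    proof
      fix x assume "x \<in> E j"
      then have "c + 1 / real (Suc j) < \<bar>f x\<bar>" by (simp add: E_def)
      moreover have "0 < 1 / real (Suc j)" by simp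
      ultimately have "\<bar>f x\<bar> > 0" using assms(2) by linarith
      then have "f x \<noteq> 0" by simp
      then have "\<not> R < \<bar>x\<bar>" using R by blast
      then show "x \<in> {-R..R}" by auto
    qed
    have m[measurable]: "E j \<in> sets borel" unfolding E_def by measurable
    have fin: "emeasure lborel (E j) < \<infinity>"
      using emeasure_mono[OF b, of lborel] by (auto simp: emeasure_lborel_Icc_eq intro: le_less_trans)
    have "ennreal (c + 1 / real (Suc j)) * emeasure lborel (E j) = (\<integral>\<^sup>+x. ennreal (c + 1 / real (Suc j)) * indicator (E j) x \<partial>lborel)"
      by (simp add: nn_integral_cmult_indicator)
    also have "\<dots> \<le> (\<integral>\<^sup>+x. ennreal \<bar>f x\<bar> * indicator (E j) x \<partial>lborel)"
      by (rule nn_integral_mono) (auto simp: E_def split: split_indicator intro: ennreal_leI)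
    also have "\<dots> = emeasure ?D (E j)" by (subst emeasure_density) auto
    also have "\<dots> \<le> ennreal c * emeasure lborel (E j)"
      by (rule nn_integral_off_rising[OF assms m]) (use b bounded_subset[OF bounded_closed_interval] in \<open>auto simp: E_def\<close>)
    finally have *: "ennreal (c + 1 / real (Suc j)) * emeasure lborel (E j) \<le> ennreal c * emeasure lborel (E j)" .
    obtain r where r: "emeasure lborel (E j) = ennreal r" "r \<ge> 0" using fin by (cases "emeasure lborel (E j)") auto
    have "(c + 1 / real (Suc j)) * r \<le> c * r"
    proof -
      have "ennreal ((c + 1 / real (Suc j)) * r) = ennreal (c + 1 / real (Suc j)) * ennreal r" "ennreal (c * r) = ennreal c * ennreal r"
        by (rule ennreal_mult; use assms(2) r(2) in simp)+
      then have "ennreal ((c + 1 / real (Suc j)) * r) \<le> ennreal (c * r)" using * r(1) by simp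
      then show ?thesis by (rule ennreal_le_iff[THEN iffD1, rotated]) (use assms(2) r(2) in simp)
    qed
    then have "r = 0" using r(2) by (simp add: field_simps)
    then show ?thesis using r by auto
  qed
  then have "(\<Union>j. E j) \<in> null_sets lborel" by (intro null_sets_UN) auto
  then show ?thesis
  proof (rule AE_I')
    show "{x \<in> space lborel. \<not> (x \<notin> ?U \<longrightarrow> \<bar>f x\<bar> \<le> c)} \<subseteq> (\<Union>j. E j)"
    proof clarsimp
      fix x assume "x \<notin> ?U" "\<not> \<bar>f x\<bar> \<le> c"
      then obtain j where "1 / real (Suc j) < \<bar>f x\<bar> - c" using reals_Archimedean[of "\<bar>f x\<bar> - c"] by (auto simp: inverse_eq_divide)
      then show "\<exists>j. x \<in> E j" using \<open>x \<notin> ?U\<close> unfolding E_def by (auto simp: algebra_simps)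
    qed
  qed
qed

section \<open>The weak type (1,1) bound\<close>

lemma nn_integral_int_swap:
  fixes h :: "int \<Rightarrow> 'a \<Rightarrow> ennreal"
  assumes "\<And>n. h n \<in> borel_measurable M"
  shows "(\<integral>\<^sup>+n. \<integral>\<^sup>+x. h n x \<partial>M \<partial>count_space UNIV) = (\<integral>\<^sup>+x. \<integral>\<^sup>+n. h n x \<partial>count_space UNIV \<partial>M)"
  by (rule nn_integral_count_space_nn_integral[symmetric]) (use assms in auto)

text \<open>The integral of the \<open>r\<close>-th power of the one-sided maximal function of an interval of
  length \<open>l\<close>, over the points at distance at least \<open>l\<close> from its right end.\<close>
lemma nn_integral_power_tail:
  assumes "l > 0" "r > 1"
  shows "(\<integral>\<^sup>+x. ennreal ((l / x) powr r) * indicator {l..} x \<partial>lborel) = ennreal (l / (r - 1))"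
proof -
  let ?F = "\<lambda>x. - (l powr r / (r - 1)) * x powr (1 - r)"
  have "(\<integral>\<^sup>+x. ennreal ((l / x) powr r) * indicator {l..} x \<partial>lborel) = ennreal (0 - ?F l)"
  proof (rule nn_integral_FTC_atLeast[where F="?F" and T=0])
    show "DERIV ?F x :> (l / x) powr r" if "l \<le> x" for x
    proof -
      have "x > 0" using that assms by simp
      then have "DERIV ?F x :> - (l powr r / (r - 1)) * ((1 - r) * x powr (1 - r - 1))"
        by (intro DERIV_cmult has_real_derivative_powr)
      also have "- (l powr r / (r - 1)) * ((1 - r) * x powr (1 - r - 1)) = l powr r * x powr (- r)"
        using assms by (simp add: field_simps)
      also have "\<dots> = (l / x) powr r" using assms \<open>x > 0\<close> by (simp add: powr_divide powr_minus_divide)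
      finally show ?thesis .
    qed
    have "((\<lambda>x::real. x powr (1 - r)) \<longlongrightarrow> 0) at_top" using assms by (intro tendsto_neg_powr filterlim_ident) auto
    then have "(?F \<longlongrightarrow> - (l powr r / (r - 1)) * 0) at_top" by (intro tendsto_mult tendsto_const)
    then show "(?F \<longlongrightarrow> 0) at_top" by simp
  qed (use assms in auto)
  also have "0 - ?F l = l / (r - 1)" using assms by (simp add: powr_diff)
  finally show ?thesis .
qed

lemma nn_integral_reflect:
  assumes "g \<in> borel_measurable borel"
  shows "(\<integral>\<^sup>+x. g (c - x) \<partial>lborel) = (\<integral>\<^sup>+x. g x \<partial>(lborel::real measure))"
  using nn_integral_real_affine[OF assms, of "-1" c] by simp

text \<open>The Calderon-Zygmund decomposition \<open>f = g + b\<close> at height \<open>c\<close>, where \<open>g\<close> takes the mean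
  of \<open>f\<close> on each component of the rising set. The left end point of a component is outside
  the rising set; so \<open>\<bar>f\<bar>\<close> has mean at most \<open>c\<close> not only over a component but also over each
  initial piece of it.\<close>
locale CZ =
  fixes f :: "real \<Rightarrow> real" and c :: real
  assumes f: "nice f" and c: "c > 0"
begin

abbreviation "U \<equiv> rising (\<lambda>x. \<bar>f x\<bar>) c"

lemma U: "open U" "bounded U"
  using open_rising[OF nice_abs[OF f]] bounded_rising[OF nice_abs[OF f] _ c] by auto

lemma U_borel[measurable]: "U \<in> sets borel" using U by auto

lemmas comp = open_component_interval[OF U]

definition mean :: "real set \<Rightarrow> real" where
  "mean J = (cumul f (Sup J) - cumul f (Inf J)) / (Sup J - Inf J)"

definition g :: "real \<Rightarrow> real" where
  "g x = (if x \<in> U then mean (connected_component_set U x) else f x)"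

lemma g_component:
  assumes "J \<in> components U" "x \<in> J" shows "g x = mean J"
proof -
  obtain y where y: "J = connected_component_set U y" using assms(1) by (auto simp: components_iff)
  have "connected_component_set U x = J" using assms(2) unfolding y by (rule connected_component_eq)
  moreover have "x \<in> U" using assms in_components_subset by blast
  ultimately show ?thesis by (simp add: g_def)
qed

lemma variation_component: "J \<in> components U \<Longrightarrow> cumul (\<lambda>x. \<bar>f x\<bar>) (Sup J) - cumul (\<lambda>x. \<bar>f x\<bar>) (Inf J) \<le> c * (Sup J - Inf J)"
  using not_risingD[OF comp(3), of J "Sup J"] comp(2)[of J] by auto

lemma mean_times: "J \<in> components U \<Longrightarrow> mean J * (Sup J - Inf J) = cumul f (Sup J) - cumul f (Inf J)"
  using comp(2)[of J] by (simp add: mean_def)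

lemma abs_mean_times:
  "J \<in> components U \<Longrightarrow> \<bar>mean J\<bar> * (Sup J - Inf J) \<le> cumul (\<lambda>x. \<bar>f x\<bar>) (Sup J) - cumul (\<lambda>x. \<bar>f x\<bar>) (Inf J)"
  using comp(2)[of J] cumul_diff_abs[OF f, of "Inf J" "Sup J"] by (simp add: mean_def)

lemma abs_mean_le:
  assumes "J \<in> components U" shows "\<bar>mean J\<bar> \<le> c"
proof -
  have "\<bar>mean J\<bar> * (Sup J - Inf J) \<le> c * (Sup J - Inf J)"
    using abs_mean_times[OF assms] variation_component[OF assms] by simp
  then show ?thesis using comp(2)[OF assms] by simp
qed

lemma g_U: "x \<in> U \<Longrightarrow> \<bar>g x\<bar> \<le> c"
  using abs_mean_le[OF componentsI[of x U]] by (simp add: g_def)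

lemma nice_g: "nice g"
proof -
  have fm[measurable]: "f \<in> borel_measurable borel" using f nice_measurable by blast
  have "continuous_on (\<Union>(components U)) g"
  proof -
    have "continuous_on (\<Union>J\<in>components U. J) g"
    proof (rule continuous_on_open_UN)
      fix J assume J: "J \<in> components U"
      show "open J" using J U open_components by blast
      show "continuous_on J g"
        by (rule continuous_on_eq[of _ "\<lambda>_. mean J"]) (use g_component[OF J] in auto)
    qed
    then show ?thesis by simp
  qed
  then have "continuous_on U g" by simp
  then have "(\<lambda>x. indicator U x *\<^sub>R g x) \<in> borel_measurable borel"
    using borel_measurable_continuous_on_indicator[OF U_borel] by blast
  moreover have geq: "g = (\<lambda>x. indicator U x *\<^sub>R g x + indicator (- U) x * f x)"
    by (auto simp: g_def fun_eq_iff split: split_indicator)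
  moreover have "(\<lambda>x. indicator U x *\<^sub>R g x + indicator (- U) x * f x) \<in> borel_measurable borel"
    by (intro borel_measurable_add borel_measurable_times calculation(1) fm borel_measurable_indicator) auto
  ultimately have m: "g \<in> borel_measurable borel" by (simp only: geq[symmetric])
  obtain B R where f': "B > 0" "\<And>x. \<bar>f x\<bar> \<le> B" "\<And>x. R < \<bar>x\<bar> \<Longrightarrow> f x = 0" using niceE[OF f] by metis
  obtain R' where R': "U \<subseteq> ball 0 R'" using U(2) bounded_subset_ballD by blast
  have "\<bar>g x\<bar> \<le> max B c \<and> (max R R' < \<bar>x\<bar> \<longrightarrow> g x = 0)" for x
  proof (cases "x \<in> U")
    case True
    then have "\<bar>x\<bar> < R'" using R' by (auto simp: dist_real_def)
    then show ?thesis using g_U[OF True] by auto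
  next
    case False
    then show ?thesis using f'(2)[of x] f'(3)[of x] by (auto simp: g_def)
  qed
  then show ?thesis using m unfolding nice_def by blast
qed

lemma AE_g_le: "AE x in lborel. \<bar>g x\<bar> \<le> c"
  using AE_le_off_rising[OF f c] by eventually_elim (use g_U in \<open>auto simp: g_def\<close>)

lemma emeasure_g_component:
  assumes "J \<in> components U"
  shows "emeasure (density lborel (\<lambda>x. ennreal \<bar>g x\<bar>)) J \<le> emeasure (density lborel (\<lambda>x. ennreal \<bar>f x\<bar>)) J"
proof -
  have [measurable]: "g \<in> borel_measurable borel" using nice_g nice_measurable by blast
  have J: "J \<in> sets borel" using open_components[OF U(1) assms] by auto
  have "emeasure (density lborel (\<lambda>x. ennreal \<bar>g x\<bar>)) J = (\<integral>\<^sup>+x. ennreal \<bar>g x\<bar> * indicator J x \<partial>lborel)"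
    by (rule emeasure_density) (use J in auto)
  also have "\<dots> = (\<integral>\<^sup>+x. ennreal \<bar>mean J\<bar> * indicator J x \<partial>lborel)"
    by (intro nn_integral_cong) (auto split: split_indicator simp: g_component[OF assms])
  also have "\<dots> = ennreal \<bar>mean J\<bar> * ennreal (Sup J - Inf J)"
    using J by (simp add: nn_integral_cmult_indicator emeasure_component[OF U assms])
  also have "\<dots> = ennreal (\<bar>mean J\<bar> * (Sup J - Inf J))" using comp(2)[OF assms] by (simp add: ennreal_mult)
  also have "\<dots> \<le> ennreal (cumul (\<lambda>x. \<bar>f x\<bar>) (Sup J) - cumul (\<lambda>x. \<bar>f x\<bar>) (Inf J))"
    by (intro ennreal_leI abs_mean_times assms)
  also have "\<dots> = emeasure (density lborel (\<lambda>x. ennreal \<bar>f x\<bar>)) J"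
    by (rule emeasure_density_component[symmetric, OF U assms nice_abs[OF f]]) simp
  finally show ?thesis .
qed

lemma nn_integral_g_le: "(\<integral>\<^sup>+x. ennreal \<bar>g x\<bar> \<partial>lborel) \<le> (\<integral>\<^sup>+x. ennreal \<bar>f x\<bar> \<partial>lborel)"
proof -
  have [measurable]: "g \<in> borel_measurable borel" "f \<in> borel_measurable borel" using f nice_g nice_measurable by blast+
  let ?D = "\<lambda>h::real\<Rightarrow>real. density lborel (\<lambda>x. ennreal \<bar>h x\<bar>)"
  have split: "(\<integral>\<^sup>+x. ennreal \<bar>h x\<bar> \<partial>lborel) = emeasure (?D h) U + emeasure (?D h) (- U)"
    if [measurable]: "h \<in> borel_measurable borel" for h
  proof -
    have "(\<integral>\<^sup>+x. ennreal \<bar>h x\<bar> \<partial>lborel) = emeasure (?D h) (U \<union> - U)" by (subst emeasure_density) auto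
    also have "\<dots> = emeasure (?D h) U + emeasure (?D h) (- U)" by (rule plus_emeasure[symmetric]) auto
    finally show ?thesis .
  qed
  have "emeasure (?D g) U \<le> emeasure (?D f) U"
    unfolding emeasure_components[OF U(1), of "?D g", simplified] emeasure_components[OF U(1), of "?D f", simplified]
    by (intro nn_integral_mono) (auto intro: emeasure_g_component)
  moreover have "emeasure (?D g) (- U) = emeasure (?D f) (- U)"
  proof -
    have "emeasure (?D h) (- U) = (\<integral>\<^sup>+x. ennreal \<bar>h x\<bar> * indicator (- U) x \<partial>lborel)" if [measurable]: "h \<in> borel_measurable borel" for h
      by (rule emeasure_density) auto
    from this[of g] this[of f] show ?thesis by (auto intro!: nn_integral_cong simp: g_def split: split_indicator)
  qed
  ultimately show ?thesis unfolding split[OF \<open>g \<in> _\<close>] split[OF \<open>f \<in> _\<close>] by (simp add: add_mono)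
qed

lemma nn_integral_g_square_le:
  "(\<integral>\<^sup>+x. ennreal ((g x)\<^sup>2) \<partial>lborel) \<le> ennreal c * (\<integral>\<^sup>+x. ennreal \<bar>f x\<bar> \<partial>lborel)"
proof -
  have [measurable]: "g \<in> borel_measurable borel" using nice_g nice_measurable by blast
  have "(\<integral>\<^sup>+x. ennreal ((g x)\<^sup>2) \<partial>lborel) \<le> (\<integral>\<^sup>+x. ennreal c * ennreal \<bar>g x\<bar> \<partial>lborel)"
  proof (rule nn_integral_mono_AE)
    show "AE x in lborel. ennreal ((g x)\<^sup>2) \<le> ennreal c * ennreal \<bar>g x\<bar>"
      using AE_g_le
    proof eventually_elim
      case (elim x)
      have "(g x)\<^sup>2 = \<bar>g x\<bar> * \<bar>g x\<bar>" by (simp add: power2_eq_square)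
      also have "\<dots> \<le> c * \<bar>g x\<bar>" using elim by (intro mult_right_mono) auto
      finally show ?case using c by (subst ennreal_mult[symmetric]) (auto intro: ennreal_leI)
    qed
  qed
  also have "\<dots> = ennreal c * (\<integral>\<^sup>+x. ennreal \<bar>g x\<bar> \<partial>lborel)" by (simp add: nn_integral_cmult)
  also have "\<dots> \<le> ennreal c * (\<integral>\<^sup>+x. ennreal \<bar>f x\<bar> \<partial>lborel)" by (intro mult_left_mono nn_integral_g_le) simp
  finally show ?thesis .
qed

definition b :: "real \<Rightarrow> real" where "b x = f x - g x"

lemma nice_b: "nice b" unfolding b_def[abs_def] by (rule nice_diff[OF f nice_g])

lemma cumul_b_component:
  assumes "J \<in> components U" shows "(LBINT x:J. b x) = 0"
proof -
  note J = comp[OF assms]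
  have "(LBINT x:{Inf J<..<Sup J}. g x) = (LBINT x:{Inf J<..<Sup J}. mean J)"
    by (rule set_lebesgue_integral_cong, simp) (use J(1) g_component[OF assms] in blast)
  also have "\<dots> = cumul f (Sup J) - cumul f (Inf J)"
    using J(2) mean_times[OF assms] by (simp add: set_lebesgue_integral_def mult.commute)
  also have "\<dots> = (LBINT x:{Inf J<..<Sup J}. f x)" using cumul_diff_Ioo[OF f, of "Inf J" "Sup J"] J(2) by simp
  finally have "(LBINT x:{Inf J<..<Sup J}. b x) = 0"
    unfolding b_def by (subst set_integral_diff) (auto intro: nice_set_integrable f nice_g)
  then show ?thesis using J(1) by simp
qed

lemma b_off: "x \<notin> U \<Longrightarrow> b x = 0" by (simp add: b_def g_def)

text \<open>As \<open>b\<close> has mean zero on each component, its primitive takes the same value at all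
  points outside the rising set.\<close>
lemma cumul_b_eq:
  assumes "x \<notin> U" "z \<notin> U" "x \<le> z" shows "cumul b x = cumul b z"
proof -
  define F where "F = {J \<in> components U. J \<subseteq> {x<..z}}"
  have cF: "countable F" using countable_components_open[OF U(1)] by (rule countable_subset[rotated]) (auto simp: F_def)
  have UF: "\<Union>F = U \<inter> {x<..z}"
  proof
    show "\<Union>F \<subseteq> U \<inter> {x<..z}" unfolding F_def using in_components_subset by blast
    show "U \<inter> {x<..z} \<subseteq> \<Union>F"
    proof
      fix y assume y: "y \<in> U \<inter> {x<..z}"
      define J where "J = connected_component_set U y"
      have J: "J \<in> components U" and yJ: "y \<in> J" using y unfolding J_def by (auto simp: componentsI)
      note JI = comp[OF J]
      have "x \<notin> J" "z \<notin> J" using assms(1,2) in_components_subset[OF J] by blast+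
      moreover have iy: "Inf J < y" "y < Sup J" using subst[OF JI(1), of "\<lambda>S. y \<in> S"] yJ by auto
      moreover have memJ: "w \<in> J" if "Inf J < w" "w < Sup J" for w using that by (subst JI(1)) simp
      ultimately have "x \<le> Inf J" "Sup J \<le> z"
        using y memJ[of x] memJ[of z] by (auto simp: not_less[symmetric])
      then have "J \<subseteq> {x<..z}" by (subst JI(1)) auto
      then show "y \<in> \<Union>F" using J yJ unfolding F_def by blast
    qed
  qed
  define A where "A i = (if i \<in> to_nat_on F ` F then from_nat_into F i else {})" for i
  have A: "A i \<in> F \<or> A i = {}" for i unfolding A_def using from_nat_into_to_nat_on[OF cF] by auto
  have UA: "(\<Union>i. A i) = \<Union>F"
  proof
    show "(\<Union>i. A i) \<subseteq> \<Union>F" using A by blast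
    show "\<Union>F \<subseteq> (\<Union>i. A i)"
    proof
      fix y assume "y \<in> \<Union>F"
      then obtain J where "J \<in> F" "y \<in> J" by auto
      then have "A (to_nat_on F J) = J" using from_nat_into_to_nat_on[OF cF] by (auto simp: A_def)
      then show "y \<in> (\<Union>i. A i)" using \<open>y \<in> J\<close> by blast
    qed
  qed
  have disj: "A i \<inter> A j = {}" if "i \<noteq> j" for i j
  proof (cases "i \<in> to_nat_on F ` F \<and> j \<in> to_nat_on F ` F")
    case True
    then obtain I J where IJ: "I \<in> F" "J \<in> F" "i = to_nat_on F I" "j = to_nat_on F J" by auto
    then have "A i = I" "A j = J" using from_nat_into_to_nat_on[OF cF] by (auto simp: A_def)
    moreover have "I \<in> components U" "J \<in> components U" "I \<noteq> J" using IJ \<open>i \<noteq> j\<close> by (auto simp: F_def)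
    ultimately show ?thesis using pairwiseD[OF pairwise_disjoint_components[of U], of I J] by simp
  qed (auto simp: A_def)
  have mA: "A i \<in> sets borel" for i
  proof (cases "A i = {}")
    case False
    then have "A i \<in> components U" using A[of i] by (simp add: F_def)
    then show ?thesis by (rule borel_open[OF open_components[OF U(1)]])
  qed simp
  have "cumul b z - cumul b x = (LBINT y:{x<..z}. b y)" by (rule cumul_diff[OF nice_b assms(3)])
  also have "\<dots> = (LBINT y:U \<inter> {x<..z}. b y)"
    unfolding set_lebesgue_integral_def
    by (intro Bochner_Integration.integral_cong) (auto simp: b_off split: split_indicator)
  also have "\<dots> = (LBINT y:(\<Union>i. A i). b y)" by (simp add: UA UF)
  also have "\<dots> = (\<Sum>i. (LBINT y:A i. b y))"
  proof (rule lebesgue_integral_countable_add)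
    show "set_integrable lborel (\<Union>i. A i) b" by (rule nice_set_integrable[OF nice_b]) (use mA in auto)
  qed (use mA disj in auto)
  also have "\<dots> = (\<Sum>i. 0)"
  proof (intro suminf_cong)
    show "(LBINT y:A i. b y) = 0" for i
      using A[of i] cumul_b_component by (auto simp: F_def set_lebesgue_integral_def)
  qed
  finally show ?thesis by simp
qed

text \<open>Whole components contribute nothing to an average of \<open>b\<close>; only the component which the
  right end point hits remains.\<close>
lemma avg_b:
  assumes "x \<notin> U" "s > 0"
  shows "avg s b x = 0 \<or> (\<exists>J\<in>components U. x \<le> Inf J \<and> x + s \<in> J \<and> \<bar>avg s b x\<bar> \<le> 2 * c * (Sup J - Inf J) / s)"
proof (cases "x + s \<in> U")
  case False
  then show ?thesis using cumul_b_eq[OF assms(1) False] assms(2) by (simp add: avg_cumul[OF nice_b])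
next
  case True
  define J where "J = connected_component_set U (x + s)"
  have J: "J \<in> components U" and zJ: "x + s \<in> J" using True unfolding J_def by (auto simp: componentsI)
  note JI = comp[OF J]
  have ab: "Inf J < x + s" "x + s < Sup J" using zJ JI(1) by (metis greaterThanLessThan_iff)+
  have "x \<notin> J" using assms in_components_subset[OF J] by auto
  then have xa: "x \<le> Inf J" using JI(1) ab assms(2)
    by (metis add.commute greaterThanLessThan_iff less_add_same_cancel2 less_trans not_le)
  let ?a = "Inf J" and ?z = "x + s"
  have "cumul b ?z - cumul b x = cumul b ?z - cumul b ?a" using cumul_b_eq[OF assms(1) JI(3) xa] by simp
  also have "\<dots> = (cumul f ?z - cumul f ?a) - (cumul g ?z - cumul g ?a)"
  proof -
    have "cumul f y = cumul b y + cumul g y" for y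
      using cumul_add[OF nice_b nice_g, of y] by (simp add: b_def)
    then show ?thesis by simp
  qed
  also have "\<bar>\<dots>\<bar> \<le> 2 * c * (Sup J - Inf J)"
  proof -
    have "\<bar>cumul f ?z - cumul f ?a\<bar> \<le> c * (?z - ?a)"
      using cumul_diff_abs[OF f, of ?a ?z] not_risingD[OF JI(3), of ?z] ab by auto
    moreover have "\<bar>cumul g ?z - cumul g ?a\<bar> \<le> c * (?z - ?a)"
    proof -
      have "(LBINT x:{?a<..?z}. g x) = (LBINT x:{?a<..?z}. mean J)"
      proof (rule set_lebesgue_integral_cong)
        have "{?a<..?z} \<subseteq> J" using ab by (subst (2) JI(1)) auto
        then show "\<forall>x. x \<in> {?a<..?z} \<longrightarrow> g x = mean J" using g_component[OF J] by auto
      qed simp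
      also have "\<dots> = mean J * (?z - ?a)" using ab by (simp add: set_lebesgue_integral_def mult.commute)
      finally have "\<bar>cumul g ?z - cumul g ?a\<bar> = \<bar>mean J\<bar> * (?z - ?a)"
        using cumul_diff[OF nice_g, of ?a ?z] ab by (simp add: abs_mult)
      also have "\<dots> \<le> c * (?z - ?a)" using abs_mean_le[OF J] ab by (intro mult_right_mono) auto
      finally show ?thesis .
    qed
    moreover have "c * (?z - ?a) \<le> c * (Sup J - Inf J)" using c ab by (intro mult_left_mono) auto
    ultimately show ?thesis unfolding mult.assoc by linarith
  qed
  finally have "\<bar>avg s b x\<bar> \<le> 2 * c * (Sup J - Inf J) / s"
    using assms(2) by (simp add: avg_cumul[OF nice_b] divide_right_mono)
  then show ?thesis using J zJ xa by blast
qed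

text \<open>Averages to the right feel a component only from its left, so that it is enlarged on
  this side only.\<close>
definition Ustar :: "real set" where
  "Ustar = (\<Union>J\<in>components U. {2 * Inf J - Sup J<..<Sup J})"

lemma Ustar_borel[measurable]: "Ustar \<in> sets borel" unfolding Ustar_def by (intro borel_open open_UN) auto

lemma U_subset_Ustar: "U \<subseteq> Ustar"
proof
  fix x assume "x \<in> U"
  then obtain J where J: "J \<in> components U" "x \<in> J" by (metis UnionE Union_components)
  have "Inf J < x" "x < Sup J" using J comp(1)[OF J(1)] by (metis greaterThanLessThan_iff)+
  then have "x \<in> {2 * Inf J - Sup J<..<Sup J}" using comp(2)[OF J(1)] by auto
  then show "x \<in> Ustar" using J unfolding Ustar_def by blast
qed

lemma emeasure_Ustar: "emeasure lborel Ustar \<le> 2 * emeasure lborel U"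
proof -
  let ?D = "\<lambda>J. {2 * Inf J - Sup J<..<Sup J}"
  have cU: "countable (components U)" using countable_components_open[OF U(1)] .
  have "emeasure lborel Ustar = (\<integral>\<^sup>+x. indicator Ustar x \<partial>lborel)" by simp
  also have "\<dots> \<le> (\<integral>\<^sup>+x. \<integral>\<^sup>+J. indicator (?D J) x \<partial>count_space (components U) \<partial>lborel)"
  proof (rule nn_integral_mono)
    fix x show "indicator Ustar x \<le> (\<integral>\<^sup>+J. indicator (?D J) x \<partial>count_space (components U))"
    proof (cases "x \<in> Ustar")
      case True
      then obtain J where J: "J \<in> components U" "x \<in> ?D J" unfolding Ustar_def by blast
      have "indicator (?D J) x \<le> (\<integral>\<^sup>+J. indicator (?D J) x \<partial>count_space (components U) :: ennreal)"
        by (rule nn_integral_ge_point[OF J(1)])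
      then show ?thesis using J(2) True by simp
    qed simp
  qed
  also have "\<dots> = (\<integral>\<^sup>+J. \<integral>\<^sup>+x. indicator (?D J) x \<partial>lborel \<partial>count_space (components U))"
    by (rule nn_integral_count_space_nn_integral[OF cU]) auto
  also have "\<dots> = (\<integral>\<^sup>+J. 2 * emeasure lborel J \<partial>count_space (components U))"
  proof (rule nn_integral_cong)
    fix J assume "J \<in> space (count_space (components U))"
    then have J: "J \<in> components U" by simp
    have "(\<integral>\<^sup>+x. indicator (?D J) x \<partial>lborel) = ennreal (2 * (Sup J - Inf J))"
      using comp(2)[OF J] by simp
    also have "\<dots> = 2 * emeasure lborel J"
      using comp(2)[OF J] ennreal_mult[of 2 "Sup J - Inf J"] by (subst emeasure_component[OF U J]) simp
    finally show "(\<integral>\<^sup>+x. indicator (?D J) x \<partial>lborel) = 2 * emeasure lborel J" .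
  qed
  also have "\<dots> = 2 * emeasure lborel U"
    by (subst emeasure_components[OF U(1)]) (auto simp: nn_integral_cmult)
  finally show ?thesis .
qed

text \<open>A component at distance \<open>d\<close> to the right of \<open>x\<close> is hit only by windows longer than
  \<open>d\<close>, that is on the scales \<open>2\<^sup>n > d / 2\<close>. On these it contributes at most \<open>2 c \<bar>J\<bar> / 2\<^sup>n\<close>,
  and the squares form a geometric series.\<close>
lemma sqO_b_le:
  assumes x: "x \<notin> Ustar"
  shows "sqO b x \<le> (\<integral>\<^sup>+J. ennreal (256 / 3 * c\<^sup>2 * ((Sup J - Inf J) / (Inf J - x))\<^sup>2) * indicator {..2 * Inf J - Sup J} x \<partial>count_space (components U))"
proof -
  have xU: "x \<notin> U" using x U_subset_Ustar by blast
  have cU: "countable (components U)" using countable_components_open[OF U(1)] .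
  define h where "h n J = ennreal (if x \<le> Inf J \<and> Inf J < x + 2 powi (n + 1) then (2 * c * (Sup J - Inf J))\<^sup>2 / (2 powi n)\<^sup>2 else 0)" for n :: int and J
  define G where "G n = (\<integral>\<^sup>+J. h n J \<partial>count_space (components U))" for n
  have avgG: "ennreal ((avg s b x)\<^sup>2) \<le> G n" if s: "s \<in> {2 powi n..<2 powi (n + 1)}" for s n
  proof -
    have L: "(0::real) < 2 powi n" by simp
    have s0: "s > 0" "2 powi n \<le> s" using s less_le_trans[OF L] by auto
    from avg_b[OF xU s0(1)] show ?thesis
    proof
      assume "\<exists>J\<in>components U. x \<le> Inf J \<and> x + s \<in> J \<and> \<bar>avg s b x\<bar> \<le> 2 * c * (Sup J - Inf J) / s"
      then obtain J where J: "J \<in> components U" "x \<le> Inf J" "x + s \<in> J" "\<bar>avg s b x\<bar> \<le> 2 * c * (Sup J - Inf J) / s" by blast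
      have p: "0 \<le> 2 * c * (Sup J - Inf J)" using c comp(2)[OF J(1)] by simp
      have "\<bar>avg s b x\<bar> \<le> 2 * c * (Sup J - Inf J) / 2 powi n"
        using J(4) divide_left_mono[OF s0(2) p] L s0 by (smt (verit) mult_pos_pos)
      then have "(avg s b x)\<^sup>2 \<le> (2 * c * (Sup J - Inf J) / 2 powi n)\<^sup>2"
        by (metis abs_ge_zero power2_abs power_mono)
      moreover have "Inf J < x + s" using J(3) comp(1)[OF J(1)] by (metis greaterThanLessThan_iff)
      then have "Inf J < x + 2 powi (n + 1)" using s by simp
      ultimately have "ennreal ((avg s b x)\<^sup>2) \<le> h n J" using J(2) by (simp add: h_def power_divide ennreal_leI)
      also have "\<dots> \<le> G n" unfolding G_def by (rule nn_integral_ge_point[OF J(1)])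
      finally show ?thesis .
    qed simp
  qed
  have "osc b n x \<le> 4 * G n" for n
    unfolding osc_def
  proof (rule SUP_least)
    fix s :: real assume s: "s \<in> {2 powi n..<2 powi (n + 1)}"
    let ?A = "avg (2 powi n) b x" and ?B = "avg s b x"
    have L: "2 powi n \<in> {2 powi n..<(2::real) powi (n + 1)}" by (simp add: power_int_add)
    have "(?A - ?B)\<^sup>2 \<le> 2 * ?A\<^sup>2 + 2 * ?B\<^sup>2" using square_add_le[of ?A "- ?B"] by simp
    then have "ennreal ((?A - ?B)\<^sup>2) \<le> ennreal (2 * ?A\<^sup>2 + 2 * ?B\<^sup>2)" by (rule ennreal_leI)
    also have "\<dots> = 2 * ennreal (?A\<^sup>2) + 2 * ennreal (?B\<^sup>2)" by (simp add: ennreal_mult)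
    also have "\<dots> \<le> 2 * G n + 2 * G n" by (intro add_mono mult_left_mono avgG s L) auto
    also have "\<dots> = 4 * G n" by (simp only: distrib_right[symmetric]) simp
    finally show "ennreal ((?A - ?B)\<^sup>2) \<le> 4 * G n" .
  qed
  then have "sqO b x \<le> (\<integral>\<^sup>+n. 4 * G n \<partial>count_space UNIV)"
    unfolding sqO_def by (intro nn_integral_mono)
  also have "\<dots> = 4 * (\<integral>\<^sup>+n. G n \<partial>count_space UNIV)" by (simp add: nn_integral_cmult)
  also have "(\<integral>\<^sup>+n. G n \<partial>count_space UNIV) = (\<integral>\<^sup>+J. \<integral>\<^sup>+n. h n J \<partial>count_space UNIV \<partial>count_space (components U))"
    unfolding G_def by (rule nn_integral_int_swap) auto
  also have "4 * \<dots> = (\<integral>\<^sup>+J. 4 * (\<integral>\<^sup>+n. h n J \<partial>count_space UNIV) \<partial>count_space (components U))"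
    by (simp add: nn_integral_cmult)
  also have "\<dots> \<le> (\<integral>\<^sup>+J. ennreal (256 / 3 * c\<^sup>2 * ((Sup J - Inf J) / (Inf J - x))\<^sup>2) * indicator {..2 * Inf J - Sup J} x \<partial>count_space (components U))"
  proof (rule nn_integral_mono)
    fix J assume "J \<in> space (count_space (components U))"
    then have J: "J \<in> components U" by simp
    show "4 * (\<integral>\<^sup>+n. h n J \<partial>count_space UNIV) \<le> ennreal (256 / 3 * c\<^sup>2 * ((Sup J - Inf J) / (Inf J - x))\<^sup>2) * indicator {..2 * Inf J - Sup J} x"
    proof (cases "x \<le> Inf J")
      case False
      then show ?thesis by (simp add: h_def)
    next
      case True
      have "x \<notin> {2 * Inf J - Sup J<..<Sup J}" using x J unfolding Ustar_def by blast
      then have x2: "x \<le> 2 * Inf J - Sup J" using True comp(2)[OF J] by auto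
      define d where "d = Inf J - x"
      have d: "d > 0" using x2 comp(2)[OF J] by (simp add: d_def)
      have "(\<integral>\<^sup>+n. h n J \<partial>count_space UNIV) \<le> ennreal (4 / 3 * (2 * c * (Sup J - Inf J))\<^sup>2 / (d / 2)\<^sup>2)"
        unfolding h_def
      proof (rule sum_powi_le)
        show "(if x \<le> Inf J \<and> Inf J < x + 2 powi (n + 1) then (2 * c * (Sup J - Inf J))\<^sup>2 / (2 powi n)\<^sup>2 else 0) = 0"
          if "2 powi n \<le> d / 2" for n
          using that by (auto simp: d_def power_int_add)
      qed (use d in auto)
      then have "4 * (\<integral>\<^sup>+n. h n J \<partial>count_space UNIV) \<le> 4 * ennreal (4 / 3 * (2 * c * (Sup J - Inf J))\<^sup>2 / (d / 2)\<^sup>2)"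
        by (intro mult_left_mono) auto
      also have "\<dots> = ennreal (4 * (4 / 3 * (2 * c * (Sup J - Inf J))\<^sup>2 / (d / 2)\<^sup>2))"
        by (subst ennreal_mult) auto
      also have "4 * (4 / 3 * (2 * c * (Sup J - Inf J))\<^sup>2 / (d / 2)\<^sup>2) = 256 / 3 * c\<^sup>2 * ((Sup J - Inf J) / (Inf J - x))\<^sup>2"
        using d unfolding d_def[symmetric] by (simp add: power_mult_distrib power_divide)
      finally show ?thesis using x2 by simp
    qed
  qed
  finally show ?thesis .
qed

lemma nn_integral_sqO_b_le:
  "(\<integral>\<^sup>+x. indicator (- Ustar) x * sqO b x \<partial>lborel) \<le> ennreal (256 / 3 * c\<^sup>2) * emeasure lborel U"
proof -
  have cU: "countable (components U)" using countable_components_open[OF U(1)] .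
  let ?k = "\<lambda>J x. ennreal (256 / 3 * c\<^sup>2 * ((Sup J - Inf J) / (Inf J - x))\<^sup>2) * indicator {..2 * Inf J - Sup J} x"
  have "(\<integral>\<^sup>+x. indicator (- Ustar) x * sqO b x \<partial>lborel) \<le> (\<integral>\<^sup>+x. \<integral>\<^sup>+J. ?k J x \<partial>count_space (components U) \<partial>lborel)"
  proof (rule nn_integral_mono)
    fix x show "indicator (- Ustar) x * sqO b x \<le> (\<integral>\<^sup>+J. ?k J x \<partial>count_space (components U))"
      using sqO_b_le[of x] by (cases "x \<in> Ustar") simp_all
  qed
  also have "\<dots> = (\<integral>\<^sup>+J. \<integral>\<^sup>+x. ?k J x \<partial>lborel \<partial>count_space (components U))"
    by (rule nn_integral_count_space_nn_integral[OF cU]) measurable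
  also have "\<dots> = (\<integral>\<^sup>+J. ennreal (256 / 3 * c\<^sup>2) * emeasure lborel J \<partial>count_space (components U))"
  proof (rule nn_integral_cong)
    fix J assume "J \<in> space (count_space (components U))"
    then have J: "J \<in> components U" by simp
    define l where "l = Sup J - Inf J"
    have l: "l > 0" using comp(2)[OF J] by (simp add: l_def)
    have "(\<integral>\<^sup>+x. ?k J x \<partial>lborel) = (\<integral>\<^sup>+x. ennreal (256 / 3 * c\<^sup>2) * (ennreal ((l / (Inf J - x)) powr 2) * indicator {l..} (Inf J - x)) \<partial>lborel)"
    proof (rule nn_integral_cong)
      fix x
      show "?k J x = ennreal (256 / 3 * c\<^sup>2) * (ennreal ((l / (Inf J - x)) powr 2) * indicator {l..} (Inf J - x))"
      proof (cases "x \<le> 2 * Inf J - Sup J")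
        case True
        then have "Inf J - x \<ge> l" by (simp add: l_def)
        then have "(l / (Inf J - x)) powr 2 = (l / (Inf J - x))\<^sup>2" using l by (simp add: powr_numeral)
        then show ?thesis using True \<open>Inf J - x \<ge> l\<close> by (simp add: ennreal_mult[symmetric] l_def)
      next
        case False
        then have "\<not> l \<le> Inf J - x" by (simp add: l_def)
        then show ?thesis using False by simp
      qed
    qed
    also have "\<dots> = ennreal (256 / 3 * c\<^sup>2) * (\<integral>\<^sup>+x. ennreal ((l / (Inf J - x)) powr 2) * indicator {l..} (Inf J - x) \<partial>lborel)"
      by (rule nn_integral_cmult) measurable
    also have "(\<integral>\<^sup>+x. ennreal ((l / (Inf J - x)) powr 2) * indicator {l..} (Inf J - x) \<partial>lborel) = (\<integral>\<^sup>+x. ennreal ((l / x) powr 2) * indicator {l..} x \<partial>lborel)"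
      by (rule nn_integral_reflect[where g="\<lambda>x. ennreal ((l / x) powr 2) * indicator {l..} x"]) measurable
    also have "\<dots> = emeasure lborel J"
      using nn_integral_power_tail[OF l, of 2] emeasure_component[OF U J] by (simp add: l_def)
    finally show "(\<integral>\<^sup>+x. ?k J x \<partial>lborel) = ennreal (256 / 3 * c\<^sup>2) * emeasure lborel J" .
  qed
  also have "\<dots> = ennreal (256 / 3 * c\<^sup>2) * emeasure lborel U"
    by (subst emeasure_components[OF U(1)]) (auto simp: nn_integral_cmult)
  finally show ?thesis .
qed

text \<open>The three contributions are \<open>2 \<bar>U\<bar>\<close> for \<open>Ustar\<close>, the \<open>L\<^sup>2\<close> bound for \<open>g\<close>, and the
  integral of \<open>sqO b\<close> outside \<open>Ustar\<close>; the constants \<open>2 + 16 + 512 / 3\<close> add up to less than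
  \<open>200\<close>.\<close>
lemma weak_type_CZ:
  "ennreal c * emeasure lborel {x. ennreal (c\<^sup>2) < sqO f x} \<le> 200 * (\<integral>\<^sup>+x. ennreal \<bar>f x\<bar> \<partial>lborel)"
proof -
  let ?F = "\<integral>\<^sup>+x. ennreal \<bar>f x\<bar> \<partial>lborel" and ?k = "ennreal (2 / c\<^sup>2)" and ?o = "emeasure lborel U"
  have [measurable]: "sqO f \<in> borel_measurable borel" "sqO g \<in> borel_measurable borel" "sqO b \<in> borel_measurable borel"
    using measurable_sqO f nice_g nice_b by auto
  have fgb: "f = (\<lambda>x. g x + b x)" by (simp add: b_def)
  have sub: "sqO f x \<le> 2 * sqO g x + 2 * sqO b x" for x by (subst fgb) (rule sqO_add[OF nice_g nice_b])
  have "emeasure lborel {x. ennreal (c\<^sup>2) < sqO f x} = (\<integral>\<^sup>+x. indicator {x. ennreal (c\<^sup>2) < sqO f x} x \<partial>lborel)"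
    by (rule nn_integral_indicator[symmetric]) measurable
  also have "\<dots> \<le> (\<integral>\<^sup>+x. indicator Ustar x + (?k * sqO g x + ?k * (indicator (- Ustar) x * sqO b x)) \<partial>lborel)"
  proof (rule nn_integral_mono)
    fix x
    show "indicator {x. ennreal (c\<^sup>2) < sqO f x} x \<le> indicator Ustar x + (?k * sqO g x + ?k * (indicator (- Ustar) x * sqO b x))"
    proof (cases "x \<in> Ustar \<or> sqO f x \<le> ennreal (c\<^sup>2)")
      case True
      then show ?thesis by (auto split: split_indicator)
    next
      case False
      then have "ennreal (c\<^sup>2) \<le> 2 * sqO g x + 2 * sqO b x" using sub[of x] by auto
      then have "ennreal (1 / c\<^sup>2) * ennreal (c\<^sup>2) \<le> ennreal (1 / c\<^sup>2) * (2 * sqO g x + 2 * sqO b x)"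
        by (rule mult_left_mono) simp
      moreover have "ennreal (1 / c\<^sup>2) * ennreal (c\<^sup>2) = 1" using c by (subst ennreal_mult[symmetric]) auto
      moreover have "ennreal (1 / c\<^sup>2) * (2 * sqO g x + 2 * sqO b x) = ?k * sqO g x + ?k * sqO b x"
      proof -
        have "?k = ennreal (1 / c\<^sup>2) * 2" using ennreal_mult[of "1 / c\<^sup>2" 2] by simp
        then show ?thesis by (simp add: distrib_left mult.assoc)
      qed
      ultimately have "1 \<le> ?k * sqO g x + ?k * sqO b x" by simp
      then show ?thesis using False by (simp add: indicator_def)
    qed
  qed
  also have "\<dots> = emeasure lborel Ustar + (?k * (\<integral>\<^sup>+x. sqO g x \<partial>lborel) + ?k * (\<integral>\<^sup>+x. indicator (- Ustar) x * sqO b x \<partial>lborel))"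
    by (simp add: nn_integral_add nn_integral_cmult)
  also have "\<dots> \<le> 2 * ?o + (?k * (8 * (ennreal c * ?F)) + ?k * (ennreal (256 / 3 * c\<^sup>2) * ?o))"
    by (intro add_mono mult_left_mono emeasure_Ustar nn_integral_sqO_b_le
        order_trans[OF nn_integral_sqO_le[OF nice_g]] nn_integral_g_square_le) auto
  finally have "ennreal c * emeasure lborel {x. ennreal (c\<^sup>2) < sqO f x} \<le> ennreal c * (2 * ?o + (?k * (8 * (ennreal c * ?F)) + ?k * (ennreal (256 / 3 * c\<^sup>2) * ?o)))"
    by (rule mult_left_mono) simp
  also have "\<dots> = (2 + ?k * ennreal (256 / 3 * c\<^sup>2)) * (ennreal c * ?o) + (ennreal c * ?k * 8 * ennreal c) * ?F"
    by (simp add: algebra_simps)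
  also have "?k * ennreal (256 / 3 * c\<^sup>2) = ennreal (512 / 3)" using c by (subst ennreal_mult[symmetric]) auto
  also have "ennreal c * ?k * 8 * ennreal c = 16"
  proof -
    have 1: "ennreal c * ?k = ennreal (2 / c)" using c by (subst ennreal_mult[symmetric]) (auto simp: power2_eq_square)
    have 2: "ennreal (2 / c) * ennreal c = 2" using c by (subst ennreal_mult[symmetric]) auto
    have "ennreal c * ?k * 8 * ennreal c = 8 * (ennreal (2 / c) * ennreal c)" unfolding 1 by (simp only: ac_simps)
    then show ?thesis unfolding 2 by simp
  qed
  also have "(2 + ennreal (512 / 3)) * (ennreal c * ?o) + 16 * ?F \<le> (2 + ennreal (512 / 3)) * ?F + 16 * ?F"
    using emeasure_rising_le[OF nice_abs[OF f] _ c] by (intro add_right_mono mult_left_mono) auto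
  also have "\<dots> = (2 + ennreal (512 / 3) + 16) * ?F" by (simp only: distrib_right)
  also have "\<dots> \<le> 200 * ?F"
  proof (rule mult_right_mono)
    have "ennreal (512 / 3) \<le> ennreal 182" by (rule ennreal_leI) simp
    then have "2 + ennreal (512 / 3) + 16 \<le> 2 + 182 + (16::ennreal)" by (intro add_mono) auto
    then show "2 + ennreal (512 / 3) + 16 \<le> (200::ennreal)" by simp
  qed simp
  finally show ?thesis .
qed

end

theorem weak_type_sqO:
  assumes "nice f" "c > 0"
  shows "ennreal c * emeasure lborel {x. ennreal (c\<^sup>2) < sqO f x} \<le> 200 * (\<integral>\<^sup>+x. ennreal \<bar>f x\<bar> \<partial>lborel)"
  using CZ.weak_type_CZ[of f c] assms by (simp add: CZ_def)

section \<open>The Young function and its one-sided maximal level sets\<close>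

definition Phi :: "real \<Rightarrow> real" where "Phi t = t * (1 + log_plus t)"

lemma log_plus_nonneg: "log_plus t \<ge> 0"
  by (simp add: log_plus_def)

lemma log_plus_mono: "s \<le> t \<Longrightarrow> log_plus s \<le> log_plus t"
  by (auto simp: log_plus_def)

lemma Phi_ge: "0 \<le> t \<Longrightarrow> t \<le> Phi t"
  unfolding Phi_def using log_plus_nonneg[of t] by (simp add: algebra_simps)

lemma Phi_nonneg: "0 \<le> t \<Longrightarrow> 0 \<le> Phi t"
  using Phi_ge by fastforce

lemma Phi_mono: "0 \<le> s \<Longrightarrow> s \<le> t \<Longrightarrow> Phi s \<le> Phi t"
  unfolding Phi_def using log_plus_mono[of s t] log_plus_nonneg[of s] by (intro mult_mono) auto

text \<open>The consequence of convexity and \<open>Phi 0 = 0\<close> by which raising the level of a Luxemburg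
  average by a factor lowers the mean at least by the same factor.\<close>
lemma Phi_scale: "0 \<le> \<theta> \<Longrightarrow> \<theta> \<le> 1 \<Longrightarrow> 0 \<le> t \<Longrightarrow> Phi (\<theta> * t) \<le> \<theta> * Phi t"
  unfolding Phi_def mult.assoc
  by (intro mult_left_mono add_left_mono log_plus_mono) (auto simp: mult_left_le_one_le)

text \<open>The gain of \<open>L log L\<close> over \<open>L\<^sup>1\<close>: above \<open>A\<close>, \<open>Phi\<close> beats the identity by \<open>1 + ln A\<close>.\<close>
lemma le_Phi_log:
  assumes "A \<ge> 1" "t \<ge> 0" shows "t \<le> A + Phi t / (1 + ln A)"
proof (cases "t \<le> A")
  case True
  then show ?thesis using Phi_nonneg[OF assms(2)] assms by (simp add: add_increasing2)
next
  case False
  have "ln A \<le> log_plus t" using False assms by (simp add: log_plus_def)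
  then have "t * (1 + ln A) \<le> Phi t" unfolding Phi_def using assms by (intro mult_left_mono) auto
  then have "t \<le> Phi t / (1 + ln A)" using assms by (simp add: pos_le_divide_eq add_pos_nonneg)
  then show ?thesis using assms by simp
qed

lemma measurable_Phi[measurable]: "Phi \<in> borel_measurable borel"
  unfolding Phi_def[abs_def] log_plus_def[abs_def] by measurable

lemma nice_Phi:
  assumes "nice f" "\<mu> > 0" shows "nice (\<lambda>x. Phi (\<bar>f x\<bar> / \<mu>))"
proof -
  obtain B R where *: "f \<in> borel_measurable borel" "B > 0" "\<And>x. \<bar>f x\<bar> \<le> B" "\<And>x. R < \<bar>x\<bar> \<Longrightarrow> f x = 0" using niceE[OF assms(1)] by metis
  note [measurable] = *(1)
  have "\<bar>Phi (\<bar>f x\<bar> / \<mu>)\<bar> \<le> Phi (B / \<mu>) \<and> (R < \<bar>x\<bar> \<longrightarrow> Phi (\<bar>f x\<bar> / \<mu>) = 0)" for x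
  proof -
    have "Phi (\<bar>f x\<bar> / \<mu>) \<le> Phi (B / \<mu>)" using *(3)[of x] assms(2) by (intro Phi_mono divide_right_mono) auto
    moreover have "0 \<le> Phi (\<bar>f x\<bar> / \<mu>)" using assms(2) by (intro Phi_nonneg) auto
    ultimately show ?thesis using *(4)[of x] by (auto simp: Phi_def)
  qed
  then show ?thesis unfolding nice_def by (intro conjI exI[of _ "Phi (B / \<mu>)"] exI[of _ R]) auto
qed

text \<open>The set where some Luxemburg average of \<open>f\<close> over an interval to the right exceeds \<open>\<mu>\<close>.
  The description by \<open>rising\<close> makes the rising sun lemma applicable to it.\<close>
definition lvl :: "(real \<Rightarrow> real) \<Rightarrow> real \<Rightarrow> real set" where
  "lvl f \<mu> = rising (\<lambda>x. Phi (\<bar>f x\<bar> / \<mu>)) 1"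

lemma open_lvl: "nice f \<Longrightarrow> \<mu> > 0 \<Longrightarrow> open (lvl f \<mu>)"
  unfolding lvl_def by (intro open_rising nice_Phi)

lemma Phi_quot_nonneg: "\<mu> > 0 \<Longrightarrow> 0 \<le> Phi (\<bar>z\<bar> / \<mu>)"
  by (intro Phi_nonneg) auto

text \<open>Outside the level set the window \<open>[t, t + H]\<close> has \<open>Phi\<close>-mass at most \<open>H\<close>. On a short
  piece of it the values of \<open>\<bar>f\<bar>\<close> are split at \<open>\<mu> A\<close>: the small ones are counted with the
  length of the piece, the large ones with the mass divided by \<open>1 + ln A\<close>.\<close>
lemma lvl_variation_log:
  assumes f: "nice f" and \<mu>: "\<mu> > 0" and t: "t \<notin> lvl f \<mu>"
    and "t \<le> u" "u \<le> v" "v \<le> t + H" "v - u \<le> L" "A \<ge> 1"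
  shows "cumul (\<lambda>x. \<bar>f x\<bar>) v - cumul (\<lambda>x. \<bar>f x\<bar>) u \<le> \<mu> * (A * L + H / (1 + ln A))"
proof -
  let ?\<Phi> = "\<lambda>x. Phi (\<bar>f x\<bar> / \<mu>)" and ?S = "{u<..v}"
  note nP = nice_Phi[OF f \<mu>]
  define k where "k = \<mu> / (1 + ln A)"
  have k: "k \<ge> 0" using \<mu> assms(8) by (simp add: k_def)
  have i1: "set_integrable lborel ?S (\<lambda>x. \<mu> * A)" using assms(5) by (auto simp: set_integrable_def)
  have i2: "set_integrable lborel ?S (\<lambda>x. k * ?\<Phi> x)" by (intro nice_set_integrable nice_cmult nP) simp
  have "cumul (\<lambda>x. \<bar>f x\<bar>) v - cumul (\<lambda>x. \<bar>f x\<bar>) u = (LBINT x:?S. \<bar>f x\<bar>)" by (rule cumul_diff[OF nice_abs[OF f] assms(5)])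
  also have "\<dots> \<le> (LBINT x:?S. \<mu> * A + k * ?\<Phi> x)"
  proof (rule set_integral_mono)
    show "set_integrable lborel ?S (\<lambda>x. \<bar>f x\<bar>)" by (rule nice_set_integrable[OF nice_abs[OF f]]) simp
    show "set_integrable lborel ?S (\<lambda>x. \<mu> * A + k * ?\<Phi> x)"
      by (rule set_integral_add(1)[OF i1 i2])
    show "\<bar>f x\<bar> \<le> \<mu> * A + k * ?\<Phi> x" for x
    proof -
      have "\<bar>f x\<bar> / \<mu> \<le> A + ?\<Phi> x / (1 + ln A)" using \<mu> by (intro le_Phi_log assms(8)) auto
      then have "\<mu> * (\<bar>f x\<bar> / \<mu>) \<le> \<mu> * (A + ?\<Phi> x / (1 + ln A))" using \<mu> by (intro mult_left_mono) auto
      then show ?thesis using \<mu> by (simp add: k_def algebra_simps)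
    qed
  qed
  also have "\<dots> = \<mu> * A * (v - u) + k * (cumul ?\<Phi> v - cumul ?\<Phi> u)"
    unfolding cumul_diff[OF nP assms(5)]
    using assms(5) by (subst set_integral_add(2)[OF i1 i2]) (simp add: set_lebesgue_integral_def)
  also have "\<dots> \<le> \<mu> * A * L + k * H"
  proof -
    have "cumul ?\<Phi> v - cumul ?\<Phi> t \<le> 1 * (v - t)" using t assms(4,5) unfolding lvl_def by (intro not_risingD) auto
    moreover have "cumul ?\<Phi> t \<le> cumul ?\<Phi> u" using assms(4) by (intro cumul_mono nP Phi_quot_nonneg \<mu>)
    ultimately have "cumul ?\<Phi> v - cumul ?\<Phi> u \<le> H" using assms(6) by simp
    then show ?thesis using assms(7,8) \<mu> k by (intro add_mono mult_left_mono) auto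
  qed
  finally show ?thesis by (simp add: k_def algebra_simps)
qed

lemma lvl_variation:
  assumes f: "nice f" and \<mu>: "\<mu> > 0" and t: "t \<notin> lvl f \<mu>" and "t \<le> v"
  shows "cumul (\<lambda>x. \<bar>f x\<bar>) v - cumul (\<lambda>x. \<bar>f x\<bar>) t \<le> \<mu> * (v - t)"
proof -
  let ?\<Phi> = "\<lambda>x. Phi (\<bar>f x\<bar> / \<mu>)"
  note nP = nice_Phi[OF f \<mu>]
  have "cumul (\<lambda>x. \<bar>f x\<bar>) v - cumul (\<lambda>x. \<bar>f x\<bar>) t \<le> cumul (\<lambda>x. \<mu> * ?\<Phi> x) v - cumul (\<lambda>x. \<mu> * ?\<Phi> x) t"
  proof (rule cumul_le[OF nice_abs[OF f] nice_cmult[OF nP] assms(4)])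
    show "\<bar>f x\<bar> \<le> \<mu> * ?\<Phi> x" for x using Phi_ge[of "\<bar>f x\<bar> / \<mu>"] \<mu> by (simp add: pos_divide_le_eq mult.commute)
  qed
  also have "\<dots> = \<mu> * (cumul ?\<Phi> v - cumul ?\<Phi> t)"
    unfolding cumul_diff[OF nP assms(4)] cumul_diff[OF nice_cmult[OF nP] assms(4)] by simp
  also have "\<dots> \<le> \<mu> * (1 * (v - t))"
    using t \<mu> assms(4) unfolding lvl_def by (intro mult_left_mono not_risingD) auto
  finally show ?thesis by simp
qed

section \<open>The local good-lambda estimate\<close>

lemma sum_inverse_squares_le: "(\<Sum>i. ennreal (D / (1 + real i)\<^sup>2)) \<le> ennreal (2 * D)" if "D \<ge> 0"
proof (rule suminf_le_const)
  have *: "(\<Sum>i<Suc k. 1 / (1 + real i)\<^sup>2) \<le> 2 - 1 / real (Suc k)" for k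
  proof (induction k)
    case (Suc k)
    have "1 / (1 + real (Suc k))\<^sup>2 \<le> 1 / (real (Suc k) * (1 + real (Suc k)))"
      unfolding power2_eq_square by (intro divide_left_mono mult_right_mono mult_pos_pos) auto
    also have "\<dots> = 1 / real (Suc k) - 1 / real (Suc (Suc k))" by (simp add: field_simps)
    finally show ?case using Suc by simp
  qed simp
  have **: "(\<Sum>i<k. 1 / (1 + real i)\<^sup>2) \<le> 2" for k
    using *[of "k - 1"] by (cases k) (auto intro: order_trans)
  show "(\<Sum>i<k. ennreal (D / (1 + real i)\<^sup>2)) \<le> ennreal (2 * D)" for k
  proof -
    have "(\<Sum>i<k. ennreal (D / (1 + real i)\<^sup>2)) = ennreal (D * (\<Sum>i<k. 1 / (1 + real i)\<^sup>2))"
      using that by (simp add: sum_ennreal sum_distrib_left)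
    also have "\<dots> \<le> ennreal (D * 2)" using **[of k] that by (intro ennreal_leI mult_left_mono)
    finally show ?thesis by (simp add: mult.commute)
  qed
qed simp

lemma sqO_cong:
  assumes "nice f" "nice g" "\<And>y. x \<le> y \<Longrightarrow> f y = g y" shows "sqO f x = sqO g x"
proof -
  have "avg s f x = avg s g x" for s
    unfolding avg_def set_lebesgue_integral_def
    by (intro arg_cong2[where f="(*)"] refl Bochner_Integration.integral_cong) (auto simp: assms(3) split: split_indicator)
  then show ?thesis unfolding sqO_def osc_def by simp
qed

text \<open>With \<open>A = exp (i / 4)\<close>, a piece which is \<open>2\<^sup>i\<close> times shorter than the window has its
  small values bounded by the same \<open>O(1 / i)\<close> as the large ones.\<close>
lemma exp_quarter_bound: "exp (real i / 4) / 2 ^ i \<le> 2 / (1 + real i)"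
proof -
  have "1 - 1 / 4 \<le> exp (- (1 / 4) :: real)" using exp_ge_add_one_self[of "- (1/4)"] by simp
  then have e: "exp (1 / 4) \<le> (4 / 3 :: real)" by (simp add: exp_minus field_simps)
  have "exp (real i / 4) = exp (1 / 4) ^ i" by (simp add: exp_of_nat_mult[symmetric])
  also have "\<dots> \<le> (4 / 3) ^ i" by (intro power_mono e) simp
  finally have "exp (real i / 4) / 2 ^ i \<le> (4 / 3) ^ i / 2 ^ i" by (intro divide_right_mono) auto
  also have "(4 / 3 :: real) ^ i / 2 ^ i = (4 / 3 / 2) ^ i" by (rule power_divide[symmetric])
  also have "(4 / 3 / 2 :: real) = 1 / (3 / 2)" by simp
  also have "(1 / (3 / 2) :: real) ^ i = 1 / (3 / 2) ^ i" by (rule power_one_over)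
  also have "\<dots> \<le> 1 / (1 + real i / 2)"
    using Bernoulli_inequality[of "1/2::real" i] by (intro divide_left_mono) (auto simp: mult_ac add_pos_nonneg)
  also have "\<dots> \<le> 2 / (1 + real i)" by (simp add: field_simps)
  finally show ?thesis .
qed

text \<open>Let \<open>\<tau> = t + 4 L\<close>. For windows longer than \<open>4 L\<close>, the average at \<open>x\<close> of the part of
  \<open>f\<close> to the right of \<open>\<tau>\<close> is the average of \<open>f\<close> at \<open>y\<close>, up to the integral over \<open>[y, \<tau>]\<close>,
  which is divided by the length of the window, and up to the integral between the right end
  points \<open>x + s\<close> and \<open>y + s\<close>. The latter is where \<open>lvl_variation_log\<close> yields square summable
  errors. The few shorter scales which still reach beyond \<open>\<tau>\<close> are bounded by the size of the
  averages.\<close>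
lemma sqO_far_le:
  assumes f: "nice f" and \<mu>: "\<mu> > 0" and L: "L > 0" and t: "t \<notin> lvl f \<mu>"
    and x: "t \<le> x" "x \<le> t + L" and y: "t \<le> y" "y \<le> t + L"
  shows "sqO (\<lambda>z. indicator {t + 4 * L<..} z * f z) x \<le> 2 * sqO f y + ennreal (6916 * \<mu>\<^sup>2)"
proof -
  define \<tau> where "\<tau> = t + 4 * L"
  define f2 where "f2 = (\<lambda>z. indicator {\<tau><..} z * f z)"
  have nf2: "nice f2" unfolding f2_def by (rule nice_indicator[OF f]) simp
  let ?P = "cumul f" and ?V = "cumul (\<lambda>z. \<bar>f z\<bar>)"
  note nV = nice_abs[OF f]
  have V: "?V a \<le> ?V b" if "a \<le> b" for a b by (rule cumul_mono[OF nV _ that]) simp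
  have P2: "cumul f2 b - cumul f2 a = 0" if "a \<le> b" "b \<le> \<tau>" for a b
    using cumul_eq[OF nf2 that(1)] that by (auto simp: f2_def)
  have P2': "cumul f2 b - cumul f2 \<tau> = ?P b - ?P \<tau>" if "\<tau> \<le> b" for b
  proof -
    have "(LBINT z:{\<tau><..b}. f2 z) = (LBINT z:{\<tau><..b}. f z)"
      by (rule set_lebesgue_integral_cong) (auto simp: f2_def)
    then show ?thesis using cumul_diff[OF nf2 that] cumul_diff[OF f that] by simp
  qed
  have x\<tau>: "x \<le> \<tau>" using x L by (simp add: \<tau>_def)
  obtain n0 :: int where n0: "2 powi n0 > 4 * L" "\<And>n. 2 powi n > 4 * L \<Longrightarrow> n0 \<le> n"
    using ex_least_power2_gt[of "4 * L"] L by (metis mult_pos_pos zero_less_numeral)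
  \<comment> \<open>The errors on the large scales and on the small ones: \<open>3362 = 2 * 41\<^sup>2\<close> and \<open>324 = 18\<^sup>2\<close>;
    the sums over the scales are \<open>6724 \<mu>\<^sup>2\<close> and \<open>192 \<mu>\<^sup>2\<close>.\<close>
  define E1 where "E1 n = (if n0 \<le> n then 3362 * \<mu>\<^sup>2 / (1 + real (nat (n - n0)))\<^sup>2 else 0)" for n
  define E2 where "E2 n = (if 2 powi n > 3/2 * L then 324 * \<mu>\<^sup>2 * L\<^sup>2 / (2 powi n)\<^sup>2 else 0)" for n :: int
  have far: "ennreal ((avg (2 powi n) f2 x - avg s f2 x)\<^sup>2) \<le> 2 * osc f n y + ennreal (E1 n)"
    if n: "n0 \<le> n" and s: "s \<in> {2 powi n..<2 powi (n + 1)}" for n s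
  proof -
    define i where "i = nat (n - n0)"
    define M where "M = (2::real) powi n"
    have M0: "M > 0" by (simp add: M_def)
    have nn: "n = n0 + int i" using n by (simp add: i_def)
    have "M = 2 powi n0 * 2 ^ i" unfolding M_def nn by (simp add: power_int_add)
    then have Mi: "4 * L * 2 ^ i \<le> M" using n0(1) by (simp add: mult_right_mono)
    have i1: "1 + real i \<le> 2 ^ i" using Bernoulli_inequality[of "1::real" i] by simp
    have "4 * L \<le> 4 * L * 2 ^ i" using L by simp
    then have  M4L: "4 * L \<le> M" using Mi by linarith
    have s': "M \<le> s" "s < 2 * M" "s > 0" using s M0 by (auto simp: M_def power_int_add)
    define p where "p = ?P \<tau> - ?P y"
    define e where "e s = (?P (x + s) - ?P (y + s)) / s" for s
    have av: "avg s f2 x = avg s f y - p / s + e s" if "M \<le> s" for s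
    proof -
      have s0: "s > 0" using that M0 by simp
      have xs: "\<tau> \<le> x + s" using that  M4L x by (simp add: \<tau>_def)
      have "cumul f2 (x + s) - cumul f2 x = ?P (x + s) - ?P \<tau>"
        using P2'[OF xs] P2[OF x\<tau> order_refl] by simp
      then have "avg s f2 x = (?P (x + s) - ?P \<tau>) / s" using s0 by (simp add: avg_cumul[OF nf2])
      then show ?thesis using s0 by (simp add: avg_cumul[OF f] p_def e_def diff_divide_distrib)
    qed
    have p: "\<bar>p\<bar> \<le> 4 * L * \<mu>"
    proof -
      have y\<tau>: "y \<le> \<tau>" using y L by (simp add: \<tau>_def)
      have "\<bar>p\<bar> \<le> ?V \<tau> - ?V y" unfolding p_def by (rule cumul_diff_abs[OF f y\<tau>])
      also have "\<dots> \<le> ?V \<tau> - ?V t" using V[OF y(1)] by simp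
      also have "\<dots> \<le> \<mu> * (\<tau> - t)" by (rule lvl_variation[OF f \<mu> t]) (use L in \<open>simp add: \<tau>_def\<close>)
      finally show ?thesis by (simp add: \<tau>_def mult_ac)
    qed
    have e: "\<bar>e s\<bar> \<le> 20 * \<mu> / (1 + real i)" if s: "M \<le> s" "s < 2 * M" for s
    proof -
      define u v where "u = min (x + s) (y + s)" and "v = max (x + s) (y + s)"
      have uv: "t \<le> u" "u \<le> v" "v \<le> t + 4 * M" "v - u \<le> L"
        using s x y L M0  M4L by (auto simp: u_def v_def)
      have "\<bar>?P (x + s) - ?P (y + s)\<bar> = \<bar>?P v - ?P u\<bar>" by (auto simp: u_def v_def max_def min_def)
      also have "\<dots> \<le> ?V v - ?V u" by (rule cumul_diff_abs[OF f uv(2)])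
      also have "\<dots> \<le> \<mu> * (exp (real i / 4) * L + 4 * M / (1 + ln (exp (real i / 4))))"
        by (rule lvl_variation_log[OF f \<mu> t uv]) simp
      also have "\<dots> \<le> \<mu> * (M / (2 * (1 + real i)) + 16 * M / (1 + real i))"
      proof (intro mult_left_mono add_mono)
        have "exp (real i / 4) * L \<le> exp (real i / 4) * (M / (4 * 2 ^ i))"
          using Mi by (intro mult_left_mono) (auto simp: field_simps)
        also have "\<dots> = M / 4 * (exp (real i / 4) / 2 ^ i)" by simp
        also have "\<dots> \<le> M / 4 * (2 / (1 + real i))" using M0 by (intro mult_left_mono exp_quarter_bound) auto
        finally show "exp (real i / 4) * L \<le> M / (2 * (1 + real i))" by (simp add: field_simps)
        have "4 * M / (1 + real i / 4) \<le> 4 * M / ((1 + real i) / 4)"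
          using M0 by (intro divide_left_mono mult_pos_pos) (auto simp: field_simps)
        then show "4 * M / (1 + ln (exp (real i / 4))) \<le> 16 * M / (1 + real i)" by simp
      qed (use \<mu> in auto)
      also have "\<dots> \<le> M * (20 * \<mu> / (1 + real i))"
      proof -
        have "\<mu> * (M / (2 * (1 + real i)) + 16 * M / (1 + real i)) = 33 / 2 * (\<mu> * M) / (1 + real i)"
        proof -
          have "M / (2 * (1 + real i)) + 16 * M / (1 + real i) = (M / 2 + 16 * M) / (1 + real i)"
            by (simp only: add_divide_distrib divide_divide_eq_left)
          then show ?thesis by simp
        qed
        also have "\<dots> \<le> 20 * (\<mu> * M) / (1 + real i)" using \<mu> M0 by (intro divide_right_mono mult_right_mono) auto
        finally show ?thesis by (simp add: mult_ac)
      qed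
      also have "\<dots> \<le> s * (20 * \<mu> / (1 + real i))" using s \<mu> by (intro mult_right_mono) auto
      finally show ?thesis using s M0 by (simp add: e_def pos_divide_le_eq mult_ac)
    qed
    define d where "d = avg M f y - avg s f y"
    define q where "q = - p * (1 / M - 1 / s) + (e M - e s)"
    have "avg M f2 x - avg s f2 x = d + q"
      unfolding av[OF order_refl] av[OF s'(1)] by (simp add: d_def q_def algebra_simps)
    moreover have "\<bar>q\<bar> \<le> 41 * \<mu> / (1 + real i)"
    proof -
      have "\<bar>- p * (1 / M - 1 / s)\<bar> \<le> (4 * L * \<mu>) * (1 / M)"
        unfolding abs_mult using p s' M0 by (intro mult_mono) (auto simp: field_simps)
      also have "\<dots> \<le> \<mu> / (1 + real i)"
      proof -
        have "4 * L * (1 + real i) \<le> M" using Mi i1 L by (smt (verit) mult_left_mono)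
        then have "\<mu> * (4 * L * (1 + real i)) \<le> \<mu> * M" using \<mu> by (intro mult_left_mono) auto
        then show ?thesis using M0 by (simp add: field_simps)
      qed
      finally have "\<bar>- p * (1 / M - 1 / s)\<bar> \<le> \<mu> / (1 + real i)" .
      then have "\<bar>q\<bar> \<le> \<mu> / (1 + real i) + (20 * \<mu> / (1 + real i) + 20 * \<mu> / (1 + real i))"
      proof -
        have "\<bar>q\<bar> \<le> \<bar>- p * (1 / M - 1 / s)\<bar> + (\<bar>e M\<bar> + \<bar>e s\<bar>)"
          unfolding q_def using abs_triangle_ineq abs_triangle_ineq4 by (meson add_left_mono order_trans)
        moreover have "\<bar>e M\<bar> \<le> 20 * \<mu> / (1 + real i)" "\<bar>e s\<bar> \<le> 20 * \<mu> / (1 + real i)"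
          using e[of M] e[of s] s' M0 by auto
        ultimately show ?thesis using \<open>\<bar>- p * (1 / M - 1 / s)\<bar> \<le> \<mu> / (1 + real i)\<close> by linarith
      qed
      then show ?thesis by (simp add: add_divide_distrib[symmetric])
    qed
    then have "q\<^sup>2 \<le> (41 * \<mu> / (1 + real i))\<^sup>2" by (metis abs_ge_zero power2_abs power_mono)
    ultimately have "(avg M f2 x - avg s f2 x)\<^sup>2 \<le> 2 * d\<^sup>2 + 3362 * \<mu>\<^sup>2 / (1 + real i)\<^sup>2"
      using square_add_le[of d q] by (simp add: power_divide power_mult_distrib)
    then have "ennreal ((avg M f2 x - avg s f2 x)\<^sup>2) \<le> ennreal (2 * d\<^sup>2 + 3362 * \<mu>\<^sup>2 / (1 + real i)\<^sup>2)" by (rule ennreal_leI)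
    also have "\<dots> = 2 * ennreal (d\<^sup>2) + ennreal (E1 n)"
      using n by (simp add: ennreal_mult E1_def i_def)
    also have "ennreal (d\<^sup>2) \<le> osc f n y" using osc_upper[OF s, of f y] by (simp add: d_def M_def)
    finally show ?thesis by (simp add: M_def mult_left_mono)
  qed
  have near: "ennreal ((avg (2 powi n) f2 x - avg s f2 x)\<^sup>2) \<le> ennreal (E2 n)"
    if n: "n < n0" and s: "s \<in> {2 powi n..<2 powi (n + 1)}" for n s
  proof -
    define M where "M = (2::real) powi n"
    have M0: "M > 0" by (simp add: M_def)
    have M4: "M \<le> 4 * L" using n0(2)[of n] n by (force simp: M_def)
    have s': "M \<le> s" "s < 2 * M" "s > 0" using s M0 by (auto simp: M_def power_int_add)
    have a: "\<bar>avg s f2 x\<bar> \<le> 9 * \<mu> * L / M" if s: "M \<le> s" "s < 2 * M" for s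
    proof -
      have s0: "s > 0" using s M0 by simp
      have "\<bar>cumul f2 (x + s) - cumul f2 x\<bar> \<le> cumul (\<lambda>z. \<bar>f2 z\<bar>) (x + s) - cumul (\<lambda>z. \<bar>f2 z\<bar>) x"
        by (rule cumul_diff_abs[OF nf2]) (use s0 in simp)
      also have "\<dots> \<le> ?V (x + s) - ?V x"
        by (rule cumul_le[OF nice_abs[OF nf2] nV]) (use s0 in \<open>auto simp: f2_def split: split_indicator\<close>)
      also have "\<dots> \<le> ?V (x + s) - ?V t" using V[OF x(1)] by simp
      also have "\<dots> \<le> \<mu> * (x + s - t)" by (rule lvl_variation[OF f \<mu> t]) (use s0 x in simp)
      also have "\<dots> \<le> \<mu> * (9 * L)" using s x M4 \<mu> by (intro mult_left_mono) auto
      finally have "\<bar>avg s f2 x\<bar> \<le> \<mu> * (9 * L) / s"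
        using s0 by (simp add: avg_cumul[OF nf2] divide_right_mono)
      also have "\<dots> \<le> \<mu> * (9 * L) / M" using s M0 \<mu> L by (intro divide_left_mono mult_pos_pos) auto
      finally show ?thesis by (simp add: mult_ac)
    qed
    show ?thesis
    proof (cases "M > 3 / 2 * L")
      case True
      have "\<bar>avg M f2 x\<bar> \<le> 9 * \<mu> * L / M" "\<bar>avg s f2 x\<bar> \<le> 9 * \<mu> * L / M" using a[of M] a[of s] s' M0 by auto
      moreover have "18 * \<mu> * L / M = 9 * \<mu> * L / M + 9 * \<mu> * L / M" by (simp add: add_divide_distrib[symmetric])
      ultimately have "\<bar>avg M f2 x - avg s f2 x\<bar> \<le> 18 * \<mu> * L / M" by linarith
      then have "(avg M f2 x - avg s f2 x)\<^sup>2 \<le> (18 * \<mu> * L / M)\<^sup>2" by (metis abs_ge_zero power2_abs power_mono)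
      then show ?thesis using True by (auto simp: M_def E2_def power_divide power_mult_distrib intro!: ennreal_leI)
    next
      case False
      have "avg s f2 x = 0" if s: "M \<le> s" "s \<le> 2 * M" for s
      proof -
        have "cumul f2 (x + s) - cumul f2 x = 0" using False s x M0 by (intro P2) (auto simp: \<tau>_def)
        then show ?thesis using s M0 by (simp add: avg_cumul[OF nf2])
      qed
      from this[of M] this[of s] show ?thesis using s' M0 by (simp add: M_def)
    qed
  qed
  have "osc f2 n x \<le> 2 * osc f n y + (ennreal (E1 n) + ennreal (E2 n))" for n
    unfolding osc_def[of f2]
  proof (rule SUP_least)
    fix s :: real assume s: "s \<in> {2 powi n..<2 powi (n + 1)}"
    show "ennreal ((avg (2 powi n) f2 x - avg s f2 x)\<^sup>2) \<le> 2 * osc f n y + (ennreal (E1 n) + ennreal (E2 n))"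
    proof (cases "n0 \<le> n")
      case True
      show ?thesis using far[OF True s] by (rule order_trans) (simp add: add_left_mono)
    next
      case False
      then show ?thesis using near[of n s] s by (auto intro: order_trans add_increasing)
    qed
  qed
  then have "sqO f2 x \<le> (\<integral>\<^sup>+n. 2 * osc f n y + (ennreal (E1 n) + ennreal (E2 n)) \<partial>count_space UNIV)"
    unfolding sqO_def by (intro nn_integral_mono)
  also have "\<dots> = 2 * sqO f y + ((\<integral>\<^sup>+n. ennreal (E1 n) \<partial>count_space UNIV) + (\<integral>\<^sup>+n. ennreal (E2 n) \<partial>count_space UNIV))"
    unfolding sqO_def by (simp add: nn_integral_add nn_integral_cmult)
  also have "(\<integral>\<^sup>+n. ennreal (E1 n) \<partial>count_space UNIV) \<le> ennreal (2 * (3362 * \<mu>\<^sup>2))"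
  proof -
    have "(\<integral>\<^sup>+n. ennreal (E1 n) \<partial>count_space UNIV) = (\<Sum>i. ennreal (3362 * \<mu>\<^sup>2 / (1 + real i)\<^sup>2))"
      by (subst nn_integral_int_ge[of n0]) (auto simp: E1_def)
    also have "\<dots> \<le> ennreal (2 * (3362 * \<mu>\<^sup>2))" by (rule sum_inverse_squares_le) simp
    finally show ?thesis .
  qed
  also have "(\<integral>\<^sup>+n. ennreal (E2 n) \<partial>count_space UNIV) \<le> ennreal (4 / 3 * (324 * \<mu>\<^sup>2 * L\<^sup>2) / (3/2 * L)\<^sup>2)"
    by (rule sum_powi_le) (use L in \<open>auto simp: E2_def\<close>)
  also have "4 / 3 * (324 * \<mu>\<^sup>2 * L\<^sup>2) / (3/2 * L)\<^sup>2 = 192 * \<mu>\<^sup>2" using L by (simp add: power_mult_distrib power_divide)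
  also have "ennreal (2 * (3362 * \<mu>\<^sup>2)) + ennreal (192 * \<mu>\<^sup>2) = ennreal (6916 * \<mu>\<^sup>2)"
    by (subst ennreal_plus[symmetric]) auto
  finally show ?thesis by (simp add: f2_def \<tau>_def add_left_mono add_mono)
qed

text \<open>If \<open>sqO f x > (K l)\<^sup>2 \<ge> 9 l\<^sup>2\<close>, then \<open>sqO f1 x > l\<^sup>2\<close> for the part \<open>f1\<close> of \<open>f\<close> on
  \<open>[t, t + 4 L]\<close>, because the far part contributes at most \<open>3 l\<^sup>2\<close>. The integral of \<open>\<bar>f1\<bar>\<close>
  is at most \<open>\<gamma> l * 4 L\<close>, and the weak type bound concludes with \<open>800 = 200 * 4\<close>.\<close>
theorem local_good_lambda:
  assumes f: "nice f" and l: "l > 0" and \<gamma>: "\<gamma> > 0" "\<gamma> \<le> 1 / 100" and L: "L > 0"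
    and t: "t \<notin> lvl f (\<gamma> * l)" and y: "t \<le> y" "y \<le> t + L" "sqO f y \<le> ennreal (l\<^sup>2)" and K: "K \<ge> 3"
  shows "emeasure lborel {x \<in> {t..t + L}. ennreal ((K * l)\<^sup>2) < sqO f x} \<le> ennreal (800 * \<gamma> * L)"
proof -
  define \<mu> where "\<mu> = \<gamma> * l"
  have \<mu>: "\<mu> > 0" "t \<notin> lvl f \<mu>" using \<gamma> l t by (auto simp: \<mu>_def)
  define f1 where "f1 = (\<lambda>z. indicator {t..t + 4 * L} z * f z)"
  define f2 where "f2 = (\<lambda>z. indicator {t + 4 * L<..} z * f z)"
  have n12: "nice f1" "nice f2" unfolding f1_def f2_def by (rule nice_indicator[OF f], simp)+
  have [measurable]: "sqO f1 \<in> borel_measurable borel" using n12 by measurable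
  have "{x \<in> {t..t + L}. ennreal ((K * l)\<^sup>2) < sqO f x} \<subseteq> {x. ennreal (l\<^sup>2) < sqO f1 x}"
  proof clarsimp
    fix x assume x: "t \<le> x" "x \<le> t + L" "ennreal ((K * l)\<^sup>2) < sqO f x"
    have "sqO f x = sqO (\<lambda>z. f1 z + f2 z) x"
      by (rule sqO_cong[OF f nice_add[OF n12]]) (use x L in \<open>auto simp: f1_def f2_def split: split_indicator\<close>)
    also have "\<dots> \<le> 2 * sqO f1 x + 2 * sqO f2 x" by (rule sqO_add[OF n12])
    finally have 1: "ennreal ((K * l)\<^sup>2) < 2 * sqO f1 x + 2 * sqO f2 x" using x(3) by simp
    have "sqO f2 x \<le> 2 * sqO f y + ennreal (6916 * \<mu>\<^sup>2)"
      unfolding f2_def by (rule sqO_far_le[OF f \<mu>(1) L \<mu>(2) x(1,2) y(1,2)])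
    also have "\<dots> \<le> 2 * ennreal (l\<^sup>2) + ennreal (l\<^sup>2)"
    proof (intro add_mono mult_left_mono y(3) ennreal_leI)
      have "\<mu> \<le> 1 / 100 * l" unfolding \<mu>_def using \<gamma> l by (intro mult_right_mono) auto
      then have "\<mu>\<^sup>2 \<le> (1 / 100 * l)\<^sup>2" using \<mu> by (intro power_mono) auto
      then have "10000 * \<mu>\<^sup>2 \<le> l\<^sup>2" by (simp add: power_mult_distrib power_divide)
      then show "6916 * \<mu>\<^sup>2 \<le> l\<^sup>2" using zero_le_power2[of \<mu>] by linarith
    qed simp
    also have "\<dots> = (2 + 1) * ennreal (l\<^sup>2)" by (simp only: distrib_right mult_1_left)
    also have "2 + 1 = (3 :: ennreal)" by simp
    finally have 2: "sqO f2 x \<le> 3 * ennreal (l\<^sup>2)" .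
    show "ennreal (l\<^sup>2) < sqO f1 x"
    proof (rule ccontr)
      assume "\<not> ennreal (l\<^sup>2) < sqO f1 x"
      then have "2 * sqO f1 x + 2 * sqO f2 x \<le> 2 * ennreal (l\<^sup>2) + 2 * (3 * ennreal (l\<^sup>2))"
        using 2 by (intro add_mono mult_left_mono) auto
      also have "\<dots> = (2 + 2 * 3) * ennreal (l\<^sup>2)" by (simp only: distrib_right mult.assoc)
      also have "\<dots> = ennreal (2 * l\<^sup>2 + 2 * (3 * l\<^sup>2))" using ennreal_mult[of 8 "l\<^sup>2"] by simp
      also have "\<dots> \<le> ennreal ((K * l)\<^sup>2)"
      proof (rule ennreal_leI)
        have "(3 * l)\<^sup>2 \<le> (K * l)\<^sup>2" (is "_ \<le> ?R") using K l by (intro power_mono mult_right_mono) auto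
        then show "2 * l\<^sup>2 + 2 * (3 * l\<^sup>2) \<le> (K * l)\<^sup>2"
        proof -
          have "9 * l\<^sup>2 \<le> ?R" using \<open>(3 * l)\<^sup>2 \<le> ?R\<close> power_mult_distrib[of 3 l 2] by simp
          then show ?thesis using zero_le_power2[of l] by linarith
        qed
      qed
      finally show False using 1 by simp
    qed
  qed
  then have "emeasure lborel {x \<in> {t..t + L}. ennreal ((K * l)\<^sup>2) < sqO f x} \<le> emeasure lborel {x. ennreal (l\<^sup>2) < sqO f1 x}"
    by (rule emeasure_mono) measurable
  also have "\<dots> \<le> ennreal (800 * \<gamma> * L)"
  proof -
    have "(\<integral>\<^sup>+x. ennreal \<bar>f1 x\<bar> \<partial>lborel) = (\<integral>\<^sup>+x\<in>{t..t + 4 * L}. ennreal \<bar>f x\<bar> \<partial>lborel)"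
      by (intro nn_integral_cong) (auto simp: f1_def split: split_indicator)
    also have "\<dots> = ennreal (cumul (\<lambda>x. \<bar>f x\<bar>) (t + 4 * L) - cumul (\<lambda>x. \<bar>f x\<bar>) t)"
      by (rule nn_cumul_diff[OF nice_abs[OF f]]) (use L in auto)
    also have "\<dots> \<le> ennreal (\<mu> * (t + 4 * L - t))"
      by (intro ennreal_leI lvl_variation[OF f \<mu>]) (use L in auto)
    finally have "200 * (\<integral>\<^sup>+x. ennreal \<bar>f1 x\<bar> \<partial>lborel) \<le> 200 * ennreal (\<mu> * (4 * L))" by (intro mult_left_mono) auto
    also have "\<dots> = ennreal (200 * (\<mu> * (4 * L)))" using ennreal_mult[of 200 "\<mu> * (4 * L)"] \<mu> L by simp
    finally have "ennreal l * emeasure lborel {x. ennreal (l\<^sup>2) < sqO f1 x} \<le> ennreal (200 * (\<mu> * (4 * L)))"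
      using weak_type_sqO[OF n12(1) l] by (rule order_trans[rotated])
    then have "ennreal (1 / l) * (ennreal l * emeasure lborel {x. ennreal (l\<^sup>2) < sqO f1 x}) \<le> ennreal (1 / l) * ennreal (200 * (\<mu> * (4 * L)))"
      by (rule mult_left_mono) simp
    also have "ennreal (1 / l) * ennreal (200 * (\<mu> * (4 * L))) = ennreal (800 * \<gamma> * L)"
      using l \<mu> L by (subst ennreal_mult[symmetric]) (auto simp: \<mu>_def mult.assoc)
    also have "ennreal (1 / l) * (ennreal l * emeasure lborel {x. ennreal (l\<^sup>2) < sqO f1 x}) = emeasure lborel {x. ennreal (l\<^sup>2) < sqO f1 x}"
      using l by (simp add: mult.assoc[symmetric] ennreal_mult[symmetric])
    finally show ?thesis .
  qed
  finally show ?thesis .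
qed

section \<open>Tails of intervals\<close>

text \<open>The function \<open>M\<^sup>+ \<chi>\<^bsub>(a,b)\<^esub>\<close>.\<close>
definition tail :: "real \<Rightarrow> real \<Rightarrow> real \<Rightarrow> real" where
  "tail a b x = (if x < b then min 1 ((b - a) / (b - x)) else 0)"

lemma measurable_tail[measurable]: "tail a b \<in> borel_measurable borel"
  unfolding tail_def[abs_def] by measurable

lemma tail_nonneg: "a < b \<Longrightarrow> 0 \<le> tail a b x" by (simp add: tail_def)

lemma tail_le_1: "tail a b x \<le> 1" by (simp add: tail_def)

lemma tail_eq_1: "a \<le> x \<Longrightarrow> x < b \<Longrightarrow> tail a b x = 1"
  by (simp add: tail_def min_def le_divide_eq)

lemma tail_le_quot: "x < b \<Longrightarrow> tail a b x \<le> (b - a) / (b - x)" by (simp add: tail_def)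

lemma tail_mono:
  assumes "a < b" "x \<le> y" "y < b" shows "tail a b x \<le> tail a b y"
proof -
  have "(b - a) / (b - x) \<le> (b - a) / (b - y)" using assms by (intro divide_left_mono mult_pos_pos) auto
  then show ?thesis using assms by (auto simp: tail_def)
qed

lemma M_plus_indicator_le:
  assumes "a < b" shows "M_plus (indicator {a<..<b}) x \<le> ennreal (tail a b x)"
  unfolding M_plus_def
proof (rule SUP_least)
  fix h :: real assume "h \<in> {0<..}"
  then have h: "h > 0" by simp
  have "(\<integral>\<^sup>+y\<in>{x..x + h}. ennreal \<bar>indicator {a<..<b} y\<bar> \<partial>lebesgue) = (\<integral>\<^sup>+y. indicator ({x..x+h} \<inter> {a<..<b}) y \<partial>lebesgue)"
    by (intro nn_integral_cong) (auto split: split_indicator)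
  also have "\<dots> = emeasure lborel ({x..x+h} \<inter> {a<..<b})" by (subst nn_integral_indicator) auto
  also have "\<dots> \<le> ennreal (h * tail a b x)"
  proof -
    consider "b \<le> x \<or> x + h \<le> a" | "x < b" "a \<le> x" | "x < a" "a < x + h" "h \<le> b - x" | "x < a" "b - x < h" by linarith
    then show ?thesis
    proof cases
      case 1
      then have "{x..x+h} \<inter> {a<..<b} = {}" by auto
      then show ?thesis by simp
    next
      case 2
      have "emeasure lborel ({x..x+h} \<inter> {a<..<b}) \<le> emeasure lborel {x..x+h}" by (rule emeasure_mono) auto
      then show ?thesis using h 2 by (simp add: tail_eq_1)
    next
      case 3
      have "emeasure lborel ({x..x+h} \<inter> {a<..<b}) \<le> emeasure lborel {a..x+h}" by (rule emeasure_mono) auto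
      also have "\<dots> = ennreal (x + h - a)" using 3 by simp
      also have "\<dots> \<le> ennreal (h * tail a b x)"
      proof (rule ennreal_leI)
        have "h * (a - x) \<le> (b - x) * (a - x)" using 3 by (intro mult_right_mono) auto
        then have "(x + h - a) * (b - x) \<le> h * (b - a)" by (simp add: algebra_simps)
        then have "x + h - a \<le> h * ((b - a) / (b - x))" using 3 assms by (simp add: pos_le_divide_eq)
        then show "x + h - a \<le> h * tail a b x" using 3 assms by (auto simp: tail_def min_def)
      qed
      finally show ?thesis .
    next
      case 4
      have "emeasure lborel ({x..x+h} \<inter> {a<..<b}) \<le> emeasure lborel {a..b}" by (rule emeasure_mono) auto
      also have "\<dots> = ennreal (b - a)" using assms by simp
      also have "\<dots> \<le> ennreal (h * tail a b x)"
      proof (rule ennreal_leI)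
        have "(b - x) * ((b - a) / (b - x)) \<le> h * ((b - a) / (b - x))" using 4 assms by (intro mult_right_mono) auto
        then have "b - a \<le> h * ((b - a) / (b - x))" using 4 assms by simp
        moreover have "(b - a) / (b - x) \<le> 1" using 4 assms by simp
        ultimately show "b - a \<le> h * tail a b x" using 4 assms by (simp add: tail_def min_def)
      qed
      finally show ?thesis .
    qed
  qed
  finally have "ennreal (1 / h) * (\<integral>\<^sup>+y\<in>{x..x + h}. ennreal \<bar>indicator {a<..<b} y\<bar> \<partial>lebesgue) \<le> ennreal (1 / h) * ennreal (h * tail a b x)"
    by (rule mult_left_mono) simp
  also have "\<dots> = ennreal (tail a b x)" using h assms by (subst ennreal_mult[symmetric]) (auto simp: tail_nonneg)
  finally show "ennreal (1 / h) * (\<integral>\<^sup>+y\<in>{x..x + h}. ennreal \<bar>indicator {a<..<b} y\<bar> \<partial>lebesgue) \<le> ennreal (tail a b x)" .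
qed

text \<open>Intervals are handled as sets, and their end points are read off as infimum and
  supremum; a family of intervals is then a set of sets, like the set of components of an
  open set.\<close>
definition oivl :: "real set \<Rightarrow> bool" where
  "oivl J \<longleftrightarrow> J = {Inf J<..<Sup J} \<and> Inf J < Sup J"

lemma oivl_open: "oivl J \<Longrightarrow> open J" unfolding oivl_def by (metis open_greaterThanLessThan)

lemma oivl_mem: "oivl J \<Longrightarrow> x \<in> J \<longleftrightarrow> Inf J < x \<and> x < Sup J"
  unfolding oivl_def by (metis greaterThanLessThan_iff)

lemma oivl_emeasure: "oivl J \<Longrightarrow> emeasure lborel J = ennreal (Sup J - Inf J)"
  unfolding oivl_def by (metis emeasure_lborel_Ioo less_imp_le)

lemma oivl_components: "open U \<Longrightarrow> bounded U \<Longrightarrow> J \<in> components U \<Longrightarrow> oivl J"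
  unfolding oivl_def using open_component_interval by blast

lemma oivl_Ioo: "a < b \<Longrightarrow> oivl {a<..<b}" by (simp add: oivl_def)

text \<open>A one-sided Marcinkiewicz function of the family. It can be unbounded, but it exceeds
  large values only on sets of exponentially small measure.\<close>
definition tail_sum :: "real \<Rightarrow> real set set \<Rightarrow> real \<Rightarrow> ennreal" where
  "tail_sum r \<J> x = (\<integral>\<^sup>+J. ennreal (tail (Inf J) (Sup J) x powr r) \<partial>count_space \<J>)"

lemma tail_liminf:
  assumes "X \<longlonglongrightarrow> x" "a < b" "r > 0"
  shows "ennreal (tail a b x powr r) \<le> liminf (\<lambda>i. ennreal (tail a b (X i) powr r))"
proof (cases "x < b")
  case True
  have "eventually (\<lambda>i. X i < b) sequentially" using assms(1) True order_tendstoD(2) by blast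
  then have ev: "eventually (\<lambda>i. min 1 ((b - a) / (b - X i)) = tail a b (X i)) sequentially"
    by eventually_elim (simp add: tail_def)
  have "(\<lambda>i. min 1 ((b - a) / (b - X i))) \<longlonglongrightarrow> min 1 ((b - a) / (b - x))"
    using True assms(1) by (intro tendsto_min tendsto_divide tendsto_diff tendsto_const) auto
  then have "(\<lambda>i. tail a b (X i)) \<longlonglongrightarrow> tail a b x"
    using True Lim_transform_eventually[OF _ ev] by (simp add: tail_def)
  moreover have "tail a b x \<noteq> 0" using True assms(2) by (simp add: tail_def min_def)
  ultimately have "(\<lambda>i. ennreal (tail a b (X i) powr r)) \<longlonglongrightarrow> ennreal (tail a b x powr r)"
    by (intro tendsto_ennrealI tendsto_powr tendsto_const) auto
  then have "liminf (\<lambda>i. ennreal (tail a b (X i) powr r)) = ennreal (tail a b x powr r)"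
    by (rule lim_imp_Liminf[OF sequentially_bot])
  then show ?thesis by simp
qed (simp add: tail_def)

lemma open_tail_sum:
  assumes "\<And>J. J \<in> \<J> \<Longrightarrow> oivl J" "r > 0" shows "open {x. c < tail_sum r \<J> x}"
proof (rule open_superlevel_of_liminf)
  fix X :: "nat \<Rightarrow> real" and x assume X: "X \<longlonglongrightarrow> x"
  have "tail_sum r \<J> x \<le> (\<integral>\<^sup>+J. liminf (\<lambda>i. ennreal (tail (Inf J) (Sup J) (X i) powr r)) \<partial>count_space \<J>)"
    unfolding tail_sum_def using assms by (intro nn_integral_mono tail_liminf X) (auto simp: oivl_def)
  also have "\<dots> \<le> liminf (\<lambda>i. tail_sum r \<J> (X i))"
    unfolding tail_sum_def by (rule nn_integral_liminf) auto
  finally show "tail_sum r \<J> x \<le> liminf (\<lambda>i. tail_sum r \<J> (X i))" .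
qed

lemma measurable_tail_sum:
  assumes "\<And>J. J \<in> \<J> \<Longrightarrow> oivl J" "r > 0" shows "tail_sum r \<J> \<in> borel_measurable borel"
  by (rule borel_measurableI_greater) (simp add: open_tail_sum[OF assms])

text \<open>Over \<open>(a, b)\<close> a tail costs at most \<open>r / (r - 1)\<close> times the part of the interval inside
  \<open>(a, b)\<close>: either the interval begins to the left of \<open>a\<close>, where the tail is \<open>1\<close> up to its
  right end and \<open>0\<close> beyond, or it is contained in \<open>(a, b)\<close>.\<close>
lemma nn_integral_tail_le:
  assumes "c < e" "e \<le> b" "a < b" "r > 1"
  shows "(\<integral>\<^sup>+x. ennreal (tail c e x powr r) * indicator {a<..<b} x \<partial>lborel) \<le> ennreal (r / (r - 1)) * emeasure lborel ({c<..<e} \<inter> {a<..<b})"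
proof -
  have r1: "1 \<le> ennreal (r / (r - 1))" using assms(4) by simp
  have p1: "tail c e x powr r \<le> 1" for x
    using tail_le_1[of c e x] tail_nonneg[OF assms(1), of x] assms(4) by (intro powr_le1) auto
  consider "e \<le> a" | "c < a" "a < e" | "a \<le> c" by linarith
  then show ?thesis
  proof cases
    case 1
    then have "(\<integral>\<^sup>+x. ennreal (tail c e x powr r) * indicator {a<..<b} x \<partial>lborel) = (\<integral>\<^sup>+x. 0 \<partial>(lborel::real measure))"
      by (intro nn_integral_cong) (auto simp: tail_def split: split_indicator)
    then show ?thesis by simp
  next
    case 2
    have "(\<integral>\<^sup>+x. ennreal (tail c e x powr r) * indicator {a<..<b} x \<partial>lborel) \<le> (\<integral>\<^sup>+x. indicator ({c<..<e} \<inter> {a<..<b}) x \<partial>lborel)"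
    proof (rule nn_integral_mono)
      fix x show "ennreal (tail c e x powr r) * indicator {a<..<b} x \<le> indicator ({c<..<e} \<inter> {a<..<b}) x"
        using p1[of x] 2 by (cases "x < e") (auto simp: tail_def split: split_indicator)
    qed
    also have "\<dots> = 1 * emeasure lborel ({c<..<e} \<inter> {a<..<b})" by simp
    also have "\<dots> \<le> ennreal (r / (r - 1)) * emeasure lborel ({c<..<e} \<inter> {a<..<b})" by (intro mult_right_mono r1) simp
    finally show ?thesis .
  next
    case 3
    define l where "l = e - c"
    have l: "l > 0" using assms(1) by (simp add: l_def)
    have "(\<integral>\<^sup>+x. ennreal (tail c e x powr r) * indicator {a<..<b} x \<partial>lborel) \<le> (\<integral>\<^sup>+x. indicator {c..e} x + ennreal ((l / (e - x)) powr r) * indicator {l..} (e - x) \<partial>lborel)"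
    proof (rule nn_integral_mono)
      fix x
      show "ennreal (tail c e x powr r) * indicator {a<..<b} x \<le> indicator {c..e} x + ennreal ((l / (e - x)) powr r) * indicator {l..} (e - x)"
      proof (cases "x < e")
        case True
        show ?thesis
        proof (cases "c \<le> x")
          case True
          then show ?thesis using \<open>x < e\<close> p1[of x] by (auto simp: tail_eq_1 split: split_indicator)
        next
          case False
          then have "tail c e x powr r \<le> (l / (e - x)) powr r"
            using \<open>x < e\<close> tail_nonneg[OF assms(1), of x] assms(4) unfolding l_def by (intro powr_mono2 tail_le_quot) auto
          moreover have "l \<le> e - x" using False by (simp add: l_def)
          ultimately show ?thesis using False by (auto intro!: ennreal_leI split: split_indicator)
        qed
      qed (use assms(4) in \<open>simp add: tail_def\<close>)
    qed
    also have "\<dots> = ennreal l + (\<integral>\<^sup>+x. ennreal ((l / (e - x)) powr r) * indicator {l..} (e - x) \<partial>lborel)"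
      using assms(1) by (subst nn_integral_add) (auto simp: l_def)
    also have "(\<integral>\<^sup>+x. ennreal ((l / (e - x)) powr r) * indicator {l..} (e - x) \<partial>lborel) = (\<integral>\<^sup>+x. ennreal ((l / x) powr r) * indicator {l..} x \<partial>lborel)"
      by (rule nn_integral_reflect[where g="\<lambda>x. ennreal ((l / x) powr r) * indicator {l..} x"]) measurable
    also have "\<dots> = ennreal (l / (r - 1))" by (rule nn_integral_power_tail[OF l assms(4)])
    also have "ennreal l + ennreal (l / (r - 1)) = ennreal (r / (r - 1) * l)"
    proof -
      have "l + l / (r - 1) = r / (r - 1) * l" using assms(4) by (simp add: field_simps)
      then show ?thesis using l assms(4) by (simp add: ennreal_plus[symmetric] del: ennreal_plus)
    qed
    also have "\<dots> = ennreal (r / (r - 1)) * ennreal l" using l assms(4) by (intro ennreal_mult) auto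
    also have "{c<..<e} \<inter> {a<..<b} = {c<..<e}" using 3 assms by auto
    then have "ennreal l = emeasure lborel ({c<..<e} \<inter> {a<..<b})" using assms(1) by (simp add: l_def)
    finally show ?thesis .
  qed
qed

section \<open>Exponential integrability of a sum of tails\<close>

locale ivl_family =
  fixes \<J> :: "real set set" and r :: real
  assumes ivl: "\<And>J. J \<in> \<J> \<Longrightarrow> oivl J" and dis: "disjoint \<J>" and r1: "r > 1"
begin

lemma cnt: "countable \<J>"
  by (rule countable_disjoint_open_subsets[OF _ dis]) (rule oivl_open[OF ivl])

lemma borelJ: "J \<in> \<J> \<Longrightarrow> J \<in> sets borel"
  by (rule borel_open[OF oivl_open[OF ivl]])

lemma subfamily: "\<K> \<subseteq> \<J> \<Longrightarrow> ivl_family \<K> r"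
  using ivl dis r1 unfolding ivl_family_def by (auto intro: pairwise_subset)

lemma sum_emeasure_Int_le:
  assumes "B \<in> sets borel"
  shows "(\<integral>\<^sup>+J. emeasure lborel (J \<inter> B) \<partial>count_space \<J>) = emeasure lborel (\<Union>\<J> \<inter> B)"
proof -
  have "emeasure lborel (\<Union>J\<in>\<J>. J \<inter> B) = (\<integral>\<^sup>+J. emeasure lborel (J \<inter> B) \<partial>count_space \<J>)"
    using cnt borelJ assms dis
    by (intro emeasure_UN_countable) (auto simp: disjoint_family_on_def pairwise_def disjnt_def)
  moreover have "(\<Union>J\<in>\<J>. J \<inter> B) = \<Union>\<J> \<inter> B" by auto
  ultimately show ?thesis by simp
qed

lemma nn_integral_tail_sum_le:
  assumes "\<And>J. J \<in> \<J> \<Longrightarrow> Sup J \<le> b" "a < b"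
  shows "(\<integral>\<^sup>+x. tail_sum r \<J> x * indicator {a<..<b} x \<partial>lborel) \<le> ennreal (r / (r - 1)) * ennreal (b - a)"
proof -
  have "(\<integral>\<^sup>+x. tail_sum r \<J> x * indicator {a<..<b} x \<partial>lborel)
     = (\<integral>\<^sup>+x. \<integral>\<^sup>+J. ennreal (tail (Inf J) (Sup J) x powr r) * indicator {a<..<b} x \<partial>count_space \<J> \<partial>lborel)"
    unfolding tail_sum_def by (intro nn_integral_cong nn_integral_multc[symmetric]) auto
  also have "\<dots> = (\<integral>\<^sup>+J. \<integral>\<^sup>+x. ennreal (tail (Inf J) (Sup J) x powr r) * indicator {a<..<b} x \<partial>lborel \<partial>count_space \<J>)"
    by (rule nn_integral_count_space_nn_integral[OF cnt]) measurable
  also have "\<dots> \<le> (\<integral>\<^sup>+J. ennreal (r / (r - 1)) * emeasure lborel (J \<inter> {a<..<b}) \<partial>count_space \<J>)"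
  proof (rule nn_integral_mono)
    fix J assume "J \<in> space (count_space \<J>)"
    then have J: "J \<in> \<J>" "J = {Inf J<..<Sup J}" "Inf J < Sup J" using ivl by (auto simp: oivl_def)
    show "(\<integral>\<^sup>+x. ennreal (tail (Inf J) (Sup J) x powr r) * indicator {a<..<b} x \<partial>lborel) \<le> ennreal (r / (r - 1)) * emeasure lborel (J \<inter> {a<..<b})"
      using nn_integral_tail_le[OF J(3) assms(1)[OF J(1)] assms(2) r1] J(2) by simp
  qed
  also have "\<dots> = ennreal (r / (r - 1)) * emeasure lborel (\<Union>\<J> \<inter> {a<..<b})"
    by (simp add: nn_integral_cmult sum_emeasure_Int_le)
  also have "\<dots> \<le> ennreal (r / (r - 1)) * emeasure lborel {a<..<b}"
    by (intro mult_left_mono emeasure_mono) auto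
  finally show ?thesis using assms(2) by simp
qed

text \<open>The tail of an interval which ends beyond \<open>b\<close> increases up to \<open>b\<close>.\<close>
lemma tail_sum_split:
  assumes "x \<le> b"
  shows "tail_sum r \<J> x \<le> tail_sum r {J \<in> \<J>. Sup J \<le> b} x + tail_sum r \<J> b"
proof -
  have "tail_sum r \<J> x \<le> (\<integral>\<^sup>+J. ennreal (tail (Inf J) (Sup J) x powr r) * indicator {J. Sup J \<le> b} J + ennreal (tail (Inf J) (Sup J) b powr r) \<partial>count_space \<J>)"
    unfolding tail_sum_def
  proof (rule nn_integral_mono)
    fix J assume "J \<in> space (count_space \<J>)"
    then have J: "Inf J < Sup J" using ivl by (auto simp: oivl_def)
    show "ennreal (tail (Inf J) (Sup J) x powr r) \<le> ennreal (tail (Inf J) (Sup J) x powr r) * indicator {J. Sup J \<le> b} J + ennreal (tail (Inf J) (Sup J) b powr r)"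
    proof (cases "Sup J \<le> b")
      case False
      then have "tail (Inf J) (Sup J) x powr r \<le> tail (Inf J) (Sup J) b powr r"
        using r1 tail_nonneg[OF J] assms J by (intro powr_mono2 tail_mono) auto
      then show ?thesis using False by (simp add: ennreal_leI)
    qed simp
  qed
  also have "\<dots> = (\<integral>\<^sup>+J. ennreal (tail (Inf J) (Sup J) x powr r) * indicator {J. Sup J \<le> b} J \<partial>count_space \<J>) + tail_sum r \<J> b"
    unfolding tail_sum_def by (rule nn_integral_add) auto
  also have "(\<integral>\<^sup>+J. ennreal (tail (Inf J) (Sup J) x powr r) * indicator {J. Sup J \<le> b} J \<partial>count_space \<J>) = tail_sum r {J \<in> \<J>. Sup J \<le> b} x"
    unfolding tail_sum_def
    by (subst nn_integral_count_space_indicator[of "{J \<in> \<J>. Sup J \<le> b}"], simp, subst nn_integral_count_space_indicator, simp)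
       (auto intro!: nn_integral_cong split: split_indicator)
  finally show ?thesis .
qed

definition A where "A = 2 * r / (r - 1)"

lemma A_pos: "A > 0" using r1 by (simp add: A_def)

text \<open>A stopping argument. On a component \<open>(a, b)\<close> of the set where the sum exceeds \<open>n A\<close>,
  the intervals ending beyond \<open>b\<close> contribute at most the value at \<open>b\<close>, and \<open>b\<close> is outside
  the set or equal to \<open>\<beta>\<close>, so this is at most \<open>n A\<close>. The remaining intervals contribute an
  integral of at most \<open>A / 2 * (b - a)\<close> over \<open>(a, b)\<close>, so that their sum exceeds \<open>A\<close> on at
  most half of \<open>(a, b)\<close>.\<close>
theorem tail_sum_decay:
  assumes "\<And>J. J \<in> \<J> \<Longrightarrow> Sup J \<le> \<beta>" "\<alpha> < \<beta>"
  shows "emeasure lborel {x \<in> {\<alpha><..<\<beta>}. ennreal (real n * A) < tail_sum r \<J> x} \<le> ennreal ((\<beta> - \<alpha>) / 2 ^ n)"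
proof (induction n)
  case 0
  have "emeasure lborel {x \<in> {\<alpha><..<\<beta>}. ennreal (real 0 * A) < tail_sum r \<J> x} \<le> emeasure lborel {\<alpha><..<\<beta>}"
    by (rule emeasure_mono) auto
  then show ?case using assms(2) by simp
next
  case (Suc n)
  have [measurable]: "tail_sum r \<J> \<in> borel_measurable borel" using measurable_tail_sum[OF ivl] r1 by auto
  define V where "V = {x \<in> {\<alpha><..<\<beta>}. ennreal (real n * A) < tail_sum r \<J> x}"
  define V' where "V' = {x \<in> {\<alpha><..<\<beta>}. ennreal (real (Suc n) * A) < tail_sum r \<J> x}"
  have V_eq: "V = {\<alpha><..<\<beta>} \<inter> {x. ennreal (real n * A) < tail_sum r \<J> x}" unfolding V_def by auto
  have oV: "open V" unfolding V_eq using ivl r1 by (intro open_Int open_tail_sum) auto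
  have bV: "bounded V" by (rule bounded_subset[OF bounded_Ioo[of \<alpha> \<beta>]]) (auto simp: V_def)
  have mV': "V' \<in> sets borel" unfolding V'_def by measurable
  have "ennreal (real n * A) \<le> ennreal (real (Suc n) * A)" using A_pos by (intro ennreal_leI mult_right_mono) auto
  then have sub: "V' \<subseteq> V" unfolding V_def V'_def by (auto intro: le_less_trans)
  have "emeasure lborel V' = (\<integral>\<^sup>+J. emeasure lborel (V' \<inter> J) \<partial>count_space (components V))"
    by (rule emeasure_Int_components[OF oV _ _ sub]) (use mV' in auto)
  also have "\<dots> \<le> (\<integral>\<^sup>+J. ennreal (1/2) * emeasure lborel J \<partial>count_space (components V))"
  proof (rule nn_integral_mono)
    fix J assume "J \<in> space (count_space (components V))"
    then have J: "J \<in> components V" by simp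
    note JI = open_component_interval[OF oV bV J]
    have JV: "J \<subseteq> V" by (rule in_components_subset[OF J])
    define a b where "a = Inf J" and "b = Sup J"
    have ab: "a < b" "J = {a<..<b}" using JI by (auto simp: a_def b_def)
    have bnd: "b \<le> \<beta>" "\<alpha> \<le> a"
    proof -
      have "{a<..<b} \<subseteq> {\<alpha><..<\<beta>}" using JV unfolding ab(2)[symmetric] V_def by auto
      then show "b \<le> \<beta>" "\<alpha> \<le> a" using ab(1) by (auto simp: greaterThanLessThan_subseteq_greaterThanLessThan)
    qed
    have tb: "tail_sum r \<J> b \<le> ennreal (real n * A)"
    proof (cases "b < \<beta>")
      case True
      then show ?thesis using JI(4) bnd ab(1) unfolding b_def[symmetric] V_def by auto
    next
      case False
      have "tail_sum r \<J> b = (\<integral>\<^sup>+J. 0 \<partial>count_space \<J>)"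
        unfolding tail_sum_def using False assms(1) by (intro nn_integral_cong) (force simp: tail_def)
      then show ?thesis by simp
    qed
    let ?\<psi> = "tail_sum r {J \<in> \<J>. Sup J \<le> b}"
    interpret sub: ivl_family "{J \<in> \<J>. Sup J \<le> b}" r by (rule subfamily) auto
    have [measurable]: "?\<psi> \<in> borel_measurable borel" using measurable_tail_sum[OF sub.ivl] r1 by auto
    have "ennreal A * emeasure lborel (V' \<inter> J) = (\<integral>\<^sup>+x. ennreal A * indicator (V' \<inter> J) x \<partial>lborel)"
      using mV' ab(2) by (simp add: nn_integral_cmult_indicator)
    also have "\<dots> \<le> (\<integral>\<^sup>+x. ?\<psi> x * indicator {a<..<b} x \<partial>lborel)"
    proof (rule nn_integral_mono)
      fix x show "ennreal A * indicator (V' \<inter> J) x \<le> ?\<psi> x * indicator {a<..<b} x"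
      proof (cases "x \<in> V' \<inter> J")
        case True
        then have x: "x \<le> b" "ennreal (real (Suc n) * A) < tail_sum r \<J> x" using ab(2) by (auto simp: V'_def)
        have "tail_sum r \<J> x \<le> ?\<psi> x + ennreal (real n * A)"
          using tail_sum_split[OF x(1)] tb by (meson add_left_mono order_trans)
        then have "ennreal (real (Suc n) * A) < ?\<psi> x + ennreal (real n * A)" using x(2) by simp
        moreover have "ennreal (real (Suc n) * A) = ennreal A + ennreal (real n * A)"
          using A_pos by (simp add: ennreal_plus[symmetric] algebra_simps del: ennreal_plus)
        ultimately have lt: "ennreal A + ennreal (real n * A) < ?\<psi> x + ennreal (real n * A)" by simp
        have "ennreal A \<le> ?\<psi> x"
        proof (rule ccontr)
          assume "\<not> ennreal A \<le> ?\<psi> x"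
          then have "?\<psi> x + ennreal (real n * A) \<le> ennreal A + ennreal (real n * A)" by (intro add_right_mono) simp
          then show False using lt by simp
        qed
        then show ?thesis using True ab(2) by simp
      qed simp
    qed
    also have "\<dots> \<le> ennreal (r / (r - 1)) * ennreal (b - a)" by (rule sub.nn_integral_tail_sum_le) (use ab in auto)
    finally have "ennreal (1 / A) * (ennreal A * emeasure lborel (V' \<inter> J)) \<le> ennreal (1 / A) * (ennreal (r / (r - 1)) * ennreal (b - a))"
      by (rule mult_left_mono) simp
    moreover have "ennreal (1 / A) * (ennreal A * emeasure lborel (V' \<inter> J)) = emeasure lborel (V' \<inter> J)"
      using A_pos by (simp add: mult.assoc[symmetric] ennreal_mult[symmetric])
    moreover have "ennreal (1 / A) * ennreal (r / (r - 1)) = ennreal (1/2)"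
    proof -
      have "1 / A * (r / (r - 1)) = 1 / 2" using r1 by (simp add: A_def field_simps)
      moreover have "ennreal (1 / A) * ennreal (r / (r - 1)) = ennreal (1 / A * (r / (r - 1)))"
        using r1 A_pos by (intro ennreal_mult[symmetric]) auto
      ultimately show ?thesis by (simp only:)
    qed
    ultimately show "emeasure lborel (V' \<inter> J) \<le> ennreal (1/2) * emeasure lborel J"
      using ab by (simp add: mult.assoc[symmetric])
  qed
  also have "\<dots> = ennreal (1/2) * emeasure lborel V"
    by (subst emeasure_components[OF oV]) (auto simp: nn_integral_cmult)
  also have "\<dots> \<le> ennreal (1/2) * ennreal ((\<beta> - \<alpha>) / 2 ^ n)"
    using Suc by (intro mult_left_mono) (auto simp: V_def)
  also have "\<dots> = ennreal ((\<beta> - \<alpha>) / 2 ^ Suc n)" using assms(2) by (subst ennreal_mult[symmetric]) auto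
  finally show ?case by (simp add: V'_def)
qed

end

section \<open>Tails of families to the left of their hull\<close>

context ivl_family begin

text \<open>The family is contained in \<open>(a, b)\<close> and has density at most \<open>\<eta>\<close> in each initial piece
  of \<open>(a, b)\<close>. To the left of \<open>a\<close> its tails then add up to much less than the tail of
  \<open>(a, b)\<close>, by a factor of order \<open>\<eta>\<^sup>r\<close> up to a logarithmic loss near \<open>a\<close>.\<close>
context
  fixes a b \<eta> :: real
  assumes ab: "a < b" and sub: "\<And>J. J \<in> \<J> \<Longrightarrow> J \<subseteq> {a<..<b}" and \<eta>0: "\<eta> \<ge> 0"
    and dens: "\<And>l. l > 0 \<Longrightarrow> emeasure lborel (\<Union>\<J> \<inter> {a<..<a + l}) \<le> ennreal (\<eta> * l)"
begin

lemma sub_bounds: assumes "J \<in> \<J>" shows "a \<le> Inf J" "Inf J < Sup J" "Sup J \<le> b" "J = {Inf J<..<Sup J}"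
proof -
  show J: "J = {Inf J<..<Sup J}" "Inf J < Sup J" using ivl[OF assms] by (auto simp: oivl_def)
  have "{Inf J<..<Sup J} \<subseteq> {a<..<b}" using sub[OF assms] J(1) by metis
  then show "a \<le> Inf J" "Sup J \<le> b" using J(2) by (auto simp: greaterThanLessThan_subseteq_greaterThanLessThan)
qed

lemma length_le: assumes "J \<in> \<J>" shows "Sup J - Inf J \<le> \<eta> * (Sup J - a)"
proof -
  note J = sub_bounds[OF assms]
  have "ennreal (Sup J - Inf J) = emeasure lborel J" using oivl_emeasure[OF ivl[OF assms]] by simp
  also have "\<dots> \<le> emeasure lborel (\<Union>\<J> \<inter> {a<..<a + (Sup J - a)})"
  proof (rule emeasure_mono)
    have "J \<subseteq> {a<..<Sup J}" by (subst J(4)) (use J(1) in auto)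
    then show "J \<subseteq> \<Union>\<J> \<inter> {a<..<a + (Sup J - a)}" using assms by auto
    show "\<Union>\<J> \<inter> {a<..<a + (Sup J - a)} \<in> sets lborel"
      using ivl oivl_open by (auto intro!: borel_open open_Int open_Union)
  qed
  also have "\<dots> \<le> ennreal (\<eta> * (Sup J - a))" by (rule dens) (use J in auto)
  finally show ?thesis using J \<eta>0 by (subst (asm) ennreal_le_iff) auto
qed

lemma sum_length_le: "(\<integral>\<^sup>+J. ennreal (Sup J - Inf J) \<partial>count_space \<J>) \<le> ennreal (\<eta> * (b - a))"
proof -
  have "(\<integral>\<^sup>+J. ennreal (Sup J - Inf J) \<partial>count_space \<J>) = (\<integral>\<^sup>+J. emeasure lborel (J \<inter> {a<..<a + (b - a)}) \<partial>count_space \<J>)"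
  proof (rule nn_integral_cong)
    fix J assume "J \<in> space (count_space \<J>)"
    then have J: "J \<in> \<J>" by simp
    have "J \<inter> {a<..<a + (b - a)} = J" using sub[OF J] by auto
    then show "ennreal (Sup J - Inf J) = emeasure lborel (J \<inter> {a<..<a + (b - a)})" using oivl_emeasure[OF ivl[OF J]] by simp
  qed
  also have "\<dots> = emeasure lborel (\<Union>\<J> \<inter> {a<..<a + (b - a)})" by (rule sum_emeasure_Int_le) simp
  also have "\<dots> \<le> ennreal (\<eta> * (b - a))" by (rule dens) (use ab in simp)
  finally show ?thesis .
qed

text \<open>Of the \<open>r\<close> factors \<open>\<bar>J\<bar> / (Sup J - x)\<close>, the first stays in order to be summed over the
  family, and the others yield the gain.\<close>
lemma tail_powr_le:
  assumes J: "J \<in> \<J>" and x: "x < a" and q: "(Sup J - Inf J) / (Sup J - x) \<le> \<beta>"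
  shows "tail (Inf J) (Sup J) x powr r \<le> \<beta> powr (r - 1) * ((Sup J - Inf J) / (Sup J - x))"
proof -
  note Jb = sub_bounds[OF J]
  define z where "z = (Sup J - Inf J) / (Sup J - x)"
  have z: "z > 0" "z \<le> \<beta>" using Jb x q by (auto simp: z_def)
  have "tail (Inf J) (Sup J) x powr r \<le> z powr r"
    unfolding z_def using Jb x r1 by (intro powr_mono2 tail_le_quot tail_nonneg) auto
  also have "\<dots> = z powr (r - 1) * z" using z powr_mult_base[of z "r - 1"] by (simp add: mult.commute)
  also have "\<dots> \<le> \<beta> powr (r - 1) * z" using z r1 by (intro mult_right_mono powr_mono2) auto
  finally show ?thesis by (simp add: z_def)
qed

text \<open>From far away the family looks like a single interval of length \<open>\<eta> (b - a)\<close>.\<close>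
lemma tail_sum_far_left:
  assumes x: "x \<le> a - (b - a)"
  shows "tail_sum r \<J> x \<le> ennreal ((2 * \<eta>) powr r) * ennreal (tail a b x powr r)"
proof -
  define d where "d = a - x"
  have d: "d > 0" "d \<ge> b - a" "x < a" using x ab by (auto simp: d_def)
  define \<beta> where "\<beta> = \<eta> * (b - a) / d"
  have \<beta>0: "\<beta> \<ge> 0" using \<eta>0 ab d by (simp add: \<beta>_def)
  have "tail_sum r \<J> x \<le> (\<integral>\<^sup>+J. ennreal (\<beta> powr (r - 1) / d) * ennreal (Sup J - Inf J) \<partial>count_space \<J>)"
    unfolding tail_sum_def
  proof (rule nn_integral_mono)
    fix J assume "J \<in> space (count_space \<J>)"
    then have J: "J \<in> \<J>" by simp
    note Jb = sub_bounds[OF J]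
    have q: "(Sup J - Inf J) / (Sup J - x) \<le> (Sup J - Inf J) / d"
      using Jb d by (intro divide_left_mono mult_pos_pos) (auto simp: d_def)
    also have "\<dots> \<le> \<eta> * (b - a) / d"
    proof (intro divide_right_mono)
      have "\<eta> * (Sup J - a) \<le> \<eta> * (b - a)" using Jb \<eta>0 by (intro mult_left_mono) auto
      then show "Sup J - Inf J \<le> \<eta> * (b - a)" using length_le[OF J] by simp
    qed (use d in simp)
    finally have "tail (Inf J) (Sup J) x powr r \<le> \<beta> powr (r - 1) * ((Sup J - Inf J) / (Sup J - x))"
      unfolding \<beta>_def by (rule tail_powr_le[OF J d(3)])
    also have "\<dots> \<le> \<beta> powr (r - 1) * ((Sup J - Inf J) / d)" using q by (intro mult_left_mono) auto
    finally have "tail (Inf J) (Sup J) x powr r \<le> (\<beta> powr (r - 1) / d) * (Sup J - Inf J)" by simp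
    then show "ennreal (tail (Inf J) (Sup J) x powr r) \<le> ennreal (\<beta> powr (r - 1) / d) * ennreal (Sup J - Inf J)"
      using Jb d by (subst ennreal_mult[symmetric]) (auto intro: ennreal_leI)
  qed
  also have "\<dots> \<le> ennreal (\<beta> powr (r - 1) / d) * ennreal (\<eta> * (b - a))"
    by (simp add: nn_integral_cmult mult_left_mono sum_length_le)
  also have "\<dots> = ennreal (\<beta> powr (r - 1) * \<beta>)"
    using \<eta>0 ab d by (subst ennreal_mult[symmetric]) (auto simp: \<beta>_def)
  also have "\<beta> powr (r - 1) * \<beta> = \<beta> powr r" using \<beta>0 r1 powr_mult_base[of \<beta> "r - 1"] by (simp add: mult.commute)
  also have "\<dots> \<le> (2 * \<eta> * tail a b x) powr r"
  proof (rule powr_mono2)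
    have t: "tail a b x = (b - a) / (b - x)" using d ab by (auto simp: tail_def min_def)
    have "(b - a) / d \<le> 2 * ((b - a) / (b - x))"
    proof -
      have "b - x \<le> 2 * d" using d by (simp add: d_def)
      then have "(b - a) * (b - x) \<le> (b - a) * (2 * d)" using ab by (intro mult_left_mono) auto
      then show ?thesis using d ab by (simp add: field_simps)
    qed
    then have "\<eta> * ((b - a) / d) \<le> \<eta> * (2 * ((b - a) / (b - x)))" using \<eta>0 by (rule mult_left_mono)
    moreover have "\<beta> = \<eta> * ((b - a) / d)" by (simp add: \<beta>_def)
    moreover have "2 * \<eta> * tail a b x = \<eta> * (2 * ((b - a) / (b - x)))" unfolding t by (simp only: mult_ac)
    ultimately show "\<beta> \<le> 2 * \<eta> * tail a b x" by simp
  qed (use \<beta>0 r1 in auto)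
  also have "\<dots> = (2 * \<eta>) powr r * tail a b x powr r" using \<eta>0 tail_nonneg[OF ab] by (simp add: powr_mult)
  finally show ?thesis by (simp add: ennreal_mult ennreal_leI)
qed

text \<open>At distance \<open>d\<close> to the left of \<open>a\<close>, the function \<open>1 / (y - x)\<close> on \<open>(a, b)\<close> is
  dominated by a sum of steps of height \<open>1 / (2\<^sup>j d)\<close> on \<open>(a, a + 2\<^sup>j\<^sup>+\<^sup>1 d)\<close>, and the
  density bound makes each of them contribute at most \<open>2 \<eta>\<close>. The sum of indicator functions
  counts the \<open>j\<close> with \<open>2\<^sup>j d \<le> b - a\<close>, so there is a logarithmic loss as \<open>x\<close> approaches
  \<open>a\<close>.\<close>
lemma tail_sum_near_left:
  assumes x: "a - (b - a) \<le> x" "x < a"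
  shows "tail_sum r \<J> x \<le> ennreal (2 * \<eta> powr r) * (\<Sum>j. indicator {a - (b - a) / 2 ^ j..<a} x)"
proof -
  define d where "d = a - x"
  have d: "d > 0" "d \<le> b - a" using x by (auto simp: d_def)
  define k where "k j = (if 2 ^ j * d \<le> b - a then 1 / (2 ^ j * d) else 0)" for j :: nat
  have k0: "k j \<ge> 0" for j using d by (simp add: k_def)
  let ?X = "\<Union>\<J>"
  have X: "?X \<in> sets borel" using ivl oivl_open by (auto intro!: borel_open open_Union)
  have cover: "ennreal (1 / (y - x)) \<le> (\<Sum>j. ennreal (k j) * indicator {a<..<a + 2 ^ (j + 1) * d} y)" if y: "a < y" "y < b" for y
  proof -
    have ex: "\<exists>j. y - a < 2 ^ (j + 1) * d"
    proof -
      obtain j where "(y - a) / d < 2 ^ j" using real_arch_pow[of 2 "(y - a) / d"] by auto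
      then have "y - a < 2 ^ j * d" using d by (simp add: pos_divide_less_eq)
      also have "\<dots> \<le> 2 ^ (j + 1) * d" using d by simp
      finally show ?thesis by blast
    qed
    define j where "j = (LEAST j. y - a < 2 ^ (j + 1) * d)"
    have j: "y - a < 2 ^ (j + 1) * d" unfolding j_def by (rule LeastI_ex[OF ex])
    have jj: "2 ^ j * d \<le> b - a \<and> 2 ^ j * d \<le> y - x"
    proof (cases j)
      case 0
      then show ?thesis using d y by (simp add: d_def)
    next
      case (Suc i)
      have "\<not> y - a < 2 ^ (i + 1) * d" using not_less_Least[of i "\<lambda>j. y - a < 2 ^ (j + 1) * d"] Suc j_def by auto
      then show ?thesis using Suc y x by (auto simp: mult.assoc)
    qed
    have "ennreal (1 / (y - x)) \<le> ennreal (k j)"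
      using jj d y x by (auto simp: k_def intro!: ennreal_leI divide_left_mono mult_pos_pos)
    also have "\<dots> = (\<Sum>i\<in>{j}. ennreal (k i) * indicator {a<..<a + 2 ^ (i + 1) * d} y)" using j y by simp
    also have "\<dots> \<le> (\<Sum>j. ennreal (k j) * indicator {a<..<a + 2 ^ (j + 1) * d} y)" by (rule sum_le_suminf) auto
    finally show ?thesis .
  qed
  have "tail_sum r \<J> x \<le> (\<integral>\<^sup>+J. ennreal (\<eta> powr (r - 1)) * emeasure (density lborel (\<lambda>y. \<Sum>j. ennreal (k j) * indicator {a<..<a + 2 ^ (j + 1) * d} y)) J \<partial>count_space \<J>)"
    (is "_ \<le> (\<integral>\<^sup>+J. _ * emeasure ?D J \<partial>count_space \<J>)")
    unfolding tail_sum_def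
  proof (rule nn_integral_mono)
    fix J assume "J \<in> space (count_space \<J>)"
    then have J: "J \<in> \<J>" by simp
    note Jb = sub_bounds[OF J]
    have q: "(Sup J - Inf J) / (Sup J - x) \<le> \<eta>"
    proof -
      have "Sup J - Inf J \<le> \<eta> * (Sup J - a)" by (rule length_le[OF J])
      also have "\<dots> \<le> \<eta> * (Sup J - x)" using x \<eta>0 by (intro mult_left_mono) auto
      finally show ?thesis using Jb x by (simp add: pos_divide_le_eq)
    qed
    have "ennreal ((Sup J - Inf J) / (Sup J - x)) = ennreal (1 / (Sup J - x)) * emeasure lborel J"
      using Jb x oivl_emeasure[OF ivl[OF J]] by (simp add: ennreal_mult[symmetric])
    also have "\<dots> = (\<integral>\<^sup>+y. ennreal (1 / (Sup J - x)) * indicator J y \<partial>lborel)"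
      using borelJ[OF J] by (simp add: nn_integral_cmult_indicator)
    also have "\<dots> \<le> (\<integral>\<^sup>+y. (\<Sum>j. ennreal (k j) * indicator {a<..<a + 2 ^ (j + 1) * d} y) * indicator J y \<partial>lborel)"
    proof (rule nn_integral_mono)
      fix y show "ennreal (1 / (Sup J - x)) * indicator J y \<le> (\<Sum>j. ennreal (k j) * indicator {a<..<a + 2 ^ (j + 1) * d} y) * indicator J y"
      proof (cases "y \<in> J")
        case True
        then have y: "a < y" "y < b" "y < Sup J" using sub[OF J] oivl_mem[OF ivl[OF J]] by auto
        have "ennreal (1 / (Sup J - x)) \<le> ennreal (1 / (y - x))"
          using y x by (intro ennreal_leI divide_left_mono mult_pos_pos) auto
        also note cover[OF y(1,2)]
        finally show ?thesis using True by simp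
      qed simp
    qed
    also have "\<dots> = emeasure ?D J" using borelJ[OF J] by (subst emeasure_density) auto
    finally have le: "ennreal ((Sup J - Inf J) / (Sup J - x)) \<le> emeasure ?D J" .
    have "ennreal (tail (Inf J) (Sup J) x powr r) \<le> ennreal (\<eta> powr (r - 1) * ((Sup J - Inf J) / (Sup J - x)))"
      by (intro ennreal_leI tail_powr_le[OF J x(2) q])
    also have "\<dots> = ennreal (\<eta> powr (r - 1)) * ennreal ((Sup J - Inf J) / (Sup J - x))" using Jb x by (intro ennreal_mult) auto
    also have "\<dots> \<le> ennreal (\<eta> powr (r - 1)) * emeasure ?D J" by (intro mult_left_mono le) simp
    finally show "ennreal (tail (Inf J) (Sup J) x powr r) \<le> ennreal (\<eta> powr (r - 1)) * emeasure ?D J" .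
  qed
  also have "\<dots> = ennreal (\<eta> powr (r - 1)) * emeasure ?D ?X"
    using emeasure_Union_count_space[OF cnt _ dis, of ?D] borelJ by (simp add: nn_integral_cmult)
  also have "emeasure ?D ?X \<le> (\<Sum>j. ennreal (2 * \<eta>) * indicator {a - (b - a) / 2 ^ j..<a} x)"
  proof -
    have "emeasure ?D ?X = (\<integral>\<^sup>+y. (\<Sum>j. ennreal (k j) * indicator {a<..<a + 2 ^ (j + 1) * d} y) * indicator ?X y \<partial>lborel)"
      using X by (subst emeasure_density) auto
    also have "\<dots> = (\<integral>\<^sup>+y. (\<Sum>j. ennreal (k j) * indicator (?X \<inter> {a<..<a + 2 ^ (j + 1) * d}) y) \<partial>lborel)"
    proof (rule nn_integral_cong)
      fix y
      have "indicator (?X \<inter> B) y = (if y \<in> ?X then indicator B y else 0 :: ennreal)" for B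
        unfolding indicator_def by (simp only: Int_iff) simp
      then show "(\<Sum>j. ennreal (k j) * indicator {a<..<a + 2 ^ (j + 1) * d} y) * indicator ?X y = (\<Sum>j. ennreal (k j) * indicator (?X \<inter> {a<..<a + 2 ^ (j + 1) * d}) y)"
        by (cases "y \<in> ?X") (simp_all only: if_True if_False indicator_simps not_False_eq_True mult_1_right mult_zero_right suminf_zero)
    qed
    also have "\<dots> = (\<Sum>j. \<integral>\<^sup>+y. ennreal (k j) * indicator (?X \<inter> {a<..<a + 2 ^ (j + 1) * d}) y \<partial>lborel)"
      by (rule nn_integral_suminf) (use X in measurable)
    also have "\<dots> = (\<Sum>j. ennreal (k j) * emeasure lborel (?X \<inter> {a<..<a + 2 ^ (j + 1) * d}))"
      using X by (simp add: nn_integral_cmult_indicator)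
    also have "\<dots> \<le> (\<Sum>j. ennreal (2 * \<eta>) * indicator {a - (b - a) / 2 ^ j..<a} x)"
    proof (intro suminf_le)
      fix j
      have "ennreal (k j) * emeasure lborel (?X \<inter> {a<..<a + 2 ^ (j + 1) * d}) \<le> ennreal (k j) * ennreal (\<eta> * (2 ^ (j + 1) * d))"
        by (intro mult_left_mono dens) (use d in auto)
      also have "\<dots> = ennreal (k j * (\<eta> * (2 ^ (j + 1) * d)))" using k0 \<eta>0 d by (intro ennreal_mult[symmetric]) auto
      also have "\<dots> = ennreal (2 * \<eta>) * indicator {a - (b - a) / 2 ^ j..<a} x"
      proof (cases "2 ^ j * d \<le> b - a")
        case True
        then have "x \<in> {a - (b - a) / 2 ^ j..<a}" using x(2) by (auto simp: d_def field_simps)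
        then show ?thesis using True d by (simp add: k_def mult.commute)
      next
        case False
        then have "x \<notin> {a - (b - a) / 2 ^ j..<a}" using x(2) by (auto simp: d_def field_simps)
        then show ?thesis using False by (simp add: k_def)
      qed
      finally show "ennreal (k j) * emeasure lborel (?X \<inter> {a<..<a + 2 ^ (j + 1) * d}) \<le> ennreal (2 * \<eta>) * indicator {a - (b - a) / 2 ^ j..<a} x" .
    qed auto
    finally show ?thesis .
  qed
  also have "ennreal (\<eta> powr (r - 1)) * (\<Sum>j. ennreal (2 * \<eta>) * indicator {a - (b - a) / 2 ^ j..<a} x) =
     (ennreal (\<eta> powr (r - 1)) * ennreal (2 * \<eta>)) * (\<Sum>j. indicator {a - (b - a) / 2 ^ j..<a} x)"
    by (simp add: ennreal_suminf_cmult mult.assoc)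
  also have "ennreal (\<eta> powr (r - 1)) * ennreal (2 * \<eta>) = ennreal (2 * \<eta> powr r)"
  proof -
    have "\<eta> powr (r - 1) * (2 * \<eta>) = 2 * \<eta> powr r" using \<eta>0 r1 powr_mult_base[of \<eta> "r - 1"] by (simp add: mult.commute)
    then show ?thesis using \<eta>0 by (simp add: ennreal_mult[symmetric])
  qed
  finally show ?thesis by (simp add: mult_left_mono)
qed

end

end

section \<open>Tails of the pieces shrinking towards the right end point\<close>

lemma sum_geometric_below_4:
  fixes \<rho> :: real assumes "\<rho> > 0"
  shows "(\<Sum>i<n. if \<rho> < 4 * 2 ^ i then \<rho> / 2 ^ i else 0) \<le> max 0 (8 - 2 * \<rho> / 2 ^ n)"
proof (induction n)
  case (Suc n)
  have "\<rho> / 2 ^ n < 4" if "\<rho> < 4 * 2 ^ n" using that by (simp add: field_simps)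
  moreover have "2 * \<rho> / 2 ^ Suc n = \<rho> / 2 ^ n" by simp
  moreover have "\<rho> / 2 ^ n > 0" using assms by simp
  ultimately show ?case using Suc by (auto simp: max_def split: if_splits)
qed simp

text \<open>At a point at distance \<open>D\<close> to the left of \<open>b\<close>, the tails of the pieces of length
  comparable to \<open>(b - a) / 2\<^sup>i\<close> vanish as long as \<open>(b - a) / 2\<^sup>i \<ge> 4 D\<close>, and decay
  geometrically in \<open>i\<close> once the pieces are shorter than \<open>D\<close>.\<close>
lemma tail_pieces_le:
  assumes "a < b" "r > 1"
  shows "(\<Sum>i. ennreal (tail (b - (b - a) / 2 ^ i) (b - (b - a) / 2 ^ (i + 2)) x powr r)) \<le> ennreal 8 * ennreal (tail a b x powr r)"
proof (cases "x < b")
  case False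
  have "tail (b - (b - a) / 2 ^ i) (b - (b - a) / 2 ^ (i + 2)) x = 0" for i
  proof -
    have "0 < (b - a) / 2 ^ (i + 2)" using assms by simp
    then show ?thesis using False by (simp add: tail_def)
  qed
  then show ?thesis by simp
next
  case True
  define D where "D = b - x"
  define \<rho> where "\<rho> = (b - a) / D"
  have D: "D > 0" and \<rho>: "\<rho> > 0" using True assms by (auto simp: D_def \<rho>_def)
  define q where "q i = (if \<rho> < 4 * 2 ^ i then min 1 (\<rho> / 2 ^ i) else 0)" for i :: nat
  have q: "0 \<le> q i" "q i \<le> 1" for i using \<rho> by (auto simp: q_def)
  have t0: "tail (b - (b - a) / 2 ^ i) (b - (b - a) / 2 ^ (i + 2)) x \<le> q i" for i
  proof -
    define e where "e = (b - a) / 2 ^ (i + 2)"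
    have e: "e > 0" using assms by (simp add: e_def)
    have "e = (b - a) / 2 ^ i / 4" by (simp add: e_def mult.commute)
    then have e4: "(b - a) / 2 ^ i = 4 * e" by (metis (no_types) nonzero_mult_div_cancel_left times_divide_eq_right zero_neq_numeral)
    have \<rho>e: "\<rho> / 2 ^ i = 4 * e / D" unfolding \<rho>_def e4[symmetric] by simp
    have iff: "\<rho> < 4 * 2 ^ i \<longleftrightarrow> e < D"
    proof -
      have "\<rho> < 4 * 2 ^ i \<longleftrightarrow> \<rho> / 2 ^ i < 4" by (simp add: pos_divide_less_eq)
      also have "\<dots> \<longleftrightarrow> e < D" unfolding \<rho>e using D by (simp add: pos_divide_less_eq)
      finally show ?thesis .
    qed
    show ?thesis
    proof (cases "e < D")
      case False
      then show ?thesis using iff unfolding q_def e_def[symmetric] by (simp add: tail_def D_def)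
    next
      case True
      have "tail (b - 4 * e) (b - e) x \<le> min 1 (4 * e / D)"
      proof (cases "4 * e \<le> D")
        case True
        have "tail (b - 4 * e) (b - e) x \<le> 3 * e / (D - e)"
          using tail_le_quot[of x "b - e" "b - 4 * e"] \<open>e < D\<close> by (simp add: D_def algebra_simps)
        also have "\<dots> \<le> 4 * e / D"
        proof -
          have "e * (4 * e) \<le> e * D" using True e by (intro mult_left_mono) auto
          then show ?thesis using \<open>e < D\<close> D by (simp add: field_simps)
        qed
        finally show ?thesis using tail_le_1 by simp
      next
        case False
        then have "1 \<le> 4 * e / D" using D by simp
        then show ?thesis using tail_le_1[of "b - 4 * e" "b - e" x] by simp
      qed
      then show ?thesis using True iff unfolding q_def e_def[symmetric] e4 \<rho>e by simp
    qed
  qed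
  have t1: "tail (b - (b - a) / 2 ^ i) (b - (b - a) / 2 ^ (i + 2)) x powr r \<le> q i powr r" for i
  proof (rule powr_mono2[OF _ _ t0])
    have "(b - a) / 2 ^ (i + 2) < (b - a) / 2 ^ i" using assms by (intro divide_strict_left_mono) auto
    then show "0 \<le> tail (b - (b - a) / 2 ^ i) (b - (b - a) / 2 ^ (i + 2)) x" by (intro tail_nonneg) simp
  qed (use assms in simp)
  have t\<rho>: "tail a b x = min 1 \<rho>" using True by (simp add: tail_def \<rho>_def D_def)
  have partial: "(\<Sum>i<n. q i powr r) \<le> 8 * tail a b x powr r" for n
  proof (cases "\<rho> \<le> 1")
    case True
    have "(\<Sum>i<n. q i powr r) \<le> (\<Sum>i<n. \<rho> powr r * (1 / 2) ^ i)"
    proof (rule sum_mono)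
      fix i
      have "q i powr r \<le> (\<rho> * (1 / 2) ^ i) powr r"
        using assms q \<rho> by (intro powr_mono2) (auto simp: q_def power_one_over)
      also have "\<dots> = \<rho> powr r * ((1 / 2) ^ i) powr r" using \<rho> by (simp add: powr_mult)
      also have "((1 / 2::real) ^ i) powr r \<le> ((1 / 2) ^ i) powr 1"
        using assms by (intro powr_mono') (auto simp: power_le_one)
      finally show "q i powr r \<le> \<rho> powr r * (1 / 2) ^ i" by (simp add: mult_left_mono)
    qed
    also have "\<dots> = \<rho> powr r * (\<Sum>i<n. (1 / 2) ^ i)" by (simp add: sum_distrib_left)
    also have "(\<Sum>i<n. (1 / 2::real) ^ i) \<le> 2" by (simp add: sum_gp_strict)
    finally have "(\<Sum>i<n. q i powr r) \<le> \<rho> powr r * 2" by (simp add: mult_left_mono)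
    then show ?thesis using True unfolding t\<rho> by (smt (verit) powr_ge_zero min_absorb2)
  next
    case False
    have "(\<Sum>i<n. q i powr r) \<le> (\<Sum>i<n. if \<rho> < 4 * 2 ^ i then \<rho> / 2 ^ i else 0)"
    proof (rule sum_mono)
      fix i
      have "q i powr r \<le> q i powr 1" using q[of i] assms by (intro powr_mono') auto
      then show "q i powr r \<le> (if \<rho> < 4 * 2 ^ i then \<rho> / 2 ^ i else 0)" using q[of i] by (auto simp: q_def)
    qed
    also have "\<dots> \<le> max 0 (8 - 2 * \<rho> / 2 ^ n)" by (rule sum_geometric_below_4[OF \<rho>])
    also have "\<dots> \<le> 8" using \<rho> by simp
    finally show ?thesis using False unfolding t\<rho> by simp
  qed
  show ?thesis
  proof (rule suminf_le_const)
    fix n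
    have "(\<Sum>i<n. ennreal (tail (b - (b - a) / 2 ^ i) (b - (b - a) / 2 ^ (i + 2)) x powr r)) \<le> (\<Sum>i<n. ennreal (q i powr r))"
      by (intro sum_mono ennreal_leI t1)
    also have "\<dots> = ennreal (\<Sum>i<n. q i powr r)" by simp
    also have "\<dots> \<le> ennreal (8 * tail a b x powr r)" by (intro ennreal_leI partial)
    also have "\<dots> = ennreal 8 * ennreal (tail a b x powr r)" by (intro ennreal_mult) auto
    finally show "(\<Sum>i<n. ennreal (tail (b - (b - a) / 2 ^ i) (b - (b - a) / 2 ^ (i + 2)) x powr r)) \<le> ennreal 8 * ennreal (tail a b x powr r)" .
  qed simp
qed

lemma suminf_const_top:
  assumes A: "A > 0" shows "(\<Sum>i::nat. ennreal A) = \<infinity>"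
proof -
  define S where "S = (\<Sum>i::nat. ennreal A)"
  have le: "ennreal (real k * A) \<le> S" for k
  proof -
    have "ennreal (real k * A) = (\<Sum>i<k. ennreal A)" using A by (simp add: ennreal_mult ennreal_of_nat_eq_real_of_nat)
    also have "\<dots> \<le> S" unfolding S_def by (rule sum_le_suminf) auto
    finally show ?thesis .
  qed
  show ?thesis unfolding S_def[symmetric]
  proof (cases S)
    case (real B)
    obtain k where k: "B < real k * A" using reals_Archimedean3[OF A] by blast
    then show "S = \<infinity>" using le[of k] real by (simp add: ennreal_le_iff)
  qed simp
qed

text \<open>For finite \<open>v\<close> the indicator functions count the multiples of \<open>A\<close> between \<open>n A\<close> and
  \<open>v\<close>.\<close>
lemma layer_cake_bound:
  fixes v :: ennreal
  assumes "A > 0"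
  shows "v \<le> ennreal (real n * A) + (\<Sum>i. ennreal A * indicator {u. ennreal (real (n + i) * A) < u} v)"
proof (cases "\<exists>k. v \<le> ennreal (real (n + k) * A)")
  case True
  define k where "k = (LEAST k. v \<le> ennreal (real (n + k) * A))"
  have k: "v \<le> ennreal (real (n + k) * A)" unfolding k_def by (rule LeastI_ex[OF True])
  have "ennreal (real k * A) = (\<Sum>i<k. ennreal A)" using assms by (simp add: ennreal_mult ennreal_of_nat_eq_real_of_nat)
  also have "\<dots> = (\<Sum>i<k. ennreal A * indicator {u. ennreal (real (n + i) * A) < u} v)"
  proof (rule sum.cong)
    fix i assume "i \<in> {..<k}"
    then have "\<not> v \<le> ennreal (real (n + i) * A)" using not_less_Least[of i "\<lambda>k. v \<le> ennreal (real (n + k) * A)"] k_def by auto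
    then show "ennreal A = ennreal A * indicator {u. ennreal (real (n + i) * A) < u} v" by simp
  qed simp
  also have "\<dots> \<le> (\<Sum>i. ennreal A * indicator {u. ennreal (real (n + i) * A) < u} v)" by (rule sum_le_suminf) auto
  finally have "ennreal (real n * A) + ennreal (real k * A) \<le> ennreal (real n * A) + (\<Sum>i. ennreal A * indicator {u. ennreal (real (n + i) * A) < u} v)"
    by (rule add_left_mono)
  moreover have "ennreal (real n * A) + ennreal (real k * A) = ennreal (real (n + k) * A)"
    using assms by (simp add: ennreal_plus[symmetric] distrib_right del: ennreal_plus)
  ultimately show ?thesis using k by simp
next
  case False
  then have "(\<Sum>i. ennreal A * indicator {u. ennreal (real (n + i) * A) < u} v) = (\<Sum>i::nat. ennreal A)"
    by (intro suminf_cong) (auto simp: not_le)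
  also have "\<dots> = \<infinity>" by (rule suminf_const_top[OF assms])
  finally show ?thesis by simp
qed

section \<open>Measures satisfying the one-sided condition\<close>

text \<open>The measure with density \<open>w\<close>, where \<open>w\<close> is a weight in \<open>C\<^sub>r\<^sup>+\<close>; the maximal function
  of the interval is written as a tail.\<close>
locale Cp_measure =
  fixes \<nu> :: "real measure" and r \<epsilon> C :: real
  assumes sets_\<nu>: "sets \<nu> = sets lebesgue"
    and r1: "r > 1" and eps: "\<epsilon> > 0" and C0: "C > 0"
    and Cp: "\<And>a b c E. \<lbrakk>a < b; b < c; c - b < b - a; E \<in> sets borel; E \<subseteq> {a<..<b}\<rbrakk> \<Longrightarrow>
       emeasure \<nu> E \<le> ennreal (C * (measure lborel E / (c - b)) powr \<epsilon>) * (\<integral>\<^sup>+x. ennreal (tail a c x powr r) \<partial>\<nu>)"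
begin

definition W :: "real \<Rightarrow> real \<Rightarrow> ennreal" where
  "W a b = (\<integral>\<^sup>+x. ennreal (tail a b x powr r) \<partial>\<nu>)"

lemma borel_sets: "E \<in> sets borel \<Longrightarrow> E \<in> sets \<nu>"
  unfolding sets_\<nu> by simp

lemma borel_meas: "h \<in> borel_measurable borel \<Longrightarrow> h \<in> borel_measurable \<nu>"
proof -
  assume "h \<in> borel_measurable borel"
  then have "h \<in> borel_measurable lebesgue" by (intro measurable_completion) simp
  then show ?thesis using measurable_cong_sets[OF sets_\<nu> refl] by blast
qed

lemma Cp_emeasure:
  assumes "a < b" "b < c" "c - b < b - a" "E \<in> sets borel" "E \<subseteq> {a<..<b}"
    and "emeasure lborel E \<le> ennreal m" "m \<ge> 0"
  shows "emeasure \<nu> E \<le> ennreal (C * (m / (c - b)) powr \<epsilon>) * W a c"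
proof -
  have "measure lborel E \<le> m" using assms(6,7) by (simp add: measure_def enn2real_leI)
  then have "(measure lborel E / (c - b)) powr \<epsilon> \<le> (m / (c - b)) powr \<epsilon>"
    using assms eps by (intro powr_mono2 divide_right_mono) auto
  then have "ennreal (C * (measure lborel E / (c - b)) powr \<epsilon>) \<le> ennreal (C * (m / (c - b)) powr \<epsilon>)"
    using C0 by (intro ennreal_leI mult_left_mono) auto
  then show ?thesis using Cp[OF assms(1-5)] unfolding W_def by (meson mult_right_mono order_trans zero_le)
qed

text \<open>The condition with \<open>\<bar>E\<bar> = 0\<close> makes points null sets, so that end points may be
  disregarded.\<close>
lemma null_singleton: "emeasure \<nu> {x} = 0"
  using Cp_emeasure[of "x - 2" "x + 1" "x + 2" "{x}" 0] eps by simp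

lemma null_countable: "countable A \<Longrightarrow> emeasure \<nu> A = 0"
proof -
  assume "countable A"
  then have "(\<Union>x\<in>A. {x}) \<in> null_sets \<nu>"
    by (intro null_sets_UN') (auto simp: null_singleton borel_sets intro!: null_setsI)
  then show ?thesis by auto
qed

definition C1 :: real where "C1 = 8 * C * 4 powr \<epsilon>"

lemma C1_pos: "C1 > 0" using C0 by (simp add: C1_def)

text \<open>The condition on \<open>(a, b)\<close> looks beyond \<open>b\<close>, to the point \<open>c\<close>. For a bound by \<open>W a b\<close>
  itself, \<open>E\<close> is cut at the points \<open>p i = b - (b - a) / 2\<^sup>i\<close>, and on \<open>(p i, p (i + 1))\<close> the
  condition is applied with \<open>c = p (i + 2)\<close>. The right-hand sides add up by
  \<open>tail_pieces_le\<close>.\<close>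
lemma sparse_le:
  assumes "a < b" "E \<in> sets borel" "E \<subseteq> {a<..<b}" "\<theta> \<ge> 0"
    and sp: "\<And>\<alpha>. a \<le> \<alpha> \<Longrightarrow> \<alpha> < b \<Longrightarrow> emeasure lborel (E \<inter> {\<alpha><..<b}) \<le> ennreal (\<theta> * (b - \<alpha>))"
  shows "emeasure \<nu> E \<le> ennreal (C1 * \<theta> powr \<epsilon>) * W a b"
proof -
  define l where "l = b - a"
  have l: "l > 0" using assms by (simp add: l_def)
  define p where "p i = b - l / 2 ^ i" for i :: nat
  have p0: "p 0 = a" by (simp add: p_def l_def)
  have step: "p (Suc i) - p i = l / 2 ^ Suc i" "b - p i = l / 2 ^ i" "p i < b" "a \<le> p i" for i
  proof -
    have "l / 2 ^ i \<le> l / 1" using l by (intro divide_left_mono) auto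
    then show "p (Suc i) - p i = l / 2 ^ Suc i" "b - p i = l / 2 ^ i" "p i < b" "a \<le> p i"
      using l by (auto simp: p_def l_def field_simps)
  qed
  have lt: "p i < p (Suc i)" for i using step(1)[of i] l by (smt (verit) divide_pos_pos zero_less_power)
  have cover: "E \<subseteq> (\<Union>i. E \<inter> {p i<..<p (Suc i)}) \<union> range p"
  proof
    fix y assume y: "y \<in> E"
    then have yab: "a < y" "y < b" using assms(3) by auto
    have "\<exists>i. y < p (Suc i)"
    proof -
      obtain i where "l / (b - y) < 2 ^ i" using real_arch_pow[of 2 "l / (b - y)"] by auto
      then have "l < (b - y) * 2 ^ i" using yab by (simp add: pos_divide_less_eq mult.commute)
      also have "\<dots> \<le> (b - y) * 2 ^ Suc i" using yab by simp
      finally have "l / 2 ^ Suc i < b - y" by (subst pos_divide_less_eq) auto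
      then show ?thesis by (intro exI[of _ i]) (simp add: p_def)
    qed
    then obtain i where i: "y < p (Suc i)" "\<And>j. j < i \<Longrightarrow> \<not> y < p (Suc j)"
      using exists_least_iff[of "\<lambda>i. y < p (Suc i)"] by blast
    have "p i \<le> y" using i(2)[of "i - 1"] yab p0 by (cases i) auto
    then show "y \<in> (\<Union>i. E \<inter> {p i<..<p (Suc i)}) \<union> range p" using y i(1) by (cases "y = p i") auto
  qed
  have mE: "E \<inter> {p i<..<p (Suc i)} \<in> sets borel" for i using assms(2) by auto
  have mU: "(\<Union>i. E \<inter> {p i<..<p (Suc i)}) \<in> sets borel" by (rule sets.countable_UN, rule image_subsetI, rule mE)
  have mr: "range p \<in> sets borel" by (rule sets.countable) auto
  have "emeasure \<nu> E \<le> emeasure \<nu> ((\<Union>i. E \<inter> {p i<..<p (Suc i)}) \<union> range p)"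
    by (rule emeasure_mono[OF cover]) (intro borel_sets sets.Un mU mr)
  also have "\<dots> \<le> emeasure \<nu> (\<Union>i. E \<inter> {p i<..<p (Suc i)}) + emeasure \<nu> (range p)"
    by (rule emeasure_subadditive) (intro borel_sets mU mr)+
  also have "emeasure \<nu> (range p) = 0" by (rule null_countable) simp
  also have "emeasure \<nu> (\<Union>i. E \<inter> {p i<..<p (Suc i)}) \<le> (\<Sum>i. emeasure \<nu> (E \<inter> {p i<..<p (Suc i)}))"
    by (rule emeasure_subadditive_countably, rule image_subsetI, rule borel_sets, rule mE)
  also have "\<dots> \<le> (\<Sum>i. ennreal (C * (4 * \<theta>) powr \<epsilon>) * W (p i) (p (i + 2)))"
  proof (intro suminf_le)
    fix i
    have c: "p (i + 2) - p (Suc i) = l / 2 ^ (i + 2)" using step(1)[of "Suc i"] by simp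
    have "emeasure \<nu> (E \<inter> {p i<..<p (Suc i)}) \<le> ennreal (C * (\<theta> * (l / 2 ^ i) / (p (i + 2) - p (Suc i))) powr \<epsilon>) * W (p i) (p (i + 2))"
    proof (rule Cp_emeasure)
      show "p (Suc i) < p (i + 2)" using lt[of "Suc i"] by simp
      show "p (i + 2) - p (Suc i) < p (Suc i) - p i" unfolding c step(1) using l by (intro divide_strict_left_mono) auto
      have "emeasure lborel (E \<inter> {p i<..<p (Suc i)}) \<le> emeasure lborel (E \<inter> {p i<..<b})"
        using assms(2) step(3)[of "Suc i"] by (intro emeasure_mono) auto
      also have "\<dots> \<le> ennreal (\<theta> * (b - p i))" by (rule sp) (use step in auto)
      finally show "emeasure lborel (E \<inter> {p i<..<p (Suc i)}) \<le> ennreal (\<theta> * (l / 2 ^ i))" unfolding step(2) .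
    qed (use lt mE l assms(4) in auto)
    also have "\<theta> * (l / 2 ^ i) / (p (i + 2) - p (Suc i)) = 4 * \<theta>" unfolding c using l by simp
    finally show "emeasure \<nu> (E \<inter> {p i<..<p (Suc i)}) \<le> ennreal (C * (4 * \<theta>) powr \<epsilon>) * W (p i) (p (i + 2))" .
  qed auto
  also have "\<dots> = ennreal (C * (4 * \<theta>) powr \<epsilon>) * (\<Sum>i. W (p i) (p (i + 2)))" by (rule ennreal_suminf_cmult)
  also have "(\<Sum>i. W (p i) (p (i + 2))) = (\<integral>\<^sup>+x. (\<Sum>i. ennreal (tail (p i) (p (i + 2)) x powr r)) \<partial>\<nu>)"
    unfolding W_def by (rule nn_integral_suminf[symmetric]) (intro borel_meas, measurable)
  also have "\<dots> \<le> (\<integral>\<^sup>+x. ennreal 8 * ennreal (tail a b x powr r) \<partial>\<nu>)"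
    unfolding p_def l_def by (intro nn_integral_mono tail_pieces_le assms r1)
  also have "\<dots> = ennreal 8 * W a b" unfolding W_def by (rule nn_integral_cmult) (intro borel_meas, measurable)
  finally have "emeasure \<nu> E \<le> ennreal (C * (4 * \<theta>) powr \<epsilon>) * (ennreal 8 * W a b)" by (simp add: mult_left_mono)
  also have "\<dots> = ennreal (C1 * \<theta> powr \<epsilon>) * W a b"
  proof -
    have "ennreal (C * (4 * \<theta>) powr \<epsilon>) * ennreal 8 = ennreal (C * (4 * \<theta>) powr \<epsilon> * 8)" using C0 by (intro ennreal_mult[symmetric]) auto
    also have "C * (4 * \<theta>) powr \<epsilon> * 8 = C1 * \<theta> powr \<epsilon>" using assms(4) by (simp add: C1_def powr_mult)
    finally show ?thesis by (simp only: mult.assoc[symmetric])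
  qed
  finally show ?thesis .
qed

text \<open>The factor by which the right-hand side of the condition decays when the measure of
  the set is halved.\<close>
definition gq :: real where "gq = 2 powr (- \<epsilon>)"

lemma gq: "0 < gq" "gq < 1" using eps by (auto simp: gq_def powr_less_one)

lemma powr_half_power: "(1 / 2 ^ n) powr \<epsilon> = gq ^ n"
proof -
  have "(1 / 2 ^ n :: real) = 2 powr (- real n)" by (simp add: powr_minus_divide powr_realpow)
  then show ?thesis by (simp add: gq_def powr_powr powr_realpow[symmetric] mult.commute)
qed

lemma suminf_geometric_ennreal: "(\<Sum>i. ennreal (D * gq ^ i)) = ennreal (D / (1 - gq))" if "D \<ge> 0"
proof -
  have s: "(\<lambda>i. D * gq ^ i) sums (D * (1 / (1 - gq)))" using gq by (intro sums_mult geometric_sums) auto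
  have "(\<Sum>i. ennreal (D * gq ^ i)) = ennreal (\<Sum>i. D * gq ^ i)"
    using that gq s by (intro suminf_ennreal2) (auto simp: sums_iff)
  then show ?thesis using s by (simp add: sums_iff)
qed

definition A :: real where "A = 2 * r / (r - 1)"
definition D2 :: real where "D2 = A * C1 / (1 - gq)"
definition D1 :: real where "D1 = 2 powr r + 2 * (C * 2 powr \<epsilon> * 2 powr r / (1 - gq))"

lemma A_pos: "A > 0" using r1 by (simp add: A_def)
lemma D2_pos: "D2 > 0" using A_pos C1_pos gq by (simp add: D2_def)
lemma D1_pos: "D1 > 0" using C0 gq by (simp add: D1_def add_pos_nonneg)

text \<open>Above the height \<open>n A\<close>, the superlevel sets of the tail sum are exponentially sparse
  in each \<open>(\<alpha>, b)\<close>, so that \<open>sparse_le\<close> turns the layer cake formula into a geometric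
  series. Below this height the sum is bounded by \<open>n A\<close>.\<close>
lemma tail_sum_inside:
  assumes F: "ivl_family \<J> r" and sub: "\<And>J. J \<in> \<J> \<Longrightarrow> Sup J \<le> b" and ab: "a < b"
  shows "(\<integral>\<^sup>+x. tail_sum r \<J> x * indicator {a<..<b} x \<partial>\<nu>) \<le> ennreal (real n * A) * emeasure \<nu> {a<..<b} + ennreal (D2 * gq ^ n) * W a b"
proof -
  interpret F: ivl_family \<J> r by (rule F)
  have AA: "F.A = A" by (simp add: F.A_def A_def)
  have [measurable]: "tail_sum r \<J> \<in> borel_measurable borel" using measurable_tail_sum[OF F.ivl] r1 by auto
  define E where "E i = {x \<in> {a<..<b}. ennreal (real (n + i) * A) < tail_sum r \<J> x}" for i
  have mE: "E i \<in> sets borel" for i unfolding E_def by measurable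
  have "(\<integral>\<^sup>+x. tail_sum r \<J> x * indicator {a<..<b} x \<partial>\<nu>) \<le> (\<integral>\<^sup>+x. ennreal (real n * A) * indicator {a<..<b} x + (\<Sum>i. ennreal A * indicator (E i) x) \<partial>\<nu>)"
  proof (rule nn_integral_mono)
    fix x show "tail_sum r \<J> x * indicator {a<..<b} x \<le> ennreal (real n * A) * indicator {a<..<b} x + (\<Sum>i. ennreal A * indicator (E i) x)"
    proof (cases "x \<in> {a<..<b}")
      case True
      then have "indicator (E i) x = (indicator {u. ennreal (real (n + i) * A) < u} (tail_sum r \<J> x) :: ennreal)" for i
        unfolding E_def indicator_def by simp
      then show ?thesis using layer_cake_bound[OF A_pos, of "tail_sum r \<J> x" n] True by simp
    qed simp
  qed
  also have "\<dots> = ennreal (real n * A) * emeasure \<nu> {a<..<b} + (\<Sum>i. ennreal A * emeasure \<nu> (E i))"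
  proof -
    have i: "(\<lambda>x. ennreal A * indicator (E i) x) \<in> borel_measurable \<nu>" for i by (rule borel_meas) (use mE in measurable)
    have "(\<integral>\<^sup>+x. (\<Sum>i. ennreal A * indicator (E i) x) \<partial>\<nu>) = (\<Sum>i. ennreal A * emeasure \<nu> (E i))"
      by (subst nn_integral_suminf[OF i]) (simp add: nn_integral_cmult_indicator mE borel_sets)
    moreover have "(\<integral>\<^sup>+x. ennreal (real n * A) * indicator {a<..<b} x \<partial>\<nu>) = ennreal (real n * A) * emeasure \<nu> {a<..<b}"
      by (rule nn_integral_cmult_indicator) (simp add: borel_sets)
    moreover have "(\<lambda>x. ennreal (real n * A) * indicator {a<..<b} x) \<in> borel_measurable \<nu>" by (rule borel_meas) measurable
    then have "(\<integral>\<^sup>+x. ennreal (real n * A) * indicator {a<..<b} x + (\<Sum>i. ennreal A * indicator (E i) x) \<partial>\<nu>)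
      = (\<integral>\<^sup>+x. ennreal (real n * A) * indicator {a<..<b} x \<partial>\<nu>) + (\<integral>\<^sup>+x. (\<Sum>i. ennreal A * indicator (E i) x) \<partial>\<nu>)"
      by (rule nn_integral_add) (intro borel_measurable_suminf_order i)
    ultimately show ?thesis by (simp only:)
  qed
  also have "(\<Sum>i. ennreal A * emeasure \<nu> (E i)) \<le> (\<Sum>i. ennreal (A * C1 * gq ^ n * gq ^ i) * W a b)"
  proof (intro suminf_le)
    fix i
    have "emeasure \<nu> (E i) \<le> ennreal (C1 * (1 / 2 ^ (n + i)) powr \<epsilon>) * W a b"
    proof (rule sparse_le[OF ab mE])
      fix \<alpha> assume \<alpha>: "a \<le> \<alpha>" "\<alpha> < b"
      have "E i \<inter> {\<alpha><..<b} \<subseteq> {x \<in> {\<alpha><..<b}. ennreal (real (n + i) * F.A) < tail_sum r \<J> x}" unfolding E_def AA by auto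
      then have "emeasure lborel (E i \<inter> {\<alpha><..<b}) \<le> emeasure lborel {x \<in> {\<alpha><..<b}. ennreal (real (n + i) * F.A) < tail_sum r \<J> x}"
        by (rule emeasure_mono) measurable
      also have "\<dots> \<le> ennreal ((b - \<alpha>) / 2 ^ (n + i))" by (rule F.tail_sum_decay[OF sub \<alpha>(2)])
      finally show "emeasure lborel (E i \<inter> {\<alpha><..<b}) \<le> ennreal (1 / 2 ^ (n + i) * (b - \<alpha>))" by simp
    qed (auto simp: E_def)
    also have "(1 / 2 ^ (n + i)) powr \<epsilon> = gq ^ (n + i)" by (rule powr_half_power)
    finally have "ennreal A * emeasure \<nu> (E i) \<le> ennreal A * (ennreal (C1 * gq ^ (n + i)) * W a b)" by (rule mult_left_mono) simp
    also have "\<dots> = ennreal (A * (C1 * gq ^ (n + i))) * W a b"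
      using A_pos C1_pos gq by (subst (2) ennreal_mult) (auto simp: mult.assoc)
    finally show "ennreal A * emeasure \<nu> (E i) \<le> ennreal (A * C1 * gq ^ n * gq ^ i) * W a b" by (simp add: power_add mult.assoc)
  qed auto
  also have "\<dots> = (\<Sum>i. ennreal (A * C1 * gq ^ n * gq ^ i)) * W a b" by (rule ennreal_suminf_multc)
  also have "(\<Sum>i. ennreal (A * C1 * gq ^ n * gq ^ i)) = ennreal (D2 * gq ^ n)"
    using A_pos C1_pos gq by (subst suminf_geometric_ennreal) (auto simp: D2_def)
  finally show ?thesis by (simp add: add_left_mono)
qed

text \<open>The condition is applied to subsets of \<open>(a - l, a)\<close> with \<open>l = b - a\<close> and
  \<open>c = a + l / 2\<close>; here \<open>W\<close> of \<open>(a - l, a + l / 2)\<close> is at most \<open>2\<^sup>r\<close> times that of \<open>(a, b)\<close>.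
  The decay in \<open>j\<close> compensates the logarithmic loss in \<open>tail_sum_near_left\<close>.\<close>
lemma left_neighbourhood_le:
  assumes ab: "a < b"
  shows "emeasure \<nu> {a - (b - a) / 2 ^ j..<a} \<le> ennreal (C * 2 powr \<epsilon> * 2 powr r * gq ^ j) * W a b"
proof -
  define l where "l = b - a"
  have l: "l > 0" "b = a + l" using ab by (auto simp: l_def)
  have lj: "l / 2 ^ j \<le> l" "l / 2 ^ j > 0" using l by (auto simp: divide_le_eq)
  have "emeasure \<nu> {a - l / 2 ^ j..<a} \<le> emeasure \<nu> ({a - l / 2 ^ j} \<union> {a - l / 2 ^ j<..<a})"
    by (rule emeasure_mono) (auto intro!: borel_sets)
  also have "\<dots> \<le> emeasure \<nu> {a - l / 2 ^ j} + emeasure \<nu> {a - l / 2 ^ j<..<a}"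
    by (rule emeasure_subadditive) (auto intro!: borel_sets)
  also have "emeasure \<nu> {a - l / 2 ^ j} = 0" by (rule null_singleton)
  also have "emeasure \<nu> {a - l / 2 ^ j<..<a} \<le> ennreal (C * (l / 2 ^ j / (a + l / 2 - a)) powr \<epsilon>) * W (a - l) (a + l / 2)"
    by (rule Cp_emeasure) (use l lj in auto)
  also have "l / 2 ^ j / (a + l / 2 - a) = 2 * (1 / 2 ^ j)" using l by simp
  also have "(2 * (1 / 2 ^ j)) powr \<epsilon> = 2 powr \<epsilon> * (1 / 2 ^ j) powr \<epsilon>" by (rule powr_mult)
  also have "(1 / 2 ^ j) powr \<epsilon> = gq ^ j" by (rule powr_half_power)
  also have "W (a - l) (a + l / 2) \<le> ennreal (2 powr r) * W a b"
  proof -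
    have "W (a - l) (a + l / 2) \<le> (\<integral>\<^sup>+x. ennreal (2 powr r) * ennreal (tail a b x powr r) \<partial>\<nu>)"
      unfolding W_def
    proof (rule nn_integral_mono)
      fix x
      have "tail (a - l) (a + l / 2) x \<le> 2 * tail a b x"
      proof -
        consider "a + l / 2 \<le> x" | "x < a + l / 2" "a \<le> x" | "x < a" "a - l \<le> x" | "x < a - l" by linarith
        then show ?thesis
        proof cases
          case 1
          then show ?thesis using tail_nonneg[OF ab, of x] by (simp add: tail_def[of "a - l"])
        next
          case 2
          then have "tail a b x = 1" using l by (intro tail_eq_1) auto
          then show ?thesis using tail_le_1[of "a - l" "a + l / 2" x] by simp
        next
          case 3
          then have "1 / 2 \<le> tail a b x" using l by (auto simp: tail_def le_divide_eq)
          then show ?thesis using tail_le_1[of "a - l" "a + l / 2" x] by simp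
        next
          case 4
          have t: "tail a b x = l / (a + l - x)" using 4 l by (auto simp: tail_def min_def)
          have "tail (a - l) (a + l / 2) x \<le> (3 / 2 * l) / (a + l / 2 - x)"
            using tail_le_quot[of x "a + l / 2" "a - l"] 4 l by simp
          also have "\<dots> \<le> 2 * (l / (a + l - x))"
          proof -
            have "3 / 2 * (a + l - x) \<le> 2 * (a + l / 2 - x)" using 4 by simp
            then have "l * (3 / 2 * (a + l - x)) \<le> l * (2 * (a + l / 2 - x))" using l by (intro mult_left_mono) auto
            then show ?thesis using 4 l by (simp add: pos_divide_le_eq pos_le_divide_eq mult_ac)
          qed
          finally show ?thesis by (simp add: t)
        qed
      qed
      then have "tail (a - l) (a + l / 2) x powr r \<le> (2 * tail a b x) powr r"
        using r1 l tail_nonneg[of "a - l" "a + l / 2" x] by (intro powr_mono2) auto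
      also have "\<dots> = 2 powr r * tail a b x powr r" using tail_nonneg[OF ab] by (simp add: powr_mult)
      finally show "ennreal (tail (a - l) (a + l / 2) x powr r) \<le> ennreal (2 powr r) * ennreal (tail a b x powr r)"
        by (subst ennreal_mult[symmetric]) (auto intro: ennreal_leI)
    qed
    also have "\<dots> = ennreal (2 powr r) * W a b" unfolding W_def by (rule nn_integral_cmult) (intro borel_meas, measurable)
    finally show ?thesis .
  qed
  finally have "emeasure \<nu> {a - l / 2 ^ j..<a} \<le> ennreal (C * (2 powr \<epsilon> * gq ^ j)) * (ennreal (2 powr r) * W a b)"
    by (simp add: mult_left_mono)
  also have "\<dots> = (ennreal (C * (2 powr \<epsilon> * gq ^ j)) * ennreal (2 powr r)) * W a b" by (simp only: mult.assoc)
  also have "ennreal (C * (2 powr \<epsilon> * gq ^ j)) * ennreal (2 powr r) = ennreal (C * (2 powr \<epsilon> * gq ^ j) * 2 powr r)"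
    using C0 gq by (intro ennreal_mult[symmetric]) auto
  also have "C * (2 powr \<epsilon> * gq ^ j) * 2 powr r = C * 2 powr \<epsilon> * 2 powr r * gq ^ j" by simp
  finally show ?thesis by (simp add: l_def)
qed

text \<open>The sum of \<open>W\<close> is the integral of the tail sum. Its part inside \<open>(a, b)\<close> is mostly
  bounded by \<open>n A\<close>, with an exceptional part which is exponentially small in \<open>n\<close>; its part
  to the left of \<open>a\<close> gains \<open>\<eta>\<^sup>r\<close>.\<close>
theorem tail_sum_recursion:
  assumes F: "ivl_family \<J> r" and sub: "\<And>J. J \<in> \<J> \<Longrightarrow> J \<subseteq> {a<..<b}" and ab: "a < b" and \<eta>0: "\<eta> \<ge> 0"
    and dens: "\<And>l. l > 0 \<Longrightarrow> emeasure lborel (\<Union>\<J> \<inter> {a<..<a + l}) \<le> ennreal (\<eta> * l)"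
  shows "(\<integral>\<^sup>+J. W (Inf J) (Sup J) \<partial>count_space \<J>) \<le>
    ennreal (real n * A) * emeasure \<nu> {a<..<b} + ennreal (D2 * gq ^ n + D1 * \<eta> powr r) * W a b"
proof -
  interpret F: ivl_family \<J> r by (rule F)
  have supb: "Sup J \<le> b" if "J \<in> \<J>" for J using F.sub_bounds[OF ab sub \<eta>0 dens that] by simp
  have m[measurable]: "tail_sum r \<J> \<in> borel_measurable borel" using measurable_tail_sum[OF F.ivl] r1 by auto
  let ?G = "\<lambda>j::nat. {a - (b - a) / 2 ^ j..<a}"
  have "(\<integral>\<^sup>+J. W (Inf J) (Sup J) \<partial>count_space \<J>) = (\<integral>\<^sup>+x. tail_sum r \<J> x \<partial>\<nu>)"
    unfolding W_def tail_sum_def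
    by (rule nn_integral_count_space_nn_integral[OF F.cnt, symmetric]) (intro borel_meas, measurable)
  also have "\<dots> \<le> (\<integral>\<^sup>+x. tail_sum r \<J> x * indicator {a<..<b} x + (ennreal ((2 * \<eta>) powr r) * ennreal (tail a b x powr r) + ennreal (2 * \<eta> powr r) * (\<Sum>j. indicator (?G j) x)) \<partial>\<nu>)"
  proof (rule nn_integral_mono_AE)
    have "AE x in \<nu>. x \<noteq> a" using null_singleton[of a] by (intro AE_I[where N="{a}"]) (auto intro: borel_sets)
    then show "AE x in \<nu>. tail_sum r \<J> x \<le> tail_sum r \<J> x * indicator {a<..<b} x + (ennreal ((2 * \<eta>) powr r) * ennreal (tail a b x powr r) + ennreal (2 * \<eta> powr r) * (\<Sum>j. indicator (?G j) x))"
    proof eventually_elim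
      case (elim x)
      consider "b \<le> x" | "a < x" "x < b" | "x < a" "a - (b - a) \<le> x" | "x \<le> a - (b - a)" using elim by linarith
      then show ?case
      proof cases
        case 1
        have "tail_sum r \<J> x = (\<integral>\<^sup>+J. 0 \<partial>count_space \<J>)"
          unfolding tail_sum_def using 1 supb by (intro nn_integral_cong) (force simp: tail_def)
        then show ?thesis by simp
      next
        case 2
        then show ?thesis by simp
      next
        case 3
        show ?thesis using F.tail_sum_near_left[OF ab sub \<eta>0 dens 3(2,1)] by (auto intro: order_trans add_increasing)
      next
        case 4
        show ?thesis using F.tail_sum_far_left[OF ab sub \<eta>0 dens 4] by (auto intro: order_trans add_increasing add_increasing2)
      qed
    qed
  qed
  also have "\<dots> = (\<integral>\<^sup>+x. tail_sum r \<J> x * indicator {a<..<b} x \<partial>\<nu>) + (ennreal ((2 * \<eta>) powr r) * W a b + ennreal (2 * \<eta> powr r) * (\<Sum>j. emeasure \<nu> (?G j)))"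
  proof -
    have m0: "(\<lambda>x. tail_sum r \<J> x * indicator {a<..<b} x) \<in> borel_measurable \<nu>" by (intro borel_meas, measurable)
    have m1: "(\<lambda>x. ennreal (tail a b x powr r)) \<in> borel_measurable \<nu>" by (intro borel_meas, measurable)
    have m2: "indicator (?G j) \<in> borel_measurable \<nu>" for j by (intro borel_meas, measurable)
    have m3: "(\<lambda>x. \<Sum>j. indicator (?G j) x :: ennreal) \<in> borel_measurable \<nu>" by (intro borel_measurable_suminf_order m2)
    have c: "(\<integral>\<^sup>+x. (\<Sum>j. indicator (?G j) x) \<partial>\<nu>) = (\<Sum>j. emeasure \<nu> (?G j))"
      by (subst nn_integral_suminf[OF m2]) (simp add: borel_sets)
    have "(\<integral>\<^sup>+x. tail_sum r \<J> x * indicator {a<..<b} x + (ennreal ((2 * \<eta>) powr r) * ennreal (tail a b x powr r) + ennreal (2 * \<eta> powr r) * (\<Sum>j. indicator (?G j) x)) \<partial>\<nu>)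
      = (\<integral>\<^sup>+x. tail_sum r \<J> x * indicator {a<..<b} x \<partial>\<nu>) + (\<integral>\<^sup>+x. ennreal ((2 * \<eta>) powr r) * ennreal (tail a b x powr r) + ennreal (2 * \<eta> powr r) * (\<Sum>j. indicator (?G j) x) \<partial>\<nu>)"
      by (rule nn_integral_add[OF m0]) (intro borel_measurable_add borel_measurable_times_ennreal borel_measurable_const m1 m3)
    also have "(\<integral>\<^sup>+x. ennreal ((2 * \<eta>) powr r) * ennreal (tail a b x powr r) + ennreal (2 * \<eta> powr r) * (\<Sum>j. indicator (?G j) x) \<partial>\<nu>)
      = (\<integral>\<^sup>+x. ennreal ((2 * \<eta>) powr r) * ennreal (tail a b x powr r) \<partial>\<nu>) + (\<integral>\<^sup>+x. ennreal (2 * \<eta> powr r) * (\<Sum>j. indicator (?G j) x) \<partial>\<nu>)"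
      by (rule nn_integral_add) (intro borel_measurable_times_ennreal borel_measurable_const m1 m3)+
    also have "(\<integral>\<^sup>+x. ennreal ((2 * \<eta>) powr r) * ennreal (tail a b x powr r) \<partial>\<nu>) = ennreal ((2 * \<eta>) powr r) * W a b"
      unfolding W_def by (rule nn_integral_cmult[OF m1])
    also have "(\<integral>\<^sup>+x. ennreal (2 * \<eta> powr r) * (\<Sum>j. indicator (?G j) x) \<partial>\<nu>) = ennreal (2 * \<eta> powr r) * (\<Sum>j. emeasure \<nu> (?G j))"
      unfolding c[symmetric] by (rule nn_integral_cmult[OF m3])
    finally show ?thesis .
  qed
  also have "\<dots> \<le> (ennreal (real n * A) * emeasure \<nu> {a<..<b} + ennreal (D2 * gq ^ n) * W a b) +
     (ennreal ((2 * \<eta>) powr r) * W a b + ennreal (2 * \<eta> powr r) * (ennreal (C * 2 powr \<epsilon> * 2 powr r / (1 - gq)) * W a b))"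
  proof (intro add_mono mult_left_mono order_refl tail_sum_inside[OF F supb ab])
    have "(\<Sum>j. emeasure \<nu> (?G j)) \<le> (\<Sum>j. ennreal (C * 2 powr \<epsilon> * 2 powr r * gq ^ j) * W a b)"
      by (intro suminf_le left_neighbourhood_le ab) auto
    also have "\<dots> = (\<Sum>j. ennreal (C * 2 powr \<epsilon> * 2 powr r * gq ^ j)) * W a b" by (rule ennreal_suminf_multc)
    finally show "(\<Sum>j. emeasure \<nu> (?G j)) \<le> ennreal (C * 2 powr \<epsilon> * 2 powr r / (1 - gq)) * W a b"
      using C0 by (subst (asm) suminf_geometric_ennreal) auto
  qed auto
  also have "\<dots> = ennreal (real n * A) * emeasure \<nu> {a<..<b} + (ennreal (D2 * gq ^ n) + (ennreal ((2 * \<eta>) powr r) + ennreal (2 * \<eta> powr r) * ennreal (C * 2 powr \<epsilon> * 2 powr r / (1 - gq)))) * W a b"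
    by (simp only: distrib_right mult.assoc add.assoc)
  also have "ennreal (D2 * gq ^ n) + (ennreal ((2 * \<eta>) powr r) + ennreal (2 * \<eta> powr r) * ennreal (C * 2 powr \<epsilon> * 2 powr r / (1 - gq))) = ennreal (D2 * gq ^ n + D1 * \<eta> powr r)"
  proof -
    have k: "0 \<le> C * 2 powr \<epsilon> * 2 powr r / (1 - gq)" "0 \<le> D2 * gq ^ n" using C0 gq D2_pos by auto
    have "ennreal (D2 * gq ^ n) + (ennreal ((2 * \<eta>) powr r) + ennreal (2 * \<eta> powr r) * ennreal (C * 2 powr \<epsilon> * 2 powr r / (1 - gq)))
       = ennreal (D2 * gq ^ n + ((2 * \<eta>) powr r + 2 * \<eta> powr r * (C * 2 powr \<epsilon> * 2 powr r / (1 - gq))))"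
      using k by (simp only: ennreal_mult[symmetric] ennreal_plus[symmetric] powr_ge_zero mult_nonneg_nonneg zero_le_numeral add_nonneg_nonneg)
    also have "D2 * gq ^ n + ((2 * \<eta>) powr r + 2 * \<eta> powr r * (C * 2 powr \<epsilon> * 2 powr r / (1 - gq))) = D2 * gq ^ n + D1 * \<eta> powr r"
      using \<eta>0 by (simp add: D1_def powr_mult algebra_simps)
    finally show ?thesis .
  qed
  finally show ?thesis .
qed

end

section \<open>Summation over the levels\<close>

lemma ennreal_absorb_half:
  fixes x a :: ennreal
  assumes "x \<le> a + ennreal (1/2) * x" "x < \<infinity>" shows "x \<le> 2 * a"
proof (cases a)
  case (real a')
  obtain x' where x': "x = ennreal x'" "x' \<ge> 0" using assms(2) by (cases x) auto
  have "ennreal x' \<le> ennreal (a' + 1/2 * x')"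
  proof -
    have "ennreal (1/2) * ennreal x' = ennreal (1/2 * x')" using x' by (intro ennreal_mult[symmetric]) auto
    then show ?thesis using assms(1) real x' by (simp only: ennreal_plus[symmetric])
  qed
  then have "x' \<le> a' + 1/2 * x'" using real x' by (subst (asm) ennreal_le_iff) auto
  then have "ennreal x' \<le> ennreal (2 * a')" by (intro ennreal_leI) simp
  then show ?thesis using real x' ennreal_mult[of 2 a'] by simp
qed (simp add: ennreal_mult_top)

context Cp_measure begin

lemma emeasure_split_open_family:
  assumes "\<And>J. J \<in> F \<Longrightarrow> open J" "disjoint F" "E \<in> sets borel" "E \<subseteq> \<Union>F"
  shows "emeasure \<nu> E = (\<integral>\<^sup>+J. emeasure \<nu> (E \<inter> J) \<partial>count_space F)"
proof -
  have "emeasure \<nu> (\<Union>J\<in>F. E \<inter> J) = (\<integral>\<^sup>+J. emeasure \<nu> (E \<inter> J) \<partial>count_space F)"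
  proof (rule emeasure_UN_countable)
    show "countable F" by (rule countable_disjoint_open_subsets[OF assms(1,2)])
    show "E \<inter> J \<in> sets \<nu>" if "J \<in> F" for J using assms(1)[OF that] assms(3) by (intro borel_sets) auto
    show "disjoint_family_on (\<lambda>J. E \<inter> J) F" using assms(2) by (auto simp: disjoint_family_on_def pairwise_def disjnt_def)
  qed
  moreover have "(\<Union>J\<in>F. E \<inter> J) = E" using assms(4) by blast
  ultimately show ?thesis by simp
qed

lemma emeasure_Ioo_le_W: "a < b \<Longrightarrow> emeasure \<nu> {a<..<b} \<le> W a b"
proof -
  assume ab: "a < b"
  have "emeasure \<nu> {a<..<b} = (\<integral>\<^sup>+x. indicator {a<..<b} x \<partial>\<nu>)" by (rule nn_integral_indicator[symmetric]) (simp add: borel_sets)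
  also have "\<dots> \<le> W a b" unfolding W_def by (intro nn_integral_mono) (auto simp: tail_eq_1 split: split_indicator)
  finally show ?thesis .
qed

text \<open>The decreasing open sets \<open>U i\<close> stand for the superlevel sets of the operator, joined
  with those of the maximal function, and \<open>N i\<close> for the latter. Seen from a point outside
  \<open>U i\<close>, the next set is sparse to the right, and very sparse to the left once \<open>N i\<close> is
  removed from it.\<close>
context
  fixes U N :: "nat \<Rightarrow> real set" and \<alpha>0 \<beta>0 \<eta> \<theta> :: real
  assumes openU: "\<And>i. open (U i)" and decU: "\<And>i. U (Suc i) \<subseteq> U i"
    and J0: "\<alpha>0 < \<beta>0" "U 0 \<subseteq> {\<alpha>0<..<\<beta>0}" and N: "\<And>i. N i \<in> sets borel"
    and \<eta>\<theta>: "\<eta> \<ge> 0" "\<theta> \<ge> 0"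
    and left: "\<And>i a l. a \<notin> U i \<Longrightarrow> l > 0 \<Longrightarrow> emeasure lborel (U (Suc i) \<inter> {a<..<a + l}) \<le> ennreal (\<eta> * l)"
    and right: "\<And>i b \<alpha>. b \<notin> U i \<Longrightarrow> \<alpha> < b \<Longrightarrow> emeasure lborel ((U (Suc i) - N i) \<inter> {\<alpha><..<b}) \<le> ennreal (\<theta> * (b - \<alpha>))"
    and finW: "W \<alpha>0 \<beta>0 < \<infinity>"
begin

text \<open>At the lowest level a single interval around \<open>U 0\<close> replaces the components, so that
  the recursion starts with an explicit \<open>W\<close>, which can be compared with the maximal
  function.\<close>
definition fam :: "nat \<Rightarrow> real set set" where
  "fam i = (if i = 0 then {{\<alpha>0<..<\<beta>0}} else components (U i))"

lemma U_sub: "U i \<subseteq> {\<alpha>0<..<\<beta>0}"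
  by (induction i) (use J0 decU in blast)+

lemma bU: "bounded (U i)" using U_sub bounded_subset[OF bounded_Ioo] by blast

lemma fam_oivl: assumes "J \<in> fam i" shows "oivl J" "Inf J \<notin> U i" "Sup J \<notin> U i"
proof -
  have "oivl J \<and> Inf J \<notin> U i \<and> Sup J \<notin> U i"
  proof (cases "i = 0")
    case True
    then have J: "J = {\<alpha>0<..<\<beta>0}" using assms by (simp add: fam_def)
    then show ?thesis using J0 True oivl_Ioo[OF J0(1)] by auto
  next
    case False
    then have "J \<in> components (U i)" using assms by (simp add: fam_def)
    from oivl_components[OF openU bU this] open_component_interval(3,4)[OF openU bU this] show ?thesis by simp
  qed
  then show "oivl J" "Inf J \<notin> U i" "Sup J \<notin> U i" by auto
qed

lemma fam_disjoint: "disjoint (fam i)"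
  using pairwise_disjoint_components[of "U i"] by (auto simp: fam_def pairwise_def disjnt_def)

lemma fam_cover: "U i \<subseteq> \<Union>(fam i)" using U_sub[of i] by (auto simp: fam_def)

lemma fam_ivl: "ivl_family (fam i) r"
  using fam_oivl(1) fam_disjoint r1 by (simp add: ivl_family_def)

definition total_W :: "nat \<Rightarrow> ennreal" where "total_W i = (\<integral>\<^sup>+J. W (Inf J) (Sup J) \<partial>count_space (fam i))"
definition mass :: "nat \<Rightarrow> ennreal" where "mass i = emeasure \<nu> (\<Union>(fam i))"

lemma mass_eq: "mass i = (\<integral>\<^sup>+J. emeasure \<nu> J \<partial>count_space (fam i))"
proof -
  have o: "open J" if "J \<in> fam i" for J using fam_oivl(1)[OF that] by (rule oivl_open)
  have "mass i = (\<integral>\<^sup>+J. emeasure \<nu> (\<Union>(fam i) \<inter> J) \<partial>count_space (fam i))"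
    unfolding mass_def by (rule emeasure_split_open_family[OF o fam_disjoint]) (use o in \<open>auto intro!: borel_open open_Union\<close>)
  also have "\<dots> = (\<integral>\<^sup>+J. emeasure \<nu> J \<partial>count_space (fam i))"
    by (intro nn_integral_cong arg_cong[where f="emeasure \<nu>"]) auto
  finally show ?thesis .
qed

text \<open>Each component of \<open>U (Suc i)\<close> lies in some member of \<open>fam i\<close>, and the members are
  treated one by one with \<open>tail_sum_recursion\<close>.\<close>
lemma total_W_Suc: "total_W (Suc i) \<le> ennreal (real m * A) * mass i + ennreal (D2 * gq ^ m + D1 * \<eta> powr r) * total_W i"
proof -
  let ?F = "fam (Suc i)"
  interpret F: ivl_family ?F r by (rule fam_ivl)
  have cF: "countable (fam i)" using ivl_family.cnt[OF fam_ivl] .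
  let ?sub = "\<lambda>J. {J' \<in> ?F. J' \<subseteq> J}"
  have "total_W (Suc i) \<le> (\<integral>\<^sup>+J'. \<integral>\<^sup>+J. W (Inf J') (Sup J') * indicator {J. J' \<subseteq> J} J \<partial>count_space (fam i) \<partial>count_space ?F)"
    unfolding total_W_def
  proof (rule nn_integral_mono)
    fix J' assume "J' \<in> space (count_space ?F)"
    then have J': "J' \<in> components (U (Suc i))" by (simp add: fam_def)
    have "\<exists>J\<in>fam i. J' \<subseteq> J"
    proof (cases "i = 0")
      case True
      then show ?thesis using in_components_subset[OF J'] U_sub[of "Suc i"] by (auto simp: fam_def)
    next
      case False
      obtain x where x: "x \<in> J'" using in_components_nonempty[OF J'] by auto
      have sub: "J' \<subseteq> U i" using in_components_subset[OF J'] decU[of i] by auto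
      then obtain J where J: "J \<in> components (U i)" "x \<in> J" using x by (metis UnionE Union_components subsetD)
      have "J' \<subseteq> J" using components_maximal[OF J(1) in_components_connected[OF J'] sub] J(2) x by blast
      then show ?thesis using J False by (auto simp: fam_def)
    qed
    then obtain J where J: "J \<in> fam i" "J' \<subseteq> J" by blast
    have "W (Inf J') (Sup J') * indicator {J. J' \<subseteq> J} J \<le> (\<integral>\<^sup>+J. W (Inf J') (Sup J') * indicator {J. J' \<subseteq> J} J \<partial>count_space (fam i))"
      by (rule nn_integral_ge_point[OF J(1)])
    then show "W (Inf J') (Sup J') \<le> (\<integral>\<^sup>+J. W (Inf J') (Sup J') * indicator {J. J' \<subseteq> J} J \<partial>count_space (fam i))"
      using J(2) by simp
  qed
  also have "\<dots> = (\<integral>\<^sup>+J. \<integral>\<^sup>+J'. W (Inf J') (Sup J') * indicator {J. J' \<subseteq> J} J \<partial>count_space ?F \<partial>count_space (fam i))"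
    by (rule nn_integral_count_space_nn_integral[OF cF]) simp
  also have "\<dots> \<le> (\<integral>\<^sup>+J. ennreal (real m * A) * emeasure \<nu> J + ennreal (D2 * gq ^ m + D1 * \<eta> powr r) * W (Inf J) (Sup J) \<partial>count_space (fam i))"
  proof (rule nn_integral_mono)
    fix J assume "J \<in> space (count_space (fam i))"
    then have J: "J \<in> fam i" by simp
    have Jab: "J = {Inf J<..<Sup J}" "Inf J < Sup J" using fam_oivl(1)[OF J] by (auto simp: oivl_def)
    have "(\<integral>\<^sup>+J'. W (Inf J') (Sup J') * indicator {J. J' \<subseteq> J} J \<partial>count_space ?F) = (\<integral>\<^sup>+J'. W (Inf J') (Sup J') \<partial>count_space (?sub J))"
      by (subst nn_integral_count_space_indicator[of "?sub J"], simp, subst nn_integral_count_space_indicator, simp)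
         (auto intro!: nn_integral_cong split: split_indicator)
    also have "\<dots> \<le> ennreal (real m * A) * emeasure \<nu> {Inf J<..<Sup J} + ennreal (D2 * gq ^ m + D1 * \<eta> powr r) * W (Inf J) (Sup J)"
    proof (rule tail_sum_recursion[OF F.subfamily _ Jab(2) \<eta>\<theta>(1)])
      show "J' \<subseteq> {Inf J<..<Sup J}" if "J' \<in> ?sub J" for J' using that Jab(1) by auto
      fix l :: real assume l: "l > 0"
      have "emeasure lborel (\<Union>(?sub J) \<inter> {Inf J<..<Inf J + l}) \<le> emeasure lborel (U (Suc i) \<inter> {Inf J<..<Inf J + l})"
      proof (rule emeasure_mono)
        have "\<Union>(?sub J) \<subseteq> U (Suc i)" using in_components_subset by (auto simp: fam_def)
        then show "\<Union>(?sub J) \<inter> {Inf J<..<Inf J + l} \<subseteq> U (Suc i) \<inter> {Inf J<..<Inf J + l}" by blast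
      qed (use openU in auto)
      also have "\<dots> \<le> ennreal (\<eta> * l)" by (rule left[OF fam_oivl(2)[OF J] l])
      finally show "emeasure lborel (\<Union>(?sub J) \<inter> {Inf J<..<Inf J + l}) \<le> ennreal (\<eta> * l)" .
    qed auto
    finally show "(\<integral>\<^sup>+J'. W (Inf J') (Sup J') * indicator {J. J' \<subseteq> J} J \<partial>count_space ?F) \<le> ennreal (real m * A) * emeasure \<nu> J + ennreal (D2 * gq ^ m + D1 * \<eta> powr r) * W (Inf J) (Sup J)"
      using Jab(1) by simp
  qed
  also have "\<dots> = ennreal (real m * A) * mass i + ennreal (D2 * gq ^ m + D1 * \<eta> powr r) * total_W i"
    unfolding mass_eq total_W_def by (simp add: nn_integral_add nn_integral_cmult)
  finally show ?thesis .
qed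

lemma emeasure_U_Suc: "emeasure \<nu> (U (Suc i)) \<le> emeasure \<nu> (N i) + ennreal (C1 * \<theta> powr \<epsilon>) * total_W i"
proof -
  let ?E = "U (Suc i) - N i"
  have mE: "?E \<in> sets borel" using openU[of "Suc i"] N[of i] by auto
  have o: "open J" if "J \<in> fam i" for J using fam_oivl(1)[OF that] by (rule oivl_open)
  have "emeasure \<nu> (U (Suc i)) \<le> emeasure \<nu> (N i \<union> ?E)" by (rule emeasure_mono, blast, intro borel_sets sets.Un N mE)
  also have "\<dots> \<le> emeasure \<nu> (N i) + emeasure \<nu> ?E" using mE N by (intro emeasure_subadditive borel_sets) auto
  also have "emeasure \<nu> ?E = (\<integral>\<^sup>+J. emeasure \<nu> (?E \<inter> J) \<partial>count_space (fam i))"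
    by (rule emeasure_split_open_family[OF o fam_disjoint mE]) (use fam_cover[of i] decU[of i] in blast)+
  also have "\<dots> \<le> (\<integral>\<^sup>+J. ennreal (C1 * \<theta> powr \<epsilon>) * W (Inf J) (Sup J) \<partial>count_space (fam i))"
  proof (rule nn_integral_mono)
    fix J assume "J \<in> space (count_space (fam i))"
    then have J: "J \<in> fam i" by simp
    have Jab: "J = {Inf J<..<Sup J}" "Inf J < Sup J" using fam_oivl(1)[OF J] by (auto simp: oivl_def)
    show "emeasure \<nu> (?E \<inter> J) \<le> ennreal (C1 * \<theta> powr \<epsilon>) * W (Inf J) (Sup J)"
    proof (rule sparse_le[OF Jab(2) _ _ \<eta>\<theta>(2)])
      show "?E \<inter> J \<in> sets borel" using mE o[OF J] by auto
      show "?E \<inter> J \<subseteq> {Inf J<..<Sup J}" using Jab(1) by auto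
      fix \<alpha> assume \<alpha>: "Inf J \<le> \<alpha>" "\<alpha> < Sup J"
      have "emeasure lborel (?E \<inter> J \<inter> {\<alpha><..<Sup J}) \<le> emeasure lborel (?E \<inter> {\<alpha><..<Sup J})"
        using mE by (intro emeasure_mono) auto
      also have "\<dots> \<le> ennreal (\<theta> * (Sup J - \<alpha>))" by (rule right[OF fam_oivl(3)[OF J] \<alpha>(2)])
      finally show "emeasure lborel (?E \<inter> J \<inter> {\<alpha><..<Sup J}) \<le> ennreal (\<theta> * (Sup J - \<alpha>))" .
    qed
  qed
  also have "\<dots> = ennreal (C1 * \<theta> powr \<epsilon>) * total_W i" unfolding total_W_def by (simp add: nn_integral_cmult)
  finally show ?thesis by (simp add: add_left_mono)
qed

lemma total_W_0: "total_W 0 = W \<alpha>0 \<beta>0"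
  unfolding total_W_def fam_def using J0 by (simp add: nn_integral_count_space_finite)

lemma mass_Suc: "mass (Suc i) = emeasure \<nu> (U (Suc i))" by (simp add: mass_def fam_def)

lemma U_le_mass: "emeasure \<nu> (U i) \<le> mass i"
  unfolding mass_def using fam_cover oivl_open[OF fam_oivl(1)] by (intro emeasure_mono borel_sets) (auto intro!: borel_open open_Union)

lemma mass_le_total_W_0: "mass i \<le> total_W 0"
proof -
  have "mass i \<le> emeasure \<nu> {\<alpha>0<..<\<beta>0}"
  proof (cases i)
    case 0
    then show ?thesis by (simp add: mass_def fam_def)
  next
    case (Suc j)
    then show ?thesis using U_sub[of i] by (auto simp: mass_Suc intro!: emeasure_mono borel_sets)
  qed
  also have "\<dots> \<le> total_W 0" unfolding total_W_0 by (rule emeasure_Ioo_le_W[OF J0(1)])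
  finally show ?thesis .
qed

lemma total_W_finite: "total_W i < \<infinity>"
proof (induction i)
  case 0
  then show ?case using finW by (simp add: total_W_0)
next
  case (Suc i)
  have "mass i < \<infinity>" using mass_le_total_W_0[of i] finW by (auto simp: total_W_0 intro: le_less_trans)
  then have "ennreal (real 0 * A) * mass i + ennreal (D2 * gq ^ 0 + D1 * \<eta> powr r) * total_W i < \<infinity>"
    using Suc by (auto simp: ennreal_mult_less_top)
  then show ?case using total_W_Suc[of i 0] by (rule le_less_trans[rotated])
qed

text \<open>With \<open>X\<close> and \<open>Y\<close> the weighted sums of \<open>total_W\<close> and of \<open>mass\<close>, the recursions read
  \<open>X \<le> W \<alpha>0 \<beta>0 + k Y + X / 2\<close> and \<open>Y \<le> W \<alpha>0 \<beta>0 + q B + \<delta> X\<close>. Since both sums are finite and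
  \<open>2 k \<delta> \<le> 1 / 2\<close>, they can be solved for \<open>Y\<close>.\<close>
theorem good_lambda_sum:
  assumes q: "q \<ge> 0" and rec: "q * (D2 * gq ^ m + D1 * \<eta> powr r) \<le> 1/2"
    and d1: "q * (C1 * \<theta> powr \<epsilon>) \<le> 1" and d2: "q * (C1 * \<theta> powr \<epsilon>) * (2 * (q * (real m * A))) \<le> 1/2"
  shows "(\<Sum>i\<le>n. ennreal (q ^ i) * emeasure \<nu> (U i)) \<le> 6 * W \<alpha>0 \<beta>0 + 2 * (ennreal q * (\<Sum>i<n. ennreal (q ^ i) * emeasure \<nu> (N i)))"
proof -
  define X where "X = (\<Sum>i\<le>n. ennreal (q ^ i) * total_W i)"
  define Y where "Y = (\<Sum>i\<le>n. ennreal (q ^ i) * mass i)"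
  define B where "B = (\<Sum>i<n. ennreal (q ^ i) * emeasure \<nu> (N i))"
  define k where "k = q * (real m * A)"
  define \<delta> where "\<delta> = q * (C1 * \<theta> powr \<epsilon>)"
  have k0: "k \<ge> 0" and \<delta>0: "\<delta> \<ge> 0" and \<kappa>0: "D2 * gq ^ m + D1 * \<eta> powr r \<ge> 0"
    using q A_pos C1_pos D2_pos D1_pos gq by (auto simp: k_def \<delta>_def)
  have less_le: "(\<Sum>i<n. ennreal (q ^ i) * h i) \<le> (\<Sum>i\<le>n. ennreal (q ^ i) * h i)" for h
    by (rule sum_mono2) auto
  have shift: "(\<Sum>i\<le>n. ennreal (q ^ i) * h i) = h 0 + (\<Sum>i<n. ennreal (q ^ Suc i) * h (Suc i))" for h
    using sum.atMost_shift[of "\<lambda>i. ennreal (q ^ i) * h i" n] by simp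
  have finX: "X < \<infinity>" unfolding X_def using total_W_finite by (auto simp: ennreal_mult_less_top)
  have finY: "Y < \<infinity>" unfolding Y_def using mass_le_total_W_0 total_W_finite[of 0] by (auto simp: ennreal_mult_less_top intro: le_less_trans)
  have "X = total_W 0 + (\<Sum>i<n. ennreal (q ^ Suc i) * total_W (Suc i))" unfolding X_def by (rule shift)
  also have "\<dots> \<le> total_W 0 + (\<Sum>i<n. ennreal k * (ennreal (q ^ i) * mass i) + ennreal (1/2) * (ennreal (q ^ i) * total_W i))"
  proof (intro add_left_mono sum_mono)
    fix i
    have "ennreal (q ^ Suc i) * total_W (Suc i) \<le> ennreal (q ^ Suc i) * (ennreal (real m * A) * mass i + ennreal (D2 * gq ^ m + D1 * \<eta> powr r) * total_W i)"
      by (intro mult_left_mono total_W_Suc) simp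
    also have "\<dots> = (ennreal q * ennreal (real m * A)) * (ennreal (q ^ i) * mass i) + (ennreal q * ennreal (D2 * gq ^ m + D1 * \<eta> powr r)) * (ennreal (q ^ i) * total_W i)"
      using q by (simp add: ennreal_mult distrib_left ac_simps)
    also have "ennreal q * ennreal (real m * A) = ennreal k" unfolding k_def using q A_pos by (intro ennreal_mult[symmetric]) auto
    also have "ennreal q * ennreal (D2 * gq ^ m + D1 * \<eta> powr r) = ennreal (q * (D2 * gq ^ m + D1 * \<eta> powr r))"
      using q \<kappa>0 by (intro ennreal_mult[symmetric]) auto
    also have "ennreal k * (ennreal (q ^ i) * mass i) + ennreal (q * (D2 * gq ^ m + D1 * \<eta> powr r)) * (ennreal (q ^ i) * total_W i)
        \<le> ennreal k * (ennreal (q ^ i) * mass i) + ennreal (1/2) * (ennreal (q ^ i) * total_W i)"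
      by (intro add_left_mono mult_right_mono ennreal_leI rec) simp
    finally show "ennreal (q ^ Suc i) * total_W (Suc i) \<le> ennreal k * (ennreal (q ^ i) * mass i) + ennreal (1/2) * (ennreal (q ^ i) * total_W i)" .
  qed
  also have "\<dots> = total_W 0 + (ennreal k * (\<Sum>i<n. ennreal (q ^ i) * mass i) + ennreal (1/2) * (\<Sum>i<n. ennreal (q ^ i) * total_W i))"
    by (simp add: sum.distrib sum_distrib_left)
  also have "\<dots> \<le> total_W 0 + (ennreal k * Y + ennreal (1/2) * X)"
    unfolding X_def Y_def by (intro add_left_mono add_mono mult_left_mono less_le) auto
  finally have "X \<le> (total_W 0 + ennreal k * Y) + ennreal (1/2) * X" by (simp add: add.assoc)
  then have X: "X \<le> 2 * (total_W 0 + ennreal k * Y)" by (rule ennreal_absorb_half[OF _ finX])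
  have "Y = mass 0 + (\<Sum>i<n. ennreal (q ^ Suc i) * mass (Suc i))" unfolding Y_def by (rule shift)
  also have "\<dots> \<le> total_W 0 + (\<Sum>i<n. ennreal q * (ennreal (q ^ i) * emeasure \<nu> (N i)) + ennreal \<delta> * (ennreal (q ^ i) * total_W i))"
  proof (intro add_mono sum_mono mass_le_total_W_0)
    fix i
    have "ennreal (q ^ Suc i) * mass (Suc i) \<le> ennreal (q ^ Suc i) * (emeasure \<nu> (N i) + ennreal (C1 * \<theta> powr \<epsilon>) * total_W i)"
      unfolding mass_Suc by (intro mult_left_mono emeasure_U_Suc) simp
    also have "\<dots> = ennreal q * (ennreal (q ^ i) * emeasure \<nu> (N i)) + (ennreal q * ennreal (C1 * \<theta> powr \<epsilon>)) * (ennreal (q ^ i) * total_W i)"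
      using q by (simp add: ennreal_mult distrib_left ac_simps)
    also have "ennreal q * ennreal (C1 * \<theta> powr \<epsilon>) = ennreal \<delta>" unfolding \<delta>_def using q C1_pos by (intro ennreal_mult[symmetric]) auto
    finally show "ennreal (q ^ Suc i) * mass (Suc i) \<le> ennreal q * (ennreal (q ^ i) * emeasure \<nu> (N i)) + ennreal \<delta> * (ennreal (q ^ i) * total_W i)" .
  qed
  also have "\<dots> = total_W 0 + (ennreal q * B + ennreal \<delta> * (\<Sum>i<n. ennreal (q ^ i) * total_W i))"
    unfolding B_def by (simp add: sum.distrib sum_distrib_left)
  also have "\<dots> \<le> total_W 0 + (ennreal q * B + ennreal \<delta> * (2 * (total_W 0 + ennreal k * Y)))"
    using order_trans[OF less_le[of total_W] X[unfolded X_def]] by (intro add_left_mono mult_left_mono) auto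
  also have "\<dots> = total_W 0 + ennreal q * B + 2 * (ennreal \<delta> * total_W 0) + (ennreal \<delta> * 2 * ennreal k) * Y"
    by (simp add: distrib_left ac_simps)
  also have "\<dots> \<le> total_W 0 + ennreal q * B + 2 * (1 * total_W 0) + ennreal (1/2) * Y"
  proof (intro add_mono mult_left_mono mult_right_mono order_refl)
    show "ennreal \<delta> \<le> 1" using d1 by (simp add: \<delta>_def)
    have "ennreal \<delta> * 2 * ennreal k = ennreal (\<delta> * (2 * k))"
      using \<delta>0 k0 ennreal_mult[of \<delta> "2 * k"] ennreal_mult[of 2 k] by (simp add: mult.assoc)
    also have "\<dots> \<le> ennreal (1/2)" using d2 by (intro ennreal_leI) (simp add: \<delta>_def k_def)
    finally show "ennreal \<delta> * 2 * ennreal k \<le> ennreal (1/2)" .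
  qed auto
  finally have "Y \<le> 2 * (total_W 0 + ennreal q * B + 2 * (1 * total_W 0))" by (rule ennreal_absorb_half[OF _ finY])
  also have "\<dots> = 6 * total_W 0 + 2 * (ennreal q * B)"
  proof -
    have "2 * (total_W 0 + ennreal q * B + 2 * (1 * total_W 0)) = (2 + 4) * total_W 0 + 2 * (ennreal q * B)"
      unfolding distrib_right by (simp add: distrib_left ac_simps)
    then show ?thesis by simp
  qed
  finally have "Y \<le> 6 * total_W 0 + 2 * (ennreal q * B)" .
  moreover have "(\<Sum>i\<le>n. ennreal (q ^ i) * emeasure \<nu> (U i)) \<le> Y"
    unfolding Y_def by (intro sum_mono mult_left_mono U_le_mass) simp
  ultimately show ?thesis unfolding total_W_0 B_def by simp
qed

end

end

section \<open>Level sets and the maximal operator\<close>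

lemma Phi_antimono: "0 < \<mu> \<Longrightarrow> \<mu> \<le> \<mu>' \<Longrightarrow> Phi (\<bar>z\<bar> / \<mu>') \<le> Phi (\<bar>z\<bar> / \<mu>)"
  by (intro Phi_mono divide_left_mono) auto

lemma Phi_shrink:
  assumes "0 < t" "t \<le> \<mu>" shows "Phi (\<bar>z\<bar> / \<mu>) \<le> t / \<mu> * Phi (\<bar>z\<bar> / t)"
proof -
  have "Phi (t / \<mu> * (\<bar>z\<bar> / t)) \<le> t / \<mu> * Phi (\<bar>z\<bar> / t)" using assms by (intro Phi_scale) auto
  then show ?thesis using assms by simp
qed

lemma cumul_cmult: "nice f \<Longrightarrow> a \<le> b \<Longrightarrow> cumul (\<lambda>x. k * f x) b - cumul (\<lambda>x. k * f x) a = k * (cumul f b - cumul f a)"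
  by (simp add: cumul_diff nice_cmult)

lemma lvl_antimono:
  assumes "nice f" "0 < \<mu>" "\<mu> \<le> \<mu>'" shows "lvl f \<mu>' \<subseteq> lvl f \<mu>"
proof
  fix x assume "x \<in> lvl f \<mu>'"
  then obtain h where h: "h > 0" "1 * h < cumul (\<lambda>x. Phi (\<bar>f x\<bar> / \<mu>')) (x + h) - cumul (\<lambda>x. Phi (\<bar>f x\<bar> / \<mu>')) x"
    unfolding lvl_def rising_def by auto
  note h(2)
  also have "cumul (\<lambda>x. Phi (\<bar>f x\<bar> / \<mu>')) (x + h) - cumul (\<lambda>x. Phi (\<bar>f x\<bar> / \<mu>')) x \<le> cumul (\<lambda>x. Phi (\<bar>f x\<bar> / \<mu>)) (x + h) - cumul (\<lambda>x. Phi (\<bar>f x\<bar> / \<mu>)) x"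
    using assms h(1) by (intro cumul_le nice_Phi Phi_antimono) auto
  finally show "x \<in> lvl f \<mu>" using h(1) unfolding lvl_def rising_def by auto
qed

text \<open>Windows which start in \<open>(a, a + l)\<close> and witness the level \<open>K \<mu>\<close> end before \<open>a + 2 l\<close>,
  because longer ones would contradict the choice of \<open>a\<close>. The part of \<open>Phi (\<bar>f x\<bar> / \<mu>)\<close> on
  \<open>[a, a + 2 l]\<close> has integral at most \<open>2 l\<close>, and its rising set at height \<open>K\<close> contains the
  set in question.\<close>
lemma lvl_density:
  assumes f: "nice f" and \<mu>: "\<mu> > 0" and K: "K \<ge> 3" and a: "a \<notin> lvl f \<mu>" and l: "l > 0"
  shows "emeasure lborel (lvl f (K * \<mu>) \<inter> {a<..<a + l}) \<le> ennreal (2 * l / K)"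
proof -
  let ?\<Phi> = "\<lambda>x. Phi (\<bar>f x\<bar> / \<mu>)" and ?\<Psi> = "\<lambda>x. Phi (\<bar>f x\<bar> / (K * \<mu>))"
  have K\<mu>: "K * \<mu> > 0" "\<mu> \<le> K * \<mu>" using K \<mu> by auto
  note n1 = nice_Phi[OF f \<mu>] and n2 = nice_Phi[OF f K\<mu>(1)]
  define \<phi> where "\<phi> = (\<lambda>x. indicator {a..a + 2 * l} x * ?\<Phi> x)"
  have n\<phi>: "nice \<phi>" unfolding \<phi>_def by (rule nice_indicator[OF n1]) simp
  have \<phi>0: "\<phi> x \<ge> 0" for x unfolding \<phi>_def using Phi_quot_nonneg[OF \<mu>] by (auto split: split_indicator)
  have "lvl f (K * \<mu>) \<inter> {a<..<a + l} \<subseteq> rising \<phi> K"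
  proof
    fix x assume x: "x \<in> lvl f (K * \<mu>) \<inter> {a<..<a + l}"
    then obtain h where h: "h > 0" "h < cumul ?\<Psi> (x + h) - cumul ?\<Psi> x" unfolding lvl_def rising_def by auto
    have "cumul ?\<Psi> (x + h) - cumul ?\<Psi> x \<le> cumul (\<lambda>x. 1 / K * ?\<Phi> x) (x + h) - cumul (\<lambda>x. 1 / K * ?\<Phi> x) x"
    proof (rule cumul_le[OF n2 nice_cmult[OF n1]])
      show "?\<Psi> x \<le> 1 / K * ?\<Phi> x" for x using Phi_shrink[OF \<mu> K\<mu>(2), of "f x"] \<mu> by simp
    qed (use h in simp)
    also have "\<dots> = 1 / K * (cumul ?\<Phi> (x + h) - cumul ?\<Phi> x)" by (rule cumul_cmult[OF n1]) (use h in simp)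
    finally have "h < 1 / K * (cumul ?\<Phi> (x + h) - cumul ?\<Phi> x)" using h(2) by linarith
    then have Kh: "K * h < cumul ?\<Phi> (x + h) - cumul ?\<Phi> x" using K by (simp add: pos_less_divide_eq mult.commute)
    also have "\<dots> \<le> cumul ?\<Phi> (x + h) - cumul ?\<Phi> a"
      using cumul_mono[OF n1 Phi_quot_nonneg[OF \<mu>], of a x] x by auto
    also have "\<dots> \<le> 1 * (x + h - a)" using a x h unfolding lvl_def by (intro not_risingD) auto
    finally have "K * h < x + h - a" by simp
    moreover have "3 * h \<le> K * h" using K h by (intro mult_right_mono) auto
    moreover have "a < x" "x < a + l" using x by auto
    ultimately have "x + h \<le> a + 2 * l" using h(1) by linarith
    then have "(LBINT y:{x<..x + h}. ?\<Phi> y) = (LBINT y:{x<..x + h}. \<phi> y)"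
      using \<open>a < x\<close> by (intro set_lebesgue_integral_cong) (auto simp: \<phi>_def)
    then have "cumul ?\<Phi> (x + h) - cumul ?\<Phi> x = cumul \<phi> (x + h) - cumul \<phi> x"
      using cumul_diff[OF n1, of x "x + h"] cumul_diff[OF n\<phi>, of x "x + h"] h(1) by simp
    then show "x \<in> rising \<phi> K" using Kh h unfolding rising_def by auto
  qed
  then have "emeasure lborel (lvl f (K * \<mu>) \<inter> {a<..<a + l}) \<le> emeasure lborel (rising \<phi> K)"
    using open_rising[OF n\<phi>] by (intro emeasure_mono) auto
  also have "\<dots> \<le> ennreal (2 * l / K)"
  proof -
    have "(\<integral>\<^sup>+x. ennreal (\<phi> x) \<partial>lborel) = (\<integral>\<^sup>+x\<in>{a..a + 2 * l}. ennreal (?\<Phi> x) \<partial>lborel)"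
      unfolding \<phi>_def by (intro nn_integral_cong) (auto split: split_indicator)
    also have "\<dots> = ennreal (cumul ?\<Phi> (a + 2 * l) - cumul ?\<Phi> a)"
      by (rule nn_cumul_diff[OF n1 Phi_quot_nonneg[OF \<mu>]]) (use l in simp)
    also have "\<dots> \<le> ennreal (1 * (a + 2 * l - a))"
      using a l unfolding lvl_def by (intro ennreal_leI not_risingD) auto
    finally have "ennreal K * emeasure lborel (rising \<phi> K) \<le> ennreal (2 * l)"
      using emeasure_rising_le[OF n\<phi> \<phi>0, of K] K by (auto intro: order_trans)
    then have "ennreal (1 / K) * (ennreal K * emeasure lborel (rising \<phi> K)) \<le> ennreal (1 / K) * ennreal (2 * l)"
      by (rule mult_left_mono) simp
    moreover have "ennreal (1 / K) * (ennreal K * emeasure lborel (rising \<phi> K)) = emeasure lborel (rising \<phi> K)"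
      using K by (simp add: mult.assoc[symmetric] ennreal_mult[symmetric])
    moreover have "ennreal (1 / K) * ennreal (2 * l) = ennreal (2 * l / K)" using K l by (simp add: ennreal_mult[symmetric])
    ultimately show ?thesis by simp
  qed
  finally show ?thesis .
qed

lemma le_Luxemburg_Icc:
  assumes f: "nice f" and h: "h > 0"
    and t: "\<And>t. t > 0 \<Longrightarrow> cumul (\<lambda>x. Phi (\<bar>f x\<bar> / t)) (x + h) - cumul (\<lambda>x. Phi (\<bar>f x\<bar> / t)) x \<le> h \<Longrightarrow> u \<le> t"
  shows "ennreal u \<le> M_LlogL_plus f x"
proof -
  have "ennreal u \<le> Luxemburg (\<lambda>t. t * (1 + log_plus t)) f {x..x + h}"
    unfolding Luxemburg_def Phi_def[symmetric]
  proof (rule INF_greatest)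
    fix s :: real assume "s \<in> {t. 0 < t \<and> (\<integral>\<^sup>+ y\<in>{x..x + h}. ennreal (Phi (\<bar>f y\<bar> / t)) \<partial>lebesgue) / emeasure lebesgue {x..x + h} \<le> 1}"
    then have s: "0 < s" "set_nn_integral lebesgue {x..x + h} (\<lambda>y. ennreal (Phi (\<bar>f y\<bar> / s))) / emeasure lebesgue {x..x+h} \<le> 1"
      unfolding mem_Collect_eq by blast+
    note nP = nice_Phi[OF f s(1)]
    have [measurable]: "(\<lambda>y. Phi (\<bar>f y\<bar> / s)) \<in> borel_measurable borel" using nP nice_measurable by blast
    have "set_nn_integral lebesgue {x..x + h} (\<lambda>y. ennreal (Phi (\<bar>f y\<bar> / s))) = set_nn_integral lborel {x..x + h} (\<lambda>y. ennreal (Phi (\<bar>f y\<bar> / s)))"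
      by (rule nn_integral_completion)
    also have "\<dots> = ennreal (cumul (\<lambda>x. Phi (\<bar>f x\<bar> / s)) (x + h) - cumul (\<lambda>x. Phi (\<bar>f x\<bar> / s)) x)" (is "_ = ennreal ?v")
      by (rule nn_cumul_diff[OF nP Phi_quot_nonneg[OF s(1)]]) (use h in simp)
    finally have "ennreal ?v / ennreal h \<le> 1" using s(2) h by simp
    moreover have "?v \<ge> 0" using cumul_mono[OF nP Phi_quot_nonneg[OF s(1)], of x "x + h"] h by simp
    ultimately have "?v / h \<le> 1" using h by (simp add: divide_ennreal)
    then have "u \<le> s" using h by (intro t[OF s(1)]) (simp add: pos_divide_le_eq)
    then show "ennreal u \<le> ennreal s" by (rule ennreal_leI)
  qed
  also have "\<dots> \<le> M_LlogL_plus f x"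
    unfolding M_LlogL_plus_def M_Young_plus_def by (rule SUP_upper) (use h in simp)
  finally show ?thesis .
qed

lemma lvl_le_M:
  assumes f: "nice f" and \<mu>: "\<mu> > 0" and x: "x \<in> lvl f \<mu>" shows "ennreal \<mu> \<le> M_LlogL_plus f x"
proof -
  obtain h where h: "h > 0" "h < cumul (\<lambda>x. Phi (\<bar>f x\<bar> / \<mu>)) (x + h) - cumul (\<lambda>x. Phi (\<bar>f x\<bar> / \<mu>)) x"
    using x unfolding lvl_def rising_def by auto
  show ?thesis
  proof (rule le_Luxemburg_Icc[OF f h(1)])
    fix t :: real assume t: "t > 0" "cumul (\<lambda>x. Phi (\<bar>f x\<bar> / t)) (x + h) - cumul (\<lambda>x. Phi (\<bar>f x\<bar> / t)) x \<le> h"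
    show "\<mu> \<le> t"
    proof (rule ccontr)
      assume "\<not> \<mu> \<le> t"
      then have "cumul (\<lambda>x. Phi (\<bar>f x\<bar> / \<mu>)) (x + h) - cumul (\<lambda>x. Phi (\<bar>f x\<bar> / \<mu>)) x \<le> cumul (\<lambda>x. Phi (\<bar>f x\<bar> / t)) (x + h) - cumul (\<lambda>x. Phi (\<bar>f x\<bar> / t)) x"
        using t h(1) \<mu> by (intro cumul_le nice_Phi f Phi_antimono) auto
      then show False using t(2) h(2) by simp
    qed
  qed
qed

lemma cumul_left_const:
  assumes "nice g" "\<And>x. R < \<bar>x\<bar> \<Longrightarrow> g x = 0" "a \<le> b" "b \<le> -R" "R \<ge> 0"
  shows "cumul g a = cumul g b"
proof (cases "b = a")
  case False
  \<comment> \<open>The support may contain \<open>-R\<close>, so the claim at \<open>b = -R\<close> needs the continuity of the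
    primitive.\<close>
  have ev: "cumul g a = cumul g z" if "a \<le> z" "z < b" for z
    by (rule cumul_eq[OF assms(1)]) (use that assms in auto)
  have "\<forall>\<^sub>F z in at_left b. cumul g a = cumul g z"
    unfolding eventually_at_left_field using ev False assms(3) by (intro exI[of _ a]) auto
  moreover have "(cumul g \<longlongrightarrow> cumul g b) (at_left b)"
    using isCont_cumul[OF assms(1), of b] unfolding isCont_def by (rule tendsto_within_subset) simp
  ultimately have "((\<lambda>z. cumul g a) \<longlongrightarrow> cumul g b) (at_left b)" by (simp add: tendsto_cong)
  then show ?thesis by (simp add: tendsto_const_iff)
qed simp

lemma cumul_supp:
  assumes "nice g" "\<And>x. g x \<ge> 0" "\<And>x. R < \<bar>x\<bar> \<Longrightarrow> g x = 0" "R \<ge> 0" "a \<le> b"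
  shows "cumul g b - cumul g a \<le> cumul g R - cumul g (-R)"
proof -
  have "cumul g b \<le> cumul g (max b R)" by (rule cumul_mono[OF assms(1,2)]) simp
  also have "\<dots> = cumul g R" by (rule cumul_eq[symmetric, OF assms(1)]) (use assms(3,4) in auto)
  finally have "cumul g b \<le> cumul g R" .
  moreover have "cumul g (-R) = cumul g (min a (-R))"
    by (rule cumul_left_const[symmetric, OF assms(1,3)]) (use assms(4) in auto)
  moreover have "cumul g (min a (-R)) \<le> cumul g a" by (rule cumul_mono[OF assms(1,2)]) simp
  ultimately show ?thesis by simp
qed

lemma sqO_eq_0:
  assumes "nice f" "\<And>s. s > 0 \<Longrightarrow> cumul f (x + s) = cumul f x" shows "sqO f x = 0"
proof -
  have "avg s f x = 0" if "s > 0" for s using assms that by (simp add: avg_cumul)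
  moreover have "0 < s" if "2 powi n \<le> s" for s :: real and n :: int using less_le_trans[OF _ that] by simp
  ultimately have "osc f n x = 0" for n
    unfolding osc_def by (intro antisym SUP_least) auto
  then show ?thesis by (simp add: sqO_def)
qed

text \<open>At distance \<open>d\<close> to the left of the support, windows shorter than \<open>d\<close> see nothing, and
  longer ones have averages at most \<open>\<mu> d / s\<close>.\<close>
lemma sqO_left_of_support:
  assumes f: "nice f" and supp: "\<And>x. R < \<bar>x\<bar> \<Longrightarrow> f x = 0" and R: "R \<ge> 0" and d: "d > 0" "x = - R - d"
    and V: "cumul (\<lambda>x. \<bar>f x\<bar>) R - cumul (\<lambda>x. \<bar>f x\<bar>) (-R) \<le> \<mu> * d" and \<mu>: "\<mu> \<ge> 0"
  shows "sqO f x \<le> ennreal (22 * \<mu>\<^sup>2)"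
proof -
  let ?V = "cumul (\<lambda>x. \<bar>f x\<bar>)"
  define E where "E n = (if 2 powi n > d / 2 then 4 * \<mu>\<^sup>2 * d\<^sup>2 / (2 powi n)\<^sup>2 else 0)" for n :: int
  have "osc f n x \<le> ennreal (E n)" for n
    unfolding osc_def
  proof (rule SUP_least)
    fix s :: real assume s: "s \<in> {2 powi n..<2 powi (n + 1)}"
    define M where "M = (2::real) powi n"
    have M0: "M > 0" by (simp add: M_def)
    have s': "M \<le> s" "s < 2 * M" "s > 0" using s M0 by (auto simp: M_def power_int_add)
    show "ennreal ((avg (2 powi n) f x - avg s f x)\<^sup>2) \<le> ennreal (E n)"
    proof (cases "M > d / 2")
      case True
      have a: "\<bar>avg s f x\<bar> \<le> \<mu> * d / M" if "M \<le> s" for s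
      proof -
        have s0: "s > 0" using that M0 by simp
        have "\<bar>cumul f (x + s) - cumul f x\<bar> \<le> ?V (x + s) - ?V x" by (rule cumul_diff_abs[OF f]) (use s0 in simp)
        also have "\<dots> \<le> ?V R - ?V (-R)" by (rule cumul_supp[OF nice_abs[OF f]]) (use supp R s0 in auto)
        also have "\<dots> \<le> \<mu> * d" by (rule V)
        finally have "\<bar>avg s f x\<bar> \<le> \<mu> * d / s" using s0 by (simp add: avg_cumul[OF f] divide_right_mono)
        also have "\<dots> \<le> \<mu> * d / M" using that M0 s0 \<mu> d by (intro divide_left_mono mult_pos_pos) auto
        finally show ?thesis .
      qed
      have "\<bar>avg M f x - avg s f x\<bar> \<le> \<mu> * d / M + \<mu> * d / M" using a[of M] a[of s] s' by linarith
      then have "\<bar>avg M f x - avg s f x\<bar> \<le> 2 * \<mu> * d / M" by (simp add: add_divide_distrib[symmetric])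
      then have "(avg M f x - avg s f x)\<^sup>2 \<le> (2 * \<mu> * d / M)\<^sup>2" by (metis abs_ge_zero power2_abs power_mono)
      then show ?thesis using True by (auto simp: M_def E_def power_divide power_mult_distrib intro!: ennreal_leI)
    next
      case False
      have "avg s f x = 0" if "0 < s" "s \<le> 2 * M" for s
      proof -
        have "x + s \<le> - R" using that False d by simp
        then have "cumul f x = cumul f (x + s)" using that R by (intro cumul_left_const[OF f supp]) auto
        then show ?thesis using that by (simp add: avg_cumul[OF f])
      qed
      from this[of M] this[of s] show ?thesis using s' M0 by (simp add: M_def)
    qed
  qed
  then have "sqO f x \<le> (\<integral>\<^sup>+n. ennreal (E n) \<partial>count_space UNIV)" unfolding sqO_def by (intro nn_integral_mono)
  also have "\<dots> \<le> ennreal (4 / 3 * (4 * \<mu>\<^sup>2 * d\<^sup>2) / (d / 2)\<^sup>2)"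
    by (rule sum_powi_le) (use d in \<open>auto simp: E_def\<close>)
  also have "4 / 3 * (4 * \<mu>\<^sup>2 * d\<^sup>2) / (d / 2)\<^sup>2 = 64 / 3 * \<mu>\<^sup>2" using d by (simp add: power_divide)
  also have "ennreal (64 / 3 * \<mu>\<^sup>2) \<le> ennreal (22 * \<mu>\<^sup>2)" by (intro ennreal_leI mult_right_mono) auto
  finally show ?thesis .
qed

section \<open>Powers of extended numbers\<close>

lemma epowr_ennreal: "0 \<le> t \<Longrightarrow> epowr (ennreal t) a = ennreal (t powr a)"
  by (simp add: epowr_def)

lemma epowr_top: "epowr \<infinity> a = \<infinity>" "epowr top a = top"
  by (auto simp: epowr_def)

lemma epowr_mono: "a \<ge> 0 \<Longrightarrow> u \<le> v \<Longrightarrow> epowr u a \<le> epowr v a"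
proof (cases v)
  case (real v')
  assume a: "a \<ge> 0" "u \<le> v"
  then obtain u' where "u = ennreal u'" "u' \<ge> 0" using real by (cases u) (auto simp: top_unique)
  then show ?thesis using a real by (auto simp: epowr_ennreal intro!: ennreal_leI powr_mono2)
qed (simp add: epowr_top)

lemma epowr_epowr: "epowr (epowr u a) b = epowr u (a * b)"
  by (cases u) (auto simp: epowr_ennreal epowr_top powr_powr)

lemma epowr_strict_mono:
  assumes "a > 0" "u < v" shows "epowr u a < epowr v a"
proof -
  obtain u' where u: "u = ennreal u'" "u' \<ge> 0" using assms(2) by (cases u) auto
  show ?thesis
  proof (cases v)
    case (real v')
    then have "u' < v'" using assms(2) u by (simp add: ennreal_less_iff)
    then have "u' powr a < v' powr a" using u assms(1) by (intro powr_less_mono2) auto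
    then show ?thesis using u real by (simp add: epowr_ennreal ennreal_less_iff)
  qed (use u in \<open>simp add: epowr_ennreal epowr_top\<close>)
qed

lemma measurable_epowr[measurable]: "(\<lambda>x. epowr x a) \<in> borel_measurable borel"
  unfolding epowr_def by measurable

lemma powr_geometric:
  fixes \<Lambda> K p :: real
  assumes "\<Lambda> > 0" "K > 0" shows "(\<Lambda> * K ^ i) powr p = \<Lambda> powr p * (K powr p) ^ i"
proof -
  have "(K ^ i) powr p = (K powr real i) powr p" using assms by (simp add: powr_realpow)
  also have "\<dots> = (K powr p) powr real i" by (simp add: powr_powr mult.commute)
  also have "\<dots> = (K powr p) ^ i" using assms by (simp add: powr_realpow)
  finally have "(K ^ i) powr p = (K powr p) ^ i" .
  then show ?thesis using assms by (simp add: powr_mult)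
qed

text \<open>A geometric sum, dominated by its last level below \<open>v / \<gamma>\<close>.\<close>
lemma sum_levels_le:
  fixes v :: ennreal
  assumes K: "K > 1" and p: "p > 0" and \<Lambda>: "\<Lambda> > 0" and \<gamma>: "\<gamma> > 0"
  shows "(\<Sum>i<n. ennreal ((\<Lambda> * K ^ i) powr p) * indicator {u. ennreal (\<gamma> * (\<Lambda> * K ^ i)) \<le> u} v)
    \<le> ennreal ((1 / \<gamma>) powr p * (K powr p / (K powr p - 1))) * epowr v p"
proof (cases v)
  case (real v')
  define q where "q = K powr p"
  have q: "q > 1" using K p by (simp add: q_def)
  define T where "T i = (if \<gamma> * (\<Lambda> * K ^ i) \<le> v' then (\<Lambda> * K ^ i) powr p else 0)" for i
  have pw: "(\<Lambda> * K ^ i) powr p = \<Lambda> powr p * q ^ i" for i using powr_geometric[OF \<Lambda>, of K i p] K by (simp add: q_def)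
  define B where "B = (1 / \<gamma>) powr p * (q / (q - 1)) * v' powr p"
  have B0: "B \<ge> 0" using q by (simp add: B_def)
  have *: "(\<Sum>i<n. T i) \<le> B \<and> (\<Sum>i<n. T i) \<le> \<Lambda> powr p * q ^ n / (q - 1)" for n
  proof (induction n)
    case 0
    then show ?case using B0 q by simp
  next
    case (Suc n)
    have s2: "\<Lambda> powr p * q ^ n / (q - 1) + \<Lambda> powr p * q ^ n = \<Lambda> powr p * q ^ Suc n / (q - 1)"
      using q by (simp add: field_simps)
    have s3: "\<Lambda> powr p * q ^ n / (q - 1) \<le> \<Lambda> powr p * q ^ Suc n / (q - 1)"
      using q by (intro divide_right_mono mult_left_mono) auto
    show ?case
    proof (cases "\<gamma> * (\<Lambda> * K ^ n) \<le> v'")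
      case True
      have "(\<Lambda> * K ^ n) powr p \<le> (1 / \<gamma> * v') powr p"
        using True \<gamma> \<Lambda> K p by (intro powr_mono2) (auto simp: field_simps)
      also have "\<dots> = (1 / \<gamma>) powr p * v' powr p" by (rule powr_mult)
      finally have "(\<Lambda> * K ^ n) powr p * (q / (q - 1)) \<le> ((1 / \<gamma>) powr p * v' powr p) * (q / (q - 1))"
        using q by (intro mult_right_mono) auto
      then have "\<Lambda> powr p * q ^ Suc n / (q - 1) \<le> B" by (simp add: pw B_def mult_ac)
      then show ?thesis using Suc s2 True by (simp add: T_def pw)
    next
      case False
      then show ?thesis using Suc s3 by (simp add: T_def)
    qed
  qed
  have "(\<Sum>i<n. ennreal ((\<Lambda> * K ^ i) powr p) * indicator {u. ennreal (\<gamma> * (\<Lambda> * K ^ i)) \<le> u} v) = (\<Sum>i<n. ennreal (T i))"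
    using real by (intro sum.cong) (auto simp: T_def ennreal_le_iff split: split_indicator)
  also have "\<dots> = ennreal (\<Sum>i<n. T i)" by (rule sum_ennreal) (simp add: T_def)
  also have "\<dots> \<le> ennreal B" using * by (intro ennreal_leI) blast
  also have "\<dots> = ennreal ((1 / \<gamma>) powr p * (q / (q - 1))) * ennreal (v' powr p)"
    unfolding B_def using q by (intro ennreal_mult) auto
  also have "ennreal (v' powr p) = epowr v p" using real by (simp add: epowr_ennreal)
  finally show ?thesis by (simp add: q_def)
next
  case top
  define D where "D = (1 / \<gamma>) powr p * (K powr p / (K powr p - 1))"
  have "K powr p > 1" using K p by simp
  then have "D > 0" unfolding D_def using \<gamma> by (intro mult_pos_pos divide_pos_pos) auto
  then have "ennreal D * epowr v p = top" using top by (simp add: epowr_top ennreal_mult_eq_top_iff)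
  then show ?thesis unfolding D_def by (simp only: top_greatest)
qed

text \<open>Here \<open>u\<close> is a square, hence the exponent \<open>p / 2\<close>; the loss \<open>K\<^sup>p\<close> is the ratio of
  consecutive levels.\<close>
lemma epowr_le_level_sum:
  fixes u :: ennreal
  assumes K: "K > 1" and p: "p > 0" and \<Lambda>: "\<Lambda> > 0"
  shows "epowr u (p / 2) * indicator {u. ennreal (\<Lambda>\<^sup>2) < u} u
    \<le> (\<Sum>i. ennreal (K powr p * (\<Lambda> * K ^ i) powr p) * indicator {u. ennreal ((\<Lambda> * K ^ i)\<^sup>2) < u} u)"
proof (cases "ennreal (\<Lambda>\<^sup>2) < u")
  case True
  have pw: "(\<Lambda> * K ^ i) powr p = \<Lambda> powr p * (K powr p) ^ i" for i using powr_geometric[OF \<Lambda>, of K i p] K by simp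
  have q: "K powr p > 1" using K p by simp
  show ?thesis
  proof (cases u)
    case (real u')
    define s where "s = sqrt u'"
    have s: "s > \<Lambda>" "u' = s\<^sup>2" using True real \<Lambda> by (auto simp: s_def ennreal_less_iff real_less_rsqrt)
    obtain k where "s / \<Lambda> < K ^ k" using real_arch_pow[OF K] by blast
    then have "s \<le> \<Lambda> * K ^ k" using \<Lambda> by (simp add: pos_divide_less_eq mult.commute)
    also have "\<dots> \<le> \<Lambda> * K ^ Suc k" using \<Lambda> K by (intro mult_left_mono) auto
    finally have ex: "\<exists>i. s \<le> \<Lambda> * K ^ Suc i" by blast
    define i where "i = (LEAST i. s \<le> \<Lambda> * K ^ Suc i)"
    have i: "s \<le> \<Lambda> * K ^ Suc i" unfolding i_def by (rule LeastI_ex[OF ex])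
    have lt: "\<Lambda> * K ^ i < s"
    proof (cases i)
      case (Suc j)
      have "\<not> s \<le> \<Lambda> * K ^ Suc j" using not_less_Least[of j "\<lambda>i. s \<le> \<Lambda> * K ^ Suc i"] Suc i_def by auto
      then show ?thesis using Suc by simp
    qed (use s in simp)
    then have lt2: "(\<Lambda> * K ^ i)\<^sup>2 < s\<^sup>2" using \<Lambda> K by (intro power_strict_mono) auto
    have "s powr p \<le> (\<Lambda> * K ^ Suc i) powr p" using i s \<Lambda> p by (intro powr_mono2) auto
    also have "\<dots> = K powr p * (\<Lambda> * K ^ i) powr p" using pw[of "Suc i"] pw[of i] by simp
    finally have 1: "s powr p \<le> K powr p * (\<Lambda> * K ^ i) powr p" .
    have "epowr u (p / 2) = ennreal (s powr p)"
    proof -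
      have "(s\<^sup>2) powr (p / 2) = s powr p" using s \<Lambda> by (simp add: powr_powr flip: powr_numeral)
      then show ?thesis using real s by (simp add: epowr_ennreal)
    qed
    also have "\<dots> \<le> ennreal (K powr p * (\<Lambda> * K ^ i) powr p)" by (rule ennreal_leI[OF 1])
    also have "\<dots> = (\<Sum>j\<in>{i}. ennreal (K powr p * (\<Lambda> * K ^ j) powr p) * indicator {u. ennreal ((\<Lambda> * K ^ j)\<^sup>2) < u} u)"
      using lt2 real s by (simp add: ennreal_less_iff)
    also have "\<dots> \<le> (\<Sum>i. ennreal (K powr p * (\<Lambda> * K ^ i) powr p) * indicator {u. ennreal ((\<Lambda> * K ^ i)\<^sup>2) < u} u)"
      by (rule sum_le_suminf) auto
    finally show ?thesis using True by simp
  next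
    case top
    have "(\<Sum>i::nat. ennreal (\<Lambda> powr p)) \<le> (\<Sum>i. ennreal (K powr p * (\<Lambda> * K ^ i) powr p) * indicator {u. ennreal ((\<Lambda> * K ^ i)\<^sup>2) < u} u)"
    proof (intro suminf_le)
      fix i
      have "1 * \<Lambda> powr p * 1 \<le> K powr p * (\<Lambda> powr p) * (K powr p) ^ i"
        using q by (intro mult_mono) auto
      then show "ennreal (\<Lambda> powr p) \<le> ennreal (K powr p * (\<Lambda> * K ^ i) powr p) * indicator {u. ennreal ((\<Lambda> * K ^ i)\<^sup>2) < u} u"
        using top by (simp add: pw ennreal_leI mult.assoc)
    qed auto
    then have "(\<Sum>i. ennreal (K powr p * (\<Lambda> * K ^ i) powr p) * indicator {u. ennreal ((\<Lambda> * K ^ i)\<^sup>2) < u} u) = top"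
      unfolding suminf_const_top[OF powr_gt_zero[THEN iffD2, OF less_imp_neq[OF \<Lambda>, symmetric]]] by (simp only: infinity_ennreal_def top_unique)
    then show ?thesis by (simp only: top_greatest)
  qed
qed simp

section \<open>The sum over all levels above a lowest one\<close>

context Cp_measure begin

text \<open>The order of the choices matters. First \<open>K\<close> is taken so large that \<open>K\<^sup>p\<^sup>-\<^sup>r\<close> is small,
  which is possible by \<open>p < r\<close>; then \<open>m\<close> is chosen, and \<open>\<gamma>\<close> comes last because its smallness
  has to compensate for \<open>m\<close> and \<open>K\<^sup>2\<^sup>p\<close>.\<close>
lemma choose_constants:
  assumes p: "0 < p" "p < r"
  obtains K \<gamma> m where "K \<ge> 3" "\<gamma> > 0" "\<gamma> \<le> 1 / 100" "800 * \<gamma> \<le> 1 / K"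
    "K powr p * (D2 * gq ^ m + D1 * (3 / K) powr r) \<le> 1/2"
    "K powr p * (C1 * (800 * \<gamma>) powr \<epsilon>) \<le> 1"
    "K powr p * (C1 * (800 * \<gamma>) powr \<epsilon>) * (2 * (K powr p * (real m * A))) \<le> 1/2"
proof -
  have "((\<lambda>K::real. D1 * 3 powr r * K powr (p - r)) \<longlongrightarrow> D1 * 3 powr r * 0) at_top"
    using p by (intro tendsto_mult tendsto_const tendsto_neg_powr filterlim_ident) auto
  then have "\<forall>\<^sub>F K in at_top. D1 * 3 powr r * K powr (p - r) < 1/4" by (rule order_tendstoD) simp
  then obtain K where K: "K \<ge> 3" "D1 * 3 powr r * K powr (p - r) < 1/4"
    by (metis (no_types, lifting) eventually_at_top_linorder linorder_le_cases order_refl)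
  define q where "q = K powr p"
  have q: "q > 0" using K by (simp add: q_def)
  have K1: "q * (D1 * (3 / K) powr r) \<le> 1/4"
  proof -
    have "q * (D1 * (3 / K) powr r) = D1 * 3 powr r * K powr (p - r)" 
    proof -
      have a: "(3 / K) powr r = 3 powr r / K powr r" using K by (simp add: powr_divide)
      have b: "K powr (p - r) = q / K powr r" by (simp add: q_def powr_diff)
      show ?thesis unfolding a b by simp
    qed
    then show ?thesis using K(2) by linarith
  qed
  obtain m where "gq ^ m < 1 / (4 * q * D2)"
    using real_arch_pow_inv[of "1 / (4 * q * D2)" gq] gq q D2_pos by auto
  then have m: "q * (D2 * gq ^ m) \<le> 1/4" using q D2_pos by (simp add: field_simps)
  define e where "e = min (1 / (q * C1)) (1 / (4 * q * C1 * q * (real m * A) + 1))"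
  have den: "0 < 4 * q * C1 * q * (real m * A) + 1" using q C1_pos A_pos by (simp add: add_nonneg_pos)
  have e: "e > 0" using q C1_pos den by (simp add: e_def)
  define \<gamma> where "\<gamma> = min (1 / K) (e powr (1 / \<epsilon>)) / 800"
  have \<gamma>: "\<gamma> > 0" "800 * \<gamma> \<le> 1 / K" "800 * \<gamma> \<le> e powr (1 / \<epsilon>)" using K e by (auto simp: \<gamma>_def)
  have "1 / K \<le> 1 / 3" using K by simp
  then have \<gamma>2: "\<gamma> \<le> 1 / 100" using \<gamma>(2) by linarith
  have "(800 * \<gamma>) powr \<epsilon> \<le> (e powr (1 / \<epsilon>)) powr \<epsilon>" using \<gamma> eps by (intro powr_mono2) auto
  also have "\<dots> = e" using e eps by (simp add: powr_powr)
  finally have ge: "(800 * \<gamma>) powr \<epsilon> \<le> e" .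
  have c1: "q * (C1 * (800 * \<gamma>) powr \<epsilon>) \<le> 1"
  proof -
    have "q * (C1 * (800 * \<gamma>) powr \<epsilon>) \<le> q * (C1 * (1 / (q * C1)))"
      using ge q C1_pos by (intro mult_left_mono) (auto simp: e_def)
    then show ?thesis using q C1_pos by simp
  qed
  have c2: "q * (C1 * (800 * \<gamma>) powr \<epsilon>) * (2 * (q * (real m * A))) \<le> 1/2"
  proof -
    define z where "z = 4 * q * C1 * q * (real m * A)"
    have z: "z \<ge> 0" using q C1_pos A_pos by (simp add: z_def)
    have "(800 * \<gamma>) powr \<epsilon> \<le> 1 / (z + 1)" using ge by (simp add: e_def z_def)
    then have "z * (800 * \<gamma>) powr \<epsilon> \<le> z * (1 / (z + 1))" using z by (rule mult_left_mono)
    also have "\<dots> \<le> 1" using z by simp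
    finally show ?thesis by (simp add: z_def mult_ac)
  qed
  show thesis
    by (rule that[OF K(1) \<gamma>(1) \<gamma>2 \<gamma>(2), of m]) (use K1 m c1 c2 in \<open>simp_all add: q_def[symmetric] distrib_left\<close>)
qed

text \<open>The maximal function enters only through Borel functions below its power, whose
  integrals are bounded by \<open>\<M>\<close>; this keeps its measurability out of the argument.\<close>
context
  fixes p K \<gamma> :: real and m :: nat and f :: "real \<Rightarrow> real" and \<M> :: ennreal
  assumes p: "0 < p" "p < r"
    and K: "K \<ge> 3" and \<gamma>: "\<gamma> > 0" "\<gamma> \<le> 1 / 100" "800 * \<gamma> \<le> 1 / K"
    and rec: "K powr p * (D2 * gq ^ m + D1 * (3 / K) powr r) \<le> 1/2"
    and d1: "K powr p * (C1 * (800 * \<gamma>) powr \<epsilon>) \<le> 1"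
    and d2: "K powr p * (C1 * (800 * \<gamma>) powr \<epsilon>) * (2 * (K powr p * (real m * A))) \<le> 1/2"
    and f: "nice f"
    and \<M>: "\<And>g. g \<in> borel_measurable borel \<Longrightarrow> (\<And>x. g x \<le> epowr (M_LlogL_plus f x) p) \<Longrightarrow> (\<integral>\<^sup>+x. g x \<partial>\<nu>) \<le> \<M>"
begin

text \<open>The constant of \<open>sum_levels_le\<close>.\<close>
definition DN :: real where "DN = (1 / \<gamma>) powr p * (K powr p / (K powr p - 1))"

lemma q1: "K powr p > 1" using K p by simp

lemma DN_pos: "DN > 0" unfolding DN_def using q1 \<gamma>(1) by (intro mult_pos_pos divide_pos_pos) auto

lemma sum_lvl_le:
  assumes \<Lambda>: "\<Lambda> > 0"
  shows "(\<Sum>i<n. ennreal ((\<Lambda> * K ^ i) powr p) * emeasure \<nu> (lvl f (\<gamma> * (\<Lambda> * K ^ i)))) \<le> ennreal DN * \<M>"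
proof -
  have pos: "\<gamma> * (\<Lambda> * K ^ i) > 0" for i using \<gamma> \<Lambda> K by simp
  have mN: "lvl f (\<gamma> * (\<Lambda> * K ^ i)) \<in> sets borel" for i using open_lvl[OF f pos] by auto
  define h where "h x = (\<Sum>i<n. ennreal ((\<Lambda> * K ^ i) powr p) * indicator (lvl f (\<gamma> * (\<Lambda> * K ^ i))) x)" for x
  have mh: "h \<in> borel_measurable borel" unfolding h_def by (use mN in measurable)
  have hle: "h x \<le> ennreal DN * epowr (M_LlogL_plus f x) p" for x
  proof -
    have "h x \<le> (\<Sum>i<n. ennreal ((\<Lambda> * K ^ i) powr p) * indicator {u. ennreal (\<gamma> * (\<Lambda> * K ^ i)) \<le> u} (M_LlogL_plus f x))"
      unfolding h_def by (intro sum_mono mult_left_mono) (auto simp: lvl_le_M[OF f pos] split: split_indicator)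
    also have "\<dots> \<le> ennreal DN * epowr (M_LlogL_plus f x) p"
      unfolding DN_def by (rule sum_levels_le) (use K p \<Lambda> \<gamma> in auto)
    finally show ?thesis .
  qed
  have "(\<integral>\<^sup>+x. ennreal (1 / DN) * h x \<partial>\<nu>) \<le> \<M>"
  proof (rule \<M>)
    show "(\<lambda>x. ennreal (1 / DN) * h x) \<in> borel_measurable borel" using mh by measurable
    show "ennreal (1 / DN) * h x \<le> epowr (M_LlogL_plus f x) p" for x
    proof -
      have "ennreal (1 / DN) * h x \<le> ennreal (1 / DN) * (ennreal DN * epowr (M_LlogL_plus f x) p)" by (intro mult_left_mono hle) simp
      also have "\<dots> = epowr (M_LlogL_plus f x) p" using DN_pos by (simp add: mult.assoc[symmetric] ennreal_mult[symmetric])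
      finally show ?thesis .
    qed
  qed
  then have "ennreal (1 / DN) * (\<integral>\<^sup>+x. h x \<partial>\<nu>) \<le> \<M>" by (subst (asm) nn_integral_cmult[OF borel_meas[OF mh]])
  then have "ennreal DN * (ennreal (1 / DN) * (\<integral>\<^sup>+x. h x \<partial>\<nu>)) \<le> ennreal DN * \<M>" by (rule mult_left_mono) simp
  moreover have "ennreal DN * (ennreal (1 / DN) * (\<integral>\<^sup>+x. h x \<partial>\<nu>)) = (\<integral>\<^sup>+x. h x \<partial>\<nu>)"
    using DN_pos by (simp add: mult.assoc[symmetric] ennreal_mult[symmetric])
  moreover have "(\<integral>\<^sup>+x. h x \<partial>\<nu>) = (\<Sum>i<n. ennreal ((\<Lambda> * K ^ i) powr p) * emeasure \<nu> (lvl f (\<gamma> * (\<Lambda> * K ^ i))))"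
    unfolding h_def
  proof (subst nn_integral_sum)
    show "(\<lambda>x. ennreal ((\<Lambda> * K ^ i) powr p) * indicator (lvl f (\<gamma> * (\<Lambda> * K ^ i))) x) \<in> borel_measurable \<nu>" for i
      by (intro borel_meas) (use mN[of i] in measurable)
  qed (simp only: nn_integral_cmult_indicator[OF borel_sets[OF mN]])
  ultimately show ?thesis by simp
qed

text \<open>To the left of the support, a window which starts at \<open>x\<close> and ends at \<open>R\<close> carries the
  whole mass \<open>I\<close> at the level \<open>\<gamma> \<Lambda>\<close>; so the maximal function of \<open>f\<close> at \<open>x\<close> is at least of
  the order of \<open>\<gamma> \<Lambda>\<close> times the tail of \<open>(-R - I, R)\<close>. The length \<open>I\<close> is chosen for this
  comparison. As tails are at most \<open>1\<close>, the power \<open>r\<close> may be replaced by \<open>p < r\<close>.\<close>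
lemma W_start_le:
  assumes \<Lambda>: "\<Lambda> > 0" and R: "R > 0" "\<And>x. R < \<bar>x\<bar> \<Longrightarrow> f x = 0"
    and I: "I = cumul (\<lambda>x. Phi (\<bar>f x\<bar> / (\<gamma> * \<Lambda>))) R - cumul (\<lambda>x. Phi (\<bar>f x\<bar> / (\<gamma> * \<Lambda>))) (- R)" "I \<ge> 2 * R"
  shows "ennreal (\<Lambda> powr p) * W (- R - I) R \<le> ennreal ((2 / \<gamma>) powr p) * \<M> + ennreal (\<Lambda> powr p) * emeasure \<nu> {-R..R}"
proof -
  define \<mu> where "\<mu> = \<gamma> * \<Lambda>"
  have \<mu>: "\<mu> > 0" using \<gamma> \<Lambda> by (simp add: \<mu>_def)
  define \<alpha> where "\<alpha> = - R - I"
  have \<alpha>: "\<alpha> < R" using R I by (simp add: \<alpha>_def)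
  define g where "g x = ennreal ((\<mu> / 2 * tail \<alpha> R x) powr p) * indicator {..-R} x" for x
  have mg: "g \<in> borel_measurable borel" unfolding g_def[abs_def] by measurable
  have low: "ennreal (\<mu> / 2 * tail \<alpha> R x) \<le> M_LlogL_plus f x" if x: "x \<le> - R" for x
  proof (rule le_Luxemburg_Icc[OF f, of "R - x"])
    show "R - x > 0" using x R by simp
    fix t :: real assume t: "t > 0" "cumul (\<lambda>x. Phi (\<bar>f x\<bar> / t)) (x + (R - x)) - cumul (\<lambda>x. Phi (\<bar>f x\<bar> / t)) x \<le> R - x"
    show "\<mu> / 2 * tail \<alpha> R x \<le> t"
    proof (cases "\<mu> \<le> t")
      case True
      have "\<mu> / 2 * tail \<alpha> R x \<le> \<mu> / 2 * 1" using \<mu> by (intro mult_left_mono tail_le_1) auto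
      then show ?thesis using True \<mu> by linarith
    next
      case False
      then have t\<mu>: "t \<le> \<mu>" by simp
      note n1 = nice_Phi[OF f \<mu>] and n2 = nice_Phi[OF f t(1)]
      have "I = cumul (\<lambda>x. Phi (\<bar>f x\<bar> / \<mu>)) R - cumul (\<lambda>x. Phi (\<bar>f x\<bar> / \<mu>)) x"
        using cumul_left_const[OF n1, of R x "-R"] R x I(1) by (simp add: \<mu>_def Phi_def)
      also have "\<dots> \<le> cumul (\<lambda>x. t / \<mu> * Phi (\<bar>f x\<bar> / t)) R - cumul (\<lambda>x. t / \<mu> * Phi (\<bar>f x\<bar> / t)) x"
        by (rule cumul_le[OF n1 nice_cmult[OF n2]]) (use x R Phi_shrink[OF t(1) t\<mu>] in auto)
      also have "\<dots> = t / \<mu> * (cumul (\<lambda>x. Phi (\<bar>f x\<bar> / t)) R - cumul (\<lambda>x. Phi (\<bar>f x\<bar> / t)) x)"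
        by (rule cumul_cmult[OF n2]) (use x R in simp)
      also have "\<dots> \<le> t / \<mu> * (R - x)" using t \<mu> by (intro mult_left_mono) auto
      finally have It: "I * \<mu> \<le> t * (R - x)" using \<mu> by (simp add: field_simps)
      have "tail \<alpha> R x \<le> (R - \<alpha>) / (R - x)" using x R by (intro tail_le_quot) simp
      also have "\<dots> \<le> 2 * I / (R - x)" using x R I(2) by (intro divide_right_mono) (auto simp: \<alpha>_def)
      finally have "\<mu> / 2 * tail \<alpha> R x \<le> \<mu> / 2 * (2 * I / (R - x))" using \<mu> by (intro mult_left_mono) auto
      also have "\<dots> = I * \<mu> / (R - x)" by simp
      also have "\<dots> \<le> t" using It x R by (simp add: pos_divide_le_eq)
      finally show ?thesis .
    qed
  qed
  have "(\<integral>\<^sup>+x. g x \<partial>\<nu>) \<le> \<M>"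
  proof (rule \<M>[OF mg])
    show "g x \<le> epowr (M_LlogL_plus f x) p" for x
    proof (cases "x \<le> - R")
      case True
      have "epowr (ennreal (\<mu> / 2 * tail \<alpha> R x)) p \<le> epowr (M_LlogL_plus f x) p"
        using p low[OF True] by (intro epowr_mono) auto
      then show ?thesis using True \<mu> tail_nonneg[OF \<alpha>, of x] by (simp add: g_def epowr_ennreal)
    qed (simp add: g_def)
  qed
  have "ennreal (\<Lambda> powr p) * W \<alpha> R = (\<integral>\<^sup>+x. ennreal (\<Lambda> powr p) * ennreal (tail \<alpha> R x powr r) \<partial>\<nu>)"
    unfolding W_def by (rule nn_integral_cmult[symmetric]) (intro borel_meas, measurable)
  also have "\<dots> \<le> (\<integral>\<^sup>+x. ennreal ((2 / \<gamma>) powr p) * g x + ennreal (\<Lambda> powr p) * indicator {-R..R} x \<partial>\<nu>)"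
  proof (rule nn_integral_mono)
    fix x
    have t: "0 \<le> tail \<alpha> R x" "tail \<alpha> R x \<le> 1" using tail_nonneg[OF \<alpha>] tail_le_1 by auto
    have le: "tail \<alpha> R x powr r \<le> tail \<alpha> R x powr p" using t p by (intro powr_mono') auto
    show "ennreal (\<Lambda> powr p) * ennreal (tail \<alpha> R x powr r) \<le> ennreal ((2 / \<gamma>) powr p) * g x + ennreal (\<Lambda> powr p) * indicator {-R..R} x"
    proof (cases "x \<le> - R")
      case True
      have "ennreal (\<Lambda> powr p) * ennreal (tail \<alpha> R x powr r) \<le> ennreal (\<Lambda> powr p) * ennreal (tail \<alpha> R x powr p)"
        by (intro mult_left_mono ennreal_leI le) simp
      also have "\<dots> = ennreal ((2 / \<gamma>) powr p) * g x"
      proof -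
        have "\<Lambda> powr p * tail \<alpha> R x powr p = (\<Lambda> * tail \<alpha> R x) powr p" using \<Lambda> t by (simp add: powr_mult)
        also have "\<Lambda> * tail \<alpha> R x = 2 / \<gamma> * (\<mu> / 2 * tail \<alpha> R x)" using \<gamma> by (simp add: \<mu>_def)
        also have "\<dots> powr p = (2 / \<gamma>) powr p * (\<mu> / 2 * tail \<alpha> R x) powr p" using \<gamma> \<mu> t by (intro powr_mult)
        finally show ?thesis using True by (simp add: g_def ennreal_mult[symmetric])
      qed
      finally show ?thesis by (simp add: add_increasing2)
    next
      case False
      show ?thesis
      proof (cases "x < R")
        case True
        have "tail \<alpha> R x powr r \<le> 1" using t r1 by (intro powr_le1) auto
        then have "ennreal (\<Lambda> powr p) * ennreal (tail \<alpha> R x powr r) \<le> ennreal (\<Lambda> powr p) * 1"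
          by (intro mult_left_mono) auto
        then show ?thesis using True False by (simp add: add_increasing)
      qed (use r1 in \<open>simp add: tail_def\<close>)
    qed
  qed
  also have "\<dots> = ennreal ((2 / \<gamma>) powr p) * (\<integral>\<^sup>+x. g x \<partial>\<nu>) + ennreal (\<Lambda> powr p) * emeasure \<nu> {-R..R}"
  proof -
    have m1: "(\<lambda>x. ennreal ((2 / \<gamma>) powr p) * g x) \<in> borel_measurable \<nu>" "(\<lambda>x. ennreal (\<Lambda> powr p) * indicator {-R..R} x) \<in> borel_measurable \<nu>"
      by (intro borel_meas; use mg in measurable)+
    show ?thesis
      by (simp add: nn_integral_add[OF m1] nn_integral_cmult[OF borel_meas[OF mg]] nn_integral_cmult_indicator borel_sets)
  qed
  also have "\<dots> \<le> ennreal ((2 / \<gamma>) powr p) * \<M> + ennreal (\<Lambda> powr p) * emeasure \<nu> {-R..R}"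
    using \<open>(\<integral>\<^sup>+x. g x \<partial>\<nu>) \<le> \<M>\<close> by (intro add_right_mono mult_left_mono) auto
  finally show ?thesis by (simp add: \<alpha>_def)
qed

text \<open>The set \<open>U i\<close> contains \<open>N i\<close> so that points outside \<open>U i\<close>, the end points of
  components among them, satisfy both hypotheses of \<open>local_good_lambda\<close>.\<close>
lemma sum_superlevel_le:
  assumes \<Lambda>: "\<Lambda> > 0" and R: "R > 0" "\<And>x. R < \<bar>x\<bar> \<Longrightarrow> f x = 0"
    and I: "I = cumul (\<lambda>x. Phi (\<bar>f x\<bar> / (\<gamma> * \<Lambda>))) R - cumul (\<lambda>x. Phi (\<bar>f x\<bar> / (\<gamma> * \<Lambda>))) (- R)" "I \<ge> 2 * R"
    and fin: "\<M> < \<infinity>" "emeasure \<nu> {-R..R} < \<infinity>"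
  shows "(\<Sum>i\<le>n. ennreal ((\<Lambda> * K ^ i) powr p) * emeasure \<nu> {x. ennreal ((\<Lambda> * K ^ i)\<^sup>2) < sqO f x})
    \<le> ennreal (6 * (2 / \<gamma>) powr p + 2 * K powr p * DN) * \<M> + 6 * (ennreal (\<Lambda> powr p) * emeasure \<nu> {-R..R})"
proof -
  define q where "q = K powr p"
  define lv where "lv i = \<Lambda> * K ^ i" for i :: nat
  have lv0: "lv i > 0" for i using \<Lambda> K by (simp add: lv_def)
  have lvS: "lv (Suc i) = K * lv i" for i by (simp add: lv_def)
  define N where "N i = lvl f (\<gamma> * lv i)" for i
  define U where "U i = {x. ennreal ((lv i)\<^sup>2) < sqO f x} \<union> N i" for i
  have \<mu>0: "\<gamma> * lv i > 0" for i using \<gamma> lv0 by simp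
  have N_Suc: "N (Suc i) = lvl f (K * (\<gamma> * lv i))" for i by (simp add: N_def lvS mult_ac)
  have N_dec: "N (Suc i) \<subseteq> N i" for i
    unfolding N_Suc unfolding N_def using \<mu>0[of i] K mult_right_mono[of 1 K "\<gamma> * lv i"] by (intro lvl_antimono f) auto
  have N_open: "open (N i)" for i unfolding N_def by (rule open_lvl[OF f \<mu>0])
  \<comment> \<open>To the left of \<open>\<alpha>0\<close> the averages of \<open>f\<close> are too small to reach the lowest level.\<close>
  define \<alpha>0 where "\<alpha>0 = - R - I"
  have Ipos: "I > 0" using I(2) R(1) by simp
  have \<alpha>R: "\<alpha>0 < R" using R Ipos by (simp add: \<alpha>0_def)
  have \<mu>: "\<gamma> * \<Lambda> > 0" using \<gamma> \<Lambda> by simp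
  note nP = nice_Phi[OF f \<mu>]
  have P_supp: "Phi (\<bar>f x\<bar> / (\<gamma> * \<Lambda>)) = 0" if "R < \<bar>x\<bar>" for x using R(2)[OF that] by (simp add: Phi_def)
  have U0: "U 0 \<subseteq> {\<alpha>0<..<R}"
  proof
    fix x assume x: "x \<in> U 0"
    have "x < R"
    proof (rule ccontr)
      assume "\<not> x < R"
      then have xR: "R \<le> x" by simp
      have "cumul f (x + s) = cumul f x" if "s > 0" for s
        by (rule cumul_eq[symmetric, OF f]) (use that xR R in auto)
      then have "sqO f x = 0" by (rule sqO_eq_0[OF f])
      moreover have "x \<notin> N 0"
      proof
        assume "x \<in> N 0"
        then obtain h where h: "h > 0" "h < cumul (\<lambda>x. Phi (\<bar>f x\<bar> / (\<gamma> * \<Lambda>))) (x + h) - cumul (\<lambda>x. Phi (\<bar>f x\<bar> / (\<gamma> * \<Lambda>))) x"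
          unfolding N_def lvl_def rising_def by (auto simp: lv_def)
        have "cumul (\<lambda>x. Phi (\<bar>f x\<bar> / (\<gamma> * \<Lambda>))) x = cumul (\<lambda>x. Phi (\<bar>f x\<bar> / (\<gamma> * \<Lambda>))) (x + h)"
          by (rule cumul_eq[OF nP]) (use h xR R(1) P_supp in auto)
        then show False using h by simp
      qed
      ultimately show False using x by (simp add: U_def)
    qed
    moreover have "\<alpha>0 < x"
    proof (rule ccontr)
      assume "\<not> \<alpha>0 < x"
      define d where "d = - R - x"
      have d: "d \<ge> I" "d > 0" using \<open>\<not> \<alpha>0 < x\<close> Ipos by (auto simp: d_def \<alpha>0_def)
      have "cumul (\<lambda>x. \<bar>f x\<bar>) R - cumul (\<lambda>x. \<bar>f x\<bar>) (-R) \<le> (\<gamma> * \<Lambda>) * d"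
      proof -
        have "cumul (\<lambda>x. \<bar>f x\<bar>) R - cumul (\<lambda>x. \<bar>f x\<bar>) (-R) \<le> cumul (\<lambda>x. (\<gamma> * \<Lambda>) * Phi (\<bar>f x\<bar> / (\<gamma> * \<Lambda>))) R - cumul (\<lambda>x. (\<gamma> * \<Lambda>) * Phi (\<bar>f x\<bar> / (\<gamma> * \<Lambda>))) (-R)"
        proof (rule cumul_le[OF nice_abs[OF f] nice_cmult[OF nP]])
          show "\<bar>f x\<bar> \<le> \<gamma> * \<Lambda> * Phi (\<bar>f x\<bar> / (\<gamma> * \<Lambda>))" for x
            using Phi_ge[of "\<bar>f x\<bar> / (\<gamma> * \<Lambda>)"] \<mu> by (simp add: pos_divide_le_eq mult.commute)
        qed (use R in simp)
        also have "\<dots> = (\<gamma> * \<Lambda>) * I" unfolding I(1) by (rule cumul_cmult[OF nP]) (use R in simp)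
        also have "\<dots> \<le> (\<gamma> * \<Lambda>) * d" using d \<mu> by (intro mult_left_mono) auto
        finally show ?thesis .
      qed
      then have "sqO f x \<le> ennreal (22 * (\<gamma> * \<Lambda>)\<^sup>2)"
        by (intro sqO_left_of_support[OF f R(2), of _ d]) (use R(1) d \<mu> in \<open>auto simp: d_def\<close>)
      also have "\<dots> \<le> ennreal (\<Lambda>\<^sup>2)"
      proof (rule ennreal_leI)
        have "\<gamma>\<^sup>2 \<le> (1 / 100)\<^sup>2" using \<gamma> by (intro power_mono) auto
        then have "22 * \<gamma>\<^sup>2 \<le> 1" by (simp add: power2_eq_square)
        then have "22 * \<gamma>\<^sup>2 * \<Lambda>\<^sup>2 \<le> 1 * \<Lambda>\<^sup>2" by (intro mult_right_mono) auto
        then show "22 * (\<gamma> * \<Lambda>)\<^sup>2 \<le> \<Lambda>\<^sup>2" by (simp add: power_mult_distrib)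
      qed
      finally have "\<not> ennreal ((lv 0)\<^sup>2) < sqO f x" by (simp add: lv_def not_less)
      moreover have "x \<notin> N 0"
      proof
        assume "x \<in> N 0"
        then obtain h where h: "h > 0" "h < cumul (\<lambda>x. Phi (\<bar>f x\<bar> / (\<gamma> * \<Lambda>))) (x + h) - cumul (\<lambda>x. Phi (\<bar>f x\<bar> / (\<gamma> * \<Lambda>))) x"
          unfolding N_def lvl_def rising_def by (auto simp: lv_def)
        show False
        proof (cases "x + h \<le> - R")
          case True
          have "cumul (\<lambda>x. Phi (\<bar>f x\<bar> / (\<gamma> * \<Lambda>))) x = cumul (\<lambda>x. Phi (\<bar>f x\<bar> / (\<gamma> * \<Lambda>))) (x + h)"
            by (rule cumul_left_const[OF nP P_supp]) (use h True R(1) in auto)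
          then show False using h by simp
        next
          case False
          then have "h > d" by (simp add: d_def)
          moreover have "cumul (\<lambda>x. Phi (\<bar>f x\<bar> / (\<gamma> * \<Lambda>))) (x + h) - cumul (\<lambda>x. Phi (\<bar>f x\<bar> / (\<gamma> * \<Lambda>))) x \<le> I"
            unfolding I(1) by (rule cumul_supp[OF nP Phi_quot_nonneg[OF \<mu>] P_supp]) (use R(1) h in auto)
          ultimately show False using h d by simp
        qed
      qed
      ultimately show False using x by (simp add: U_def)
    qed
    ultimately show "x \<in> {\<alpha>0<..<R}" by simp
  qed
  have U_open: "open (U i)" for i unfolding U_def using open_sqO[OF f] N_open by (intro open_Un)
  have U_dec: "U (Suc i) \<subseteq> U i" for i
  proof -
    have "(lv i)\<^sup>2 \<le> (lv (Suc i))\<^sup>2"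
    proof (rule power_mono)
      have "1 * lv i \<le> K * lv i" using K lv0[of i] by (intro mult_right_mono) auto
      then show "lv i \<le> lv (Suc i)" by (simp add: lvS)
    qed (use lv0[of i] in simp)
    from le_less_trans[OF ennreal_leI[OF this]] show ?thesis using N_dec[of i] unfolding U_def by blast
  qed
  have N_meas: "N i \<in> sets borel" for i using N_open by auto
  have left: "emeasure lborel (U (Suc i) \<inter> {a<..<a + l}) \<le> ennreal (3 / K * l)" if a: "a \<notin> U i" and l: "l > 0" for i a l
  proof -
    let ?Q = "{x \<in> {a..a + l}. ennreal ((K * lv i)\<^sup>2) < sqO f x}" and ?N = "N (Suc i) \<inter> {a<..<a + l}"
    have mQ: "?Q \<in> sets borel" using measurable_sqO[OF f] by measurable
    have mN: "?N \<in> sets borel" by (intro borel_open open_Int N_open open_greaterThanLessThan)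
    have "U (Suc i) \<inter> {a<..<a + l} \<subseteq> ?Q \<union> ?N"
    proof
      fix x assume x: "x \<in> U (Suc i) \<inter> {a<..<a + l}"
      then have "x \<in> {a..a + l}" by auto
      then show "x \<in> ?Q \<union> ?N" using x unfolding U_def lvS by blast
    qed
    then have "emeasure lborel (U (Suc i) \<inter> {a<..<a + l}) \<le> emeasure lborel (?Q \<union> ?N)"
      by (rule emeasure_mono) (unfold sets_lborel, intro sets.Un mQ mN)
    also have "\<dots> \<le> emeasure lborel ?Q + emeasure lborel ?N" by (rule emeasure_subadditive) (unfold sets_lborel, rule mQ, rule mN)
    also have "\<dots> \<le> ennreal (800 * \<gamma> * l) + ennreal (2 * l / K)"
    proof (intro add_mono)
      show "emeasure lborel ?Q \<le> ennreal (800 * \<gamma> * l)"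
        by (rule local_good_lambda[OF f lv0 \<gamma>(1,2) l _ order_refl _ _ K]) (use a l in \<open>auto simp: U_def N_def\<close>)
      show "emeasure lborel ?N \<le> ennreal (2 * l / K)"
        unfolding N_Suc by (rule lvl_density[OF f \<mu>0 K _ l]) (use a in \<open>auto simp: U_def N_def\<close>)
    qed
    also have "\<dots> = ennreal (800 * \<gamma> * l + 2 * l / K)" using \<gamma> l K by (intro ennreal_plus[symmetric]) auto
    also have "\<dots> \<le> ennreal (3 / K * l)"
    proof (rule ennreal_leI)
      have "800 * \<gamma> * l \<le> 1 / K * l" using \<gamma>(3) l by (intro mult_right_mono) auto
      moreover have "3 / K * l = 1 / K * l + 2 * l / K" using K by (simp add: field_simps)
      ultimately show "800 * \<gamma> * l + 2 * l / K \<le> 3 / K * l" by linarith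
    qed
    finally show ?thesis .
  qed
  have right: "emeasure lborel ((U (Suc i) - N i) \<inter> {\<alpha><..<b}) \<le> ennreal (800 * \<gamma> * (b - \<alpha>))" if b: "b \<notin> U i" and \<alpha>: "\<alpha> < b" for i b \<alpha>
  proof (cases "(U (Suc i) - N i) \<inter> {\<alpha><..<b} = {}")
    case False
    let ?E = "(U (Suc i) - N i) \<inter> {\<alpha><..<b}"
    \<comment> \<open>The estimate to the left of \<open>b\<close> is also an estimate to the right of some point: the first
      point of the closure of \<open>?E\<close> lies outside the open set \<open>N i\<close>, and \<open>b\<close> takes the role
      of \<open>y\<close>.\<close>
    define t where "t = Inf ?E"
    have bb: "bdd_below ?E" by (rule bdd_belowI[of _ \<alpha>]) auto
    have "t \<in> closure ?E" unfolding t_def by (rule closure_contains_Inf[OF False bb])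
    also have "\<dots> \<subseteq> - N i" by (rule closure_minimal) (use N_open in auto)
    finally have tN: "t \<notin> N i" by simp
    have t\<alpha>: "\<alpha> \<le> t" unfolding t_def using False by (intro cInf_greatest) auto
    obtain z where "z \<in> ?E" using False by blast
    then have tb: "t < b" unfolding t_def using cInf_lower[OF _ bb, of z] by auto
    have "?E \<subseteq> {x \<in> {t..t + (b - t)}. ennreal ((K * lv i)\<^sup>2) < sqO f x}"
    proof
      fix x assume x: "x \<in> ?E"
      then have "t \<le> x" unfolding t_def using bb by (rule cInf_lower)
      then show "x \<in> {x \<in> {t..t + (b - t)}. ennreal ((K * lv i)\<^sup>2) < sqO f x}" using x N_dec[of i] by (auto simp: U_def lvS)
    qed
    then have "emeasure lborel ?E \<le> emeasure lborel {x \<in> {t..t + (b - t)}. ennreal ((K * lv i)\<^sup>2) < sqO f x}"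
      by (rule emeasure_mono) (use measurable_sqO[OF f] in measurable)
    also have "\<dots> \<le> ennreal (800 * \<gamma> * (b - t))"
      by (rule local_good_lambda[OF f lv0 \<gamma>(1,2) _ _ less_imp_le[OF tb] _ _ K]) (use tb tN b in \<open>auto simp: U_def N_def\<close>)
    also have "\<dots> \<le> ennreal (800 * \<gamma> * (b - \<alpha>))" using t\<alpha> \<gamma> by (intro ennreal_leI mult_left_mono) auto
    finally show ?thesis .
  qed simp
  have W_fin: "W \<alpha>0 R < \<infinity>"
  proof -
    have "ennreal (\<Lambda> powr p) * W \<alpha>0 R < \<infinity>"
      unfolding \<alpha>0_def by (rule le_less_trans[OF W_start_le[OF \<Lambda> R I]]) (use fin in \<open>auto simp: ennreal_mult_less_top\<close>)
    then show ?thesis using \<Lambda> by (auto simp: ennreal_mult_less_top)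
  qed
  have main: "(\<Sum>i\<le>n. ennreal (q ^ i) * emeasure \<nu> (U i)) \<le> 6 * W \<alpha>0 R + 2 * (ennreal q * (\<Sum>i<n. ennreal (q ^ i) * emeasure \<nu> (N i)))"
    unfolding q_def
    by (rule good_lambda_sum[OF U_open U_dec \<alpha>R U0 N_meas _ _ left right W_fin _ rec d1 d2]) (use K \<gamma> in auto)
  have pw: "ennreal ((\<Lambda> * K ^ i) powr p) = ennreal (\<Lambda> powr p) * ennreal (q ^ i)" for i
    using powr_geometric[OF \<Lambda>, of K i p] K by (simp add: q_def ennreal_mult)
  have "(\<Sum>i\<le>n. ennreal ((\<Lambda> * K ^ i) powr p) * emeasure \<nu> {x. ennreal ((\<Lambda> * K ^ i)\<^sup>2) < sqO f x})
      \<le> (\<Sum>i\<le>n. ennreal ((\<Lambda> * K ^ i) powr p) * emeasure \<nu> (U i))"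
    using U_open by (intro sum_mono mult_left_mono emeasure_mono borel_sets) (auto simp: U_def lv_def)
  also have "\<dots> = ennreal (\<Lambda> powr p) * (\<Sum>i\<le>n. ennreal (q ^ i) * emeasure \<nu> (U i))"
    by (simp add: pw sum_distrib_left mult.assoc)
  also have "\<dots> \<le> ennreal (\<Lambda> powr p) * (6 * W \<alpha>0 R + 2 * (ennreal q * (\<Sum>i<n. ennreal (q ^ i) * emeasure \<nu> (N i))))"
    by (intro mult_left_mono main) simp
  also have "\<dots> = 6 * (ennreal (\<Lambda> powr p) * W \<alpha>0 R) + 2 * (ennreal q * (\<Sum>i<n. ennreal ((\<Lambda> * K ^ i) powr p) * emeasure \<nu> (N i)))"
    by (simp add: pw sum_distrib_left distrib_left ac_simps)
  also have "\<dots> \<le> 6 * (ennreal ((2 / \<gamma>) powr p) * \<M> + ennreal (\<Lambda> powr p) * emeasure \<nu> {-R..R}) + 2 * (ennreal q * (ennreal DN * \<M>))"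
    unfolding \<alpha>0_def N_def lv_def
    by (intro add_mono mult_left_mono W_start_le[OF \<Lambda> R I] sum_lvl_le[OF \<Lambda>]) auto
  also have "\<dots> = (6 * ennreal ((2 / \<gamma>) powr p) + 2 * ennreal q * ennreal DN) * \<M> + 6 * (ennreal (\<Lambda> powr p) * emeasure \<nu> {-R..R})"
    by (simp add: distrib_left distrib_right ac_simps)
  also have "6 * ennreal ((2 / \<gamma>) powr p) + 2 * ennreal q * ennreal DN = ennreal (6 * (2 / \<gamma>) powr p + 2 * K powr p * DN)"
    using DN_pos by (simp add: q_def ennreal_mult)
  finally show ?thesis .
qed

end

end

section \<open>The estimate for bounded functions of bounded support\<close>

context Cp_measure begin

text \<open>As the lowest level \<open>L j\<close> tends to \<open>0\<close>, the error \<open>(L j)\<^sup>p\<close> times the measure of an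
  interval around the support vanishes, and the levels exhaust the points where
  \<open>sqO f > 0\<close>.\<close>
theorem nice_estimate:
  assumes p: "0 < p" "p < r" and loc: "\<And>a b. emeasure \<nu> {a..b} < \<infinity>"
  obtains B where "B > 0"
    "\<And>f \<M>. nice f \<Longrightarrow>
      (\<And>g. g \<in> borel_measurable borel \<Longrightarrow> (\<And>x. g x \<le> epowr (M_LlogL_plus f x) p) \<Longrightarrow> (\<integral>\<^sup>+x. g x \<partial>\<nu>) \<le> \<M>) \<Longrightarrow>
      (\<integral>\<^sup>+x. epowr (sqO f x) (p / 2) \<partial>\<nu>) \<le> ennreal B * \<M>"
proof -
  obtain K \<gamma> m where c: "K \<ge> 3" "\<gamma> > 0" "\<gamma> \<le> 1 / 100" "800 * \<gamma> \<le> 1 / K"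
    "K powr p * (D2 * gq ^ m + D1 * (3 / K) powr r) \<le> 1/2"
    "K powr p * (C1 * (800 * \<gamma>) powr \<epsilon>) \<le> 1"
    "K powr p * (C1 * (800 * \<gamma>) powr \<epsilon>) * (2 * (K powr p * (real m * A))) \<le> 1/2"
    using choose_constants[OF p] by metis
  define q where "q = K powr p"
  define D where "D = 6 * (2 / \<gamma>) powr p + 2 * K powr p * ((1 / \<gamma>) powr p * (K powr p / (K powr p - 1)))"
  have q: "q > 1" using c(1) p by (simp add: q_def)
  have D: "D > 0" unfolding D_def q_def[symmetric] using q c(2) by (intro add_pos_nonneg mult_nonneg_nonneg mult_pos_pos divide_nonneg_nonneg) auto
  show thesis
  proof (rule that[of "q * D"])
    show "q * D > 0" using q D by simp
    fix f \<M>
    assume f: "nice f" and M: "\<And>g. g \<in> borel_measurable borel \<Longrightarrow> (\<And>x. g x \<le> epowr (M_LlogL_plus f x) p) \<Longrightarrow> (\<integral>\<^sup>+x. g x \<partial>\<nu>) \<le> \<M>"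
    obtain R where R: "R > 0" "\<And>x. R < \<bar>x\<bar> \<Longrightarrow> f x = 0" using niceE[OF f] by metis
    let ?V = "cumul (\<lambda>x. \<bar>f x\<bar>)"
    define V where "V = ?V R - ?V (-R)"
    have Vle: "\<bar>cumul f b - cumul f a\<bar> \<le> V" if "a \<le> b" for a b
    proof -
      have "\<bar>cumul f b - cumul f a\<bar> \<le> ?V b - ?V a" by (rule cumul_diff_abs[OF f that])
      also have "\<dots> \<le> V" unfolding V_def by (rule cumul_supp[OF nice_abs[OF f]]) (use R that in auto)
      finally show ?thesis .
    qed
    show "(\<integral>\<^sup>+x. epowr (sqO f x) (p / 2) \<partial>\<nu>) \<le> ennreal (q * D) * \<M>"
    proof (cases "\<M> = \<infinity> \<or> V = 0")
      case True
      then show ?thesis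
      proof
        assume "\<M> = \<infinity>"
        then have "ennreal (q * D) * \<M> = top" using q D by (simp add: ennreal_mult_eq_top_iff)
        then show ?thesis by (simp only: top_greatest)
      next
        assume V: "V = 0"
        have "sqO f x = 0" for x
        proof (rule sqO_eq_0[OF f])
          fix s :: real assume "s > 0"
          then have "\<bar>cumul f (x + s) - cumul f x\<bar> \<le> V" by (intro Vle) simp
          then show "cumul f (x + s) = cumul f x" using V by simp
        qed
        then have "(\<integral>\<^sup>+x. epowr (sqO f x) (p / 2) \<partial>\<nu>) = (\<integral>\<^sup>+x. 0 \<partial>\<nu>)"
          by (intro nn_integral_cong) (simp add: epowr_def)
        then show ?thesis by simp
      qed
    next
      case False
      then have Mfin: "\<M> < \<infinity>" and "V \<noteq> 0" by (auto simp: less_top)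
      then have V: "V > 0" using Vle[of 0 0] by simp
      \<comment> \<open>The factor in front ensures \<open>I \<ge> 2 * R\<close> for the \<open>Phi\<close>-mass \<open>I\<close> at the level \<open>\<gamma> * L j\<close>.\<close>
      define L where "L j = V / (2 * R * \<gamma>) / real (Suc j)" for j
      have L: "L j > 0" for j using V R c(2) by (simp add: L_def)
      have Lle: "L j \<le> V / (2 * R * \<gamma>)" for j
      proof -
        have "V / (2 * R * \<gamma>) / real (Suc j) \<le> V / (2 * R * \<gamma>) / 1" using V R c(2) by (intro divide_left_mono) auto
        then show ?thesis by (simp add: L_def)
      qed
      have L0: "L \<longlonglongrightarrow> 0"
      proof -
        have "(\<lambda>j. V / (2 * R * \<gamma>) * inverse (real (Suc j))) \<longlonglongrightarrow> 0" by (intro tendsto_mult_right_zero LIMSEQ_inverse_real_of_nat)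
        then show ?thesis by (simp only: L_def[abs_def] divide_inverse[of _ "real (Suc _)"])
      qed
      have [measurable]: "sqO f \<in> borel_measurable borel" by (rule measurable_sqO[OF f])
      define h where "h j x = epowr (sqO f x) (p / 2) * indicator {u. ennreal ((L j)\<^sup>2) < u} (sqO f x)" for j x
      have mh: "h j \<in> borel_measurable \<nu>" for j unfolding h_def[abs_def] by (rule borel_meas) measurable
      have hj: "(\<integral>\<^sup>+x. h j x \<partial>\<nu>) \<le> ennreal q * (ennreal D * \<M> + 6 * (ennreal (L j powr p) * emeasure \<nu> {-R..R}))" for j
      proof -
        define I where "I = cumul (\<lambda>x. Phi (\<bar>f x\<bar> / (\<gamma> * L j))) R - cumul (\<lambda>x. Phi (\<bar>f x\<bar> / (\<gamma> * L j))) (- R)"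
        have \<mu>: "\<gamma> * L j > 0" using c(2) L by simp
        note nP = nice_Phi[OF f \<mu>]
        have "V \<le> cumul (\<lambda>x. (\<gamma> * L j) * Phi (\<bar>f x\<bar> / (\<gamma> * L j))) R - cumul (\<lambda>x. (\<gamma> * L j) * Phi (\<bar>f x\<bar> / (\<gamma> * L j))) (-R)"
          unfolding V_def
        proof (rule cumul_le[OF nice_abs[OF f] nice_cmult[OF nP]])
          show "\<bar>f x\<bar> \<le> \<gamma> * L j * Phi (\<bar>f x\<bar> / (\<gamma> * L j))" for x
            using Phi_ge[of "\<bar>f x\<bar> / (\<gamma> * L j)"] \<mu> by (simp add: pos_divide_le_eq mult.commute)
        qed (use R in simp)
        also have "\<dots> = (\<gamma> * L j) * I" unfolding I_def by (rule cumul_cmult[OF nP]) (use R in simp)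
        finally have VI: "V \<le> (\<gamma> * L j) * I" .
        have "2 * R * (\<gamma> * L j) \<le> 2 * R * (\<gamma> * (V / (2 * R * \<gamma>)))" using Lle R c(2) by (intro mult_left_mono) auto
        also have "\<dots> = V" using R c(2) by simp
        finally have "2 * R * (\<gamma> * L j) \<le> I * (\<gamma> * L j)" using VI by (simp add: mult.commute)
        then have I2: "2 * R \<le> I" using \<mu> by (rule mult_right_le_imp_le)
        have part: "(\<Sum>i<n. ennreal (q * (L j * K ^ i) powr p) * emeasure \<nu> {x. ennreal ((L j * K ^ i)\<^sup>2) < sqO f x})
          \<le> ennreal q * (ennreal D * \<M> + 6 * (ennreal (L j powr p) * emeasure \<nu> {-R..R}))" for n
        proof -
          have "(\<Sum>i<n. ennreal (q * (L j * K ^ i) powr p) * emeasure \<nu> {x. ennreal ((L j * K ^ i)\<^sup>2) < sqO f x})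
            = ennreal q * (\<Sum>i<n. ennreal ((L j * K ^ i) powr p) * emeasure \<nu> {x. ennreal ((L j * K ^ i)\<^sup>2) < sqO f x})"
            using q by (simp add: sum_distrib_left ennreal_mult mult.assoc)
          also have "\<dots> \<le> ennreal q * (\<Sum>i\<le>n. ennreal ((L j * K ^ i) powr p) * emeasure \<nu> {x. ennreal ((L j * K ^ i)\<^sup>2) < sqO f x})"
            by (intro mult_left_mono sum_mono2) auto
          also have "\<dots> \<le> ennreal q * (ennreal D * \<M> + 6 * (ennreal (L j powr p) * emeasure \<nu> {-R..R}))"
          proof (rule mult_left_mono)
            show "(\<Sum>i\<le>n. ennreal ((L j * K ^ i) powr p) * emeasure \<nu> {x. ennreal ((L j * K ^ i)\<^sup>2) < sqO f x}) \<le> ennreal D * \<M> + 6 * (ennreal (L j powr p) * emeasure \<nu> {-R..R})"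
              using sum_superlevel_le[OF p c f M L R I_def I2 Mfin loc] DN_def[OF p c f M] unfolding D_def by simp
          qed simp
          finally show ?thesis .
        qed
        have "(\<integral>\<^sup>+x. h j x \<partial>\<nu>) \<le> (\<integral>\<^sup>+x. (\<Sum>i. ennreal (q * (L j * K ^ i) powr p) * indicator {x. ennreal ((L j * K ^ i)\<^sup>2) < sqO f x} x) \<partial>\<nu>)"
        proof (rule nn_integral_mono)
          fix x
          show "h j x \<le> (\<Sum>i. ennreal (q * (L j * K ^ i) powr p) * indicator {x. ennreal ((L j * K ^ i)\<^sup>2) < sqO f x} x)"
            using epowr_le_level_sum[of K p "L j" "sqO f x"] c(1) p L unfolding h_def q_def by (simp add: indicator_def)
        qed
        also have "\<dots> = (\<Sum>i. ennreal (q * (L j * K ^ i) powr p) * emeasure \<nu> {x. ennreal ((L j * K ^ i)\<^sup>2) < sqO f x})"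
        proof (subst nn_integral_suminf)
          show "(\<lambda>x. ennreal (q * (L j * K ^ i) powr p) * indicator {x. ennreal ((L j * K ^ i)\<^sup>2) < sqO f x} x) \<in> borel_measurable \<nu>" for i
            by (rule borel_meas) measurable
        qed (simp add: nn_integral_cmult_indicator borel_sets)
        also have "\<dots> \<le> ennreal q * (ennreal D * \<M> + 6 * (ennreal (L j powr p) * emeasure \<nu> {-R..R}))"
          by (rule suminf_le_const[OF _ part]) simp
        finally show ?thesis .
      qed
      obtain \<M>' where \<M>': "\<M> = ennreal \<M>'" "\<M>' \<ge> 0" using Mfin by (cases \<M>) auto
      obtain w where w: "emeasure \<nu> {-R..R} = ennreal w" "w \<ge> 0" using loc[of "-R" R] by (cases "emeasure \<nu> {-R..R}") auto
      have hj': "(\<integral>\<^sup>+x. h j x \<partial>\<nu>) \<le> ennreal (q * (D * \<M>' + 6 * (L j powr p * w)))" for j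
      proof -
        have "ennreal q * (ennreal D * \<M> + 6 * (ennreal (L j powr p) * emeasure \<nu> {-R..R})) = ennreal (q * (D * \<M>' + 6 * (L j powr p * w)))"
          using q D \<M>' w by (simp add: ennreal_mult)
        then show ?thesis using hj[of j] by simp
      qed
      have lim: "(\<lambda>j. ennreal (q * (D * \<M>' + 6 * (L j powr p * w)))) \<longlonglongrightarrow> ennreal (q * (D * \<M>' + 6 * (0 * w)))"
      proof -
        have "(\<lambda>j. L j powr p) \<longlonglongrightarrow> 0 powr p"
          using L0 p L by (intro tendsto_powr') (auto intro!: always_eventually less_imp_le)
        then have "(\<lambda>j. L j powr p) \<longlonglongrightarrow> 0" by simp
        then show ?thesis by (intro tendsto_intros)
      qed
      have "(\<integral>\<^sup>+x. epowr (sqO f x) (p / 2) \<partial>\<nu>) \<le> (\<integral>\<^sup>+x. liminf (\<lambda>j. h j x) \<partial>\<nu>)"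
      proof (rule nn_integral_mono)
        fix x show "epowr (sqO f x) (p / 2) \<le> liminf (\<lambda>j. h j x)"
        proof (cases "sqO f x = 0")
          case True
          then show ?thesis by (simp add: epowr_def)
        next
          case False
          have "(\<lambda>j. ennreal ((L j)\<^sup>2)) \<longlonglongrightarrow> ennreal (0\<^sup>2)" by (intro tendsto_intros L0)
          then have "\<forall>\<^sub>F j in sequentially. ennreal ((L j)\<^sup>2) < sqO f x"
            by (rule order_tendstoD) (use False in \<open>simp add: zero_less_iff_neq_zero\<close>)
          then have "\<forall>\<^sub>F j in sequentially. epowr (sqO f x) (p / 2) \<le> h j x"
            by eventually_elim (simp add: h_def)
          then show ?thesis by (rule Liminf_bounded)
        qed
      qed
      also have "\<dots> \<le> liminf (\<lambda>j. \<integral>\<^sup>+x. h j x \<partial>\<nu>)" by (rule nn_integral_liminf[OF mh])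
      also have "\<dots> \<le> liminf (\<lambda>j. ennreal (q * (D * \<M>' + 6 * (L j powr p * w))))"
        by (intro Liminf_mono always_eventually allI hj')
      also have "\<dots> = ennreal (q * (D * \<M>' + 6 * (0 * w)))" by (rule lim_imp_Liminf[OF sequentially_bot lim])
      also have "\<dots> = ennreal (q * D) * \<M>" using q D \<M>' by (simp add: ennreal_mult mult.assoc)
      finally show ?thesis .
    qed
  qed
qed

end

section \<open>Truncation\<close>

lemma locally_integrable_Icc: "locally_integrable f \<Longrightarrow> set_integrable lebesgue {a..b} f"
  unfolding locally_integrable_def by simp

lemma locally_integrable_measurable:
  assumes "locally_integrable f" shows "f \<in> borel_measurable lebesgue"
proof (rule borel_measurable_LIMSEQ_real)
  show "(\<lambda>x. indicator {-real n..real n} x *\<^sub>R f x) \<in> borel_measurable lebesgue" for n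
    using locally_integrable_Icc[OF assms, of "-real n" "real n"] unfolding set_integrable_def by (rule borel_measurable_integrable)
  fix x :: real
  obtain N :: nat where N: "\<bar>x\<bar> \<le> real N" using real_arch_simple by blast
  have "\<forall>\<^sub>F n in sequentially. indicator {-real n..real n} x *\<^sub>R f x = f x"
    using eventually_ge_at_top[of N] by eventually_elim (use N in \<open>auto simp: indicator_def\<close>)
  then show "(\<lambda>n. indicator {-real n..real n} x *\<^sub>R f x) \<longlonglongrightarrow> f x" by (rule tendsto_eventually)
qed

definition trunc :: "(real \<Rightarrow> real) \<Rightarrow> nat \<Rightarrow> real \<Rightarrow> real" where
  "trunc f n x = (if \<bar>x\<bar> \<le> real n \<and> \<bar>f x\<bar> \<le> real n then f x else 0)"

lemma nice_trunc:
  assumes [measurable]: "f \<in> borel_measurable borel" shows "nice (trunc f n)"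
proof -
  have "\<bar>trunc f n x\<bar> \<le> real n \<and> (real n < \<bar>x\<bar> \<longrightarrow> trunc f n x = 0)" for x by (auto simp: trunc_def)
  moreover have "trunc f n \<in> borel_measurable borel" unfolding trunc_def[abs_def] by measurable
  ultimately show ?thesis unfolding nice_def by blast
qed

lemma trunc_tendsto: "(\<lambda>n. trunc f n x) \<longlonglongrightarrow> f x"
proof -
  obtain N :: nat where N: "max \<bar>x\<bar> \<bar>f x\<bar> \<le> real N" using real_arch_simple by blast
  have "\<forall>\<^sub>F n in sequentially. trunc f n x = f x"
    using eventually_ge_at_top[of N] by eventually_elim (use N in \<open>auto simp: trunc_def\<close>)
  then show ?thesis by (rule tendsto_eventually)
qed

lemma avg_trunc_tendsto:
  assumes f: "locally_integrable f" and g[measurable]: "g \<in> borel_measurable borel" and ae: "AE x in lebesgue. f x = g x"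
  shows "(\<lambda>n. avg s (trunc g n) x) \<longlonglongrightarrow> avg s f x"
  unfolding avg_def set_lebesgue_integral_def
proof (intro tendsto_mult tendsto_const integral_dominated_convergence)
  have [measurable]: "trunc g n \<in> borel_measurable borel" for n using nice_trunc[OF g] nice_measurable by blast
  show "(\<lambda>y. indicator {x..x + s} y *\<^sub>R f y) \<in> borel_measurable lebesgue" 
    using locally_integrable_Icc[OF f] unfolding set_integrable_def by (rule borel_measurable_integrable)
  show "(\<lambda>y. indicator {x..x + s} y *\<^sub>R trunc g n y) \<in> borel_measurable lebesgue" for n
    by (intro measurable_completion) simp
  show "integrable lebesgue (\<lambda>y. \<bar>indicator {x..x + s} y *\<^sub>R f y\<bar>)"
    using locally_integrable_Icc[OF f] unfolding set_integrable_def by (rule integrable_abs)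
  show "AE y in lebesgue. (\<lambda>n. indicator {x..x + s} y *\<^sub>R trunc g n y) \<longlonglongrightarrow> indicator {x..x + s} y *\<^sub>R f y"
    using ae by eventually_elim (auto intro!: tendsto_intros trunc_tendsto)
  show "AE y in lebesgue. norm (indicator {x..x + s} y *\<^sub>R trunc g n y) \<le> \<bar>indicator {x..x + s} y *\<^sub>R f y\<bar>" for n
    using ae by eventually_elim (auto simp: trunc_def indicator_def)
qed

lemma M_LlogL_plus_trunc_le:
  assumes ae: "AE x in lebesgue. f x = g x"
  shows "M_LlogL_plus (trunc g n) x \<le> M_LlogL_plus f x"
  unfolding M_LlogL_plus_def M_Young_plus_def Phi_def[symmetric]
proof (intro SUP_mono bexI)
  fix h :: real assume "h \<in> {0<..}"
  show "Luxemburg Phi (trunc g n) {x..x + h} \<le> Luxemburg Phi f {x..x + h}"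
    unfolding Luxemburg_def
  proof (rule INF_superset_mono[OF _ order_refl], rule subsetI)
    fix t :: real assume "t \<in> {t. 0 < t \<and> set_nn_integral lebesgue {x..x + h} (\<lambda>y. ennreal (Phi (\<bar>f y\<bar> / t))) / emeasure lebesgue {x..x + h} \<le> 1}"
    then have t: "0 < t" and le: "set_nn_integral lebesgue {x..x + h} (\<lambda>y. ennreal (Phi (\<bar>f y\<bar> / t))) / emeasure lebesgue {x..x + h} \<le> 1" by auto
    have "set_nn_integral lebesgue {x..x + h} (\<lambda>y. ennreal (Phi (\<bar>trunc g n y\<bar> / t))) \<le> set_nn_integral lebesgue {x..x + h} (\<lambda>y. ennreal (Phi (\<bar>f y\<bar> / t)))"
    proof (rule nn_integral_mono_AE)
      show "AE y in lebesgue. ennreal (Phi (\<bar>trunc g n y\<bar> / t)) * indicator {x..x + h} y \<le> ennreal (Phi (\<bar>f y\<bar> / t)) * indicator {x..x + h} y"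
        using ae
      proof eventually_elim
        case (elim y)
        have "Phi (\<bar>trunc g n y\<bar> / t) \<le> Phi (\<bar>f y\<bar> / t)" using t elim by (intro Phi_mono divide_right_mono) (auto simp: trunc_def)
        then show ?case by (intro mult_right_mono ennreal_leI) auto
      qed
    qed
    then have "set_nn_integral lebesgue {x..x + h} (\<lambda>y. ennreal (Phi (\<bar>trunc g n y\<bar> / t))) / emeasure lebesgue {x..x + h} \<le> 1"
      using le by (meson divide_right_mono_ennreal order_trans)
    with t show "t \<in> {t. 0 < t \<and> set_nn_integral lebesgue {x..x + h} (\<lambda>y. ennreal (Phi (\<bar>trunc g n y\<bar> / t))) / emeasure lebesgue {x..x + h} \<le> 1}" by simp
  qed
qed

lemma epowr_liminf:
  assumes "a > 0" "u \<le> liminf v" shows "epowr u a \<le> liminf (\<lambda>n. epowr (v n) a)"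
  unfolding le_Liminf_iff
proof (intro allI impI)
  fix c assume c: "c < epowr u a"
  then have "c \<noteq> top" by auto
  then obtain c' where c': "c = ennreal c'" "c' \<ge> 0" by (cases c) auto
  define d where "d = epowr c (1 / a)"
  have dc: "epowr d a = c" using assms(1) c' by (simp add: d_def epowr_ennreal powr_powr)
  have "d < u" using epowr_mono[of a u d] assms(1) c dc by (meson less_imp_le not_le)
  then have "\<forall>\<^sub>F n in sequentially. d < v n" using assms(2) le_Liminf_iff by blast
  then show "\<forall>\<^sub>F n in sequentially. c < epowr (v n) a"
    by eventually_elim (use epowr_strict_mono[OF assms(1)] dc in metis)
qed

section \<open>The discrete square function and the weighted bound\<close>

text \<open>The difference in \<open>S\<^sup>+\<close> belongs to the lengths \<open>M = 2\<^sup>n\<^sup>-\<^sup>1\<close> and \<open>2 M\<close>. The latter is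
  excluded from the supremum in \<open>O\<^sup>+\<close>, but it is the limit of lengths \<open>s i\<close> below \<open>2 M\<close>.\<close>
lemma S_plus_le_O_plus:
  assumes f: "locally_integrable f" shows "S_plus f x \<le> O_plus f x"
proof -
  have term_le: "ennreal (\<bar>avg (2 powi n) f x - avg (2 powi (n - 1)) f x\<bar>\<^sup>2) \<le> osc f (n - 1) x" for n :: int
  proof -
    define M where "M = (2::real) powi (n - 1)"
    have M0: "M > 0" by (simp add: M_def)
    have M2: "2 powi n = 2 * M" using power_int_add[of "2::real" "n - 1" 1] by (simp add: M_def)
    define s where "s i = 2 * M - M / real (Suc i)" for i
    have s: "s i \<in> {M..<2 * M}" for i
    proof -
      have "M / real (Suc i) \<le> M / 1" using M0 by (intro divide_left_mono) auto
      then show ?thesis using M0 by (simp add: s_def)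
    qed
    have slim: "s \<longlonglongrightarrow> 2 * M"
    proof -
      have "(\<lambda>i. M * inverse (real (Suc i))) \<longlonglongrightarrow> 0" by (intro tendsto_mult_right_zero LIMSEQ_inverse_real_of_nat)
      then have "(\<lambda>i. 2 * M - M * inverse (real (Suc i))) \<longlonglongrightarrow> 2 * M - 0" by (intro tendsto_diff tendsto_const)
      then show ?thesis by (simp add: s_def[abs_def] divide_inverse)
    qed
    have int: "(\<lambda>i. LINT y:{x..x + s i}|lebesgue. f y) \<longlonglongrightarrow> (LINT y:{x..x + 2 * M}|lebesgue. f y)"
      unfolding set_lebesgue_integral_def
    proof (rule integral_dominated_convergence)
      show "(\<lambda>y. indicator {x..x + 2 * M} y *\<^sub>R f y) \<in> borel_measurable lebesgue" "(\<lambda>y. indicator {x..x + s i} y *\<^sub>R f y) \<in> borel_measurable lebesgue" for i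
        using locally_integrable_Icc[OF f] unfolding set_integrable_def by (auto intro: borel_measurable_integrable)
      show "integrable lebesgue (\<lambda>y. \<bar>indicator {x..x + 2 * M} y *\<^sub>R f y\<bar>)"
        using locally_integrable_Icc[OF f] unfolding set_integrable_def by (rule integrable_abs)
      show "AE y in lebesgue. norm (indicator {x..x + s i} y *\<^sub>R f y) \<le> \<bar>indicator {x..x + 2 * M} y *\<^sub>R f y\<bar>" for i
        using s[of i] by (intro AE_I2) (auto simp: indicator_def)
      have "AE y in lebesgue. y \<noteq> x + 2 * M" using AE_lborel_singleton[of "x + 2 * M"] by (rule AE_completion)
      then show "AE y in lebesgue. (\<lambda>i. indicator {x..x + s i} y *\<^sub>R f y) \<longlonglongrightarrow> indicator {x..x + 2 * M} y *\<^sub>R f y"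
      proof eventually_elim
        case (elim y)
        show ?case
        proof (cases "y < x + 2 * M")
          case True
          then have "\<forall>\<^sub>F i in sequentially. y - x < s i" using slim by (intro order_tendstoD) auto
          then have "\<forall>\<^sub>F i in sequentially. indicator {x..x + s i} y *\<^sub>R f y = indicator {x..x + 2 * M} y *\<^sub>R f y"
            by eventually_elim (use True in \<open>auto simp: indicator_def\<close>)
          then show ?thesis by (rule tendsto_eventually)
        next
          case False
          then have "indicator {x..x + s i} y *\<^sub>R f y = indicator {x..x + 2 * M} y *\<^sub>R f y" for i
            using elim s[of i] by (auto simp: indicator_def)
          then show ?thesis by (simp only: tendsto_const)
        qed
      qed
    qed
    have "(\<lambda>i. avg (s i) f x) \<longlonglongrightarrow> avg (2 * M) f x"
      unfolding avg_def using M0 by (intro tendsto_mult tendsto_divide tendsto_const slim int) auto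
    then have lim: "(\<lambda>i. ennreal ((avg M f x - avg (s i) f x)\<^sup>2)) \<longlonglongrightarrow> ennreal ((avg M f x - avg (2 * M) f x)\<^sup>2)"
      by (intro tendsto_ennrealI tendsto_power tendsto_diff tendsto_const)
    have le: "ennreal ((avg M f x - avg (s i) f x)\<^sup>2) \<le> osc f (n - 1) x" for i
      using osc_upper[of "s i" "n - 1" f x] s[of i] M2 by (simp add: M_def)
    have "ennreal ((avg M f x - avg (2 * M) f x)\<^sup>2) \<le> osc f (n - 1) x"
      by (rule LIMSEQ_le_const2[OF lim]) (use le in blast)
    then show ?thesis by (simp add: M2 M_def power2_commute)
  qed
  have "(\<Sum>\<^sub>\<infinity>n::int. ennreal (\<bar>avg (2 powi n) f x - avg (2 powi (n - 1)) f x\<bar>\<^sup>2)) \<le> (\<integral>\<^sup>+n. osc f (n - 1) x \<partial>count_space UNIV)"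
    unfolding infsum_int_eq_nn_integral by (intro nn_integral_mono term_le)
  also have "\<dots> = sqO f x"
    unfolding sqO_def
    by (rule nn_integral_bij_count_space) (rule bij_betw_byWitness[where f'="\<lambda>n. n + 1"], auto)
  finally show ?thesis unfolding O_plus_eq S_plus_def by (intro epowr_mono) auto
qed

theorem theorem9:
  fixes p \<epsilon> :: real and w :: "real \<Rightarrow> real"
    and G :: "(real \<Rightarrow> real) \<Rightarrow> real \<Rightarrow> ennreal"
  assumes "0 < p" and "0 < \<epsilon>"
    and "weight w" and "w \<in> C_plus (max p 1 + \<epsilon>)"
    and "G = S_plus \<or> G = O_plus"
  shows "\<exists>C::real. C > 0 \<and>
    (\<forall>f. locally_integrable f \<longrightarrow>
       Lp_norm p w (G f) \<le> ennreal C * Lp_norm p w (M_LlogL_plus f))"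
proof -
  define r where "r = max p 1 + \<epsilon>"
  have r: "r > 1" "p < r" using assms(2) by (auto simp: r_def max_def)
  have wloc: "locally_integrable w" and w0: "\<And>x. w x \<ge> 0" using assms(3) by (auto simp: weight_def)
  have [measurable]: "w \<in> borel_measurable lebesgue" by (rule locally_integrable_measurable[OF wloc])
  define \<nu> where "\<nu> = density lebesgue (\<lambda>x. ennreal (w x))"
  obtain e C where eC: "e > 0" "C > 0"
    "\<And>a b c E. a < b \<Longrightarrow> b < c \<Longrightarrow> c - b < b - a \<Longrightarrow> E \<in> sets lebesgue \<Longrightarrow> E \<subseteq> {a<..<b} \<Longrightarrow>
       (\<integral>\<^sup>+ x\<in>E. ennreal (w x) \<partial>lebesgue) \<le> ennreal (C * (measure lebesgue E / (c - b)) powr e) *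
            (\<integral>\<^sup>+ x. epowr (M_plus (indicator {a<..<c}) x) r * ennreal (w x) \<partial>lebesgue)"
    using assms(4) unfolding C_plus_def r_def[symmetric] by blast
  have nn\<nu>: "(\<integral>\<^sup>+x. g x \<partial>\<nu>) = (\<integral>\<^sup>+x. g x * ennreal (w x) \<partial>lebesgue)" if "g \<in> borel_measurable lebesgue" for g
    unfolding \<nu>_def using that by (subst nn_integral_density) (auto simp: mult.commute)
  interpret Cp_measure \<nu> r e C
  proof
    show "sets \<nu> = sets lebesgue" by (simp add: \<nu>_def)
    fix a b c :: real and E assume h: "a < b" "b < c" "c - b < b - a" "E \<in> sets borel" "E \<subseteq> {a<..<b}"
    have "emeasure \<nu> E = (\<integral>\<^sup>+ x\<in>E. ennreal (w x) \<partial>lebesgue)"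
      unfolding \<nu>_def using h(4) by (subst emeasure_density) auto
    also have "\<dots> \<le> ennreal (C * (measure lebesgue E / (c - b)) powr e) *
            (\<integral>\<^sup>+ x. epowr (M_plus (indicator {a<..<c}) x) r * ennreal (w x) \<partial>lebesgue)"
      by (rule eC(3)[OF h(1-3) _ h(5)]) (use h(4) in simp)
    also have "measure lebesgue E = measure lborel E" using h(4) by simp
    also have "ennreal (C * (measure lborel E / (c - b)) powr e) * (\<integral>\<^sup>+ x. epowr (M_plus (indicator {a<..<c}) x) r * ennreal (w x) \<partial>lebesgue)
      \<le> ennreal (C * (measure lborel E / (c - b)) powr e) * (\<integral>\<^sup>+ x. ennreal (tail a c x powr r) * ennreal (w x) \<partial>lebesgue)"
    proof (intro mult_left_mono[of "nn_integral _ _"] nn_integral_mono mult_right_mono)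
      fix x
      have "epowr (M_plus (indicator {a<..<c}) x) r \<le> epowr (ennreal (tail a c x)) r"
        using h r by (intro epowr_mono M_plus_indicator_le) auto
      then show "epowr (M_plus (indicator {a<..<c}) x) r \<le> ennreal (tail a c x powr r)"
        using h tail_nonneg[of a c x] by (simp add: epowr_ennreal)
    qed simp_all
    also have "(\<integral>\<^sup>+ x. ennreal (tail a c x powr r) * ennreal (w x) \<partial>lebesgue) = (\<integral>\<^sup>+x. ennreal (tail a c x powr r) \<partial>\<nu>)"
      by (rule nn\<nu>[symmetric]) (intro measurable_completion, measurable)
    finally show "emeasure \<nu> E \<le> ennreal (C * (measure lborel E / (c - b)) powr e) * (\<integral>\<^sup>+x. ennreal (tail a c x powr r) \<partial>\<nu>)"
      .
  qed (use r eC in auto)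
  have loc: "emeasure \<nu> {a..b} < \<infinity>" for a b
  proof -
    have "emeasure \<nu> {a..b} = (\<integral>\<^sup>+ x. ennreal (norm (indicator {a..b} x *\<^sub>R w x)) \<partial>lebesgue)"
      unfolding \<nu>_def using w0 by (subst emeasure_density) (auto intro!: nn_integral_cong simp: indicator_def)
    also have "\<dots> < \<infinity>" using locally_integrable_Icc[OF wloc, of a b] unfolding set_integrable_def integrable_iff_bounded by blast
    finally show ?thesis .
  qed
  obtain B where B: "B > 0"
    "\<And>f \<M>. nice f \<Longrightarrow>
      (\<And>g. g \<in> borel_measurable borel \<Longrightarrow> (\<And>x. g x \<le> epowr (M_LlogL_plus f x) p) \<Longrightarrow> (\<integral>\<^sup>+x. g x \<partial>\<nu>) \<le> \<M>) \<Longrightarrow>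
      (\<integral>\<^sup>+x. epowr (sqO f x) (p / 2) \<partial>\<nu>) \<le> ennreal B * \<M>"
    by (rule nice_estimate[OF assms(1) r(2) loc]) (rule that, assumption, blast)
  show ?thesis
  proof (intro exI[of _ "B powr (1 / p)"] conjI allI impI)
    show "B powr (1 / p) > 0" using B by simp
    fix f assume f: "locally_integrable f"
    define \<M> where "\<M> = (\<integral>\<^sup>+ x. epowr (M_LlogL_plus f x) p * ennreal (w x) \<partial>lebesgue)"
    \<comment> \<open>A Borel representative of \<open>f\<close>: it has the same averages, and its truncations have smaller
      Luxemburg averages.\<close>
    obtain g where g: "g \<in> borel_measurable borel" "AE x in lebesgue. f x = g x"
    proof -
      from completion_ex_borel_measurable_real[OF locally_integrable_measurable[OF f]] obtain g
        where "g \<in> borel_measurable lborel" "AE x in lborel. f x = g x" by blast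
      then show ?thesis by (intro that[of g] AE_completion) simp_all
    qed
    have nt: "nice (trunc g n)" for n by (rule nice_trunc[OF g(1)])
    have est: "(\<integral>\<^sup>+x. epowr (sqO (trunc g n) x) (p / 2) \<partial>\<nu>) \<le> ennreal B * \<M>" for n
    proof (rule B(2)[OF nt])
      fix k assume k: "k \<in> borel_measurable borel" "\<And>x. k x \<le> epowr (M_LlogL_plus (trunc g n) x) p"
      have "(\<integral>\<^sup>+x. k x \<partial>\<nu>) = (\<integral>\<^sup>+x. k x * ennreal (w x) \<partial>lebesgue)"
        by (rule nn\<nu>) (use k(1) in \<open>intro measurable_completion, simp\<close>)
      also have "\<dots> \<le> \<M>" unfolding \<M>_def
      proof (intro nn_integral_mono mult_right_mono)
        fix x show "k x \<le> epowr (M_LlogL_plus f x) p"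
          using k(2)[of x] epowr_mono[OF less_imp_le[OF assms(1)] M_LlogL_plus_trunc_le[OF g(2), of n x]] by (rule order_trans)
      qed simp
      finally show "(\<integral>\<^sup>+x. k x \<partial>\<nu>) \<le> \<M>" .
    qed
    have ms: "(\<lambda>x. epowr (sqO (trunc g n) x) (p / 2)) \<in> borel_measurable lebesgue" for n
    proof -
      have [measurable]: "sqO (trunc g n) \<in> borel_measurable borel" by (rule measurable_sqO[OF nt])
      have "(\<lambda>x. epowr (sqO (trunc g n) x) (p / 2)) \<in> borel_measurable borel" by measurable
      then show ?thesis by (intro measurable_completion) simp
    qed
    have "(\<integral>\<^sup>+ x. epowr (G f x) p * ennreal (w x) \<partial>lebesgue) \<le> (\<integral>\<^sup>+ x. liminf (\<lambda>n. epowr (sqO (trunc g n) x) (p / 2)) * ennreal (w x) \<partial>lebesgue)"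
    proof (intro nn_integral_mono mult_right_mono)
      fix x
      have "G f x \<le> O_plus f x" using assms(5) S_plus_le_O_plus[OF f] by auto
      then have "epowr (G f x) p \<le> epowr (O_plus f x) p" using assms(1) by (intro epowr_mono) auto
      also have "\<dots> = epowr (sqO f x) (p / 2)" by (simp add: O_plus_eq epowr_epowr)
      also have "\<dots> \<le> liminf (\<lambda>n. epowr (sqO (trunc g n) x) (p / 2))"
        using assms(1) avg_trunc_tendsto[OF f g] by (intro epowr_liminf sqO_liminf) auto
      finally show "epowr (G f x) p \<le> liminf (\<lambda>n. epowr (sqO (trunc g n) x) (p / 2))" .
    qed simp
    also have "\<dots> = (\<integral>\<^sup>+ x. liminf (\<lambda>n. epowr (sqO (trunc g n) x) (p / 2)) \<partial>\<nu>)"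
      by (rule nn\<nu>[symmetric]) (intro borel_measurable_liminf ms)
    also have "\<dots> \<le> liminf (\<lambda>n. \<integral>\<^sup>+ x. epowr (sqO (trunc g n) x) (p / 2) \<partial>\<nu>)"
      by (rule nn_integral_liminf) (use ms measurable_cong_sets[OF sets_\<nu> refl] in blast)
    also have "\<dots> \<le> liminf (\<lambda>n::nat. ennreal B * \<M>)" by (intro Liminf_mono always_eventually allI est)
    also have "\<dots> = ennreal B * \<M>" by (simp add: Liminf_const)
    finally have "Lp_norm p w (G f) \<le> epowr (ennreal B * \<M>) (1 / p)"
      unfolding Lp_norm_def using assms(1) by (intro epowr_mono) auto
    also have "\<dots> = ennreal (B powr (1 / p)) * epowr \<M> (1 / p)"
    proof (cases \<M>)
      case (real m)
      then show ?thesis using B(1) by (simp add: ennreal_mult[symmetric] epowr_ennreal powr_mult)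
    next
      case top
      then show ?thesis using B(1) by (simp add: epowr_top ennreal_mult_top ennreal_mult_eq_top_iff)
    qed
    finally show "Lp_norm p w (G f) \<le> ennreal (B powr (1 / p)) * Lp_norm p w (M_LlogL_plus f)"
      by (simp add: Lp_norm_def \<M>_def)
  qed
qed

end
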